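(* Let $H$ and $H'$ be bounded Jordan domains in $\mathbb{C}$ whose boundaries are the Jordan curves $\gamma$ and $\gamma'$, respectively. Let $G=H\setminus\bigcup_{j=1}^nF_j$ be an $(n+1)$-connected domain, where the $F_j$ are disjoint connected compact subsets of $H$, each containing more than one point. Let $\mathfrak{F}_1,\dots,\mathfrak{F}_n$ be shape fields on $\overline{H'}$. Suppose that $z_1,z_2,z_3\in\gamma$ are three distinct counterclockwise ordered points, and similarly $z_1',z_2',z_3'\in\gamma'$. Then there are sets $F_1',\dots,F_n'$, with each $F_j'$ in the image of the shape field $\mathfrak{F}_j$, and there is a conformal equivalence of $G$ and $H'\setminus\bigcup_{j=1}^nF_j'$, such that under this conformal equivalence each $F_j$ corresponds to $F_j'$ and each $z_k$ corresponds to $z_k'$ ($k=1,2,3$).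
   Context: A bounded domain is $(n+1)$-connected if its complement in the Riemann sphere has exactly $n+1$ connected components. Two planar sets are homothetic if there is a map $z\mapsto \alpha z+\beta$ with $\alpha>0$ real and $\beta\in\mathbb{C}$ taking one onto the other. A (convex) shape field on a set $D\subset\mathbb{C}$ is a continuous function $\mathfrak{F}$ (with respect to the Hausdorff metric) which assigns to each $p\in D$ a compact convex set $\mathfrak{F}(p)\subset\mathbb{C}$ containing more than a single point. The image of $\mathfrak{F}$ is the collection of all sets $P\subset D$ which are homothetic to $\mathfrak{F}(p)$ for some point $p$ on the boundary of $P$. That $F_j$ corresponds to $F_j'$ under a conformal equivalence $f$ means that the boundary components correspond: for sequences $(x_k)$ in $G$, $x_k$ tends to $\partial F_j$ if and only if $f(x_k)$ tends to $\partial F_j'$. That $z_k$ corresponds to $z_k'$ means that the continuous extension of $f$ to $\gamma$ maps $z_k$ to $z_k'$. *)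

theory Defs
  imports "HOL-Complex_Analysis.Complex_Analysis"
begin

definition jordan_curve :: "complex set \<Rightarrow> bool" where
  "jordan_curve \<gamma> \<longleftrightarrow> (\<exists>c. simple_path c \<and> pathfinish c = pathstart c \<and> path_image c = \<gamma>)"

definition bounded_jordan_domain :: "complex set \<Rightarrow> bool" where
  "bounded_jordan_domain H \<longleftrightarrow>
     open H \<and> connected H \<and> bounded H \<and> H \<noteq> {} \<and> jordan_curve (frontier H)"

(* The base point of the parametrization c is arbitrary, so the order is only
   up to cyclic permutation. *)
definition ccw_ordered :: "complex set \<Rightarrow> complex \<Rightarrow> complex \<Rightarrow> complex \<Rightarrow> bool" where
  "ccw_ordered \<gamma> z1 z2 z3 \<longleftrightarrow>
     (\<exists>c t1 t2 t3. simple_path c \<and> pathfinish c = pathstart c \<and> path_image c = \<gamma> \<and>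
        (\<forall>w \<in> inside \<gamma>. winding_number c w = 1) \<and>
        0 \<le> t1 \<and> t1 < t2 \<and> t2 < t3 \<and> t3 < 1 \<and>
        c t1 = z1 \<and> c t2 = z2 \<and> c t3 = z3)"

(* The Riemann sphere is the one-point compactification of the plane, on the type
   complex option with None as the point at infinity. *)
definition riemann_sphere :: "complex option topology" where
  "riemann_sphere = Alexandroff_compactification euclidean"

(* m-connected bounded domain. Only used with m > 0, where card S = m entails that
   S is finite. *)
definition connected_of_order :: "nat \<Rightarrow> complex set \<Rightarrow> bool" where
  "connected_of_order m G \<longleftrightarrow>
     open G \<and> connected G \<and> bounded G \<and> G \<noteq> {} \<and>
     card (connected_components_of
       (subtopology riemann_sphere (topspace riemann_sphere - Some ` G))) = m"

definition homothetic :: "complex set \<Rightarrow> complex set \<Rightarrow> bool" where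
  "homothetic A B \<longleftrightarrow>
     (\<exists>(\<alpha>::real) (\<beta>::complex). \<alpha> > 0 \<and> (\<lambda>z. of_real \<alpha> * z + \<beta>) ` A = B)"

(* The Hausdorff distance, meaningful for nonempty bounded sets. *)
definition hausdorff_dist :: "complex set \<Rightarrow> complex set \<Rightarrow> real" where
  "hausdorff_dist A B = max (SUP a\<in>A. infdist a B) (SUP b\<in>B. infdist b A)"

definition shape_field :: "complex set \<Rightarrow> (complex \<Rightarrow> complex set) \<Rightarrow> bool" where
  "shape_field D S \<longleftrightarrow>
     (\<forall>p\<in>D. compact (S p) \<and> convex (S p) \<and> (\<exists>a\<in>S p. \<exists>b\<in>S p. a \<noteq> b)) \<and>
     (\<forall>p\<in>D. ((\<lambda>q. hausdorff_dist (S q) (S p)) \<longlongrightarrow> 0) (at p within D))"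

definition shape_field_image ::
    "complex set \<Rightarrow> (complex \<Rightarrow> complex set) \<Rightarrow> complex set set" where
  "shape_field_image D S = {P. P \<subseteq> D \<and> (\<exists>p\<in>frontier P. homothetic P (S p))}"

definition conformal_equivalence ::
    "complex set \<Rightarrow> complex set \<Rightarrow> (complex \<Rightarrow> complex) \<Rightarrow> bool" where
  "conformal_equivalence G G' f \<longleftrightarrow>
     f holomorphic_on G \<and> bij_betw f G G' \<and> inv_into G f holomorphic_on G'"

definition tends_to_set :: "(nat \<Rightarrow> complex) \<Rightarrow> complex set \<Rightarrow> bool" where
  "tends_to_set x A \<longleftrightarrow> (\<lambda>k. infdist (x k) A) \<longlonglongrightarrow> 0"

definition boundary_corresponds ::
    "(complex \<Rightarrow> complex) \<Rightarrow> complex set \<Rightarrow> complex set \<Rightarrow> complex set \<Rightarrow> bool" where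
  "boundary_corresponds f G F F' \<longleftrightarrow>
     (\<forall>x. range x \<subseteq> G \<longrightarrow>
        (tends_to_set x (frontier F) \<longleftrightarrow> tends_to_set (\<lambda>k. f (x k)) (frontier F')))"

end

theory Submission
  imports Defs
begin

text \<open>By Caratheodory's theorem, \<open>H\<close> and \<open>H'\<close> may be replaced by the upper half-plane, with the marked points
at infinity, 0 and 1. Doubling across the real axis and solving an extremal problem for the coefficient of \<open>1/z\<close>
maps a half-plane with \<open>n\<close> holes onto a half-plane with \<open>n\<close> horizontal slits, uniquely once 0, 1 and infinity are
fixed; so its conformal type is given by \<open>3n\<close> real numbers, the positions and lengths of the slits. A choice of
shapes is given by \<open>3n\<close> real numbers as well, namely the position of a boundary point and the size of each
shape. The slit data of a choice of shapes depend continuously on it, by a compactness theorem for conformal maps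
of finitely connected domains, and a Leray-Schauder argument, in which the slits shrink to points, shows that
every slit datum is attained, in particular that of \<open>G\<close>.\<close>

text \<open>The parameter set has a wall at size 0, where shapes degenerate to points and slits to
  length 0, and a homotopy that starts with point slits starts on that wall. Sizes are therefore
  real numbers of either sign, a negative one standing for a point, and the slit length is corrected
  by the negative part of the size. A sign argument then shows that zeros have nonnegative sizes,
  and that a slit of positive length comes from a shape of positive size. Zeros cannot escape by
  colliding or by running into the boundary either: the inverse maps, from domains whose slits lie
  inside the slits that belong to \<open>G\<close>, have a limit whose holes are again disjoint and
  inside the half-plane. Horizontal slits suit this argument because a shortened slit stays inside
  the old one, because point slits make the slit map the identity, and because three real numbers
  describe each slit. Centres are recorded by their half-plane coordinates, so that at size 0 the
  datum equals the parameter. Fixing 0, 1 and infinity uses up the affine freedom and is also what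
  the three marked boundary points prescribe.\<close>

abbreviation LIMS ("(_)/ ----> (_)" [60, 60] 60) where "X ----> l \<equiv> X \<longlonglongrightarrow> l"
notation tendsto (infixr "--->" 55)
abbreviation EV (binder "EV " 10) where "EV k. P k \<equiv> \<forall>\<^sub>F k in sequentially. P k"
abbreviation IFF (infixr "<->" 25) where "(A::bool) <-> B \<equiv> A = B"
abbreviation LIMINF (infix "-oo->" 55) where "f -oo-> l \<equiv> (f ---> l) at_infinity"
abbreviation hol (infixl "hol" 50) where "f hol S \<equiv> f holomorphic_on S"
abbreviation "far R \<equiv> {z. cmod z > R}"
abbreviation "uhp \<equiv> {w. Im w > 0}"

section \<open>Planar topology\<close>

text \<open>In a separation of \<open>X\<close>, the piece that misses \<open>C\<close> lies in
  \<open>D\<close> and equals \<open>D\<close> minus the other, open piece; it is thus open and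
  closed in the whole space, which is connected.\<close>

lemma connected_superset_by_closed:
 fixes X :: "'a::real_normed_vector set"
 assumes "open X" "connected C" "C <= X" "X <= C Un D" "closed D" "D <= X"
 shows "connected X"
proof (rule ccontr)
 assume "~ connected X"
 then obtain A B where AB: "open A" "open B" "X = A Un B" "A Int B = {}" "A ~= {}" "B ~= {}"
 proof -
  from `~ connected X` obtain A B where "open A" "open B" "X <= A Un B" "A Int B Int X = {}" "A Int X ~= {}" "B Int X ~= {}"
   unfolding connected_def by blast
  thus thesis using that[of "A Int X" "B Int X"] `open X` by blast
 qed
 have *: False if o: "open A" "open B" "X = A Un B" "A Int B = {}" "A ~= {}" "B ~= {}" "C <= A" for A B
 proof -
  have "B = D - A" using that assms by blast
  hence "closed B" using `closed D` `open A` by auto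
  hence "B = UNIV" using `open B` `B ~= {}` by (metis clopen)
  thus False using that by auto
 qed
 have "C <= A | C <= B" using `connected C` AB `C <= X` unfolding connected_def by blast
 thus False using *[of A B] *[of B A] AB by auto
qed

text \<open>Janiszewski's theorem for \<open>K\<close> and \<open>-U\<close>: they are disjoint, and
  the empty intersection counts as connected.\<close>

lemma connected_open_diff_closed:
 fixes U K :: "complex set"
 assumes "open U" "connected U" "compact K" "K <= U" "connected (-K)"
 shows "connected (U - K)"
proof -
 have "K Int - U = {}" using assms by auto
 hence "connected (- (K Un - U))" using assms by (intro Janiszewski_connected) (simp_all add: closed_Compl)
 moreover have "- (K Un - U) = U - K" by auto
 ultimately show ?thesis by simp
qed

lemma connected_compl_Un:
 fixes S T :: "complex set"
 assumes "compact S" "compact T" "S Int T = {}" "connected (-S)" "connected (-T)"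
 shows "connected (-(S Un T))" using assms by (intro Janiszewski_connected) (auto simp: compact_imp_closed)

lemma connected_compl_UN:
 fixes E :: "'i => complex set"
 assumes "finite I" "!!i. i : I ==> compact (E i)" "!!i. i : I ==> connected (- E i)" "disjoint_family_on E I"
 shows "connected (-(UN i:I. E i))" using assms
proof (induction I rule: finite_induct)
 case (insert i I)
 have "connected (-(E i Un (UN i:I. E i)))"
 proof (rule connected_compl_Un)
  show "E i Int (UN i:I. E i) = {}" using insert by (auto simp: disjoint_family_on_def)
  show "connected (- \<Union> (E ` I))" using insert by (auto simp: disjoint_family_on_def)
 qed (use insert in auto)
 thus ?case by simp
qed auto

lemma connected_compl_part:
 fixes A B :: "complex set"
 assumes "closed A" "closed B" "A Int B = {}" "connected (-(A Un B))"
 shows "connected (-A)" by (rule connected_superset_by_closed[of _ "-(A Un B)" B]) (use assms in auto)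

lemma connected_compl_of_diff:
 fixes V K :: "'a::real_normed_vector set"
 assumes "open V" "closed K" "K <= V" "connected (V - K)"
 shows "connected (-K)" by (rule connected_superset_by_closed[of _ "V - K" "-V"]) (use assms in auto)

text \<open>Convergence of holes is always stated as inclusion in such neighbourhoods, in one
  direction or the other, because the compactness theorems give only one of the two
  inclusions.\<close>

definition nhd :: "'a::metric_space set => real => 'a set" where
 "nhd A e = (UN a:A. ball a e)"

lemma in_nhd_iff: "x : nhd A e <-> (EX a:A. dist a x < e)" by (auto simp: nhd_def)

lemma open_nhd[intro, simp]: "open (nhd A e)" by (auto simp: nhd_def)

lemma subset_nhd: "e > 0 ==> A <= nhd A e" by (auto simp: nhd_def)

lemma nhd_mono: "A <= B ==> d <= e ==> nhd A d <= nhd B e"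
 by (meson in_nhd_iff less_le_trans subset_iff)

lemma bounded_nhd: "bounded A ==> bounded (nhd A e)"
proof -
 assume "bounded A"
 then obtain x B where "ALL a:A. dist x a <= B" by (auto simp: bounded_def)
 hence "dist x y <= B + e" if y: "y : nhd A e" for y
 proof -
  obtain a where "a : A" "dist a y < e" using y by (auto simp: in_nhd_iff)
  thus ?thesis using `ALL a:A. dist x a <= B` dist_triangle[of x y a] by auto
 qed
 thus ?thesis by (auto simp: bounded_def)
qed

lemma connected_nhd:
 fixes A :: "'a::real_normed_vector set"
 assumes "connected A" shows "connected (nhd A e)"
proof (cases "e > 0")
 case True
 have eq: "nhd A e = (UN a:A. A Un ball a e)" using True by (auto simp: nhd_def)
 show ?thesis unfolding eq
 proof (rule connected_Union)
  fix s assume "s : (%a. A Un ball a e) ` A"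
  thus "connected s" using assms True by (auto intro!: connected_Un)
 next
  show "\<Inter> ((%a. A Un ball a e) ` A) ~= {}" by simp
 qed
next
 case False
 hence "nhd A e = {}" by (auto simp: nhd_def)
 thus ?thesis by simp
qed

lemma nhd_subset_open:
 assumes "compact A" "open U" "A <= U"
 obtains e where "e > 0" "nhd A e <= U" using compact_subset_open_imp_ball_epsilon_subset[OF assms] unfolding nhd_def by auto

lemma nhd_disjoint:
 assumes "compact A" "compact B" "A Int B = {}"
 obtains e where "e > 0" "nhd A e Int nhd B e = {}"
proof -
 obtain d where d: "d > 0" "nhd A d <= - B"
  using nhd_subset_open[of A "-B"] assms by (metis compact_imp_closed disjoint_eq_subset_Compl open_Compl)
 have "nhd A (d/2) Int nhd B (d/2) = {}"
 proof (rule ccontr)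
  assume "nhd A (d/2) Int nhd B (d/2) ~= {}"
  then obtain x a b where "a : A" "b : B" "dist a x < d/2" "dist b x < d/2" by (auto simp: in_nhd_iff)
  hence "dist a b < d" using dist_triangle_half_r[of x a d b] by (simp add: dist_commute)
  hence "b : nhd A d" using `a : A` by (auto simp: in_nhd_iff)
  thus False using d `b : B` by auto
 qed
 thus ?thesis using that[of "d/2"] d by auto
qed

lemma nhds_disjoint_family:
 assumes "finite I" "!!i. i : I ==> compact (E i)" "disjoint_family_on E I"
 obtains e where "e > 0" "!!i j. i : I ==> j : I ==> i ~= j ==> nhd (E i) e Int nhd (E j) e = {}"
proof -
 have "EX e>0. ALL p:P. fst p ~= snd p --> nhd (E (fst p)) e Int nhd (E (snd p)) e = {}" if "finite P" "P <= I \<times> I" for P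
  using that
 proof (induction P rule: finite_induct)
  case empty
  thus ?case by (auto intro: exI[of _ 1])
 next
  case (insert p P)
  then obtain e where e: "e > 0" "ALL p:P. fst p ~= snd p --> nhd (E (fst p)) e Int nhd (E (snd p)) e = {}" by auto
  have "EX d>0. fst p ~= snd p --> nhd (E (fst p)) d Int nhd (E (snd p)) d = {}"
  proof (cases "fst p = snd p")
   case False
   thus ?thesis using nhd_disjoint[of "E (fst p)" "E (snd p)"] insert assms
    by (metis disjoint_family_on_def insert_subset mem_Times_iff)
  qed (auto intro: exI[of _ 1])
  then obtain d where d: "d > 0" "fst p ~= snd p --> nhd (E (fst p)) d Int nhd (E (snd p)) d = {}" by auto
  show ?case
  proof (intro exI[of _ "min d e"] conjI ballI impI)
   fix q assume "q : insert p P" "fst q ~= snd q"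
   thus "nhd (E (fst q)) (min d e) Int nhd (E (snd q)) (min d e) = {}"
    using d e nhd_mono[OF order_refl, of "min d e" d "E (fst q)"] nhd_mono[OF order_refl, of "min d e" d "E (snd q)"]
     nhd_mono[OF order_refl, of "min d e" e "E (fst q)"] nhd_mono[OF order_refl, of "min d e" e "E (snd q)"]
    by (cases "q = p") (simp, blast)+
  qed (use d e in auto)
 qed
 from this[of "I \<times> I"] obtain e where "e > 0" "ALL p:I \<times> I. fst p ~= snd p --> nhd (E (fst p)) e Int nhd (E (snd p)) e = {}"
  using assms by blast
 thus ?thesis using that[of e] by simp
qed

section \<open>Conformal maps between complements of finitely many continua\<close>

lemma tendsto_subseq: "x ----> l ==> strict_mono r ==> (%k. x (r k)) ----> l"
 using LIMSEQ_subseq_LIMSEQ by (fastforce simp: o_def)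

text \<open>The holes are an indexed family, so that a map can be said to preserve the index; single
  points are allowed as holes.\<close>

definition holes :: "'i set => ('i => complex set) => bool" where
 "holes I E <-> finite I & (ALL i:I. compact (E i) & connected (E i) & E i ~= {}) &
   disjoint_family_on E I & connected (- (UN i:I. E i))"

definition hdom :: "'i set => ('i => complex set) => complex set" where
 "hdom I E = - (UN i:I. E i)"

text \<open>Infinity is kept out of the type: that it is fixed is expressed by the two boundedness
  clauses, one for images and one for preimages of bounded sets. Boundary correspondence is required
  only for sequences along which both the points and the values converge; the boundedness supplies
  such subsequences.\<close>

definition hole_map :: "'i set => ('i => complex set) => ('i => complex set) => (complex => complex) => bool" where
 "hole_map I E L f <-> holes I E & holes I L & f hol hdom I E &
   bij_betw f (hdom I E) (hdom I L) &
   (ALL R. bounded (f ` (hdom I E Int cball 0 R))) &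
   (ALL R. bounded {z : hdom I E. f z : cball 0 R}) &
   (ALL x z w i. range x <= hdom I E --> x ----> z --> (%k. f (x k)) ----> w --> i : I --> (z : E i <-> w : L i))"

lemma compact_holes: "holes I E ==> compact (UN i:I. E i)"
 by (auto simp: holes_def)

lemma open_hdom: "holes I E ==> open (hdom I E)"
 unfolding hdom_def using compact_holes compact_imp_closed by blast

lemma connected_hdom: "holes I E ==> connected (hdom I E)"
 by (auto simp: hdom_def holes_def)

lemma hdom_outside_ball:
 assumes "holes I E" obtains R where "R > 0" "(UN i:I. E i) <= ball 0 R"
 using compact_holes[OF assms] by (metis bounded_subset_ballD compact_imp_bounded)

lemma holes_subset_nhd:
 assumes "holes I E" "ep > 0"
 obtains e where "0 < e" "e <= ep" "!!i j. i : I ==> j : I ==> i ~= j ==> nhd (E i) e Int nhd (E j) e = {}"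
proof -
 obtain e where e: "e > 0" "!!i j. i : I ==> j : I ==> i ~= j ==> nhd (E i) e Int nhd (E j) e = {}"
  using nhds_disjoint_family[of I E] assms by (auto simp: holes_def)
 show ?thesis
 proof (rule that[of "min e ep"])
  fix i j assume "i : I" "j : I" "i ~= j"
  hence "nhd (E i) e Int nhd (E j) e = {}" using e by auto
  moreover have "nhd (E k) (min e ep) <= nhd (E k) e" for k by (intro nhd_mono) auto
  ultimately show "nhd (E i) (min e ep) Int nhd (E j) (min e ep) = {}" by auto
 qed (use e assms in auto)
qed

lemma holes_connected_compl:
 assumes "holes I E" "i : I" shows "connected (- E i)"
proof (rule connected_compl_part[where B = "UN j:I-{i}. E j"])
 show "closed (E i)" using assms by (auto simp: holes_def compact_imp_closed)
 show "closed (UN j:I-{i}. E j)" using assms by (intro closed_UN) (auto simp: holes_def compact_imp_closed)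
 show "E i Int (UN j:I-{i}. E j) = {}" using assms by (auto simp: holes_def disjoint_family_on_def)
 have "E i Un (UN j:I-{i}. E j) = (UN j:I. E j)" using assms by auto
 thus "connected (- (E i Un (UN j:I-{i}. E j)))" using assms by (simp add: holes_def)
qed

lemma holesI:
 fixes E :: "'i => complex set"
 assumes "finite I" "!!i. i : I ==> compact (E i)" "!!i. i : I ==> connected (E i)" "!!i. i : I ==> E i ~= {}"
  "!!i. i : I ==> connected (- E i)" "disjoint_family_on E I"
 shows "holes I E" using assms connected_compl_UN[of I E] by (auto simp: holes_def)

lemma bounded_subset_cball:
 fixes S :: "'a::real_normed_vector set"
 assumes "bounded S" obtains R where "S <= cball 0 R" using assms by (meson bounded_iff mem_cball_0 subsetI)

lemma holomorphic_on_inv_into: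
 assumes "f hol S" "open S" "inj_on f S"
 shows "inv_into S f hol f ` S"
proof -
 obtain h where h: "h hol f ` S" "!!z. z : S ==> h (f z) = z" using holomorphic_has_inverse[OF assms] by metis
 show ?thesis by (rule holomorphic_transform[OF h(1)]) (use h(2) assms(3) in auto)
qed

lemma hole_map_inv:
 assumes "hole_map I E L f" shows "hole_map I L E (inv_into (hdom I E) f)"
proof -
 let ?g = "inv_into (hdom I E) f"
 have E: "holes I E" and L: "holes I L" and hl: "f hol hdom I E" and bij: "bij_betw f (hdom I E) (hdom I L)"
  and b1: "!!R. bounded (f ` (hdom I E Int cball 0 R))" and b2: "!!R. bounded {z : hdom I E. f z : cball 0 R}"
  and c: "!!x z w i. range x <= hdom I E ==> x ----> z ==> (%k. f (x k)) ----> w ==> i : I ==> z : E i <-> w : L i"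
  using assms unfolding hole_map_def by auto
 have fg: "f (?g w) = w" "?g w : hdom I E" if "w : hdom I L" for w
  using bij that by (auto simp: bij_betw_def f_inv_into_f inv_into_into)
 have gf: "?g (f z) = z" "f z : hdom I L" if "z : hdom I E" for z using bij that by (auto simp: bij_betw_def)
 have img: "f ` hdom I E = hdom I L" using bij by (auto simp: bij_betw_def)
 have "?g hol hdom I L" using holomorphic_on_inv_into[OF hl open_hdom[OF E]] bij by (simp add: bij_betw_def)
 moreover have "bij_betw ?g (hdom I L) (hdom I E)" using bij by (rule bij_betw_inv_into)
 moreover have "bounded (?g ` (hdom I L Int cball 0 R))" for R by (rule bounded_subset[OF b2[of R]]) (use fg in auto)
 moreover have "bounded {w : hdom I L. ?g w : cball 0 R}" for R
 proof (rule bounded_subset[OF b1[of R]], rule subsetI)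
  fix w assume "w : {w : hdom I L. ?g w : cball 0 R}"
  thus "w : f ` (hdom I E Int cball 0 R)" using fg[of w] by force
 qed
 moreover have "z : L i <-> w : E i" if "range x <= hdom I L" "x ----> z" "(%k. ?g (x k)) ----> w" "i : I" for x z w i
  using c[of "%k. ?g (x k)" w z i] that fg by (auto simp: image_subset_iff)
 ultimately show ?thesis unfolding hole_map_def using E L by blast
qed

lemma hole_mapD:
 assumes "hole_map I E L f"
 shows "holes I E" "holes I L" "f hol hdom I E" "bij_betw f (hdom I E) (hdom I L)"
  "inj_on f (hdom I E)" "f ` hdom I E = hdom I L"
  "bounded (f ` (hdom I E Int cball 0 R))" "bounded {z : hdom I E. f z : cball 0 R}"
  "range x <= hdom I E ==> x ----> z ==> (%k. f (x k)) ----> w ==> i : I ==> z : E i <-> w : L i"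
 using assms unfolding hole_map_def bij_betw_def by auto

lemma hole_map_bounded_iff:
 assumes "hole_map I E L f" "range x <= hdom I E"
 shows "bounded (range (%k. f (x k))) <-> bounded (range x)"
proof
 assume "bounded (range x)"
 then obtain R where "range x <= cball 0 R" using bounded_subset_cball by auto
 hence "range (%k. f (x k)) <= f ` (hdom I E Int cball 0 R)" using assms by auto
 thus "bounded (range (%k. f (x k)))" using hole_mapD(7)[OF assms(1)] bounded_subset by blast
next
 assume "bounded (range (%k. f (x k)))"
 then obtain R where "range (%k. f (x k)) <= cball 0 R" using bounded_subset_cball by auto
 hence "range x <= {z : hdom I E. f z : cball 0 R}" using assms by auto
 thus "bounded (range x)" using hole_mapD(8)[OF assms(1)] bounded_subset by blast
qed

lemma bounded_seq_subseq:
 fixes x :: "nat => 'a::heine_borel"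
 assumes "bounded (range x)" obtains l r where "strict_mono (r::nat => nat)" "(%k. x (r k)) ----> l"
 using bounded_imp_convergent_subsequence[OF assms] by (auto simp: o_def)

lemma hole_map_comp:
 assumes f: "hole_map I E L f" and g: "hole_map I L K g"
 shows "hole_map I E K (%z. g (f z))"
proof -
 note F = hole_mapD[OF f] and G = hole_mapD[OF g]
 have sub: "f z : hdom I L" if "z : hdom I E" for z using F(6) that by auto
 have "(%z. g (f z)) hol hdom I E" using holomorphic_on_compose_gen[OF F(3) G(3)] sub by (auto simp: o_def)
 moreover have "bij_betw (%z. g (f z)) (hdom I E) (hdom I K)" using bij_betw_trans[OF F(4) G(4)] by (simp add: o_def)
 moreover have "bounded ((%z. g (f z)) ` (hdom I E Int cball 0 R))" for R
 proof -
  obtain R' where "f ` (hdom I E Int cball 0 R) <= cball 0 R'" using F(7) bounded_subset_cball by auto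
  hence "(%z. g (f z)) ` (hdom I E Int cball 0 R) <= g ` (hdom I L Int cball 0 R')" using sub by auto
  thus ?thesis using G(7) bounded_subset by blast
 qed
 moreover have "bounded {z : hdom I E. g (f z) : cball 0 R}" for R
 proof -
  obtain R' where "{z : hdom I L. g z : cball 0 R} <= cball 0 R'" using G(8) bounded_subset_cball by auto
  hence "{z : hdom I E. g (f z) : cball 0 R} <= {z : hdom I E. f z : cball 0 R'}" using sub by blast
  thus ?thesis using F(8) bounded_subset by blast
 qed
 moreover have "z : E i <-> w : K i"
  if x: "range x <= hdom I E" "x ----> z" "(%k. g (f (x k))) ----> w" "i : I" for x z w i
 proof -
  have "bounded (range (%k. f (x k)))" using hole_map_bounded_iff[OF f x(1)] x(2) convergent_imp_bounded by blast
  then obtain r l where r: "strict_mono r" "(%k. f (x (r k))) ----> l" by (rule bounded_seq_subseq)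
  have "(%k. x (r k)) ----> z" "(%k. g (f (x (r k)))) ----> w"
   using tendsto_subseq[OF x(2) r(1)] tendsto_subseq[OF x(3) r(1)] by auto
  moreover have "range (%k. x (r k)) <= hdom I E" "range (%k. f (x (r k))) <= hdom I L" using x(1) sub by auto
  ultimately show ?thesis using F(9)[of "%k. x (r k)" z l i] G(9)[of "%k. f (x (r k))" l w i] r x(4) by auto
 qed
 ultimately show ?thesis unfolding hole_map_def using F(1) G(2) by blast
qed

lemma compact_subseq:
 fixes S :: "'a::metric_space set"
 assumes "compact S" "!!k. x k : S"
 obtains l r where "l : S" "strict_mono (r :: nat => nat)" "(%k. x (r k)) ----> l"
 using assms unfolding compact_def o_def by metis

lemma tendsto_close:
 fixes x y :: "nat => 'a::real_normed_vector"
 assumes "!!k. dist (x k) (y k) < 1 / real (Suc k)" "y ----> l"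
 shows "x ----> l"
proof -
 have "(%k. x k - y k) ----> 0" by (rule Lim_null_comparison[OF _ lim_1_over_n[THEN LIMSEQ_Suc]])
   (use assms(1) in "auto simp: dist_norm intro!: always_eventually less_imp_le")
 from tendsto_add[OF this assms(2)] show ?thesis by simp
qed

lemma not_eventually_subseq:
 assumes "~ eventually P sequentially"
 shows "EX r :: nat => nat. strict_mono r & (ALL k. ~ P (r k))"
proof -
 have "infinite {k. ~ P k}" using assms by (metis cofinite_eq_sequentially eventually_cofinite)
 from infinite_enumerate[OF this] show ?thesis by simp
qed

lemma hole_map_tendsto:
 assumes f: "hole_map I E L f" and x: "range x <= hdom I E" "x ----> z" "z : E i" "i : I" and "e > 0"
 shows "EV k. f (x k) : nhd (L i) e"
proof (rule ccontr)
 assume "~ ?thesis"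
 from not_eventually_subseq[OF this] obtain r :: "nat => nat" where r: "strict_mono r" "!!k. f (x (r k)) ~: nhd (L i) e" by auto
 have "bounded (range (%k. f (x k)))" using hole_map_bounded_iff[OF f x(1)] x(2) convergent_imp_bounded by blast
 hence "bounded (range (%k. f (x (r k))))" by (rule bounded_subset) auto
 then obtain s l where s: "strict_mono s" "(%k. f (x (r (s k)))) ----> l" by (rule bounded_seq_subseq)
 have "(%k. x (r (s k))) ----> z" using tendsto_subseq[OF x(2) strict_mono_o[OF r(1) s(1)]] by simp
 hence "l : L i" using hole_mapD(9)[OF f, of "%k. x (r (s k))" z l i] x s by auto
 hence "l : nhd (L i) e" using subset_nhd[OF `e > 0`] by blast
 hence "EV k. f (x (r (s k))) : nhd (L i) e" using s(2) topological_tendstoD by blast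
 thus False using r(2) by auto
qed

text \<open>Compactness of \<open>E i\<close> turns the sequential correspondence into a uniform
  one: bad points at distance below \<open>1 / Suc k\<close> would converge, along a subsequence, to
  a point of \<open>E i\<close>.\<close>

lemma hole_map_nhd:
 assumes f: "hole_map I E L f" and i: "i : I" and "e > 0"
 obtains d where "d > 0" "!!z. z : nhd (E i) d ==> z : hdom I E ==> f z : nhd (L i) e"
proof (rule ccontr)
 assume "~ thesis"
 hence "ALL d>0. EX z. z : nhd (E i) d & z : hdom I E & f z ~: nhd (L i) e" using that by blast
 hence "ALL k. EX z. z : nhd (E i) (1 / real (Suc k)) & z : hdom I E & f z ~: nhd (L i) e" by auto
 then obtain x where x: "!!k. x k : nhd (E i) (1 / real (Suc k))" "!!k. x k : hdom I E" "!!k. f (x k) ~: nhd (L i) e" by metis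
 then obtain a where a: "!!k. a k : E i" "!!k. dist (a k) (x k) < 1 / real (Suc k)" unfolding in_nhd_iff by metis
 have "compact (E i)" using hole_mapD(1)[OF f] i by (auto simp: holes_def)
 then obtain l r where r: "l : E i" "strict_mono r" "(%k. a (r k)) ----> l" using compact_subseq a(1) by metis
 have "1 / real (Suc (r k)) <= 1 / real (Suc k)" for k using seq_suble[OF r(2), of k] by (simp add: frac_le)
 hence "dist (x (r k)) (a (r k)) < 1 / real (Suc k)" for k using a(2)[of "r k"] by (metis dist_commute less_le_trans)
 hence "(%k. x (r k)) ----> l" using r(3) by (rule tendsto_close)
 hence "EV k. f (x (r k)) : nhd (L i) e" using hole_map_tendsto[OF f _ _ r(1) i `e > 0`, of "%k. x (r k)"] x(2) by auto
 thus False using x(3) by auto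
qed

lemma injective_open_image:
 assumes "f hol S" "open S" "inj_on f S" "T <= S" "open T"
 shows "open (f ` T)" using open_mapping_thm3[of f T] assms holomorphic_on_subset inj_on_subset by blast

lemma eventually_norm_gt_at_infinity:
 "filterlim f at_infinity F ==> eventually (%x. norm (f x) > B) F"
 by (drule filterlim_at_infinity_imp_norm_at_top) (auto simp: filterlim_at_top_dense)

text \<open>The part of \<open>far M\<close> covered by the image of \<open>far r\<close> is open
  since \<open>f\<close> is an open map, and closed in \<open>far M\<close> since \<open>f\<close>
  tends to infinity at infinity and maps the circle of radius \<open>r\<close> into
  \<open>cball 0 M\<close>; as \<open>far M\<close> is connected, it is covered completely.
  Injectivity then leaves no value in \<open>far M\<close> for the points of
  \<open>cball 0 r\<close>.\<close>

lemma inj_image_far: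
 assumes E: "holes I E" and hl: "f hol hdom I E" and inj: "inj_on f (hdom I E)"
  and inf: "filterlim f at_infinity at_infinity"
  and r: "(UN i:I. E i) <= ball 0 r" and M: "!!z. cmod z = r ==> cmod (f z) <= M"
 shows "far M <= f ` far r"
  and "f ` (hdom I E Int cball 0 r) <= cball 0 M"
proof -
 define S where "S = far M"
 define T where "T = far r"
 have S: "connected S"
 proof -
  have "S = - cball 0 M" by (auto simp: S_def)
  thus ?thesis by (simp add: connected_complement_bounded_convex)
 qed
 have openT: "open T" unfolding T_def by (intro open_Collect_less continuous_intros)
 have T: "T <= hdom I E" "z : hdom I E" if "cmod z >= r" for z using r that by (auto simp: T_def hdom_def)
 have T': "T <= hdom I E" using r by (auto simp: T_def hdom_def)
 have oT: "open (f ` T)" using injective_open_image[OF hl open_hdom[OF E] inj T' openT] .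
 have clos: "l : f ` T" if l: "l : S" "!!k. w k : f ` T" "w ----> l" for l and w :: "nat => complex"
 proof -
  obtain z where z: "!!k. z k : T" "!!k. w k = f (z k)" using l(2) unfolding image_iff by metis
  have "bounded (range z)"
  proof -
   obtain B where B: "!!k. cmod (w k) <= B" using convergent_imp_bounded[OF l(3)] by (auto simp: bounded_iff)
   have "eventually (%z. cmod (f z) > B) at_infinity" using inf by (rule eventually_norm_gt_at_infinity)
   then obtain b where "!!z. cmod z >= b ==> cmod (f z) > B" by (auto simp: eventually_at_infinity)
   hence "cmod (z k) <= b" for k using B[of k] z(2)[of k] by (metis linear not_le)
   thus ?thesis by (auto simp: bounded_iff)
  qed
  then obtain q a where q: "strict_mono q" "(%k. z (q k)) ----> a" by (rule bounded_seq_subseq)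
  have "cmod (z k) >= r" for k using z(1)[of k] by (auto simp: T_def)
  hence ar: "cmod a >= r" using q(2) tendsto_norm LIMSEQ_le_const by blast
  hence "a : hdom I E" using T(2) by auto
  hence "isCont f a" using hl open_hdom[OF E] holomorphic_on_imp_continuous_on continuous_on_eq_continuous_at by blast
  hence "(%k. f (z (q k))) ----> f a" using q(2) by (rule isCont_tendsto_compose)
  moreover have "(%k. f (z (q k))) ----> l" using tendsto_subseq[OF l(3) q(1)] z(2) by simp
  ultimately have "l = f a" using LIMSEQ_unique by blast
  moreover have "cmod a ~= r" using M[of a] l(1) `l = f a` by (auto simp: S_def)
  ultimately show ?thesis using ar by (auto simp: T_def)
 qed
 have "S <= f ` T"
 proof -
  have "closedin (top_of_set S) (S Int f ` T)"
  proof -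
   have "l : f ` T" if "l : S" "l : closure (f ` T)" for l using clos[OF that(1)] that(2) by (auto simp: closure_sequential)
   hence "S Int f ` T = S Int closure (f ` T)" using closure_subset[of "f ` T"] by auto
   thus ?thesis by (simp add: closedin_closed_Int)
  qed
  moreover have "openin (top_of_set S) (S Int f ` T)" using oT by auto
  moreover have "S Int f ` T ~= {}"
  proof -
   have "eventually (%z. cmod (f z) > M) at_infinity" using inf by (rule eventually_norm_gt_at_infinity)
   then obtain b where b: "!!z. cmod z >= b ==> cmod (f z) > M" by (auto simp: eventually_at_infinity)
   define c where "c = complex_of_real (max b (r + 1))"
   have "c : T" by (auto simp: T_def c_def)
   moreover have "cmod c >= b" by (auto simp: c_def)
   ultimately show ?thesis using b[of c] unfolding S_def by blast
  qed
  ultimately have "S Int f ` T = S" using S connected_clopen by blast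
  thus ?thesis by auto
 qed
 thus "far M <= f ` far r" by (simp add: S_def T_def)
 show "f ` (hdom I E Int cball 0 r) <= cball 0 M"
 proof
  fix w assume "w : f ` (hdom I E Int cball 0 r)"
  then obtain z where z: "z : hdom I E" "cmod z <= r" "w = f z" by auto
  show "w : cball 0 M"
  proof (rule ccontr)
   assume "w ~: cball 0 M"
   hence "w : S" by (auto simp: S_def)
   then obtain z' where "z' : T" "w = f z'" using \<open>S <= f ` T\<close> by auto
   hence "z' = z" using inj z T' by (auto simp: inj_on_def)
   thus False using z `z' : T` by (auto simp: T_def)
  qed
 qed
qed

text \<open>A component inside the interior of \<open>K\<close> would be open and closed, hence the
  whole plane, which is unbounded.\<close>

lemma component_meets_frontier:
 fixes K :: "complex set"
 assumes "compact K" "q : K"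
 shows "connected_component_set K q Int frontier K ~= {}"
proof
 assume a: "connected_component_set K q Int frontier K = {}"
 let ?Q = "connected_component_set K q"
 have "closed K" using assms by (simp add: compact_imp_closed)
 have "?Q <= K" by (rule connected_component_subset)
 have Qint: "?Q <= interior K" using a `?Q <= K` `closed K` by (auto simp: frontier_def)
 have cl: "closed ?Q" using `closed K` by (rule closed_connected_component)
 have "open ?Q"
 using openI Qint mem_interior connected_component_maximal connected_component_eq by (metis connected_component_intermediate_subset interior_subset open_connected_component open_interior)
 hence "?Q = {} | ?Q = UNIV" using cl clopen[of ?Q] by simp
 moreover have "q : ?Q" using assms(2) by simp
 ultimately have "?Q = UNIV" by blast
 hence "bounded (UNIV :: complex set)" using compact_imp_bounded[OF assms(1)] bounded_subset `?Q <= K` by metis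
 thus False by simp
qed

text \<open>The image holes are the components of the complement \<open>K\<close> of the image. To
  each \<open>E i\<close> belongs a connected cluster set \<open>C i\<close>, the limit of images of
  shrinking rings around \<open>E i\<close>; \<open>L i\<close> is the component of \<open>K\<close>
  that contains it. All components arise in this way because each meets the frontier of
  \<open>K\<close>, and frontier points are cluster values. No component arises twice because a thin
  ring around it has a connected preimage, which lies near the holes and therefore near only one of
  them.\<close>

theorem hole_map_exists:
 assumes E: "holes I E" and hl: "f hol hdom I E" and inj: "inj_on f (hdom I E)"
  and inf: "filterlim f at_infinity at_infinity"
 shows "EX L. hole_map I E L f"
proof -
 let ?D = "hdom I E"
 define D' where "D' = f ` ?D"
 have oD: "open ?D" and cD: "connected ?D" using open_hdom[OF E] connected_hdom[OF E] by auto
 have conf: "continuous_on ?D f" using hl by (rule holomorphic_on_imp_continuous_on)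
 have oD': "open D'" unfolding D'_def using injective_open_image[OF hl oD inj] oD by blast
 have cD': "connected D'" unfolding D'_def using conf cD by (rule connected_continuous_image)
 obtain R0 where R0: "R0 > 0" "(UN i:I. E i) <= ball 0 R0" using hdom_outside_ball[OF E] .
 have sph: "EX M. ALL z. cmod z = R --> cmod (f z) <= M" if "R >= R0" for R
 proof -
  have "sphere 0 R <= ?D" using R0 that by (auto simp: hdom_def)
  hence "compact (f ` sphere 0 R)" using conf by (meson compact_continuous_image compact_sphere continuous_on_subset)
  thus ?thesis using compact_imp_bounded by (fastforce simp: bounded_iff)
 qed
 have bd1: "bounded (f ` (?D Int cball 0 R))" for R
 proof -
  obtain M where M: "!!z. cmod z = max R R0 ==> cmod (f z) <= M" using sph[of "max R R0"] by auto
  have "f ` (?D Int cball 0 (max R R0)) <= cball 0 M" by (rule inj_image_far(2)[OF E hl inj inf]) (use R0 M in auto)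
  hence "f ` (?D Int cball 0 R) <= cball 0 M" by auto
  thus ?thesis using bounded_subset by blast
 qed
 have bd2: "bounded {z : ?D. f z : cball 0 R}" for R
 proof -
  have "eventually (%z. cmod (f z) > R) at_infinity" using inf by (rule eventually_norm_gt_at_infinity)
  then obtain b where "!!z. cmod z >= b ==> cmod (f z) > R" by (auto simp: eventually_at_infinity)
  hence "!!z. cmod (f z) <= R ==> cmod z <= b" by (metis linear not_le)
  thus ?thesis unfolding bounded_iff by auto
 qed
 define K where "K = - D'"
 have "compact K"
 proof -
  obtain M where M: "!!z. cmod z = R0 ==> cmod (f z) <= M" using sph[of R0] by auto
  have "far M <= f ` far R0" by (rule inj_image_far(1)[OF E hl inj inf]) (use R0 M in auto)
  also have "... <= D'" unfolding D'_def using R0(2) by (intro image_mono) (auto simp: hdom_def)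
  finally have "K <= cball 0 M" by (auto simp: K_def not_le[symmetric])
  thus ?thesis using oD' bounded_subset compact_eq_bounded_closed unfolding K_def by blast
 qed
 \<comment> \<open>A value \<open>f a\<close> is taken near \<open>a\<close> on a whole
   neighbourhood, so by injectivity points with values near \<open>f a\<close> lie near
   \<open>a\<close> and cannot leave the domain.\<close>
 have seqK: "w : K" if "range x <= ?D" "x ----> z" "z ~: ?D" "(%k. f (x k)) ----> w" for x z w
 proof (rule ccontr)
  assume "w ~: K"
  then obtain a where a: "a : ?D" "w = f a" by (auto simp: K_def D'_def)
  obtain e where e: "e > 0" "cball a e <= ?D" using oD a(1) open_contains_cball by blast
  have "open (f ` ball a e)" using injective_open_image[OF hl oD inj] e by (meson ball_subset_cball open_ball order_trans)
  moreover have "w : f ` ball a e" using a e by auto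
  ultimately have "EV k. f (x k) : f ` ball a e" using that(4) topological_tendstoD by blast
  hence "EV k. x k : cball a e"
  proof eventually_elim
   case (elim k)
   thus ?case using inj that(1) e(2) by (force simp: inj_on_def)
  qed
  hence "z : cball a e" by (intro Lim_in_closed_set[OF closed_cball _ _ that(2)]) auto
  thus False using e that(3) by auto
 qed
 obtain ep where ep: "ep > 0" "!!i j. i : I ==> j : I ==> i ~= j ==> nhd (E i) ep Int nhd (E j) ep = {}"
  using holes_subset_nhd[OF E zero_less_one] by metis
 \<comment> \<open>Rings around \<open>E i\<close>, connected because \<open>E i\<close> does not
   separate the plane; their width is at most \<open>ep\<close>, so they avoid the other
   holes.\<close>
 define N where "N i n = nhd (E i) (ep / real (Suc n)) - E i" for i n
 have N: "N i n <= ?D" "connected (N i n)" "N i n ~= {}" if "i : I" for i n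
 proof -
  have comp: "compact (E i)" "connected (E i)" "E i ~= {}" using E that by (auto simp: holes_def)
  have p: "ep / real (Suc n) > 0" using ep by auto
  have le: "ep / real (Suc n) <= ep" using ep(1) by (auto simp: field_simps)
  have Ej: "E j <= nhd (E j) ep" for j using ep by (intro subset_nhd)
  show "N i n <= ?D"
  proof
   fix x assume x: "x : N i n"
   hence "x : nhd (E i) ep" using nhd_mono[OF order_refl le] by (auto simp: N_def)
   hence "x ~: E j" if "j : I" "j ~= i" for j using ep(2)[of i j] Ej[of j] `i : I` that by auto
   moreover have "x ~: E i" using x by (auto simp: N_def)
   ultimately show "x : ?D" unfolding hdom_def by blast
  qed
  show "connected (N i n)" unfolding N_def
   using comp subset_nhd[OF p] holes_connected_compl[OF E that] by (intro connected_open_diff_closed connected_nhd) auto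
  show "N i n ~= {}"
  using subset_nhd p comp open_nhd compact_imp_closed clopen by (metis Diff_eq_empty_iff N_def compact_open dual_order.antisym)
 qed
 have Nmono: "N i n <= N i m" if "m <= n" for i n m
  unfolding N_def using nhd_mono[OF order_refl, of "ep / real (Suc n)" "ep / real (Suc m)"] ep(1) that by (auto simp: frac_le)
 define C where "C i = (\<Inter>n. closure (f ` N i n))" for i
 have C: "C i ~= {}" "connected (C i)" "C i <= K" if "i : I" for i
 proof -
  have comp: "compact (closure (f ` N i n))" for n
  proof -
   have "bounded (E i)" using E that by (auto simp: holes_def compact_imp_bounded)
   hence "bounded (N i n)" unfolding N_def by (meson bounded_nhd bounded_subset Diff_subset)
   then obtain R where "N i n <= cball 0 R" by (rule bounded_subset_cball)
   hence "f ` N i n <= f ` (?D Int cball 0 R)" using N[OF that] by auto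
   hence "bounded (f ` N i n)" using bd1 bounded_subset by blast
   thus ?thesis by simp
  qed
  have mono: "closure (f ` N i n) <= closure (f ` N i m)" if "m <= n" for m n
   using Nmono[OF that] by (intro closure_mono image_mono)
  have con: "connected (closure (f ` N i n))" for n
   using connected_continuous_image[OF continuous_on_subset[OF conf N(1)[OF that]] N(2)[OF that]] connected_imp_connected_closure by blast
  show "C i ~= {}" unfolding C_def by (rule compact_nest) (use comp mono N(3)[OF that] in auto)
  show "connected (C i)" unfolding C_def by (rule connected_nest) (use comp mono con in auto)
  show "C i <= K"
  proof
   fix w assume w: "w : C i"
   have "EX x. x : N i k & dist (f x) w < 1 / real (Suc k)" for k
   proof -
    have "w : closure (f ` N i k)" using w by (auto simp: C_def)
    thus ?thesis unfolding closure_approachable by (auto dest!: spec[of _ "1 / real (Suc k)"])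
   qed
   then obtain x where x: "!!k. x k : N i k" "!!k. dist (f (x k)) w < 1 / real (Suc k)" by metis
   have fx: "(%k. f (x k)) ----> w" by (rule tendsto_close[OF x(2) tendsto_const])
   have "bounded (E i)" using E that by (auto simp: holes_def compact_imp_bounded)
   have "bounded (range x)"
   proof -
    have "range x <= N i 0" using x(1) Nmono by blast
    thus ?thesis using bounded_nhd[OF `bounded (E i)`] bounded_subset unfolding N_def by blast
   qed
   then obtain q z where q: "strict_mono q" "(%k. x (q k)) ----> z" by (rule bounded_seq_subseq)
   have "z ~: ?D"
   proof
    assume "z : ?D"
    hence "z : - E i" "open (- E i)" using E that by (auto simp: hdom_def holes_def compact_imp_closed)
    then obtain d where d: "d > 0" "ball z d <= - E i" using open_contains_ball by blast
    obtain n0 where n0: "ep / real (Suc n0) < d / 2"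
    proof -
     obtain n0 where "ep / (d/2) < real n0" using reals_Archimedean2 by blast
     hence "ep / (d/2) < real (Suc n0)" by simp
     hence "ep / real (Suc n0) < d / 2" using d by (simp add: field_simps)
     thus ?thesis using that by blast
    qed
    have "EV k. dist (x (q k)) z < d / 2" using q(2) d unfolding tendsto_iff by (meson half_gt_zero)
    then obtain k where k: "k >= n0" "dist (x (q k)) z < d / 2" unfolding eventually_sequentially by (metis le_add1 le_add2)
    have "q k >= n0" using k(1) seq_suble[OF q(1), of k] by simp
    hence "x (q k) : N i n0" using x(1)[of "q k"] Nmono by blast
    then obtain a where "a : E i" "dist a (x (q k)) < d / 2" using n0 unfolding N_def in_nhd_iff Diff_iff by (meson less_trans)
    hence "dist z a < d" using k(2) dist_triangle[of z a "x (q k)"] by (simp add: dist_commute)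
    thus False using d(2) `a : E i` by auto
   qed
   moreover have "range (%k. x (q k)) <= ?D" using x(1) N(1)[OF that] by blast
   moreover have "(%k. f (x (q k))) ----> w" using tendsto_subseq[OF fx q(1)] by simp
   ultimately show "w : K" using seqK q(2) by blast
  qed
 qed
 have limC: "w : C i" if "range x <= ?D" "x ----> z" "z : E i" "(%k. f (x k)) ----> w" "i : I" for x z w i unfolding C_def
 proof
  fix n
  have "z : nhd (E i) (ep / real (Suc n))" using subset_nhd[of "ep / real (Suc n)" "E i"] ep(1) that by auto
  hence "EV k. x k : nhd (E i) (ep / real (Suc n))" using that(2) topological_tendstoD open_nhd by metis
  hence "EV k. f (x k) : f ` N i n"
  proof eventually_elim
   case (elim k)
   have "x k ~: E i" using that by (auto simp: hdom_def)
   thus ?case using elim by (auto simp: N_def)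
  qed
  thus "w : closure (f ` N i n)"
   by (intro Lim_in_closed_set[OF closed_closure _ _ that(4)]) (auto elim!: eventually_mono intro: subsetD[OF closure_subset])
 qed
 define c where "c i = (SOME w. w : C i)" for i
 \<comment> \<open>\<open>C i\<close> holds only limit values, for example only the boundary of a
   fat hole; its component in \<open>K\<close> is the whole hole.\<close>
 define L where "L i = connected_component_set K (c i)" for i
 have c: "c i : C i" if "i : I" for i using C(1)[OF that] unfolding c_def by (meson all_not_in_conv someI_ex)
 have CL: "C i <= L i" if "i : I" for i unfolding L_def using C[OF that] c[OF that] by (intro connected_component_maximal)
 have LK: "L i <= K" for i unfolding L_def by (rule connected_component_subset)
 have Lcon: "connected (L i)" for i unfolding L_def by simp
 have "closed K" using `compact K` by (simp add: compact_imp_closed)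
 have Lcomp: "compact (L i)" for i
  unfolding L_def using `compact K` connected_component_subset by (metis bounded_subset closed_connected_component compact_eq_bounded_closed)
 have Lne: "L i ~= {}" if "i : I" for i using CL[OF that] C(1)[OF that] by auto
 have front: "EX i:I. w : C i" if w: "w : frontier K" for w
 proof -
  have "w : closure D'" using w unfolding frontier_def K_def by (simp add: closure_interior)
  have "w : K" using w `closed K` by (meson frontier_subset_closed subsetD)
  obtain y where y: "!!k. y k : D'" "y ----> w" using `w : closure D'` unfolding closure_sequential by blast
  then obtain x where x: "!!k. x k : ?D" "!!k. y k = f (x k)" unfolding D'_def image_iff by metis
  obtain R where "range y <= cball 0 R" using convergent_imp_bounded[OF y(2)] bounded_subset_cball by auto
  hence "range x <= {z : ?D. f z : cball 0 R}" using x by auto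
  hence "bounded (range x)" using bd2 bounded_subset by blast
  then obtain q z where q: "strict_mono q" "(%k. x (q k)) ----> z" by (rule bounded_seq_subseq)
  have fq: "(%k. f (x (q k))) ----> w" using tendsto_subseq[OF y(2) q(1)] x(2) by simp
  have "z ~: ?D"
  proof
   assume "z : ?D"
   hence "isCont f z" using conf oD by (simp add: continuous_on_eq_continuous_at)
   hence "(%k. f (x (q k))) ----> f z" using q(2) by (rule isCont_tendsto_compose)
   hence "w = f z" using fq LIMSEQ_unique by blast
   thus False using `z : ?D` `w : K` by (auto simp: K_def D'_def)
  qed
  then obtain i where "i : I" "z : E i" by (auto simp: hdom_def)
  moreover have "range (%k. x (q k)) <= ?D" using x by auto
  ultimately show ?thesis using limC[OF _ q(2) _ fq] by blast
 qed
 have LU: "(UN i:I. L i) = K"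
 proof
  show "K <= (UN i:I. L i)"
  proof
   fix q assume "q : K"
   then obtain w where w: "w : connected_component_set K q" "w : frontier K"
    using component_meets_frontier[OF `compact K`] by blast
   then obtain i where i: "i : I" "w : C i" using front by blast
   have "connected_component_set K (c i) = connected_component_set K w"
    using CL[OF i(1)] i(2) unfolding L_def by (metis connected_component_eq subsetD)
   also have "... = connected_component_set K q" using w(1) by (metis connected_component_eq)
   finally have "q : L i" unfolding L_def using `q : K` by simp
   thus "q : (UN i:I. L i)" using i by auto
  qed
 qed (use LK in auto)
 have Ldisj: "i = j" if ij: "i : I" "j : I" "L i Int L j ~= {}" for i j
 proof (rule ccontr)
  assume "i ~= j"
  have eq: "L i = L j" using ij(3) unfolding L_def by (metis connected_component_eq disjoint_iff)
  define Q where "Q = L i"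
  define Rest where "Rest = (UN k:{k:I. L k ~= Q}. L k)"
  have "closed Rest" unfolding Rest_def using E Lcomp by (intro closed_UN) (auto simp: holes_def compact_imp_closed)
  have dj: "Q Int Rest = {}"
  unfolding Q_def L_def Rest_def using that connected_component_disjoint connected_component_eq disjoint_iff by blast
  have QR: "Q Un Rest = K" using LU ij unfolding Q_def Rest_def by auto
  have Qc: "compact Q" "closed Q" unfolding Q_def using Lcomp compact_imp_closed by auto
  have "connected (- Q)" by (rule connected_compl_part[where B = Rest]) (use Qc `closed Rest` dj QR cD' in "auto simp: K_def")
  obtain dl0 where dl0: "dl0 > 0" "nhd Q dl0 <= - Rest" using nhd_subset_open[OF Qc(1), of "- Rest"] `closed Rest` dj by auto
  \<comment> \<open>Rings around the doubly used component \<open>Q\<close>, inside the image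
    domain. For some \<open>n\<close> the preimage lies in the union of the disjoint sets
    \<open>nhd (E k) ep\<close>, yet it meets those of \<open>i\<close> and of
    \<open>j\<close>.\<close>
  define T where "T n = nhd Q (dl0 / real (Suc n)) - Q" for n
  have TD: "T n <= D'" for n
  proof -
   have "nhd Q (dl0 / real (Suc n)) <= nhd Q dl0" using dl0 by (intro nhd_mono) (auto simp: field_simps)
   hence "T n <= - Q Int - Rest" using dl0 by (auto simp: T_def)
   thus ?thesis using QR unfolding K_def by auto
  qed
  have Tcon: "connected (T n)" for n unfolding T_def
   using dl0 Lcon `connected (- Q)` Qc by (intro connected_open_diff_closed connected_nhd subset_nhd) (auto simp: Q_def)
  let ?g = "inv_into ?D f"
  have conG: "continuous_on D' ?g"
   unfolding D'_def using holomorphic_on_inv_into[OF hl oD inj] by (rule holomorphic_on_imp_continuous_on)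
  have gD: "?g w : ?D" "f (?g w) = w" if "w : D'" for w using that unfolding D'_def by (auto simp: inv_into_into f_inv_into_f)
  have "EX n. ?g ` T n <= (UN k:I. nhd (E k) ep)"
  proof (rule ccontr)
   assume "~ ?thesis"
   hence "ALL n. EX w. w : T n & ?g w ~: (UN k:I. nhd (E k) ep)" by blast
   then obtain w where w: "!!n. w n : T n" "!!n. ?g (w n) ~: (UN k:I. nhd (E k) ep)" by metis
   have wD: "w n : D'" for n using TD w(1) by blast
   have "w n : nhd Q (dl0 / real (Suc n))" for n using w by (auto simp: T_def)
   hence "w n : nhd Q dl0" for n using dl0 nhd_mono[OF order_refl, of "dl0 / real (Suc n)" dl0 Q] by (auto simp: field_simps)
   hence "bounded (range w)" using bounded_nhd[OF compact_imp_bounded[OF Qc(1)]] by (metis bounded_subset image_subsetI)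
   then obtain R where "range w <= cball 0 R" by (rule bounded_subset_cball)
   hence "?g (w n) : {z : ?D. f z : cball 0 R}" for n using gD[OF wD[of n]] by blast
   hence "range (%n. ?g (w n)) <= {z : ?D. f z : cball 0 R}" by auto
   hence "bounded (range (%n. ?g (w n)))" using bd2 bounded_subset by blast
   then obtain q z where q: "strict_mono q" "(%k. ?g (w (q k))) ----> z" by (rule bounded_seq_subseq)
   have zn: "z ~: (UN k:I. nhd (E k) ep)"
   proof
    assume "z : (UN k:I. nhd (E k) ep)"
    hence "EV k. ?g (w (q k)) : (UN k:I. nhd (E k) ep)" using q(2) topological_tendstoD by (metis open_UN open_nhd)
    thus False using w(2) by auto
   qed
   have "z : ?D" unfolding hdom_def using ep subset_nhd zn by blast
   hence "isCont f z" using conf oD by (simp add: continuous_on_eq_continuous_at)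
   hence "(%k. f (?g (w (q k)))) ----> f z" using q(2) by (rule isCont_tendsto_compose)
   hence wq: "(%k. w (q k)) ----> f z" using gD(2)[OF wD] by simp
   have "f z : Q"
   proof (rule ccontr)
    assume "f z ~: Q"
    then obtain d where d: "d > 0" "ball (f z) d <= - Q" using Qc(2) by (meson ComplI open_Compl open_contains_ball)
    obtain n0 where n0: "dl0 / (d/2) < real n0" using reals_Archimedean2 by blast
    hence n1: "dl0 / real (Suc n) < d / 2" if "n >= n0" for n
    proof -
     have "dl0 / (d/2) < real (Suc n)" using n0 that by simp
     thus ?thesis using d by (simp add: field_simps)
    qed
    have "EV k. dist (w (q k)) (f z) < d / 2" using wq d unfolding tendsto_iff by (meson half_gt_zero)
    then obtain k where k: "k >= n0" "dist (w (q k)) (f z) < d / 2" unfolding eventually_sequentially by (metis le_add1 le_add2)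
    have "q k >= n0" using k(1) seq_suble[OF q(1), of k] by simp
    then obtain a where "a : Q" "dist a (w (q k)) < d / 2"
     using n1[of "q k"] w(1)[of "q k"] unfolding T_def in_nhd_iff Diff_iff by (meson less_trans)
    hence "dist (f z) a < d" using k(2) dist_triangle[of "f z" a "w (q k)"] by (simp add: dist_commute)
    thus False using d(2) `a : Q` by auto
   qed
   thus False using `z : ?D` QR unfolding K_def D'_def by auto
  qed
  then obtain n where n: "?g ` T n <= (UN k:I. nhd (E k) ep)" by auto
  have gT: "connected (?g ` T n)" using connected_continuous_image[OF continuous_on_subset[OF conG TD] Tcon] .
  have meet: "?g ` T n Int nhd (E k) ep ~= {}" if k: "k : I" "L k = Q" for k
  proof -
   obtain w where w: "w : C k" using C(1)[OF k(1)] by auto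
   hence "w : Q" using CL k by auto
   hence wn: "w : nhd Q (dl0 / real (Suc n))" using subset_nhd[of "dl0 / real (Suc n)" Q] dl0 by auto
   have "w : closure (f ` N k 0)" using w by (auto simp: C_def)
   then obtain y where "y : f ` N k 0" "y : nhd Q (dl0 / real (Suc n))"
    using wn open_nhd by (metis closure_iff_nhds_not_empty disjoint_iff order_refl)
   then obtain x where x: "x : N k 0" "f x : nhd Q (dl0 / real (Suc n))" by auto
   have xD: "x : ?D" using x(1) N(1)[OF k(1)] by auto
   hence "f x ~: Q" using QR unfolding K_def D'_def by auto
   hence "f x : T n" using x(2) by (auto simp: T_def)
   moreover have "?g (f x) = x" using xD inj by auto
   moreover have "x : nhd (E k) ep" using x(1) by (auto simp: N_def)
   ultimately show ?thesis by auto
  qed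
  let ?A = "nhd (E i) ep" and ?B = "UN k:I-{i}. nhd (E k) ep"
  have "open ?A" "open ?B" by auto
  moreover have "?A Int ?B Int ?g ` T n = {}" using ep(2)[OF ij(1)] by auto
  moreover have "?g ` T n <= ?A Un ?B" using n by auto
  moreover have "?A Int ?g ` T n ~= {}" using meet[of i] ij by (auto simp: Q_def)
  moreover have "?B Int ?g ` T n ~= {}" using meet[of j] ij eq `i ~= j` by (auto simp: Q_def)
  ultimately show False using gT unfolding connected_def by (metis (no_types, lifting))
 qed
 have L: "holes I L" unfolding holes_def
 proof (intro conjI ballI)
  show "finite I" using E by (auto simp: holes_def)
  show "disjoint_family_on L I" using Ldisj by (auto simp: disjoint_family_on_def)
  show "connected (- (UN i:I. L i))" using LU cD' by (simp add: K_def)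
 qed (use Lcomp Lcon Lne in auto)
 have D'L: "D' = hdom I L" using LU by (auto simp: hdom_def K_def)
 have "hole_map I E L f" unfolding hole_map_def
 proof (intro conjI allI impI)
  show "bij_betw f ?D (hdom I L)" using inj D'L by (auto simp: bij_betw_def D'_def)
  fix x z w i assume x: "range x <= ?D" "x ----> z" "(%k. f (x k)) ----> w" "i : I"
  have 1: "w : L k" if "z : E k" "k : I" for k using limC[OF x(1,2) that(1) x(3) that(2)] CL[OF that(2)] by auto
  show "z : E i <-> w : L i"
  proof
   assume w: "w : L i"
   have "z ~: ?D"
   proof
    assume "z : ?D"
    hence "isCont f z" using conf oD by (simp add: continuous_on_eq_continuous_at)
    hence "(%k. f (x k)) ----> f z" using x(2) by (rule isCont_tendsto_compose)
    hence "w = f z" using x(3) LIMSEQ_unique by blast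
    thus False using `z : ?D` w LK by (auto simp: K_def D'_def)
   qed
   then obtain k where k: "k : I" "z : E k" by (auto simp: hdom_def)
   hence "w : L k" using 1 by blast
   hence "k = i" using Ldisj[of k i] k x(4) w by auto
   thus "z : E i" using k by simp
  qed (use 1 x(4) in auto)
 qed (use E L hl bd1 bd2 in auto)
 thus ?thesis by auto
qed

section \<open>Distortion of univalent functions, with constants that are not sharp\<close>

lemma simple_scale_holomorphic:
 assumes "f hol ball 0 1" "0 < t" "t < 1"
 shows "(%z. f (of_real t * z)) hol cball 0 1"
proof -
 have "(f o (%z. of_real t * z)) hol cball 0 1"
 proof (rule holomorphic_on_compose_gen[OF _ assms(1)])
  show "(*) (complex_of_real t) ` cball 0 1 <= ball 0 1"
  proof
   fix w assume "w : (*) (complex_of_real t) ` cball 0 1"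
   then obtain z where z: "cmod z <= 1" "w = of_real t * z" by auto
   have "cmod w = t * cmod z" using z assms by (simp add: norm_mult)
   also have "... <= t * 1" using z assms by simp
   finally show "w : ball 0 1" using assms by simp
  qed
 qed (intro holomorphic_intros)
 thus ?thesis by (simp add: o_def)
qed

text \<open>Otherwise the inverse function, precomposed with doubling, would be a self-map of the
  unit disc with derivative 2 at 0, against the Schwarz lemma.\<close>

lemma univalent_omits:
 assumes k: "k hol ball 0 1" "inj_on k (ball 0 1)" "k 0 = 0" "deriv k 0 = 1"
 obtains w where "cmod w < 2" "w ~: k ` ball 0 1"
proof (rule ccontr)
 assume "~ thesis"
 hence sub: "ball 0 2 <= k ` ball 0 1" using that by force
 let ?g = "inv_into (ball 0 1) k"
 have g: "?g hol k ` ball 0 1" using k by (intro holomorphic_on_inv_into) auto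
 define fi where "fi z = ?g (2 * z)" for z
 have im: "(%z. 2 * z) ` ball 0 1 <= ball (0::complex) 2" by auto
 have "fi hol ball 0 1" unfolding fi_def using holomorphic_on_compose_gen[of "%z. 2 * z" "ball 0 1" ?g "k ` ball 0 1"] g im sub
  by (auto simp: o_def intro!: holomorphic_intros)
 moreover have g0: "?g 0 = 0" using k inv_into_f_f[of k "ball 0 1" 0] by simp
 hence "fi 0 = 0" by (simp add: fi_def)
 moreover have "cmod (fi z) < 1" if "cmod z < 1" for z
 proof -
  have "2 * z : k ` ball 0 1" using that sub by auto
  hence "?g (2 * z) : ball 0 1" by (rule inv_into_into)
  thus ?thesis by (simp add: fi_def)
 qed
 ultimately have le: "cmod (deriv fi 0) <= 1" using Schwarz_Lemma(2)[of fi 0] by simp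
 have "(fi has_field_derivative deriv fi 0) (at 0)" using `fi hol ball 0 1` by (intro holomorphic_derivI[of _ "ball 0 1"]) auto
 moreover have "(k has_field_derivative 1) (at 0)" using k by (metis holomorphic_derivI centre_in_ball open_ball zero_less_one)
 ultimately have "((%z. k (fi z)) has_field_derivative 1 * deriv fi 0) (at 0)"
  using DERIV_chain2[of k 1 fi 0 "deriv fi 0" UNIV] `fi 0 = 0` by simp
 moreover have "((%z. k (fi z)) has_field_derivative 2) (at 0)"
 proof (rule has_field_derivative_transform_within_open[of "%z. 2 * z" _ _ "ball 0 1"])
  show "((%z. 2 * z) has_field_derivative 2) (at (0::complex))" by simp
  show "2 * z = k (fi z)" if "z : ball 0 1" for z
  proof -
   have "2 * z : k ` ball 0 1" using that sub im by blast
   thus ?thesis by (simp add: fi_def f_inv_into_f)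
  qed
 qed auto
 ultimately have "deriv fi 0 = 2" using DERIV_unique by simp
 thus False using le by simp
qed

text \<open>The root is normalised by \<open>h 0 = 1\<close>. Where \<open>h z = -1\<close> one has
  \<open>k z = 0\<close>, hence \<open>z = 0\<close> by injectivity, where \<open>h\<close> is 1. So
  \<open>- h\<close> omits 0 and 1, as Schottky's theorem requires.\<close>

lemma sqrt_of_univalent:
 assumes k: "k hol ball 0 1" "inj_on k (ball 0 1)" "k 0 = 0" and w: "w ~: k ` ball 0 1"
 obtains h where "h hol ball 0 1" "h 0 = 1" "!!z. z : ball 0 1 ==> (h z)^2 = 1 - k z / w"
  "!!z. z : ball 0 1 ==> h z ~= 0 & h z ~= -1"
proof -
 have w0: "w ~= 0" using w k(3) by auto
 have "(%z. 1 - k z / w) hol ball 0 1" using k by (intro holomorphic_intros) auto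
 moreover have nz: "1 - k z / w ~= 0" if "z : ball 0 1" for z using that w by auto
 ultimately obtain g where g: "g hol ball 0 1" "!!z. z : ball 0 1 ==> 1 - k z / w = (g z)^2"
  using contractible_imp_holomorphic_sqrt[of "%z. 1 - k z / w" "ball 0 1"] convex_imp_contractible convex_ball by metis
 have g0: "(g 0)^2 = 1" using g(2)[of 0] k(3) by simp
 define h where "h z = g z * g 0" for z
 have h: "h hol ball 0 1" unfolding h_def using g by (intro holomorphic_intros) auto
 have h2: "(h z)^2 = 1 - k z / w" if "z : ball 0 1" for z using g(2)[OF that] g0 by (simp add: h_def power_mult_distrib)
 have h0: "h 0 = 1" using g0 by (simp add: h_def power2_eq_square)
 have "h z ~= 0 & h z ~= -1" if "z : ball 0 1" for z
 proof
  show "h z ~= 0" using h2[OF that] nz[OF that] by auto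
  show "h z ~= -1"
  proof
   assume "h z = -1"
   hence "k z = k 0" using h2[OF that] w0 k(3) by simp
   hence "z = 0" using k(2) that by (metis centre_in_ball inj_onD zero_less_one)
   thus False using h0 `h z = -1` by simp
  qed
 qed
 thus ?thesis using that h h0 h2 by blast
qed

lemma univalent_bound:
 "EX M>0. ALL k. k hol ball 0 1 & inj_on k (ball 0 1) & k 0 = 0 & deriv k 0 = 1 -->
   (ALL z. cmod z <= 1/2 --> cmod (k z) < M)"
proof -
 \<comment> \<open>Schottky's bound on the disc of radius 2/3 for a function whose value at 0 has
   modulus at most 1.\<close>
 define B where "B = exp (pi * exp (pi * (2 + 2 * 1 + 12 * (2/3) / (1 - 2/3 :: real))))"
 have B: "B > 0" by (simp add: B_def)
 show ?thesis
 proof (intro exI[of _ "2 * (1 + B^2) + 1"] conjI allI impI)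
  show "2 * (1 + B\<^sup>2) + 1 > 0" by (intro add_nonneg_pos) auto
  fix k z assume "k hol ball 0 1 & inj_on k (ball 0 1) & k 0 = 0 & deriv k 0 = 1" and z: "cmod z <= 1/2"
  hence k: "k hol ball 0 1" "inj_on k (ball 0 1)" "k 0 = 0" "deriv k 0 = 1" by auto
  obtain w where w: "cmod w < 2" "w ~: k ` ball 0 1" using univalent_omits[OF k] .
  obtain h where h: "h hol ball 0 1" "h 0 = 1" "!!z. z : ball 0 1 ==> (h z)^2 = 1 - k z / w"
   "!!z. z : ball 0 1 ==> h z ~= 0 & h z ~= -1" by (rule sqrt_of_univalent[OF k(1-3) w(2)]) blast
  \<comment> \<open>The factor 3/4 makes the function holomorphic on the closed disc; radius 2/3
    there corresponds to radius 1/2 for \<open>h\<close>.\<close>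
  define F where "F z = - h (of_real (3/4) * z)" for z
  have F: "F hol cball 0 1" unfolding F_def using simple_scale_holomorphic[OF h(1), of "3/4"] by (intro holomorphic_intros) auto
  have "~ (F z = 0 | F z = 1)" if "z : cball 0 1" for z
  proof -
   have "of_real (3/4) * z : ball 0 1" using that by simp
   thus ?thesis using h(4) unfolding F_def by (metis add.inverse_inverse neg_equal_0_iff_equal)
  qed
  moreover have "cmod (F 0) <= 1" using h(2) by (simp add: F_def)
  ultimately have "cmod (F u) <= B" if "cmod u <= 2/3" for u unfolding B_def using Schottky[OF F, of 1 "2/3" u] that by simp
  from this[of "of_real (4/3) * z"] have "cmod (h z) <= B" using z by (simp add: F_def)
  hence hb: "cmod ((h z)^2) <= B^2" by (simp add: norm_power power_mono)
  have w0: "w ~= 0" using w k(3) by auto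
  have "k z = w * (1 - (h z)^2)" using h(3)[of z] z w0 by simp
  hence "cmod (k z) = cmod w * cmod (1 - (h z)^2)" by (simp add: norm_mult)
  also have "... <= 2 * (1 + B^2)"
  proof (intro mult_mono)
   show "cmod (1 - (h z)^2) <= 1 + B^2" using norm_triangle_ineq4[of 1 "(h z)^2"] hb by simp
  qed (use w in auto)
  finally show "cmod (k z) < 2 * (1 + B\<^sup>2) + 1" by simp
 qed
qed

text \<open>The upper bound and Cauchy's inequality bound the second derivative near 0, so on a
  circle of small fixed radius \<open>rh\<close> the function differs from the identity by at most
  \<open>rh / 2\<close>. The image of \<open>ball 0 rh\<close> then contains
  \<open>ball 0 (rh / 2)\<close>, and by injectivity other points have no values there.\<close>

lemma univalent_lower_bound:
 "EX c>0. ALL k. k hol ball 0 1 & inj_on k (ball 0 1) & k 0 = 0 & deriv k 0 = 1 -->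
   (ALL z. 1/2 <= cmod z & cmod z < 1 --> c <= cmod (k z))"
proof -
 obtain M where M: "M > 0" "!!k z. k hol ball 0 1 ==> inj_on k (ball 0 1) ==> k 0 = 0 ==> deriv k 0 = 1 ==> cmod z <= 1/2 ==> cmod (k z) < M"
  using univalent_bound by blast
 \<comment> \<open>The second derivative is bounded by \<open>fact 2 * M / (1/4)^2\<close>, which is
   \<open>32 * M\<close>; the divisor \<open>64 * M\<close> makes \<open>32 * M * rh\<close> at most
   1/2.\<close>
 define rh where "rh = min (1/4) (1 / (64 * M))"
 have rh: "rh > 0" "rh <= 1/4" "32 * M * rh <= 1/2" using M by (auto simp: rh_def min_def)
 show ?thesis
 proof (intro exI[of _ "rh/2"] conjI allI impI)
  fix k z assume "k hol ball 0 1 & inj_on k (ball 0 1) & k 0 = 0 & deriv k 0 = 1" and z: "1/2 <= cmod z & cmod z < 1"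
  hence k: "k hol ball 0 1" "inj_on k (ball 0 1)" "k 0 = 0" "deriv k 0 = 1" by auto
  have d2: "cmod (deriv (deriv k) u) <= 32 * M" if "cmod u <= 1/4" for u
  proof -
   have sub: "cball u (1/4) <= cball 0 (1/2)"
   proof
    fix v assume "v : cball u (1/4)"
    hence "cmod (v - u) <= 1/4" by (simp add: dist_norm norm_minus_commute)
    thus "v : cball 0 (1/2)" using that norm_triangle_ineq2[of v u] by simp
   qed
   hence sub': "cball u (1/4) <= ball 0 1" by auto
   have "cmod ((deriv ^^ 2) k u) <= (fact 2) * M / (1/4)^2"
   proof (rule Cauchy_higher_deriv_bound[where y = 0])
    show "k hol ball u (1/4)" using k(1) sub' by force
    show "continuous_on (cball u (1/4)) k" using k(1) sub' by (meson holomorphic_on_imp_continuous_on holomorphic_on_subset)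
    show "k w : ball 0 M" if "w : ball u (1/4)" for w using that sub ball_subset_cball subsetD M k by fastforce
   qed auto
   thus ?thesis by (simp add: numeral_2_eq_2)
  qed
  have b4: "cball 0 (1/4) <= ball (0::complex) 1" by auto
  have dk: "deriv k hol ball 0 1" using k(1) by (intro holomorphic_deriv) auto
  have d1: "cmod (deriv k u - 1) <= 32 * M * rh" if "cmod u <= rh" for u
  proof -
   have "cmod (deriv k u - deriv k 0) <= 32 * M * cmod (u - 0)"
   proof (rule field_differentiable_bound[of "cball 0 (1/4)"])
    show "(deriv k has_field_derivative deriv (deriv k) v) (at v within cball 0 (1 / 4))" if "v : cball 0 (1/4)" for v
     using holomorphic_derivI[OF dk open_ball] that b4 by blast
   qed (use d2 that rh in auto)
   also have "... <= 32 * M * rh" using that M by simp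
   finally show ?thesis using k(4) by simp
  qed
  have low: "cmod (k u) >= rh/2" if "cmod u = rh" for u
  proof -
   have "cmod ((k u - u) - (k 0 - 0)) <= (32 * M * rh) * cmod (u - 0)"
   proof (rule field_differentiable_bound[of "cball 0 rh" "%u. k u - u" "%u. deriv k u - 1"])
    show "((%u. k u - u) has_field_derivative deriv k v - 1) (at v within cball 0 rh)" if "v : cball 0 rh" for v
    proof -
     have "v : ball 0 1" using that rh by auto
     hence "(k has_field_derivative deriv k v) (at v)" using holomorphic_derivI[OF k(1) open_ball] by blast
     hence "((%u. k u - u) has_field_derivative deriv k v - 1) (at v)" by (rule DERIV_diff[OF _ DERIV_ident])
     thus ?thesis by (rule has_field_derivative_at_within)
    qed
   qed (use d1 that rh in auto)
   also have "... <= (1/2) * rh" using rh that by simp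
   finally have "cmod (k u - u) <= rh/2" using k(3) by simp
   thus ?thesis using norm_triangle_ineq2[of u "u - k u"] that by (simp add: norm_minus_commute)
  qed
  have sub: "ball (k 0) (rh/2) <= k ` ball 0 rh"
  proof (rule ball_subset_open_map_image)
   show "continuous_on (closure (ball 0 rh)) k"
    using rh by (intro continuous_on_subset[OF holomorphic_on_imp_continuous_on[OF k(1)]]) (auto simp: closure_ball)
   have "ball 0 rh <= ball (0::complex) 1" using rh by auto
   hence "open (k ` ball 0 rh)" using injective_open_image[OF k(1) open_ball k(2)] open_ball by simp
   thus "open (k ` interior (ball 0 rh))" by simp
   show "rh / 2 <= cmod (k z - k 0)" if "z : frontier (ball 0 rh)" for z using that low[of z] rh k(3) by simp
  qed (use rh in auto)
  show "rh/2 <= cmod (k z)"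
  proof (rule ccontr)
   assume "~ ?thesis"
   hence "k z : k ` ball 0 rh" using sub k(3) by auto
   then obtain u where u: "cmod u < rh" "k z = k u" by auto
   hence "z = u" using k(2) z rh by (auto simp: inj_on_def)
   thus False using u z rh by auto
  qed
 qed (use rh in auto)
qed

section \<open>Univalent functions near infinity\<close>

lemma inverse_to_infinity:
 fixes q :: "complex => complex"
 assumes "q hol far R" "q -oo-> l" "R > 0"
 defines "Q \<equiv> (%u. if u = 0 then l else q (inverse u))"
 shows "Q hol ball 0 (1/R)"
proof (rule no_isolated_singularity'[where K = "{0}"])
 have lim: "((%u. q (inverse u)) ---> l) (at 0)" using assms(2) lim_at_infinity_0[of q l] by (simp add: o_def)
 have "(Q ---> l) (at 0)" by (rule Lim_transform_eventually[OF lim]) (auto simp: Q_def eventually_at intro: exI[of _ 1])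
 thus "(Q ---> Q z) (at z within ball 0 (1/R))" if "z : {0}" for z
  using that by (simp add: Q_def tendsto_within_subset[of _ _ _ UNIV])
 have im: "inverse ` (ball 0 (1/R) - {0}) <= {z::complex. cmod z > R}"
 proof clarsimp
  fix u :: complex assume u: "cmod u < 1 / R" "u ~= 0"
  hence "cmod u * R < 1" using assms(3) by (simp add: pos_less_divide_eq)
  thus "R < cmod (inverse u)" using u by (simp add: inverse_eq_divide norm_divide pos_less_divide_eq mult.commute)
 qed
 have "(q o inverse) hol (ball 0 (1/R) - {0})"
  by (rule holomorphic_on_compose_gen[OF _ assms(1) im]) (auto intro!: holomorphic_intros)
 thus "Q hol ball 0 (1/R) - {0}" by (rule holomorphic_transform) (auto simp: Q_def)
qed auto

text \<open>The maximum principle for \<open>q (1 / u)\<close> on the disc of radius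
  \<open>1 / rh\<close>, where infinity has become the interior point 0; so a bound on one circle
  also bounds the limit \<open>l\<close>.\<close>

lemma max_modulus_infinity:
 fixes q :: "complex => complex"
 assumes q: "q hol far R" "q -oo-> l" "R > 0" "R < rh"
  and B: "!!z. cmod z = rh ==> cmod (q z - w) <= B"
 shows "cmod (l - w) <= B" and "cmod z >= rh ==> cmod (q z - w) <= B"
proof -
 define Q where "Q = (%u. if u = 0 then l else q (inverse u))"
 have Q: "Q hol ball 0 (1/R)" unfolding Q_def using inverse_to_infinity[OF q(1-3)] .
 have r: "0 < 1/rh" "1/rh < 1/R" using q by (auto simp: frac_less2)
 have bd: "cmod (Q u - w) <= B" if "cmod u <= 1/rh" for u
 proof (rule maximum_modulus_frontier[of "%u. Q u - w" "cball 0 (1/rh)"])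
  have "cball 0 (1/rh) <= ball (0::complex) (1/R)" using r by auto
  hence "(%u. Q u - w) hol cball 0 (1/rh)" using Q by (auto intro!: holomorphic_intros elim: holomorphic_on_subset)
  thus "(%u. Q u - w) hol interior (cball 0 (1/rh))" "continuous_on (closure (cball 0 (1/rh))) (%u. Q u - w)"
   using interior_subset holomorphic_on_subset by (blast, simp add: holomorphic_on_imp_continuous_on)
  show "cmod (Q v - w) <= B" if "v : frontier (cball 0 (1/rh))" for v
  proof -
   have "cmod v = 1/rh" using that by simp
   hence "v ~= 0" "cmod (inverse v) = rh" using r by (auto simp: norm_inverse)
   thus ?thesis using B[of "inverse v"] by (simp add: Q_def)
  qed
 qed (use that in auto)
 show "cmod (l - w) <= B" using bd[of 0] r by (simp add: Q_def)
 show "cmod (q z - w) <= B" if "cmod z >= rh"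
 proof -
  have "z ~= 0" using that q by auto
  moreover have "cmod (inverse z) <= 1/rh"
   using that q le_imp_inverse_le[of rh "cmod z"] by (simp add: inverse_eq_divide norm_divide)
  ultimately have "z ~= 0" "cmod (inverse z) <= 1/rh" by auto
  thus ?thesis using bd[of "inverse z"] by (simp add: Q_def)
 qed
qed

lemma hydrodynamic_coeff:
 fixes q :: "complex => complex"
 assumes q: "q hol far R" "q -oo-> 0" "R > 0"
 shows "EX a. ((%z. z * q z) -oo-> a)"
proof -
 define Q where "Q = (%u. if u = 0 then 0 else q (inverse u))"
 have Q: "Q hol ball 0 (1/R)" unfolding Q_def using inverse_to_infinity[OF q(1-3)] .
 hence "(Q has_field_derivative deriv Q 0) (at 0)" using q(3) by (intro holomorphic_derivI[OF Q]) auto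
 moreover have "Q 0 = 0" by (simp add: Q_def)
 ultimately have "((%u. Q u / u) ---> deriv Q 0) (at 0)" by (simp add: DERIV_def)
 hence "((%u. inverse u * q (inverse u)) ---> deriv Q 0) (at 0)"
  by (rule Lim_transform_eventually) (auto simp: Q_def eventually_at field_simps intro: exI[of _ 1])
 thus ?thesis using lim_at_infinity_0[of "%z. z * q z"] by (auto simp: o_def)
qed

text \<open>Hydrodynamic normalisation at infinity: the expansion starts with \<open>z\<close>,
  without constant term.\<close>

definition hydro :: "(complex => complex) => bool" where
 "hydro f <-> ((%z. f z - z) -oo-> 0)"

lemma hydro_at_infinity: "hydro f ==> filterlim f at_infinity at_infinity"
using tendsto_add_filterlim_at_infinity' filterlim_ident by (force simp: hydro_def)

lemma open_exterior: "open {z::complex. cmod z > R}"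
 by (intro open_Collect_less continuous_intros)

text \<open>For a surjective \<open>f\<close> the reciprocal of the inverse function would be entire
  and bounded by \<open>1 / R\<close>; Liouville's theorem makes it constant.\<close>

lemma exterior_omits:
 assumes f: "f hol far R" "inj_on f (far R)" and "R > 0"
 obtains w where "w ~: f ` far R"
proof (rule ccontr)
 assume "~ thesis"
 hence im: "f ` far R = UNIV" using that by blast
 let ?g = "inv_into (far R) f"
 have g: "?g hol UNIV" using holomorphic_on_inv_into[OF f(1) open_exterior f(2)] im by simp
 have gR: "cmod (?g w) > R" for w using inv_into_into[of w f "far R"] im by auto
 have nz: "?g w ~= 0" for w using gR[of w] `R > 0` by auto
 have "(%w. inverse (?g w)) hol UNIV" using g nz by (intro holomorphic_intros) auto
 moreover have "bounded (range (%w. inverse (?g w)))"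
 proof -
  have "cmod (inverse (?g w)) <= inverse R" for w using gR[of w] `R > 0` by (simp add: norm_inverse le_imp_inverse_le)
  thus ?thesis by (auto simp: bounded_iff)
 qed
 ultimately obtain c where c: "!!w. inverse (?g w) = c" using Liouville_theorem[of "%w. inverse (?g w)"] by (metis UNIV_I constant_on_def)
 have "f (?g w) = w" for w using f_inv_into_f[of w f "far R"] im by auto
 hence "inj ?g" by (metis injI)
 moreover have "?g 0 = ?g 1" using c by (metis inverse_inverse_eq)
 ultimately show False by (metis injD zero_neq_one)
qed

text \<open>With an omitted value \<open>w\<close>, the function \<open>R / (f (R / u) - w)\<close>
  is univalent on the unit disc, vanishes at 0 and has derivative 1 there. Its lower bound
  \<open>c\<close> on the circle of radius 1/2 bounds \<open>f z - w\<close> by \<open>R / c\<close>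
  on the circle of radius \<open>2 * R\<close>. The maximum principle at infinity extends this to
  the exterior and, since \<open>f z - z\<close> tends to 0, bounds \<open>w\<close> itself.\<close>

lemma exterior_bound:
 "EX C>0. ALL R f. R > 0 & f hol far R & inj_on f (far R) & hydro f -->
   (ALL z. 2 * R <= cmod z --> cmod (f z - z) <= C * R) & (ALL w. w ~: f ` far R --> cmod w <= C * R)"
proof -
 obtain c where c: "c > 0" "!!k z. k hol ball 0 1 ==> inj_on k (ball 0 1) ==> k 0 = 0 ==> deriv k 0 = 1 ==>
   1/2 <= cmod z ==> cmod z < 1 ==> c <= cmod (k z)" using univalent_lower_bound by blast
 define B where "B = 1 / c + 2"
 have B: "B > 0" unfolding B_def using c(1) by (intro add_pos_pos divide_pos_pos) auto
 have main: "cmod w <= B * R & (2 * R <= cmod z --> cmod (f z - z - w) <= B * R)"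
  if R: "R > 0" and f: "f hol far R" "inj_on f (far R)" "hydro f"
   and w: "w ~: f ` far R" for R f w z
 proof -
  define q where "q z = R / (f (of_real R * z) - w)" for z
  have sc: "cmod (of_real R * z) > R" if "cmod z > 1" for z using that R by (simp add: norm_mult)
  have nz: "f (of_real R * z) - w ~= 0" if "cmod z > 1" for z using w sc[OF that] by auto
  have sim: "(%z. of_real R * z) ` far 1 <= far R" using sc by auto
  have qh: "q hol far 1"
   unfolding q_def using nz holomorphic_on_compose_gen[OF _ f(1) sim] by (auto simp: o_def intro!: holomorphic_intros)
  have fR: "filterlim (%z. f (of_real R * z)) at_infinity at_infinity"
  proof (rule filterlim_compose[OF hydro_at_infinity[OF f(3)]])
   show "filterlim ((*) (complex_of_real R)) at_infinity at_infinity"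
    using R by (intro tendsto_mult_filterlim_at_infinity[where c = "of_real R"] filterlim_ident) auto
  qed
  have q0: "q -oo-> 0" unfolding q_def
   using tendsto_divide_0[OF tendsto_const tendsto_add_filterlim_at_infinity'[OF fR tendsto_const[of "-w"]]] by simp
  define k where "k = (%u. if u = 0 then 0 else q (inverse u))"
  have kh: "k hol ball 0 1" unfolding k_def using inverse_to_infinity[OF qh q0] by simp
  have inv: "cmod (inverse u) > 1" if "u : ball 0 1" "u ~= 0" for u :: complex
   using that by (simp add: norm_inverse one_less_inverse)
  have qnz: "q z ~= 0" if "cmod z > 1" for z unfolding q_def using nz[OF that] R by simp
  have kinj: "inj_on k (ball 0 1)"
  proof (rule inj_onI)
   fix u v assume uv: "u : ball 0 1" "v : ball 0 1" "k u = k v"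
   show "u = v"
   proof (cases "u = 0 | v = 0")
    case True
    thus ?thesis using uv qnz inv by (metis k_def)
   next
    case False
    hence "q (inverse u) = q (inverse v)" using uv by (simp add: k_def)
    hence "f (of_real R * inverse u) = f (of_real R * inverse v)" unfolding q_def using R by simp
    hence "of_real R * inverse u = of_real R * inverse v"
     using sc[OF inv[OF uv(1)]] sc[OF inv[OF uv(2)]] False inj_onD[OF f(2), of "of_real R * inverse u" "of_real R * inverse v"] by blast
    thus ?thesis using R by simp
   qed
  qed
  have k0: "k 0 = 0" by (simp add: k_def)
  have "deriv k 0 = 1"
  proof (rule DERIV_imp_deriv)
   have "(%z. (f z - z) + - w) -oo-> 0 + - w" using f(3) unfolding hydro_def by (intro tendsto_intros)
   moreover have inf: "filterlim (%z::complex. z) at_infinity at_infinity" by (rule filterlim_ident)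
   ultimately have "(%z. (f z - z + - w) / z) -oo-> 0" by (intro tendsto_divide_0)
   hence "(%z. 1 + (f z - z + - w) / z) -oo-> 1 + 0" by (intro tendsto_intros)
   hence "(%z. inverse (1 + (f z - z + - w) / z)) -oo-> inverse 1" by (intro tendsto_inverse) auto
   hence "(%z. z / (f z - w)) -oo-> 1" unfolding inverse_1
   proof (rule Lim_transform_eventually)
    have "inverse (1 + (f z - z + - w) / z) = z / (f z - w)" if "cmod z >= 1" for z
    proof -
     have "z ~= 0" using that by auto
     hence "1 + (f z - z + - w) / z = (f z - w) / z" by (simp add: field_simps)
     thus ?thesis by simp
    qed
    thus "\<forall>\<^sub>F z in at_infinity. inverse (1 + (f z - z + - w) / z) = z / (f z - w)"
     by (auto simp: eventually_at_infinity)
   qed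
   moreover have "filterlim (%u. of_real R * inverse u) at_infinity (at (0::complex))"
    using R by (intro tendsto_mult_filterlim_at_infinity[where c = "of_real R"] filterlim_inverse_at_infinity) auto
   ultimately have "((%u. (of_real R * inverse u) / (f (of_real R * inverse u) - w)) ---> 1) (at 0)" by (rule filterlim_compose)
   hence "((%u. k u / u) ---> 1) (at 0)"
    by (rule Lim_transform_eventually) (auto simp: k_def q_def eventually_at field_simps intro: exI[of _ 1])
   thus "(k has_field_derivative 1) (at 0)" using k0 by (simp add: DERIV_def)
  qed
  hence kc: "c <= cmod (k u)" if "1/2 <= cmod u" "cmod u < 1" for u using c(2)[OF kh kinj k0] that by simp
  have fb: "cmod (f z - z - w) <= B * R" if "cmod z = 2 * R" for z
  proof -
   define u where "u = inverse (z / of_real R)"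
   have z0: "z ~= 0" using that R by auto
   have u: "cmod u = 1/2" "u ~= 0" "of_real R * inverse u = z" using that R by (auto simp: u_def norm_divide)
   have "c <= cmod (k u)" using kc u by simp
   also have "cmod (k u) = R / cmod (f z - w)" using u R by (simp add: k_def q_def norm_divide)
   finally have cc: "c <= R / cmod (f z - w)" .
   have "cmod (f z - w) > 0" using cc c(1) by auto
   hence "cmod (f z - w) <= R / c" using cc c(1) by (simp add: field_simps)
   moreover have "cmod (f z - z - w) = cmod ((f z - w) - z)" by (simp add: algebra_simps)
   ultimately have "cmod (f z - z - w) <= R / c + 2 * R" using norm_triangle_ineq4[of "f z - w" z] that by simp
   thus ?thesis by (simp add: B_def field_simps)
  qed
  have hq: "(%z. f z - z) hol far R" using f(1) by (intro holomorphic_intros)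
  have hl: "(%z. f z - z) -oo-> 0" using f(3) by (simp add: hydro_def)
  have "R < 2 * R" using R by simp
  from max_modulus_infinity[OF hq hl R this fb] show ?thesis by simp
 qed
 show ?thesis
 proof (intro exI[of _ "2 * B"] conjI allI impI)
  fix R f z assume a: "R > 0 & f hol far R & inj_on f (far R) & hydro f" "2 * R <= cmod z"
  obtain w where "w ~: f ` far R" using exterior_omits a by blast
  hence "cmod w <= B * R" "cmod (f z - z - w) <= B * R" using main[of R f w z] a by auto
  thus "cmod (f z - z) <= 2 * B * R" using norm_triangle_ineq[of "f z - z - w" w] by simp
 next
  fix R f w assume a: "R > 0 & f hol far R & inj_on f (far R) & hydro f" "w ~: f ` far R"
  hence "cmod w <= B * R" using main[of R f w] by auto
  moreover have "B * R > 0" using B a by simp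
  ultimately show "cmod w <= 2 * B * R" by simp
 qed (use B in auto)
qed

text \<open>The function \<open>1 / f (1 / u)\<close> is univalent near 0 with value 0, so its zero
  is simple. Dividing by \<open>u\<close> and inverting gives a holomorphic \<open>p\<close> with
  \<open>f (1 / u) = p u / u\<close>, and the first two Taylor coefficients of \<open>p\<close> are
  \<open>au\<close> and \<open>be\<close>.\<close>

lemma affine_normalise:
 assumes f: "f hol far R" "inj_on f (far R)" "filterlim f at_infinity at_infinity" "R > 0"
 shows "EX au be. au ~= 0 & ((%z. f z - (au * z + be)) -oo-> 0)"
proof -
 obtain b where b: "!!z. cmod z >= b ==> cmod (f z) > 0"
  using eventually_norm_gt_at_infinity[OF f(3), of 0] by (auto simp: eventually_at_infinity)
 define S where "S = max R \<bar>b\<bar>"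
 have S: "S > 0" "S >= R" using f(4) by (auto simp: S_def)
 have nz: "f z ~= 0" if "cmod z > S" for z using that b by (auto simp: S_def)
 have "f hol far S" using f(1) S by auto
 hence h: "(%z. inverse (f z)) hol far S" using nz by (intro holomorphic_intros) auto
 have l: "(%z. inverse (f z)) -oo-> 0" using f(3) by (rule filterlim_compose[OF tendsto_inverse_0])
 define k where "k = (%u. if u = 0 then 0 else inverse (f (inverse u)))"
 have kh: "k hol ball 0 (1/S)" unfolding k_def using inverse_to_infinity[OF h l S(1)] .
 have inv: "cmod (inverse u) > S" if "u : ball 0 (1/S)" "u ~= 0" for u :: complex
 proof -
  have "cmod u * S < 1" using that S(1) by (simp add: pos_less_divide_eq)
  thus ?thesis using that by (simp add: inverse_eq_divide norm_divide pos_less_divide_eq mult.commute)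
 qed
 have kz: "k u ~= 0" if "u : ball 0 (1/S)" "u ~= 0" for u using that nz[OF inv] by (simp add: k_def)
 have kinj: "inj_on k (ball 0 (1/S))"
 proof (rule inj_onI)
  fix u v assume uv: "u : ball 0 (1/S)" "v : ball 0 (1/S)" "k u = k v"
  show "u = v"
  proof (cases "u = 0 | v = 0")
   case True
   thus ?thesis using uv kz by (metis k_def)
  next
   case False
   hence "f (inverse u) = f (inverse v)" using uv by (simp add: k_def)
   hence "inverse u = inverse v" using inv[OF uv(1)] inv[OF uv(2)] False S(2) inj_onD[OF f(2), of "inverse u" "inverse v"] by simp
   thus ?thesis by simp
  qed
 qed
 have k0: "k 0 = 0" by (simp add: k_def)
 have in0: "0 : ball (0::complex) (1/S)" using S by simp
 have dk: "deriv k 0 ~= 0" using holomorphic_injective_imp_regular[OF kh open_ball kinj in0] .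
 define q where "q u = (if u = 0 then deriv k 0 else k u / u)" for u
 have qh: "q hol ball 0 (1/S)"
 proof -
  have "q = (%u. if u = 0 then deriv k 0 else (k u - k 0) / (u - 0))" by (auto simp: q_def k0)
  thus ?thesis using pole_lemma_open[OF kh open_ball, of 0] by simp
 qed
 have qnz: "q u ~= 0" if "u : ball 0 (1/S)" for u using that dk kz by (simp add: q_def)
 define p where "p u = inverse (q u)" for u
 have ph: "p hol ball 0 (1/S)" unfolding p_def using qh qnz by (intro holomorphic_intros) auto
 have "(p has_field_derivative deriv p 0) (at 0)" using holomorphic_derivI[OF ph open_ball in0] .
 have t: "((%u. (p u - p 0) / u - deriv p 0) ---> 0) (at 0)"
  using `(p has_field_derivative deriv p 0) (at 0)` tendsto_diff[OF _ tendsto_const, of "%u. (p u - p 0) / u" "deriv p 0" "at 0" "deriv p 0"]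
  by (simp add: DERIV_def)
 have "((%u. f (inverse u) - (p 0 * inverse u + deriv p 0)) ---> 0) (at 0)"
 proof (rule Lim_transform_eventually[OF t])
  have "\<forall>\<^sub>F u in at 0. u : ball 0 (1/S) & u ~= 0"
   unfolding eventually_at using S(1) by (intro exI[of _ "1/S"]) (auto simp: dist_commute)
  thus "\<forall>\<^sub>F u in at 0. (p u - p 0) / u - deriv p 0 = f (inverse u) - (p 0 * inverse u + deriv p 0)"
  proof eventually_elim
   case (elim u)
   have "p u / u = f (inverse u)" using elim by (simp add: p_def q_def k_def field_simps)
   thus ?case by (simp add: divide_inverse algebra_simps)
  qed
 qed
 hence "(%z. f z - (p 0 * z + deriv p 0)) -oo-> 0"
  using lim_at_infinity_0[of "%z. f z - (p 0 * z + deriv p 0)" 0] by (simp add: o_def)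
 moreover have "p 0 ~= 0" using dk by (simp add: p_def q_def)
 ultimately show ?thesis by auto
qed

section \<open>Convergence on varying domains\<close>

text \<open>Locally uniform convergence as in Caratheodory's kernel theorem, but only half of the
  condition on domains: the \<open>D' k\<close> eventually contain each compact part of
  \<open>D\<close>, while they may be much larger than \<open>D\<close>.\<close>

definition kconv :: "complex set => (nat => complex set) => (nat => complex => complex) => (complex => complex) => bool" where
 "kconv D D' f g <-> open D & (ALL k. open (D' k)) & (ALL k. f k hol D' k) &
   (ALL Q. compact Q --> Q <= D --> (EV k. Q <= D' k) & uniform_limit Q f g sequentially)"

lemma open_cballE:
 assumes "open S" "x : S" obtains e where "e > 0" "cball x e <= S" using assms by (meson open_contains_cball)

lemma kconvD:
 assumes "kconv D D' f g"
 shows "open D" "open (D' k)" "f k hol D' k"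
  "compact Q ==> Q <= D ==> EV k. Q <= D' k"
  "compact Q ==> Q <= D ==> uniform_limit Q f g sequentially" using assms unfolding kconv_def by auto

lemma uniform_limit_subseq:
 assumes "uniform_limit Q f g sequentially" "strict_mono (r :: nat => nat)"
 shows "uniform_limit Q (%k. f (r k)) g sequentially" using assms filterlim_subseq[OF assms(2)] unfolding filterlim_iff by blast

lemma eventually_subseq:
 assumes "eventually P sequentially" "strict_mono (r :: nat => nat)"
 shows "EV k. P (r k)" using assms filterlim_subseq[OF assms(2)] unfolding filterlim_iff by blast

lemma kconv_subseq:
 assumes "kconv D D' f g" "strict_mono (r :: nat => nat)"
 shows "kconv D (%k. D' (r k)) (%k. f (r k)) g" unfolding kconv_def
proof (intro conjI allI impI)
 fix Q assume Q: "compact Q" "Q <= D"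
 show "EV k. Q <= D' (r k)" "uniform_limit Q (%k. f (r k)) g sequentially"
  using eventually_subseq[OF kconvD(4)[OF assms(1) Q] assms(2)] uniform_limit_subseq[OF kconvD(5)[OF assms(1) Q] assms(2)] by auto
qed (use kconvD[OF assms(1)] in auto)

lemma kconv_mono:
 assumes "kconv D D' f g" "open U" "U <= D"
 shows "kconv U D' f g" using assms unfolding kconv_def by simp

lemma kconv_shift:
 assumes "kconv D D' f g" "compact Q" "Q <= D"
 obtains N where "!!k. Q <= D' (k + N)" "kconv D (%k. D' (k + N)) (%k. f (k + N)) g"
proof -
 obtain N where N: "!!k. k >= N ==> Q <= D' k" using kconvD(4)[OF assms] unfolding eventually_sequentially by blast
 have "strict_mono (%k. k + N)" by (simp add: strict_mono_def)
 from kconv_subseq[OF assms(1) this] show ?thesis using that[of N] N by simp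
qed

lemma kconv_holomorphic:
 assumes "kconv D D' f g" shows "g hol D"
proof -
 have "g field_differentiable (at z)" if zD: "z : D" for z
 proof -
  obtain e where e: "e > 0" "cball z e <= D" using open_cballE[OF kconvD(1)[OF assms] zD] .
  obtain N where N: "!!k. cball z e <= D' (k + N)" "kconv D (%k. D' (k + N)) (%k. f (k + N)) g"
   using kconv_shift[OF assms compact_cball e(2)] by blast
  have "g hol ball z e"
  proof (rule holomorphic_uniform_sequence[OF open_ball])
   show "f (n + N) hol ball z e" for n using kconvD(3)[OF N(2), of n] N(1)[of n] by force
   show "EX d>0. cball x d <= ball z e & uniform_limit (cball x d) (%n. f (n + N)) g sequentially" if xb: "x : ball z e" for x
   proof -
    obtain d where "d > 0" "cball x d <= ball z e" using open_cballE[OF open_ball xb] .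
    moreover have "cball x d <= D" using calculation e ball_subset_cball by blast
    ultimately show ?thesis using kconvD(5)[OF N(2) compact_cball] by blast
   qed
  qed
  thus ?thesis using e by (metis centre_in_ball holomorphic_on_imp_differentiable_at open_ball)
 qed
 thus ?thesis by (simp add: field_differentiable_at_within holomorphic_on_def)
qed

lemma kconv_tendsto:
 assumes "kconv D D' f g" "z : D" "x ----> z"
 shows "(%k. f k (x k)) ----> g z"
proof -
 obtain e where e: "e > 0" "cball z e <= D" using open_cballE[OF kconvD(1)[OF assms(1)] assms(2)] .
 have ul: "uniform_limit (cball z e) f g sequentially" using kconvD(5)[OF assms(1) compact_cball e(2)] .
 have ev: "EV k. x k : cball z e"
 proof -
  have "EV k. x k : ball z e" using assms(3) e by (intro topological_tendstoD) auto
  thus ?thesis by eventually_elim auto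
 qed
 have "isCont g z" using kconv_holomorphic[OF assms(1)] kconvD(1)[OF assms(1)] assms(2)
   holomorphic_on_imp_continuous_on continuous_on_eq_continuous_at by blast
 hence gx: "(%k. g (x k)) ----> g z" using assms(3) isCont_tendsto_compose by blast
 have "(%k. f k (x k) - g (x k)) ----> 0" unfolding tendsto_iff
 proof (intro allI impI)
  fix d :: real assume "d > 0"
  hence "EV k. ALL y:cball z e. dist (f k y) (g y) < d" using ul unfolding uniform_limit_iff by blast
  with ev show "EV k. dist (f k (x k) - g (x k)) 0 < d" by eventually_elim (auto simp: dist_norm)
 qed
 from tendsto_add[OF this gx] show ?thesis by simp
qed

lemma holomorphic_nonconstant_open_subset:
 assumes "g hol D" "open D" "connected D" "~ g constant_on D" "open U" "U ~= {}" "U <= D"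
 shows "~ g constant_on U"
proof
 assume "g constant_on U"
 then obtain c where c: "!!z. z : U ==> g z = c" by (auto simp: constant_on_def)
 have "g w = c" if "w : D" for w by (rule analytic_continuation_open[of U D g "%_. c"]) (use assms c that in auto)
 thus False using assms(4) by (auto simp: constant_on_def)
qed

text \<open>Hurwitz's theorem with targets \<open>v k\<close> that move: if the functions
  \<open>f k - v k\<close> had no zero near \<open>z\<close>, neither would the limit
  \<open>g - g z\<close>.\<close>

lemma kconv_attains:
 assumes k: "kconv D D' f g" and D: "connected D" and nc: "~ g constant_on D" and z: "z : D" and v: "v ----> g z" and "e > 0"
 shows "EV k. EX y. y : D' k & dist z y < e & f k y = v k"
proof (rule ccontr)
 assume "~ ?thesis"
 from not_eventually_subseq[OF this] obtain r :: "nat => nat" where r: "strict_mono r" "!!k. ~ (EX y. y : D' (r k) & dist z y < e & f (r k) y = v (r k))"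
  by auto
 obtain d where d: "d > 0" "cball z d <= D" using open_cballE[OF kconvD(1)[OF k] z] .
 define s where "s = min d e"
 have s: "s > 0" "cball z s <= D" "s <= e" using d `e > 0` by (auto simp: s_def)
 obtain N where N: "!!k. cball z s <= D' (r (k + N))" "kconv D (%k. D' (r (k + N))) (%k. f (r (k + N))) g"
  using kconv_shift[OF kconv_subseq[OF k r(1)] compact_cball s(2)] by blast
 have mono: "strict_mono (%k. r (k + N))" using r(1) by (simp add: strict_mono_def)
 have vv: "(%k. v (r (k + N))) ----> g z" using tendsto_subseq[OF v mono] by simp
 have bsub: "ball z s <= D" using s ball_subset_cball by blast
 have "g z - g z ~= 0"
 proof (rule Hurwitz_no_zeros[of "ball z s" "%k y. f (r (k + N)) y - v (r (k + N))" "%y. g y - g z"])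
  show "(%y. f (r (n + N)) y - v (r (n + N))) hol ball z s" for n using kconvD(3)[OF N(2), of n] N(1)[of n]
   by (intro holomorphic_intros) (meson ball_subset_cball holomorphic_on_subset order_trans)
  show "(%y. g y - g z) hol ball z s"
   using kconv_holomorphic[OF k] bsub by (intro holomorphic_intros) (auto elim: holomorphic_on_subset)
  show "uniform_limit K (%k y. f (r (k + N)) y - v (r (k + N))) (%y. g y - g z) sequentially" if "compact K" "K <= ball z s" for K
  proof (rule uniform_limit_intros)
   show "uniform_limit K (%k y. f (r (k + N)) y) g sequentially" using kconvD(5)[OF N(2)] that bsub by blast
   show "uniform_limit K (%k y. v (r (k + N))) (%y. g z) sequentially" using vv unfolding uniform_limit_iff tendsto_iff by simp
  qed
  show "~ (%y. g y - g z) constant_on ball z s"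
  proof
   assume "(%y. g y - g z) constant_on ball z s"
   hence "g constant_on ball z s" unfolding constant_on_def by (metis diff_add_cancel)
   thus False
    using holomorphic_nonconstant_open_subset[OF kconv_holomorphic[OF k] kconvD(1)[OF k] D nc open_ball _ bsub] s by auto
  qed
  show "f (r (n + N)) y - v (r (n + N)) ~= 0" if "y : ball z s" for n y
  proof
   assume "f (r (n + N)) y - v (r (n + N)) = 0"
   moreover have "y : D' (r (n + N))" using that N(1)[of n] ball_subset_cball by blast
   ultimately show False using r(2)[of "n + N"] that s by auto
  qed
 qed (use s in auto)
 thus False by simp
qed

text \<open>Near each of two points with the same value of \<open>g\<close>, Hurwitz's theorem finds
  a point where \<open>f k\<close> takes this value; the two places are disjoint.\<close>

lemma kconv_inj:
 assumes k: "kconv D D' f g" and D: "connected D" and nc: "~ g constant_on D" and inj: "!!k. inj_on (f k) (D' k)"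
 shows "inj_on g D"
proof (rule inj_onI, rule ccontr)
 fix a b assume ab: "a : D" "b : D" "g a = g b" "a ~= b"
 define e where "e = dist a b / 2"
 have e: "e > 0" using ab by (simp add: e_def)
 have "(%k. g a) ----> g a" "(%k. g a) ----> g b" using ab by auto
 hence "EV k. EX y. y : D' k & dist a y < e & f k y = g a"
  "EV k. EX y. y : D' k & dist b y < e & f k y = g a" using kconv_attains[OF k D nc] ab e by auto
 hence "EV k. False"
 proof eventually_elim
  case (elim k)
  then obtain y y' where y: "y : D' k" "dist a y < e" "f k y = g a" "y' : D' k" "dist b y' < e" "f k y' = g a" by auto
  hence "y = y'" using inj[of k] by (metis inj_onD)
  thus False using y e_def dist_triangle[of a b y] by (simp add: dist_commute)
 qed
 thus False by simp
qed

lemma eventually_subset_hdom: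
 assumes E: "holes I E" and up: "!!e. e > 0 ==> EV k. ALL i:I. E' k i <= nhd (E i) e"
  and Q: "compact Q" "Q <= hdom I E"
 shows "EV k. Q <= hdom I (E' k)"
proof -
 have "(UN i:I. E i) <= - Q" using Q by (auto simp: hdom_def)
 then obtain e where e: "e > 0" "nhd (UN i:I. E i) e <= - Q"
  using nhd_subset_open[OF compact_holes[OF E], of "- Q"] Q compact_imp_closed open_Compl by metis
 have "nhd (E i) e <= - Q" if "i : I" for i using e(2) nhd_mono[of "E i" "UN i:I. E i" e e] that by blast
 thus ?thesis using up[OF e(1)] by (auto elim!: eventually_mono simp: hdom_def)
qed

text \<open>The bound depends only on the ball that contains the holes:
  \<open>exterior_bound\<close> controls \<open>f\<close> on the circle of radius \<open>s\<close>,
  and injectivity keeps the values at points inside the circle within the same bound.\<close>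

lemma hydro_bounds:
 assumes "R > 0"
 shows "EX M. ALL (I::'i set) E f. holes I E & (UN i:I. E i) <= ball 0 R & f hol hdom I E & inj_on f (hdom I E) & hydro f -->
   (ALL z:hdom I E. cmod z <= rh --> cmod (f z) <= M)"
proof -
 obtain C where C: "C > 0" "!!f z. f hol far R ==> inj_on f (far R) ==> hydro f ==> 2 * R <= cmod z ==> cmod (f z - z) <= C * R"
  using exterior_bound assms by blast
 define s where "s = max rh (2 * R)"
 have "cmod (f z) <= s + C * R"
  if E: "holes I E" and R: "(UN i:I. E i) <= ball 0 R" and f: "f hol hdom I E" "inj_on f (hdom I E)" "hydro f"
   and z: "z : hdom I E" "cmod z <= rh" for I :: "'i set" and E f z
 proof -
  have ext: "far R <= hdom I E" using R by (auto simp: hdom_def)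
  have ext2: "f hol far R" "inj_on f (far R)" using f ext holomorphic_on_subset inj_on_subset by auto
  have sph: "cmod (f y) <= s + C * R" if "cmod y = s" for y
  proof -
   have "cmod (f y - y) <= C * R" using C(2)[OF ext2 f(3), of y] that by (simp add: s_def)
   thus ?thesis using norm_triangle_ineq[of "f y - y" y] that by simp
  qed
  have "(UN i:I. E i) <= ball 0 s" using R assms by (force simp: s_def)
  from inj_image_far(2)[OF E f(1,2) hydro_at_infinity[OF f(3)] this sph] show ?thesis
   using z by (auto simp: s_def image_subset_iff)
 qed
 thus ?thesis by blast
qed


text \<open>Montel's theorem on each set of a compact exhaustion, with a diagonal
  subsequence.\<close>

lemma kconv_exists:
 assumes D: "open D" and D': "!!k. open (D' k)" and f: "!!k. f k hol D' k"
  and ev: "!!Q. compact Q ==> Q <= D ==> EV k. Q <= D' k"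
  and bd: "!!Q. compact Q ==> Q <= D ==> EX M. ALL k. ALL z:Q. z : D' k --> cmod (f k z) <= M"
 obtains r g where "strict_mono (r :: nat => nat)" "kconv D (%k. D' (r k)) (%k. f (r k)) g"
proof -
 obtain C where C: "!!n. compact (C n)" "!!n. C n <= D" "!!n. C n <= interior (C (Suc n))" "\<Union>(range C) = D"
  "!!K. [|compact K; K <= D|] ==> EX N. ALL n>=N. K <= C n" using open_Union_compact_subsets[OF D] by auto
 \<comment> \<open>Montel's theorem needs one fixed domain for all indices; replacing
   \<open>f k\<close> by 0 while \<open>C i\<close> is not yet inside \<open>D' k\<close> changes
   only finitely many members.\<close>
 define F where "F i k z = (if C i <= D' k then f k z else 0)" for i k z
 have Fh: "F i k hol interior (C i)" for i k
 proof (cases "C i <= D' k")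
  case True
  hence "f k hol interior (C i)" using f[of k] interior_subset by force
  moreover have "F i k = f k" using True by (auto simp: F_def)
  ultimately show ?thesis by simp
 next
  case False
  hence "F i k = (%_. 0)" by (intro ext) (simp add: F_def)
  thus ?thesis by simp
 qed
 have Fb: "EX M. ALL k. ALL z:C i. cmod (F i k z) <= M" for i
 proof -
  obtain M where M: "!!k z. z : C i ==> z : D' k ==> cmod (f k z) <= M" using bd[OF C(1,2), of i] by blast
  hence "cmod (F i k z) <= max M 0" if "z : C i" for k z using that M by (force simp: F_def)
  thus ?thesis by auto
 qed
 define P where "P i s <-> (EX g. g hol interior (C i) & (ALL K. compact K & K <= interior (C i) --> uniform_limit K (%n. F i (s n)) g sequentially))" for i and s :: "nat => nat"
 obtain r :: "nat => nat" where r: "strict_mono r" "!!i. P i (id o r)"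
 proof (rule subsequence_diagonalization_lemma[of P id])
  fix i and s :: "nat => nat"
  obtain M where M: "!!k z. z : C i ==> cmod (F i k z) <= M" using Fb[of i] by blast
  obtain g k where "g hol interior (C i)" "strict_mono (k :: nat => nat)"
   "!!x. x : interior (C i) ==> (%n. F i (s (k n)) x) ----> g x"
   "!!K. compact K ==> K <= interior (C i) ==> uniform_limit K ((%n. F i (s n)) o k) g sequentially"
  proof (rule Montel[of "interior (C i)" "range (%n. F i (s n))" "%n. F i (s n)"])
   show "EX B. ALL h:range (%n. F i (s n)). ALL z:K. cmod (h z) <= B" if "compact K" "K <= interior (C i)" for K
    using M that interior_subset by blast
  qed (use Fh in auto)
  thus "EX k. strict_mono k & P i (s o k)" unfolding P_def by (intro exI[of _ k] conjI exI[of _ g]) (simp_all add: o_def)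
 next
  fix i and s :: "nat => nat" and k1 k2 :: "nat => nat" and N
  assume P: "P i (s o k1)" and j: "!!j. N <= j ==> EX j'. j <= j' & k2 j = k1 j'"
  have tr: "uniform_limit K (%n. F i (s (k2 n))) g sequentially" if ul: "uniform_limit K (%n. F i (s (k1 n))) g sequentially" for K g
   unfolding uniform_limit_iff
  proof (intro allI impI)
   fix e :: real assume "e > 0"
   then obtain n0 where n0: "!!n. n >= n0 ==> ALL x:K. dist (F i (s (k1 n)) x) (g x) < e"
    using ul unfolding uniform_limit_iff eventually_sequentially by blast
   show "EV n. ALL x:K. dist (F i (s (k2 n)) x) (g x) < e" unfolding eventually_sequentially
   proof (intro exI[of _ "max N n0"] allI impI)
    fix n assume "max N n0 <= n"
    then obtain j' where "n <= j'" "k2 n = k1 j'" using j[of n] by auto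
    thus "ALL x:K. dist (F i (s (k2 n)) x) (g x) < e" using n0[of j'] `max N n0 <= n` by auto
   qed
  qed
  thus "P i (s o k2)" using P unfolding P_def by auto
 qed blast
 then obtain G where G: "!!i. G i hol interior (C i)"
  "!!i K. compact K ==> K <= interior (C i) ==> uniform_limit K (%n. F i (r n)) (G i) sequentially"
  unfolding P_def by (simp add: o_def) metis
 define g where "g z = lim (%n. f (r n) z)" for z
 have FF: "EV n. F i (r n) = f (r n)" for i
  using eventually_subseq[OF ev[OF C(1,2), of i] r(1)] by eventually_elim (auto simp: F_def)
 have gG: "g z = G i z" if "z : interior (C i)" for z i
 proof -
  have "uniform_limit {z} (%n. F i (r n)) (G i) sequentially" using G(2)[of "{z}" i] that by auto
  hence "(%n. F i (r n) z) ----> G i z" by simp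
  hence "(%n. f (r n) z) ----> G i z" by (rule Lim_transform_eventually) (use FF[of i] in "auto elim: eventually_mono")
  thus ?thesis unfolding g_def by (rule limI)
 qed
 have "kconv D (%k. D' (r k)) (%k. f (r k)) g" unfolding kconv_def
 proof (intro conjI allI impI)
  fix Q assume Q: "compact Q" "Q <= D"
  show "EV k. Q <= D' (r k)" using eventually_subseq[OF ev[OF Q] r(1)] .
  obtain i where i: "Q <= interior (C (Suc i))" using C(3,5) Q by (meson order_refl order_trans)
  have "uniform_limit Q (%n. F (Suc i) (r n)) (G (Suc i)) sequentially" using G(2) Q i by blast
  moreover have "EV n. ALL x:Q. F (Suc i) (r n) x = f (r n) x" using FF[of "Suc i"] by eventually_elim auto
  ultimately show "uniform_limit Q (%k. f (r k)) g sequentially"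
   using gG i by (subst (asm) uniform_limit_cong) (auto simp: subset_iff)
 qed (use D D' f in auto)
 thus ?thesis using that r(1) by blast
qed

text \<open>The functions \<open>z * (f k z - z)\<close> have a limit at infinity, so the maximum
  principle bounds them outside radius \<open>2 * R\<close> by their size on that circle, uniformly
  in \<open>k\<close>; this gives \<open>hydro g\<close>. Applied to the difference of two such
  functions, the same principle shows that the coefficients converge.\<close>

lemma hydro_limit:
 assumes R: "R > 0" and hl: "!!k. f k hol far R" and inj: "!!k. inj_on (f k) (far R)" and h: "!!k. hydro (f k)"
  and k: "kconv (far R) D' f g" and a: "!!k. ((%z. z * (f k z - z)) -oo-> a k)"
 shows "hydro g" "EX b. ((%z. z * (g z - z)) -oo-> b) & a ----> b"
proof -
 obtain C where C: "C > 0" "!!f z. f hol far R ==> inj_on f (far R) ==> hydro f ==> 2 * R <= cmod z ==> cmod (f z - z) <= C * R"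
  using exterior_bound R by blast
 have bnd: "cmod (z * (f n z - z)) <= 2 * C * R^2" if z: "cmod z >= 2 * R" for n z
 proof -
  have "cmod (z * (f n z - z) - 0) <= 2 * C * R^2"
  proof (rule max_modulus_infinity(2)[OF _ a R _ _ z])
   show "(%z. z * (f n z - z)) hol {z. R < cmod z}" using hl by (intro holomorphic_intros)
   show "cmod (z * (f n z - z) - 0) <= 2 * C * R\<^sup>2" if "cmod z = 2 * R" for z
   proof -
    have "cmod (z * (f n z - z)) = 2 * R * cmod (f n z - z)" using that by (simp add: norm_mult)
    also have "... <= 2 * R * (C * R)" using C(2)[OF hl inj h, of z n] that R by simp
    finally show ?thesis by (simp add: power2_eq_square mult_ac)
   qed
  qed (use R in auto)
  thus ?thesis by simp
 qed
 have gb: "cmod (z * (g z - z)) <= 2 * C * R^2" if "cmod z >= 2 * R" for z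
 proof -
  have "(%n. f n z) ----> g z" using kconv_tendsto[OF k _ tendsto_const] that R by simp
  hence "(%n. cmod (z * (f n z - z))) ----> cmod (z * (g z - z))" by (intro tendsto_intros)
  thus ?thesis by (rule LIMSEQ_le_const2) (use bnd[OF that] in auto)
 qed
 show "hydro g" unfolding hydro_def
 proof (rule Lim_null_comparison)
  show "\<forall>\<^sub>F z in at_infinity. cmod (g z - z) <= 2 * C * R^2 * cmod (inverse z)" unfolding eventually_at_infinity
  proof (intro exI[of _ "2 * R"] allI impI)
   fix z :: complex assume z: "2 * R <= cmod z"
   hence "cmod z > 0" using R by auto
   thus "cmod (g z - z) <= 2 * C * R\<^sup>2 * cmod (inverse z)"
   by (metis gb z norm_mult pos_le_divide_eq mult.commute norm_inverse divide_inverse)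
  qed
  have "((%z. cmod (inverse z)) ---> 0) (at_infinity :: complex filter)" by (intro tendsto_norm_zero tendsto_inverse_0)
  thus "((%z. 2 * C * R\<^sup>2 * cmod (inverse z)) ---> 0) (at_infinity :: complex filter)" by (rule tendsto_mult_right_zero)
 qed
 hence g0: "(%z. g z - z) -oo-> 0" by (simp add: hydro_def)
 have gh: "g hol far R" using kconv_holomorphic[OF k] .
 obtain b where b: "(%z. z * (g z - z)) -oo-> b"
  using hydrodynamic_coeff[OF holomorphic_on_diff[OF gh holomorphic_on_ident] g0 R] by blast
 have "a ----> b" unfolding tendsto_iff
 proof (intro allI impI)
  fix e :: real assume e: "e > 0"
  have sph: "compact (sphere (0::complex) (2 * R))" "sphere (0::complex) (2*R) <= far R" using R by auto
  have "EV n. ALL z:sphere 0 (2*R). dist (f n z) (g z) < e / (4 * R)"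
   using kconvD(5)[OF k sph] divide_pos_pos[OF e, of "4 * R"] R unfolding uniform_limit_iff by simp
  thus "EV n. dist (a n) b < e"
  proof eventually_elim
   case (elim n)
   have "cmod ((a n - b) - 0) <= e / 2"
   proof (rule max_modulus_infinity(1)[where q = "%z. z * (f n z - z) - z * (g z - z)"])
    show "(%z. z * (f n z - z) - z * (g z - z)) -oo-> a n - b" using a b by (intro tendsto_intros)
    show "(%z. z * (f n z - z) - z * (g z - z)) hol {z. R < cmod z}" using hl gh by (intro holomorphic_intros)
    show "cmod (z * (f n z - z) - z * (g z - z) - 0) <= e / 2" if "cmod z = 2 * R" for z
    proof -
     have "z * (f n z - z) - z * (g z - z) = z * (f n z - g z)" by (simp add: algebra_simps)
     hence "cmod (z * (f n z - z) - z * (g z - z)) = 2 * R * cmod (f n z - g z)" using that by (simp add: norm_mult)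
     also have "... <= 2 * R * (e / (4 * R))" using elim that R by (intro mult_left_mono) (auto simp: dist_norm less_imp_le)
     finally show ?thesis using R by simp
    qed
   qed (use R in auto)
   thus ?case using e by (simp add: dist_norm)
  qed
 qed
 thus "EX b. ((%z. z * (g z - z)) -oo-> b) & a ----> b" using b by blast
qed

section \<open>Compactness of maps of hole domains\<close>

lemma exterior_in_hdom: "(UN i:I. E i) <= ball 0 R ==> (far R) <= hdom I E"
 by (auto simp: hdom_def)

lemma hole_map_at_infinity:
 assumes "hole_map I E L f" shows "filterlim f at_infinity at_infinity"
proof -
 obtain R where R: "R > 0" "(UN i:I. E i) <= ball 0 R" using hdom_outside_ball[OF hole_mapD(1)[OF assms]] .
 have "\<forall>\<^sub>F z in at_infinity. B <= cmod (f z)" for B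
 proof -
  obtain b where b: "{z : hdom I E. f z : cball 0 B} <= cball 0 b" using hole_mapD(8)[OF assms, of B] bounded_subset_cball by auto
  show ?thesis unfolding eventually_at_infinity
  proof (intro exI[of _ "max (R + 1) (b + 1)"] allI impI)
   fix z :: complex assume z: "max (R + 1) (b + 1) <= cmod z"
   hence "z : hdom I E" using exterior_in_hdom[OF R(2)] by auto
   hence "f z ~: cball 0 B" using b z by auto
   thus "B <= cmod (f z)" by auto
  qed
 qed
 hence "filterlim (%z. cmod (f z)) at_top at_infinity" by (simp add: filterlim_at_top)
 thus ?thesis by (rule filterlim_norm_at_top_imp_at_infinity)
qed

lemma hole_map_hydro_factor:
 assumes "hole_map I E L f"
 obtains au be g where "au ~= 0" "!!z. f z = au * g z + be" "hydro g" "g hol hdom I E" "inj_on g (hdom I E)"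
proof -
 obtain R where R: "R > 0" "(UN i:I. E i) <= ball 0 R" using hdom_outside_ball[OF hole_mapD(1)[OF assms]] .
 have "f hol far R" "inj_on f (far R)"
  using hole_mapD(3,5)[OF assms] exterior_in_hdom[OF R(2)] holomorphic_on_subset inj_on_subset by auto
 then obtain au be where ab: "au ~= 0" "(%z. f z - (au * z + be)) -oo-> 0"
  using affine_normalise[OF _ _ hole_map_at_infinity[OF assms] R(1)] by blast
 define g where "g z = (f z - be) / au" for z
 have 1: "f z = au * g z + be" for z using ab(1) by (simp add: g_def)
 have "(%z. (f z - (au * z + be)) / au) -oo-> 0 / au" using ab by (intro tendsto_divide tendsto_const)
 moreover have "(f z - (au * z + be)) / au = g z - z" for z using ab(1) by (simp add: g_def field_simps)
 ultimately have 2: "hydro g" by (simp add: hydro_def)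
 have 3: "g hol hdom I E" unfolding g_def using hole_mapD(3)[OF assms] by (intro holomorphic_intros) auto
 have 4: "inj_on g (hdom I E)" using hole_mapD(5)[OF assms] 1 unfolding inj_on_def by simp
 show ?thesis by (rule that[OF ab(1) 1 2 3 4])
qed

lemma hydro_not_constant:
 assumes "hydro g" "far R <= D" shows "~ g constant_on D"
proof
 assume "g constant_on D"
 then obtain c where c: "!!z. z : D ==> g z = c" by (auto simp: constant_on_def)
 have "\<forall>\<^sub>F z in at_infinity. cmod (g z) > cmod c"
  using eventually_norm_gt_at_infinity[OF hydro_at_infinity[OF assms(1)]] .
 then obtain b where b: "!!z. cmod z >= b ==> cmod (g z) > cmod c" by (auto simp: eventually_at_infinity)
 define z where "z = complex_of_real (max b (abs(R) + 1))"
 have "cmod z >= b" "cmod z > R" by (auto simp: z_def)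
 thus False using b[of z] c[of z] assms(2) by auto
qed

text \<open>A point outside the limit holes is a value of \<open>g\<close>, hence by Hurwitz's
  theorem nearby points are values of \<open>f k\<close> and belong to no hole
  \<open>L' k i\<close>. This puts the image holes into the union \<open>W\<close> of the
  neighbourhoods. That \<open>L' k j\<close> lies in the neighbourhood with its own index uses
  connectedness: otherwise the image of a ring around \<open>E' k j\<close> would join two parts of
  \<open>W\<close> and leave \<open>W\<close> on the way, at values which Hurwitz's theorem forces
  to be taken away from the ring.\<close>

lemma hole_maps_limit:
 assumes hm: "!!k. hole_map I (E' k) (L' k) (f k)" and g: "hole_map I E L g"
  and up: "!!e. e > 0 ==> EV k. ALL i:I. E' k i <= nhd (E i) e"
  and kc: "kconv (hdom I E) (%k. hdom I (E' k)) f g" and nc: "~ g constant_on hdom I E"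
  and bd: "!!rh. EX M. ALL k. ALL z:hdom I (E' k). cmod z <= rh --> cmod (f k z) <= M"
  and LR: "!!k. (UN i:I. L' k i) <= cball 0 R"
  and d: "dl > 0"
 shows "EV k. ALL i:I. L' k i <= nhd (L i) dl"
proof -
 have E: "holes I E" and L: "holes I L" using hole_mapD[OF g] by auto
 have con: "connected (hdom I E)" using connected_hdom[OF E] .
 obtain e where e: "0 < e" "e <= dl" "!!i j. i : I ==> j : I ==> i ~= j ==> nhd (L i) e Int nhd (L j) e = {}"
  using holes_subset_nhd[OF L d] by auto
 define W where "W = (UN i:I. nhd (L i) e)"
 have openW: "open W" unfolding W_def by auto
 have Wdom: "w : hdom I L" if "w ~: W" for w using that subset_nhd[OF e(1)] unfolding W_def hdom_def by auto
 \<comment> \<open>The form in which Hurwitz's theorem is used below: values \<open>w k\<close> with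
   a limit outside \<open>W\<close> must be taken near the preimage of that limit.\<close>
 have att: False if r: "strict_mono (r :: nat => nat)" and w: "w ----> l" "l ~: W"
  and bad: "!!k y. y : hdom I (E' (r k)) ==> f (r k) y = w k ==> y ~: ball (inv_into (hdom I E) g l) s" and "s > 0" for r w l s
 proof -
  have l: "l : hdom I L" using Wdom w by auto
  define z where "z = inv_into (hdom I E) g l"
  have z: "z : hdom I E" "g z = l" using l hole_mapD(6)[OF g] by (auto simp: z_def inv_into_into f_inv_into_f)
  have "EV k. EX y. y : hdom I (E' (r k)) & dist z y < s & f (r k) y = w k"
   by (rule kconv_attains[OF kconv_subseq[OF kc r] con nc z(1)]) (use w z `s > 0` in auto)
  then obtain k y where "y : hdom I (E' (r k))" "dist z y < s" "f (r k) y = w k" by (auto simp: eventually_sequentially)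
  thus False using bad[of y k] by (auto simp: z_def)
 qed
 have ev1: "EV k. (UN i:I. L' k i) <= W"
 proof (rule ccontr)
  assume "~ ?thesis"
  from not_eventually_subseq[OF this] obtain r :: "nat => nat" where r: "strict_mono r" "!!k. ~ (UN i:I. L' (r k) i) <= W" by auto
  hence "ALL k. EX w. w : (UN i:I. L' (r k) i) & w ~: W" by blast
  then obtain w where w: "!!k. w k : (UN i:I. L' (r k) i)" "!!k. w k ~: W" by metis
  have "w k : cball 0 R" for k using w(1)[of k] LR[of "r k"] by blast
  hence "range w <= cball 0 R" by auto
  hence "bounded (range w)" by (rule bounded_subset[OF bounded_cball])
  then obtain q l where q: "strict_mono q" "(%k. w (q k)) ----> l" by (rule bounded_seq_subseq)
  have "closed (- W)" using openW by auto
  hence "l ~: W" using Lim_in_closed_set[OF _ _ _ q(2), of "- W"] w(2) by auto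
  show False
  proof (rule att[OF strict_mono_o[OF r(1) q(1)] q(2) `l ~: W` _ zero_less_one], unfold o_def)
   fix k y assume "y : hdom I (E' (r (q k)))" "f (r (q k)) y = w (q k)"
   hence "w (q k) : hdom I (L' (r (q k)))" using hole_mapD(6)[OF hm[of "r (q k)"]] by force
   thus "y ~: ball (inv_into (hdom I E) g l) 1" using w(1)[of "q k"] by (auto simp: hdom_def)
  qed
 qed
 have "EV k. L' k j <= nhd (L j) e" if j: "j : I" for j
 proof (rule ccontr)
  assume na: "~ ?thesis"
  have "~ (EV k. (UN i:I. L' k i) <= W --> L' k j <= nhd (L j) e)"
  proof
   assume "EV k. (UN i:I. L' k i) <= W --> L' k j <= nhd (L j) e"
   hence "EV k. L' k j <= nhd (L j) e" using ev1 by eventually_elim blast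
   thus False using na by simp
  qed
  from not_eventually_subseq[OF this] obtain r :: "nat => nat" where r: "strict_mono r" "!!k. (UN i:I. L' (r k) i) <= W" "!!k. ~ L' (r k) j <= nhd (L j) e"
   by auto
  obtain d0 where d0: "d0 > 0" "!!z. z : nhd (E j) d0 ==> z : hdom I E ==> g z : nhd (L j) e"
   using hole_map_nhd[OF g j e(1)] by blast
  obtain d1 where d1: "0 < d1" "d1 <= d0" "!!i k. i : I ==> k : I ==> i ~= k ==> nhd (E i) d1 Int nhd (E k) d1 = {}"
   using holes_subset_nhd[OF E d0(1)] by auto
  \<comment> \<open>Half, because in the end a point within \<open>ep\<close> of both
    \<open>E j\<close> and \<open>z\<close> must put \<open>z\<close> into
    \<open>nhd (E j) d0\<close>.\<close>
  define ep where "ep = d1 / 2"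
  have ep: "ep > 0" "ep + ep <= d0" "ep <= d1" using d1 by (auto simp: ep_def)
  have Ej: "compact (E j)" "connected (E j)" "E j ~= {}" using E j by (auto simp: holes_def)
  define N where "N = nhd (E j) ep"
  have Nb: "bounded N" unfolding N_def using Ej by (simp add: bounded_nhd compact_imp_bounded)
  have "~ N <= E j"
  proof
   assume "N <= E j"
   hence "N = E j" using subset_nhd[OF ep(1)] by (auto simp: N_def)
   hence "open (E j)" "closed (E j)" using Ej open_nhd compact_imp_closed unfolding N_def by metis+
   hence "E j = UNIV" using Ej clopen by blast
   thus False using Ej by simp
  qed
  \<comment> \<open>A fixed point of the ring: its values converge to \<open>g z0\<close>, so the
    image of the ring around \<open>E' k j\<close> reaches the neighbourhood with index
    \<open>j\<close> for all large \<open>k\<close>.\<close>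
  then obtain z0 where z0: "z0 : N" "z0 ~: E j" by auto
  have z0D: "z0 : hdom I E"
  proof -
   have "z0 : nhd (E j) d1" using z0 nhd_mono[OF order_refl ep(3)] by (auto simp: N_def)
   hence "z0 ~: E i" if "i : I" "i ~= j" for i using d1(3)[of j i] subset_nhd[OF d1(1), of "E i"] j that by auto
   thus ?thesis using z0 by (auto simp: hdom_def)
  qed
  have gz0: "g z0 : nhd (L j) e" using d0(2)[OF _ z0D] z0(1) nhd_mono[OF order_refl, of ep d0 "E j"] ep by (auto simp: N_def)
  have "(%k. f (r k) z0) ----> g z0" using kconv_tendsto[OF kconv_subseq[OF kc r(1)] z0D tendsto_const] .
  hence e1: "EV k. f (r k) z0 : nhd (L j) e" using gz0 topological_tendstoD by blast
  have e2: "EV k. ALL i:I. E' (r k) i <= nhd (E i) ep" using eventually_subseq[OF up[OF ep(1)] r(1)] .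
  have e3: "EV k. {z0} <= hdom I (E' (r k))" using eventually_subseq[OF kconvD(4)[OF kc, of "{z0}"] r(1)] z0D by auto
  have "EV k. EX y. y : N & y : hdom I (E' (r k)) & f (r k) y ~: W" using e1 e2 e3
  proof eventually_elim
   case (elim k)
   let ?E = "E' (r k)" and ?L = "L' (r k)" and ?f = "f (r k)"
   have hE: "holes I ?E" and hL: "holes I ?L" using hole_mapD[OF hm] by auto
   have Ek: "compact (?E j)" "connected (?E j)" "?E j ~= {}" "?E j <= N" using hE j elim(2) by (auto simp: holes_def N_def)
   have conN: "connected (N - ?E j)" unfolding N_def using Ek Ej holes_connected_compl[OF hE j]
    by (intro connected_open_diff_closed connected_nhd) (auto simp: N_def)
   have Nsub: "N - ?E j <= hdom I ?E"
   proof
    fix x assume x: "x : N - ?E j"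
    have "x ~: ?E i" if "i : I" "i ~= j" for i
    proof
     assume "x : ?E i"
     hence "x : nhd (E i) ep" using elim(2) that by auto
     hence "x : nhd (E i) d1" "x : nhd (E j) d1" using x nhd_mono[OF order_refl ep(3)] by (auto simp: N_def)
     thus False using d1(3)[of i j] that j by auto
    qed
    thus "x : hdom I ?E" using x by (auto simp: hdom_def)
   qed
   have conA: "connected (?f ` (N - ?E j))"
    using connected_continuous_image[OF continuous_on_subset[OF holomorphic_on_imp_continuous_on[OF hole_mapD(3)[OF hm]] Nsub] conN] .
   \<comment> \<open>the hole lies in the neighbourhood of some other limit hole\<close>
   have Lk: "connected (?L j)" "?L j ~= {}" "compact (?L j)" using hL j by (auto simp: holes_def)
   have LW: "?L j <= W" using r(2)[of k] j by auto
   let ?B = "UN i:I-{j}. nhd (L i) e"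
   have disj: "nhd (L j) e Int ?B = {}" using e(3) j by blast
   have "?L j Int nhd (L j) e = {}"
   proof (rule ccontr)
    assume "?L j Int nhd (L j) e ~= {}"
    moreover have "?L j <= nhd (L j) e Un ?B" using LW by (auto simp: W_def)
    moreover have "?L j Int ?B ~= {}" using r(3)[of k] calculation by blast
    moreover have "open (nhd (L j) e)" "open ?B" by auto
    ultimately show False using Lk(1) disj unfolding connected_def by (metis (no_types, lifting) Int_commute Int_empty_left)
   qed
   hence LB: "?L j <= ?B" using LW by (auto simp: W_def)
   have "EX x. x : N - ?E j & ?f x : ?B"
   proof -
    obtain s where s: "s > 0" "nhd (?L j) s <= ?B" using nhd_subset_open[OF Lk(3) _ LB] by blast
    obtain t where t: "t > 0" "!!z. z : nhd (?E j) t ==> z : hdom I ?E ==> ?f z : nhd (?L j) s"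
     using hole_map_nhd[OF hm j s(1)] by blast
    obtain t' where t': "t' > 0" "nhd (?E j) t' <= N" using nhd_subset_open[OF Ek(1) _ Ek(4)] unfolding N_def by auto
    define u where "u = min t t'"
    have u: "u > 0" "nhd (?E j) u <= N" "nhd (?E j) u <= nhd (?E j) t"
     using t t' nhd_mono[OF order_refl, of u t' "?E j"] nhd_mono[OF order_refl, of u t "?E j"] by (auto simp: u_def)
    have "~ nhd (?E j) u <= ?E j"
    proof
     assume "nhd (?E j) u <= ?E j"
     hence "nhd (?E j) u = ?E j" using subset_nhd[OF u(1)] by auto
     hence "open (?E j)" "closed (?E j)" using Ek open_nhd compact_imp_closed by metis+
     hence "?E j = UNIV" using Ek clopen by blast
     thus False using Ek by simp
    qed
    then obtain x where x: "x : nhd (?E j) u" "x ~: ?E j" by auto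
    hence "x : N - ?E j" using u by auto
    moreover have "?f x : ?B" using t(2)[of x] x u Nsub s by blast
    ultimately show ?thesis by auto
   qed
   then obtain x where x: "x : N - ?E j" "?f x : ?B" by auto
   have z0': "z0 : N - ?E j" using z0 elim(3) j by (auto simp: hdom_def)
   show ?case
   proof (rule ccontr)
    assume "~ ?thesis"
    hence "?f ` (N - ?E j) <= nhd (L j) e Un ?B" using Nsub by (auto simp: W_def)
    moreover have "open (nhd (L j) e)" "open ?B" by auto
    moreover have "nhd (L j) e Int ?f ` (N - ?E j) ~= {}" using z0' elim(1) by blast
    moreover have "?B Int ?f ` (N - ?E j) ~= {}" using x by blast
    ultimately show False using conA disj unfolding connected_def by (metis (no_types, lifting) Int_empty_left)
   qed
  qed
  then obtain n0 where "!!k. k >= n0 ==> EX y. y : N & y : hdom I (E' (r k)) & f (r k) y ~: W"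
   unfolding eventually_sequentially by blast
  hence "ALL k. EX y. y : N & y : hdom I (E' (r (k + n0))) & f (r (k + n0)) y ~: W" by simp
  then obtain y where y: "!!k. y k : N" "!!k. y k : hdom I (E' (r (k + n0)))" "!!k. f (r (k + n0)) (y k) ~: W" by metis
  define r' where "r' k = r (k + n0)" for k
  have r': "strict_mono r'" using r(1) by (simp add: strict_mono_def r'_def)
  obtain rh where rh: "N <= cball 0 rh" using Nb bounded_subset_cball by auto
  obtain M where M: "!!k z. z : hdom I (E' k) ==> cmod z <= rh ==> cmod (f k z) <= M" using bd[of rh] by blast
  have "cmod (f (r' k) (y k)) <= M" for k using M[OF y(2)[of k]] y(1)[of k] rh by (auto simp: r'_def)
  hence "bounded (range (%k. f (r' k) (y k)))" by (auto simp: bounded_iff)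
  then obtain q l where q: "strict_mono q" "(%k. f (r' (q k)) (y (q k))) ----> l" by (rule bounded_seq_subseq)
  have "closed (- W)" using openW by auto
  hence "l ~: W" using Lim_in_closed_set[OF _ _ _ q(2), of "- W"] y(3) by (auto simp: r'_def)
  hence l: "l : hdom I L" using Wdom by auto
  define z where "z = inv_into (hdom I E) g l"
  have z: "z : hdom I E" "g z = l" using l hole_mapD(6)[OF g] by (auto simp: z_def inv_into_into f_inv_into_f)
  show False
  proof (rule att[OF strict_mono_o[OF r' q(1)] q(2) `l ~: W` _ ep(1)], unfold o_def)
   fix k v assume v: "v : hdom I (E' (r' (q k)))" "f (r' (q k)) v = f (r' (q k)) (y (q k))"
   have "v = y (q k)" using v y(2)[of "q k"] hole_mapD(5)[OF hm] unfolding r'_def by (metis inj_onD)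
   hence "v : N" using y(1) by simp
   show "v ~: ball (inv_into (hdom I E) g l) ep"
   proof
    assume "v : ball (inv_into (hdom I E) g l) ep"
    hence "dist z v < ep" by (simp add: z_def)
    moreover obtain a where "a : E j" "dist a v < ep" using `v : N` by (auto simp: N_def in_nhd_iff)
    ultimately have "dist a z < d0" using ep(2) dist_triangle[of a z v] by (simp add: dist_commute)
    hence "z : nhd (E j) d0" using `a : E j` by (auto simp: in_nhd_iff)
    hence "g z : nhd (L j) e" using d0(2) z by auto
    thus False using z `l ~: W` j by (auto simp: W_def)
   qed
  qed
 qed
 hence "EV k. ALL j:I. L' k j <= nhd (L j) e" using E by (intro eventually_ball_finite) (auto simp: holes_def)
 thus ?thesis by eventually_elim (use nhd_mono[OF order_refl e(2)] in blast)
qed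


text \<open>Uniform bounds are available under hydrodynamic normalisation, so each
  \<open>f k\<close> is written as \<open>au k * h k + be k\<close>. A limit of the
  \<open>h k\<close> is injective, hence separates 0 and 1, and the factors, which are determined by
  \<open>h k 0\<close> and \<open>h k 1\<close>, converge too. Only an upper bound on the holes
  \<open>E' k\<close> enters, so they may stay much smaller than \<open>E\<close>.\<close>

lemma hole_maps_compact:
 assumes E: "holes I E" and E01: "0 : hdom I E" "1 : hdom I E"
  and up: "!!e. e > 0 ==> EV k. ALL i:I. E' k i <= nhd (E i) e"
  and hm: "!!k. hole_map I (E' k) (L' k) (f k)" and f01: "!!k. f k 0 = 0" "!!k. f k 1 = 1"
 obtains r L g where "strict_mono (r :: nat => nat)" "hole_map I E L g" "g 0 = 0" "g 1 = 1"
  "kconv (hdom I E) (%k. hdom I (E' (r k))) (%k. f (r k)) g"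
  "!!dl. dl > 0 ==> EV k. ALL i:I. L' (r k) i <= nhd (L i) dl"
proof -
 obtain R where R: "R > 0" "(UN i:I. E i) <= ball 0 R" using hdom_outside_ball[OF E] .
 have extE: "far R <= hdom I E" using exterior_in_hdom[OF R(2)] .
 have evR: "EV k. (UN i:I. E' k i) <= ball 0 R"
 proof -
  obtain e where e: "e > 0" "nhd (UN i:I. E i) e <= ball 0 R" using nhd_subset_open[OF compact_holes[OF E] open_ball R(2)] .
  show ?thesis using up[OF e(1)]
  proof eventually_elim
   case (elim k)
   have "E' k i <= nhd (UN i:I. E i) e" if "i : I" for i using elim that nhd_mono[of "E i" "UN i:I. E i" e e] by blast
   thus ?case using e(2) by blast
  qed
 qed
 obtain N where N: "!!k. (UN i:I. E' (k + N) i) <= ball 0 R" using evR unfolding eventually_sequentially by (metis le_add2)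
 define E2 where "E2 k = E' (k + N)" for k
 define L2 where "L2 k = L' (k + N)" for k
 define f2 where "f2 k = f (k + N)" for k
 have smN: "strict_mono (%k. k + N)" by (simp add: strict_mono_def)
 have hm2: "hole_map I (E2 k) (L2 k) (f2 k)" for k using hm by (simp add: E2_def L2_def f2_def)
 have E2R: "(UN i:I. E2 k i) <= ball 0 R" for k using N by (simp add: E2_def)
 have ext: "far R <= hdom I (E2 k)" for k using exterior_in_hdom[OF E2R] .
 have "ALL k. EX au be h. au ~= 0 & (ALL z. f2 k z = au * h z + be) & hydro h & h hol hdom I (E2 k) & inj_on h (hdom I (E2 k))"
  using hole_map_hydro_factor[OF hm2] by metis
 then obtain au be h where h: "!!k. au k ~= (0::complex)" "!!k z. f2 k z = au k * h k z + be k" "!!k. hydro (h k)"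
  "!!k. h k hol hdom I (E2 k)" "!!k. inj_on (h k) (hdom I (E2 k))" by metis
 have al: "au k = 1 / (h k 1 - h k 0)" "be k = - au k * h k 0" for k
 proof -
  have "au k * h k 0 + be k = 0" "au k * h k 1 + be k = 1" using h(2)[of k 0] h(2)[of k 1] f01 by (auto simp: f2_def)
  hence "au k * (h k 1 - h k 0) = 1" "be k = - au k * h k 0" by (auto simp: algebra_simps add_eq_0_iff)
  thus "au k = 1 / (h k 1 - h k 0)" "be k = - au k * h k 0" by (metis mult_eq_0_iff nonzero_mult_div_cancel_right one_neq_zero)+
 qed
 have hb: "EX M. ALL k. ALL z:hdom I (E2 k). cmod z <= rh --> cmod (h k z) <= M" for rh
 proof -
  obtain M where M: "!!(I::'a set) E f z. holes I E ==> (UN i:I. E i) <= ball 0 R ==> f hol hdom I E ==> inj_on f (hdom I E) ==> hydro f ==> z : hdom I E ==> cmod z <= rh ==> cmod (f z) <= M"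
   using hydro_bounds[OF R(1), of rh] by metis
  show ?thesis using M[OF hole_mapD(1)[OF hm2] E2R h(4,5,3)] by blast
 qed
 have ev2: "EV k. Q <= hdom I (E2 k)" if "compact Q" "Q <= hdom I E" for Q
  using eventually_subseq[OF eventually_subset_hdom[OF E up that] smN] by (simp add: E2_def)
 obtain r0 h0 where r0: "strict_mono r0" "kconv (hdom I E) (%k. hdom I (E2 (r0 k))) (%k. h (r0 k)) h0"
 proof (rule kconv_exists[of "hdom I E" "%k. hdom I (E2 k)" h])
  fix Q :: "complex set" assume Q: "compact Q" "Q <= hdom I E"
  obtain rh where "Q <= cball 0 rh" using compact_imp_bounded[OF Q(1)] bounded_subset_cball by auto
  thus "EX M. ALL k. ALL z:Q. z : hdom I (E2 k) --> cmod (h k z) <= M" using hb[of rh] by force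
 next
  show "open (hdom I (E2 k))" for k by (rule open_hdom[OF hole_mapD(1)[OF hm2]])
 qed (use open_hdom[OF E] h ev2 in auto)
 have hext: "h k hol far R" "inj_on (h k) (far R)" for k
  by (rule holomorphic_on_subset[OF h(4) ext], rule inj_on_subset[OF h(5) ext])
 have "EX a. ((%z. z * (h k z - z)) -oo-> a)" for k
  by (rule hydrodynamic_coeff[OF holomorphic_on_diff[OF hext(1) holomorphic_on_ident] _ R(1)]) (use h(3) in "simp add: hydro_def")
 then obtain a where a: "!!k. ((%z. z * (h k z - z)) -oo-> a k)" by metis
 have h0: "hydro h0" by (rule hydro_limit(1)[OF R(1) _ _ _ kconv_mono[OF r0(2) open_exterior extE] a]) (use hext h(3) in auto)
 have nc0: "~ h0 constant_on hdom I E" using hydro_not_constant[OF h0 extE] .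
 have inj0: "inj_on h0 (hdom I E)" by (rule kconv_inj[OF r0(2) connected_hdom[OF E] nc0]) (use h(5) in auto)
 have hol0: "h0 hol hdom I E" using kconv_holomorphic[OF r0(2)] .
 have d01: "h0 1 - h0 0 ~= 0" using inj0 E01 by (metis eq_iff_diff_eq_0 inj_onD zero_neq_one)
 define A where "A = 1 / (h0 1 - h0 0)"
 define B where "B = - A * h0 0"
 define g where "g z = A * h0 z + B" for z
 have A0: "A ~= 0" using d01 by (simp add: A_def)
 have lim01: "(%k. h (r0 k) 0) ----> h0 0" "(%k. h (r0 k) 1) ----> h0 1"
  using kconv_tendsto[OF r0(2) E01(1) tendsto_const] kconv_tendsto[OF r0(2) E01(2) tendsto_const] by auto
 have limA: "(%k. au (r0 k)) ----> A" unfolding al(1) A_def using d01 lim01 by (intro tendsto_intros) auto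
 have limB: "(%k. be (r0 k)) ----> B" unfolding al(2)[of "r0 _"] B_def using limA lim01 by (intro tendsto_intros)
 have unifc: "uniform_limit Q (%k z. c k) (%z. l) sequentially" if "c ----> l" for Q :: "complex set" and c and l :: complex
  using that unfolding uniform_limit_iff tendsto_iff by simp
 have kc: "kconv (hdom I E) (%k. hdom I (E2 (r0 k))) (%k. f2 (r0 k)) g" unfolding kconv_def
 proof (intro conjI allI impI)
  fix Q assume Q: "compact Q" "Q <= hdom I E"
  show "EV k. Q <= hdom I (E2 (r0 k))" using kconvD(4)[OF r0(2) Q] .
  have "bounded (h0 ` Q)"
   using Q hol0 by (meson compact_continuous_image compact_imp_bounded continuous_on_subset holomorphic_on_imp_continuous_on)
  moreover have "bounded ((%z. A) ` Q)" by (rule bounded_subset[of "{A}"]) auto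
  ultimately have "uniform_limit Q (%k z. au (r0 k) * h (r0 k) z + be (r0 k)) (%z. A * h0 z + B) sequentially"
   by (intro uniform_limit_add uniform_lim_mult unifc limA limB kconvD(5)[OF r0(2) Q])
  thus "uniform_limit Q (%k. f2 (r0 k)) g sequentially" unfolding g_def h(2) by simp
 qed (use open_hdom E hole_mapD[OF hm2] in auto)
 have gh: "g hol hdom I E" unfolding g_def using hol0 by (intro holomorphic_intros)
 have ginj: "inj_on g (hdom I E)" using inj0 A0 by (auto simp: inj_on_def g_def)
 have ginf: "filterlim g at_infinity at_infinity" unfolding g_def using hydro_at_infinity[OF h0] A0
  by (intro tendsto_add_filterlim_at_infinity'[OF _ tendsto_const] tendsto_mult_filterlim_at_infinity[OF tendsto_const])
 obtain L where L: "hole_map I E L g" using hole_map_exists[OF E gh ginj ginf] by blast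
 have gnc: "~ g constant_on hdom I E"
 proof
  assume "g constant_on hdom I E"
  hence "g 0 = g 1" using E01 by (auto simp: constant_on_def)
  thus False using ginj E01 by (metis inj_onD zero_neq_one)
 qed
 have "bounded (range (%k. au (r0 k)))" "bounded (range (%k. be (r0 k)))" using limA limB convergent_imp_bounded by auto
 then obtain a1 b1 where ab: "!!k. cmod (au (r0 k)) <= a1" "!!k. cmod (be (r0 k)) <= b1" by (auto simp: bounded_iff)
 have a1: "a1 >= 0" using ab(1)[of 0] norm_ge_zero order_trans by blast
 have bd: "EX M. ALL k. ALL z:hdom I (E2 (r0 k)). cmod z <= rh --> cmod (f2 (r0 k) z) <= M" for rh
 proof -
  obtain M where M: "!!k z. z:hdom I (E2 k) ==> cmod z <= rh ==> cmod (h k z) <= M" using hb[of rh] by blast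
  have "cmod (f2 (r0 k) z) <= a1 * M + b1" if "z:hdom I (E2 (r0 k))" "cmod z <= rh" for k z
  proof -
   have "cmod (f2 (r0 k) z) <= cmod (au (r0 k)) * cmod (h (r0 k) z) + cmod (be (r0 k))"
    unfolding h(2) using norm_triangle_ineq norm_mult by metis
   also have "... <= a1 * M + b1" using ab M[OF that] a1 by (intro add_mono mult_mono) auto
   finally show ?thesis .
  qed
  thus ?thesis by auto
 qed
 obtain C where C: "C > 0" "!!f w. f hol far R ==> inj_on f (far R) ==> hydro f ==> w ~: f ` far R ==> cmod w <= C * R"
  using exterior_bound R(1) by auto
 \<comment> \<open>An image hole consists of values omitted by \<open>h\<close>, rescaled; omitted
   values are bounded by \<open>C * R\<close>.\<close>
 have LR: "(UN i:I. L2 (r0 k) i) <= cball 0 (a1 * (C * R) + b1)" for k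
 proof
  fix w assume w: "w : (UN i:I. L2 (r0 k) i)"
  define v where "v = (w - be (r0 k)) / au (r0 k)"
  have wv: "w = au (r0 k) * v + be (r0 k)" using h(1) by (simp add: v_def)
  have "v ~: h (r0 k) ` far R"
  proof
   assume "v : h (r0 k) ` far R"
   then obtain z where z: "z : hdom I (E2 (r0 k))" "v = h (r0 k) z" using ext by blast
   hence "f2 (r0 k) z = w" by (simp add: h(2) wv)
   hence "w : hdom I (L2 (r0 k))" using hole_mapD(6)[OF hm2] z(1) by blast
   thus False using w by (auto simp: hdom_def)
  qed
  hence v: "cmod v <= C * R" using C(2)[OF hext h(3)] by blast
  have "cmod w <= cmod (au (r0 k)) * cmod v + cmod (be (r0 k))" unfolding wv using norm_triangle_ineq norm_mult by metis
  also have "... <= a1 * (C * R) + b1" using ab v a1 by (intro add_mono mult_mono) auto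
  finally show "w : cball 0 (a1 * (C * R) + b1)" by simp
 qed
 define r where "r k = r0 k + N" for k
 have r: "strict_mono r" using r0(1) by (simp add: strict_mono_def r_def)
 show ?thesis
 proof (rule that[OF r L])
  show "g 0 = 0" by (simp add: g_def B_def)
  show "g 1 = 1" using d01 by (simp add: g_def B_def A_def divide_simps)
  show "kconv (hdom I E) (%k. hdom I (E' (r k))) (%k. f (r k)) g" using kc by (simp add: E2_def f2_def r_def)
  fix dl :: real assume "dl > 0"
  have "EV k. ALL i:I. L2 (r0 k) i <= nhd (L i) dl"
  proof (rule hole_maps_limit[OF hm2 L _ kc gnc bd LR `dl > 0`])
   fix e :: real assume "e > 0"
   show "EV k. ALL i:I. E2 (r0 k) i <= nhd (E i) e" using eventually_subseq[OF up[OF `e > 0`] r] by (simp add: E2_def r_def)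
  qed
  thus "EV k. ALL i:I. L' (r k) i <= nhd (L i) dl" by (simp add: L2_def r_def)
 qed
qed

section \<open>Joukowski maps on the complement of a continuum\<close>

lemma inversion_simply_connected:
 fixes L :: "complex set"
 assumes L: "compact L" "connected L" "connected (-L)" "p : L"
 defines "W \<equiv> {t. t = 0 | p + inverse t ~: L}"
 shows "open W" "simply_connected W"
proof -
 obtain B where B: "B > 0" "!!w. w : L ==> cmod (w - p) < B"
 proof -
  have "bounded ((%w. w - p) ` L)" using L(1) by (intro compact_imp_bounded compact_continuous_image continuous_intros)
  then obtain b where b: "!!w. w : L ==> cmod (w - p) <= b" by (auto simp: bounded_iff)
  show ?thesis using that[of "abs(b) + 1"] b by force
 qed
 define W2 where "W2 = (%w. inverse (w - p)) ` (- L)"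
 have W2: "W2 = {t. t ~= 0 & p + inverse t ~: L}"
 proof (intro set_eqI iffI)
  fix t assume "t : W2"
  then obtain w where "w ~: L" "t = inverse (w - p)" by (auto simp: W2_def)
  thus "t : {t. t ~= 0 & p + inverse t ~: L}" using L(4) by auto
 next
  fix t assume "t : {t. t ~= 0 & p + inverse t ~: L}"
  thus "t : W2" unfolding W2_def by force
 qed
 have ballW: "ball 0 (1/B) <= W"
 proof
  fix t :: complex assume t: "t : ball 0 (1/B)"
  show "t : W"
  proof (rule ccontr)
   assume "t ~: W"
   hence "t ~= 0" "p + inverse t : L" by (auto simp: W_def)
   hence "cmod (inverse t) < B" using B(2) by force
   hence "1 < B * cmod t" using `t ~= 0` by (simp add: norm_divide inverse_eq_divide pos_divide_less_eq)
   thus False using t B(1) by (simp add: pos_less_divide_eq mult.commute)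
  qed
 qed
 have Weq: "W = ball 0 (1/B) Un W2" using ballW W2 by (auto simp: W_def B(1))
 have "open W2"
 proof -
  have "open ((- {0}) Int (%t. p + inverse t) -` (- L))"
   using L(1) by (intro continuous_open_preimage continuous_intros) (auto simp: compact_imp_closed)
  moreover have "W2 = (- {0}) Int (%t. p + inverse t) -` (- L)" unfolding W2 by auto
  ultimately show ?thesis by simp
 qed
 thus "open W" unfolding Weq by auto
 have "connected W2" unfolding W2_def using L by (intro connected_continuous_image continuous_intros) auto
 moreover have "ball 0 (1/B) Int W2 ~= {}"
 proof -
  define c where "c = complex_of_real (1 / (2 * B))"
  have "cmod c = 1 / (2 * B)" unfolding c_def using B(1) by (subst norm_of_real) simp
  hence "c : ball 0 (1/B)" "c ~= 0" using B(1) by (auto simp: field_simps)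
  hence "c : W2" using ballW W2 by (auto simp: W_def)
  thus ?thesis using `c : ball 0 (1/B)` by blast
 qed
 ultimately have conW: "connected W" unfolding Weq by (intro connected_Un) auto
 \<comment> \<open>The winding number of \<open>g\<close> around \<open>1 / (w - p)\<close>, as a
   function of \<open>w\<close> in \<open>L\<close>, is continuous and integer-valued, and it
   vanishes for \<open>w\<close> near \<open>p\<close>, where \<open>1 / (w - p)\<close> is far
   away. As \<open>L\<close> is connected it vanishes everywhere, so \<open>g\<close> winds around
   no point outside \<open>W\<close>.\<close>
 have "winding_number g z = 0" if g: "path g" "path_image g <= W" "pathfinish g = pathstart g" and z: "z ~: W" for g z
 proof -
  define fi where "fi w = (if w = p then 0 else winding_number g (inverse (w - p)))" for w
  have npi: "inverse (w - p) ~: path_image g" if "w : L" "w ~= p" for w using that g(2) by (auto simp: W_def)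
  obtain B' where B': "!!z. B' <= cmod z ==> winding_number g z = 0" using winding_number_zero_at_infinity[OF g(1,3)] by blast
  have "continuous_on L fi" unfolding continuous_on_eq_continuous_within
  proof
   fix w assume w: "w : L"
   show "continuous (at w within L) fi"
   proof (cases "w = p")
    case True
    have "\<forall>\<^sub>F y in at w within L. fi y = 0" unfolding eventually_at
    proof (intro exI[of _ "1 / (abs(B') + 1)"] conjI ballI impI)
     fix y assume y: "y : L" "y ~= w & dist y w < 1 / (abs(B') + 1)"
     hence "cmod (y - p) * (abs(B') + 1) < 1" using True by (simp add: dist_norm pos_less_divide_eq)
     moreover have "cmod (y - p) > 0" using y True by simp
     ultimately have "abs(B') + 1 < cmod (inverse (y - p))"
      by (simp add: norm_divide inverse_eq_divide pos_less_divide_eq mult.commute)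
     thus "fi y = 0" using B'[of "inverse (y - p)"] by (simp add: fi_def)
    qed auto
    hence "(fi ---> 0) (at w within L)" by (rule tendsto_eventually)
    thus ?thesis using True by (simp add: continuous_within fi_def)
   next
    case False
    have "open (- path_image g)" using g(1) by (simp add: closed_path_image open_Compl)
    hence "isCont (winding_number g) (inverse (w - p))" using npi[OF w False] continuous_at_winding_number[OF g(1)] by blast
    hence "isCont (%w. winding_number g (inverse (w - p))) w"
    proof (rule isCont_o2[rotated])
     show "isCont (%w. inverse (w - p)) w" using False by (auto intro!: continuous_intros)
    qed
    hence "((%w. winding_number g (inverse (w - p))) ---> fi w) (at w)" using False by (simp add: isCont_def fi_def)
    hence "(fi ---> fi w) (at w)"
    proof (rule Lim_transform_eventually)
     have "\<forall>\<^sub>F y in at w. y ~= p" using False by (auto simp: eventually_at dist_commute intro!: exI[of _ "dist w p"])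
     thus "\<forall>\<^sub>F y in at w. winding_number g (inverse (y - p)) = fi y" by eventually_elim (simp add: fi_def)
    qed
    thus ?thesis by (simp add: continuous_within tendsto_within_subset[of _ _ _ UNIV])
   qed
  qed
  moreover have "fi w : \<int>" if "w : L" for w using npi[OF that] integer_winding_number[OF g(1,3)] by (auto simp: fi_def)
  moreover have "EX e>0. ALL y. y : S & fi y ~= fi x --> e <= cmod (fi y - fi x)" if "S <= L" "x : S" for S x
  proof (intro exI[of _ 1] conjI allI impI)
   fix y assume "y : S & fi y ~= fi x"
   hence "fi y - fi x : \<int>" and nz: "fi y - fi x ~= 0" using calculation(2) that by (auto intro: Ints_diff)
   then obtain i where i: "fi y - fi x = of_int i" by (auto elim: Ints_cases)
   hence "i ~= 0" using nz by auto
   thus "1 <= cmod (fi y - fi x)" unfolding i norm_of_int by simp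
  qed simp
  ultimately have "fi constant_on L" using continuous_discrete_range_constant[OF L(2), of fi] by blast
  moreover have zz: "z ~= 0" "p + inverse z : L" using z by (auto simp: W_def)
  ultimately have "fi (p + inverse z) = fi p" using L(4) by (auto simp: constant_on_def)
  thus ?thesis using zz by (simp add: fi_def)
 qed
 thus "simply_connected W" using simply_connected_eq_winding_number_zero[OF `open W`] conW by blast
qed

text \<open>A branch of the inverse of the Joukowski map with foci \<open>a\<close> and
  \<open>b\<close>. It needs a square root of \<open>(w - a) * (w - b)\<close>; with
  \<open>t = 1 / (w - b)\<close> one has \<open>(w - a) / (w - b) = 1 + (b - a) * t\<close>, which
  has no zero on the inverted complement, a simply connected set.\<close>

lemma joukowski_inverse:
 fixes L :: "complex set"
 assumes L: "compact L" "connected L" "connected (-L)" and ab: "a : L" "b : L" "a ~= b"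
 obtains ze where "ze hol (-L)" "!!w. w ~: L ==> ze w ~= 0"
  "!!w. w ~: L ==> ze w + ((b - a) / 4)^2 / ze w = w - (a + b) / 2"
  "(%w. ze w - w) -oo-> - (a + b) / 2"
proof -
 define W where "W = {t. t = 0 | b + inverse t ~: L}"
 have W: "open W" "simply_connected W" unfolding W_def using inversion_simply_connected[OF L ab(2)] by auto
 have W0: "0 : W" by (simp add: W_def)
 have "1 + (b - a) * t ~= 0" if "t : W" for t
 proof
  assume "1 + (b - a) * t = 0"
  hence "(a - b) * t = 1" by (simp add: algebra_simps)
  hence "t ~= 0" "inverse t = a - b" using inverse_unique[of t "a - b"] by (auto simp: mult.commute)
  thus False using that ab(1) by (simp add: W_def)
 qed
 moreover have "(%t. 1 + (b - a) * t) hol W" by (intro holomorphic_intros)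
 ultimately obtain q0 where q0: "q0 hol W" "!!t. t : W ==> 1 + (b - a) * t = (q0 t)^2"
  using simply_connected_eq_holomorphic_sqrt[OF W(1)] W(2) by blast
 have q00: "(q0 0)^2 = 1" using q0(2)[OF W0] by simp
 define q where "q t = q0 t * q0 0" for t
 have q: "q hol W" unfolding q_def using q0(1) by (intro holomorphic_intros)
 have q2: "(q t)^2 = 1 + (b - a) * t" if "t : W" for t using q0(2)[OF that] q00 by (simp add: q_def power_mult_distrib)
 have q1: "q 0 = 1" using q00 by (simp add: q_def power2_eq_square)
 define s where "s w = (w - b) * q (inverse (w - b))" for w
 have wb: "w - b ~= 0" "inverse (w - b) : W" if "w ~: L" for w using that ab(2) by (auto simp: W_def)
 have s2: "(s w)^2 = (w - a) * (w - b)" if "w ~: L" for w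
 proof -
  have "(s w)^2 = (w - b)^2 * (1 + (b - a) * inverse (w - b))" unfolding s_def power_mult_distrib using q2[OF wb(2)[OF that]] by simp
  also have "... = (w - a) * (w - b)" using wb(1)[OF that] by (simp add: field_simps power2_eq_square)
  finally show ?thesis .
 qed
 have hs: "s hol (-L)"
 proof -
  have "(q o (%w. inverse (w - b))) hol (-L)"
   by (rule holomorphic_on_compose_gen[OF _ q]) (use wb in "auto intro!: holomorphic_intros")
  thus ?thesis unfolding s_def by (auto simp: o_def intro!: holomorphic_intros)
 qed
 have dq: "(q has_field_derivative deriv q 0) (at 0)" using holomorphic_derivI[OF q W(1) W0] .
 have dq0: "deriv q 0 = (b - a) / 2"
 proof -
  have "((%t. (q t)^2) has_field_derivative 2 * deriv q 0) (at 0)" using DERIV_power[OF dq, of 2] q1 by simp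
  moreover have "((%t. (q t)^2) has_field_derivative (b - a)) (at 0)"
   by (rule has_field_derivative_transform_within_open[of "%t. 1 + (b - a) * t" _ _ W])
     (use W(1) W0 q2 in "auto intro!: derivative_eq_intros")
  ultimately have "2 * deriv q 0 = b - a" using DERIV_unique by blast
  thus ?thesis by (simp add: field_simps)
 qed
 have slim: "(%w. s w - w) -oo-> - (a + b) / 2"
 proof -
  have "((%t. (q t - 1) / t) ---> (b - a) / 2) (at 0)" using dq unfolding DERIV_def q1 dq0 by simp
  moreover have "filterlim (%w. inverse (w - b)) (at 0) at_infinity"
  proof -
   have "filterlim (%w. w + - b) at_infinity at_infinity"
    by (intro tendsto_add_filterlim_at_infinity'[OF filterlim_ident tendsto_const])
   thus ?thesis by (simp add: filterlim_inverse_at_iff)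
  qed
  ultimately have "(%w. (q (inverse (w - b)) - 1) / inverse (w - b)) -oo-> (b - a) / 2" by (rule filterlim_compose)
  hence "(%w. (q (inverse (w - b)) - 1) / inverse (w - b) - b) -oo-> (b - a) / 2 - b" by (rule tendsto_diff[OF _ tendsto_const])
  moreover have "(q (inverse (w - b)) - 1) / inverse (w - b) - b = s w - w" for w
   by (simp add: s_def divide_inverse algebra_simps)
  moreover have "(b - a) / 2 - b = - (a + b) / 2" by simp
  ultimately show ?thesis by simp
 qed
 define m where "m = (a + b) / 2"
 define ze where "ze w = (w - m + s w) / 2" for w
 \<comment> \<open>The two roots of the quadratic equation have product
   \<open>((b - a) / 4)^2\<close>, so \<open>ze\<close> has no zero and the other root is
   \<open>((b - a) / 4)^2 / ze w\<close>.\<close>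
 have prod: "ze w * ((w - m - s w) / 2) = ((b - a) / 4)^2" if "w ~: L" for w
 proof -
  have "ze w * ((w - m - s w) / 2) = ((w - m)^2 - (s w)^2) / 4" by (simp add: ze_def field_simps power2_eq_square)
  also have "... = ((b - a) / 4)^2" unfolding s2[OF that] m_def by (simp add: field_simps power2_eq_square)
  finally show ?thesis .
 qed
 show ?thesis
 proof (rule that[of ze])
  show "ze hol (-L)" unfolding ze_def using hs by (intro holomorphic_intros) auto
  show nz: "ze w ~= 0" if "w ~: L" for w using prod[OF that] ab(3) by auto
  show "ze w + ((b - a) / 4)^2 / ze w = w - (a + b) / 2" if "w ~: L" for w
  proof -
   have "((b - a) / 4)^2 / ze w = (w - m - s w) / 2" using prod[OF that] nz[OF that] by (metis nonzero_mult_div_cancel_left)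
   moreover have "ze w + (w - m - s w) / 2 = w - m" by (simp add: ze_def field_simps)
   ultimately show ?thesis unfolding m_def by (simp only:)
  qed
  have "(%w. ((s w - w) - m) / 2) -oo-> (- (a + b) / 2 - m) / 2" using slim by (intro tendsto_intros) auto
  moreover have "((s w - w) - m) / 2 = ze w - w" for w by (simp add: ze_def)
  moreover have "(- (a + b) / 2 - m) / 2 = - (a + b) / 2" by (simp add: m_def field_simps)
  ultimately show "(%w. ze w - w) -oo-> - (a + b) / 2" by (simp only:)
 qed
qed

text \<open>Replacing \<open>k\<close> by \<open>t\<close> in the Joukowski formula shifts the
  coefficient of \<open>1/z\<close> by \<open>t - k\<close>. The difference of two values of
  \<open>T\<close> is \<open>(ze w - ze w') * (1 - t / (ze w * ze w'))\<close>, which explains the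
  condition that no product of two values of \<open>ze\<close> equals \<open>t\<close>.\<close>

lemma joukowski_combination:
 fixes ze :: "complex => complex"
 assumes h: "ze hol U" and nz': "ALL w:U. ze w ~= 0" and eq': "ALL w:U. ze w + k / ze w = w - m"
  and lim: "(%w. ze w - w) -oo-> - m" and t': "ALL w:U. ALL w':U. ze w * ze w' ~= t"
  and U: "far R <= U"
 defines "T \<equiv> %w. ze w + t / ze w + m"
 shows "T hol U" "inj_on T U" "hydro T" "(%w. w * (T w - w)) -oo-> t - k"
proof -
 note nz = bspec[OF nz'] and eq = bspec[OF eq'] and t = bspec[OF bspec[OF t']]
 show "T hol U" unfolding T_def using h nz by (intro holomorphic_intros) auto
 show "inj_on T U"
 proof (rule inj_onI)
  fix w w' assume w: "w : U" "w' : U" "T w = T w'"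
  have "(ze w - ze w') * (ze w * ze w' - t) = 0" using w nz[OF w(1)] nz[OF w(2)] by (simp add: T_def field_simps)
  hence "ze w = ze w'" using t[OF w(1,2)] by simp
  hence "w - m = w' - m" using eq[OF w(1)] eq[OF w(2)] by metis
  thus "w = w'" by simp
 qed
 have inf: "filterlim ze at_infinity at_infinity" using tendsto_add_filterlim_at_infinity[OF lim filterlim_ident] by simp
 have q: "(%w. c / ze w) -oo-> 0" for c using tendsto_divide_0[OF tendsto_const inf] .
 have "(%w. (ze w - w) + t / ze w + m) -oo-> - m + 0 + m" using lim q by (intro tendsto_intros)
 thus "hydro T" unfolding hydro_def T_def by (simp add: algebra_simps)
 have evU: "\<forall>\<^sub>F w in at_infinity. w : U" unfolding eventually_at_infinity using U by (intro exI[of _ "R + 1"]) auto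
 have "(%w. 1 - (ze w - w) / ze w) -oo-> 1 - 0" by (intro tendsto_diff tendsto_const tendsto_divide_0[OF lim inf])
 hence "(%w. (t - k) * (1 - (ze w - w) / ze w)) -oo-> (t - k) * (1 - 0)" by (intro tendsto_mult tendsto_const)
 hence "(%w. (t - k) * (1 - (ze w - w) / ze w)) -oo-> t - k" by simp
 thus "(%w. w * (T w - w)) -oo-> t - k"
 proof (rule Lim_transform_eventually)
  show "\<forall>\<^sub>F w in at_infinity. (t - k) * (1 - (ze w - w) / ze w) = w * (T w - w)" using evU
  proof eventually_elim
   case (elim w)
   have e: "w - m = ze w + k / ze w" using eq[OF elim] by simp
   have w: "w = ze w + k / ze w + m" using e by (simp add: algebra_simps)
   have "T w - w = T w - (ze w + k / ze w + m)" using arg_cong[OF w, of "%x. T w - x"] .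
   hence "T w - w = (t - k) / ze w" by (simp add: T_def diff_divide_distrib)
   moreover have "1 - (ze w - w) / ze w = w / ze w" using nz[OF elim] by (simp add: field_simps)
   ultimately show ?case by simp
  qed
 qed
qed

section \<open>Horizontal slit domains\<close>

lemma sum_inverse_less_imp:
 fixes x r :: real
 assumes "x > 0" "0 < r" "r < 1" "x + 1 / x <= r + 1 / r" shows "r <= x"
proof (rule ccontr)
 assume "~ r <= x"
 hence xr: "x < r" by simp
 have "(r - x) * (1 - x * r) > 0"
 proof (rule mult_pos_pos)
  have "x * r < 1 * 1" using xr assms by (intro mult_strict_mono) auto
  thus "0 < 1 - x * r" by simp
 qed (use xr in simp)
 moreover have "(x + 1 / x - (r + 1 / r)) * (x * r) = (r - x) * (1 - x * r)" using assms by (simp add: field_simps)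
 moreover have "x * r > 0" using assms by simp
 ultimately have "x + 1 / x - (r + 1 / r) > 0" by (metis zero_less_mult_pos2)
 thus False using assms by simp
qed

lemma cmod_add_squares_identity:
 "cmod (v - 1)^2 + cmod (v + 1)^2 = 2 * (cmod v)^2 + 2" unfolding cmod_power2 by (simp add: power2_eq_square algebra_simps)

text \<open>Circles around 0 are mapped to confocal ellipses: with \<open>v = z / d\<close>, the two
  focal distances are \<open>cmod d / cmod v\<close> times the squares of
  \<open>cmod (v + 1)\<close> and \<open>cmod (v - 1)\<close>, and the parallelogram law adds these
  squares.\<close>

lemma joukowski_focal:
 fixes z k w m d :: complex
 assumes "z ~= 0" "d ~= 0" "z + d^2 / z = w - m"
 shows "(cmod (w - (m - 2 * d)) + cmod (w - (m + 2 * d))) / (2 * cmod d) = cmod z / cmod d + 1 / (cmod z / cmod d)"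
proof -
 define v where "v = z / d"
 have v: "v ~= 0" "z = v * d" using assms by (auto simp: v_def)
 have w: "w = m + d * (v + 1 / v)" using v assms by (simp add: field_simps power2_eq_square)
 have 1: "w - (m - 2 * d) = d * ((v + 1)^2 / v)" using v(1) unfolding w by (simp add: field_simps power2_eq_square)
 have 2: "w - (m + 2 * d) = d * ((v - 1)^2 / v)" using v(1) unfolding w by (simp add: field_simps power2_eq_square)
 have "cmod (w - (m - 2 * d)) + cmod (w - (m + 2 * d)) = cmod d * ((cmod (v - 1)^2 + cmod (v + 1)^2) / cmod v)"
  unfolding 1 2 by (simp add: norm_mult norm_divide norm_power add_divide_distrib algebra_simps)
 also have "... = cmod d * ((2 * (cmod v)^2 + 2) / cmod v)" unfolding cmod_add_squares_identity ..
 also have "... = 2 * cmod d * (cmod v + 1 / cmod v)" using v(1) by (simp add: field_simps power2_eq_square)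
 finally have "(cmod (w - (m - 2 * d)) + cmod (w - (m + 2 * d))) / (2 * cmod d) = cmod v + 1 / cmod v" using assms(2) by simp
 moreover have "cmod v = cmod z / cmod d" by (simp add: v_def norm_divide)
 ultimately show ?thesis by simp
qed

lemma ellipse_complement_connected:
 fixes a b :: complex
 shows "connected (- {w. cmod (w - a) + cmod (w - b) <= c})"
proof (rule connected_complement_bounded_convex)
 show "bounded {w. cmod (w - a) + cmod (w - b) <= c}"
 proof (rule bounded_subset[OF bounded_cball[of a c]])
  show "{w. cmod (w - a) + cmod (w - b) <= c} <= cball a c"
  proof
   fix w assume "w : {w. cmod (w - a) + cmod (w - b) <= c}"
   hence "cmod (w - a) <= c" using norm_ge_zero[of "w - b"] by (simp del: norm_ge_zero)
   thus "w : cball a c" by (simp add: dist_norm norm_minus_commute)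
  qed
 qed
 show "convex {w. cmod (w - a) + cmod (w - b) <= c}"
 proof (rule convexI)
  fix x y u v assume x: "x : {w. cmod (w - a) + cmod (w - b) <= c}" and y: "y : {w. cmod (w - a) + cmod (w - b) <= c}"
   and uv: "0 <= u" "0 <= v" "u + v = (1::real)"
  have e: "cmod (u *\<^sub>R x + v *\<^sub>R y - p) <= u * cmod (x - p) + v * cmod (y - p)" for p
  proof -
   have "p = u *\<^sub>R p + v *\<^sub>R p" using uv(3) by (metis scaleR_add_left scaleR_one)
   hence "u *\<^sub>R x + v *\<^sub>R y - p = u *\<^sub>R (x - p) + v *\<^sub>R (y - p)" by (metis add_diff_add scaleR_diff_right)
   thus ?thesis using norm_triangle_ineq[of "u *\<^sub>R (x - p)" "v *\<^sub>R (y - p)"] uv by simp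
  qed
  have "cmod (u *\<^sub>R x + v *\<^sub>R y - a) + cmod (u *\<^sub>R x + v *\<^sub>R y - b)
   <= u * (cmod (x - a) + cmod (x - b)) + v * (cmod (y - a) + cmod (y - b))" using e[of a] e[of b] by (simp add: algebra_simps)
  also have "... <= u * c + v * c" using x y uv by (intro add_mono mult_left_mono) auto
  also have "... = c" using uv(3) by (metis distrib_right mult_1)
  finally show "u *\<^sub>R x + v *\<^sub>R y : {w. cmod (w - a) + cmod (w - b) <= c}" by simp
 qed
qed simp

text \<open>For \<open>x = cmod (ze w) / cmod d\<close>, the ellipse condition reads
  \<open>x + 1 / x <= r + 1 / r\<close>. Outside the ellipse \<open>x + 1 / x > 2\<close>, so
  \<open>x\<close> is never 1; it exceeds 1 near infinity and hence on the whole connected outside.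
  Inside, the inequality itself gives \<open>r <= x\<close>.\<close>

lemma joukowski_lower_bound:
 fixes L :: "complex set"
 assumes L: "compact L" and c: "ze hol (-L)" "!!w. w ~: L ==> ze w ~= 0"
  "!!w. w ~: L ==> ze w + ((b - a) / 4)^2 / ze w = w - (a + b) / 2"
  "(%w. ze w - w) -oo-> - (a + b) / 2" and ab: "a ~= b"
  and r: "0 < r" "r < 1"
  and thin: "!!w. w : L ==> cmod (w - a) + cmod (w - b) <= (r + 1 / r) / 2 * cmod (b - a)"
  and w: "w ~: L"
 shows "r * (cmod (b - a) / 4) <= cmod (ze w)"
proof -
 define d where "d = (b - a) / 4"
 define m where "m = (a + b) / 2"
 have d0: "d ~= 0" using ab by (simp add: d_def)
 have am: "m - 2 * d = a" "m + 2 * d = b" by (auto simp: m_def d_def field_simps)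
 have cd: "cmod (b - a) = 4 * cmod d" by (simp add: d_def)
 define x where "x w = cmod (ze w) / cmod d" for w
 have x0: "x w > 0" if "w ~: L" for w using c(2)[OF that] d0 by (simp add: x_def)
 have foc: "(cmod (w - a) + cmod (w - b)) / (2 * cmod d) = x w + 1 / x w" if "w ~: L" for w
  using joukowski_focal[OF c(2)[OF that] d0, of w m] c(3)[OF that] unfolding am by (simp add: d_def m_def x_def)
 define N where "N = {w. cmod (w - a) + cmod (w - b) <= (r + 1 / r) / 2 * cmod (b - a)}"
 have rc: "(r + 1 / r) / 2 * (4 * cmod d) = (r + 1 / r) * (2 * cmod d)" by simp
 have LN: "L <= N" using thin by (auto simp: N_def)
 have rr: "r + 1 / r > 2"
 proof -
  have "(1 - r)^2 > 0" using r by simp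
  hence "1 + r^2 > 2 * r" by (simp add: power2_diff)
  thus ?thesis using r by (simp add: field_simps power2_eq_square)
 qed
 have out: "x w + 1 / x w > r + 1 / r" if "w ~: N" for w
 proof -
  have "w ~: L" using that LN by auto
  have "cmod (w - a) + cmod (w - b) > (r + 1 / r) * (2 * cmod d)" using that unfolding N_def cd mem_Collect_eq rc not_le .
  hence "(cmod (w - a) + cmod (w - b)) / (2 * cmod d) > r + 1 / r" using d0 by (simp add: pos_less_divide_eq)
  thus ?thesis using foc[OF `w ~: L`] by simp
 qed
 have big: "x w > 1" if w: "w ~: N" for w
 proof (rule ccontr)
  assume "~ x w > 1"
  have ne1: "x u ~= 1" if "u : -N" for u using out[of u] that rr by auto
  have cont: "continuous_on (-N) x"
   unfolding x_def using LN d0 by (intro continuous_intros continuous_on_subset[OF holomorphic_on_imp_continuous_on[OF c(1)]]) auto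
  have con: "connected (x ` (-N))" using connected_continuous_image[OF cont] ellipse_complement_connected unfolding N_def by blast
  have "filterlim ze at_infinity at_infinity" using tendsto_add_filterlim_at_infinity[OF c(4) filterlim_ident] by simp
  hence "\<forall>\<^sub>F u in at_infinity. cmod (ze u) > cmod d" by (rule eventually_norm_gt_at_infinity)
  then obtain B where B: "!!u. cmod u >= B ==> cmod (ze u) > cmod d" by (auto simp: eventually_at_infinity)
  have "bounded N"
  proof (rule bounded_subset[OF bounded_cball])
   show "N <= cball a ((r + 1 / r) / 2 * cmod (b - a))"
   proof
    fix w assume "w : N"
    hence "cmod (w - a) <= (r + 1 / r) / 2 * cmod (b - a)"
     using norm_ge_zero[of "w - b"] unfolding N_def mem_Collect_eq by linarith
    thus "w : cball a ((r + 1 / r) / 2 * cmod (b - a))" by (simp add: dist_norm norm_minus_commute)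
   qed
  qed
  then obtain B' where B': "N <= cball 0 B'" using bounded_subset_cball by auto
  define u where "u = complex_of_real (max \<bar>B\<bar> (abs(B') + 1))"
  have u1: "cmod u >= B" "cmod u > B'" unfolding u_def by auto
  have u2: "u ~: N" using u1(2) B' by auto
  have u3: "x u > 1" using B[OF u1(1)] d0 by (simp add: x_def)
  have "1 : x ` (-N)" using connectedD_interval[OF con, of "x w" "x u" 1] `~ x w > 1` u3 u2 w by auto
  thus False using ne1 by auto
 qed
 have "r <= x w"
 proof (cases "w : N")
  case True
  hence "(cmod (w - a) + cmod (w - b)) / (2 * cmod d) <= r + 1 / r"
   unfolding N_def cd rc using d0 pos_divide_le_eq[of "2 * cmod d"] by simp
  thus ?thesis using sum_inverse_less_imp[OF x0[OF w] r] foc[OF w] by simp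
 next
  case False
  thus ?thesis using big[of w] r by simp
 qed
 thus ?thesis using d0 by (simp add: x_def cd pos_le_divide_eq)
qed

text \<open>All chords have slope at most \<open>s\<close>, so lengths are at most
  \<open>sqrt (1 + s^2)\<close> times horizontal extents, and these add up along \<open>a\<close>,
  \<open>w\<close>, \<open>b\<close>. If the chord from \<open>a\<close> to \<open>b\<close>, of
  slope \<open>y\<close>, is nearly as steep, its own length is nearly as large; \<open>q\<close>
  measures the loss.\<close>

lemma slope_bound:
 fixes L :: "complex set"
 assumes le: "!!x y. x : L ==> y : L ==> abs(Im (y - x)) <= s * abs(Re (y - x))" and s: "s >= 0"
  and abw: "a : L" "b : L" "w : L" "Re a <= Re w" "Re w <= Re b"
  and y: "abs(Im (b - a)) = y * Re (b - a)" "y >= 0" and q: "q >= 0" "1 + s^2 <= q^2 * (1 + y^2)"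
 shows "cmod (w - a) + cmod (w - b) <= q * cmod (b - a)"
proof -
 have n: "cmod (u - v) <= sqrt (1 + s^2) * abs(Re (u - v))" if "u : L" "v : L" for u v
 proof -
  have "(Im (u - v))^2 <= (s * abs(Re (u - v)))^2" using le[OF that(2,1)] abs_le_square_iff[of "Im (u - v)" "s * abs(Re (u - v))"] s by simp
  hence "(cmod (u - v))^2 <= (1 + s^2) * (Re (u - v))^2" unfolding cmod_power2 by (simp add: algebra_simps)
  hence "sqrt ((cmod (u - v))^2) <= sqrt ((1 + s^2) * (Re (u - v))^2)" by (rule real_sqrt_le_mono)
  thus ?thesis by (simp add: real_sqrt_mult)
 qed
 have X: "Re (b - a) >= 0" using abw by simp
 have "cmod (w - a) + cmod (w - b) <= sqrt (1 + s^2) * abs(Re (w - a)) + sqrt (1 + s^2) * abs(Re (w - b))"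
  by (rule add_mono[OF n[OF abw(3,1)] n[OF abw(3,2)]])
 also have "... = sqrt (1 + s^2) * Re (b - a)" using abw by (simp add: algebra_simps)
 also have "... <= (q * sqrt (1 + y^2)) * Re (b - a)"
 proof (rule mult_right_mono[OF _ X])
  have "sqrt (1 + s^2) <= sqrt (q^2 * (1 + y^2))" using q(2) by simp
  also have "... = q * sqrt (1 + y^2)" using q(1) by (simp add: real_sqrt_mult)
  finally show "sqrt (1 + s^2) <= q * sqrt (1 + y^2)" .
 qed
 also have "... = q * cmod (b - a)"
 proof -
  have "(cmod (b - a))^2 = (1 + y^2) * (Re (b - a))^2"
  proof -
   have "(Im (b - a))^2 = (y * Re (b - a))^2" using y(1) by (metis power2_abs)
   thus ?thesis unfolding cmod_power2 power_mult_distrib by (simp add: distrib_right del: minus_complex.sel)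
  qed
  hence "sqrt ((cmod (b - a))^2) = sqrt ((1 + y^2) * (Re (b - a))^2)" by simp
  hence "cmod (b - a) = sqrt (1 + y^2) * Re (b - a)" using X by (simp add: real_sqrt_mult)
  thus ?thesis by simp
 qed
 finally show ?thesis .
qed

text \<open>With foci \<open>a\<close> and \<open>b\<close> in \<open>L\<close>, the choice
  \<open>t = 0\<close> gives the coefficient \<open>- ((b - a) / 4)^2\<close>, whose real part is
  positive when the chord is steeper than 45 degrees. If no chord is, \<open>L\<close> is a
  Lipschitz graph over the real axis. An arc of it between the ends of a chord of nearly maximal
  slope lies in a thin ellipse, so that the values of \<open>ze\<close> off the arc are bounded
  below, and a positive real \<open>t\<close> just below the square of that bound is allowed; it is
  large enough to make \<open>t - k\<close> positive in real part.\<close>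

lemma horizontal_improvement:
 fixes L :: "complex set"
 assumes L: "compact L" "connected L" "connected (-L)" and nh: "EX a:L. EX b:L. Im a ~= Im b"
 obtains T c where "T hol (-L)" "inj_on T (-L)" "hydro T" "(%w. w * (T w - w)) -oo-> c" "Re c > 0"
proof (cases "ALL a:L. ALL b:L. abs(Im (b - a)) <= abs(Re (b - a))")
 case False
 then obtain a b where ab: "a : L" "b : L" "abs(Im (b - a)) > abs(Re (b - a))" by auto
 hence "a ~= b" by auto
 obtain ze where z: "ze hol (-L)" "!!w. w ~: L ==> ze w ~= 0"
  "!!w. w ~: L ==> ze w + ((b - a) / 4)^2 / ze w = w - (a + b) / 2"
  "(%w. ze w - w) -oo-> - (a + b) / 2" using joukowski_inverse[OF L ab(1,2) `a ~= b`] by blast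
 obtain R where "L <= ball 0 R" using L(1) compact_imp_bounded bounded_subset_ballD by metis
 hence R: "far R <= -L" by auto
 have lim': "(%w. ze w - w) -oo-> - ((a + b) / 2)" using z(4) by (simp add: minus_divide_left)
 have t0: "ALL w:-L. ALL w':-L. ze w * ze w' ~= 0" using z(2) by simp
 have zz: "ALL w:-L. ze w ~= 0" "ALL w:-L. ze w + ((b - a) / 4)^2 / ze w = w - (a + b) / 2" using z(2,3) by auto
 note J = joukowski_combination[OF z(1) zz lim' t0 R]
 have "Re (0 - ((b - a) / 4)^2) > 0"
 proof -
  have "(Re (b - a))^2 < (Im (b - a))^2" using power2_strict_mono[of "Re (b - a)" "Im (b - a)"] ab(3) by simp
  moreover have "Re (0 - ((b - a) / 4)^2) = ((Im (b - a))^2 - (Re (b - a))^2) / 16" by (simp add: power2_eq_square field_simps)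
  ultimately show ?thesis by simp
 qed
 thus ?thesis by (rule that[OF J])
next
 case True
 define S where "S = {abs(Im (b - a)) / abs(Re (b - a)) |a b. a : L & b : L & a ~= b}"
 have Re0: "Re (b - a) ~= 0" if "a : L" "b : L" "a ~= b" for a b
 proof
  assume "Re (b - a) = 0"
  moreover hence "Im (b - a) = 0" using True that by force
  ultimately show False using that(3) by (simp add: complex_eq_iff)
 qed
 have S1: "bdd_above S" unfolding S_def
 proof (rule bdd_aboveI[of _ 1], clarsimp)
  fix a b assume "a : L" "b : L" "a ~= b"
  thus "abs(Im b - Im a) / abs(Re b - Re a) <= 1" using True by (simp add: divide_le_eq)
 qed
 define s where "s = Sup S"
 have le: "abs(Im (y - x)) <= s * abs(Re (y - x))" if "x : L" "y : L" for x y
 proof (cases "x = y")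
  case False
  hence "abs(Im (y - x)) / abs(Re (y - x)) <= s" unfolding s_def using that S1 by (intro cSup_upper) (auto simp: S_def)
  thus ?thesis using Re0[OF that False] by (simp add: pos_divide_le_eq)
 qed simp
 obtain a0 b0 where ab0: "a0 : L" "b0 : L" "Im a0 ~= Im b0" using nh by blast
 have "0 < abs(Im (b0 - a0)) / abs(Re (b0 - a0))" using Re0[of a0 b0] ab0 by force
 also have "... <= s" unfolding s_def using ab0 S1 by (intro cSup_upper) (auto simp: S_def)
 finally have s: "s > 0" .
 have s1: "s <= 1" unfolding s_def
 proof (rule cSup_least)
  show "S ~= {}" using ab0 by (auto simp: S_def)
  show "x <= 1" if "x : S" for x using that True by (auto simp: S_def divide_le_eq)
 qed
 \<comment> \<open>The value \<open>1 - s^2 / 8\<close> is chosen against the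
   \<open>1 - s^2 / 6\<close> in \<open>t\<close> below: \<open>cmod t\<close> must stay under
   \<open>r^2 * mu^2\<close>, while the gain from a slope of at least \<open>3/4 * s\<close> must
   outweigh the loss caused by \<open>s^2 / 6\<close>.\<close>
 define r where "r = sqrt (1 - s^2 / 8)"
 have s2: "0 < s^2" "s^2 <= 1" using s s1 by (auto simp: power_le_one)
 have rsq: "r^2 = 1 - s^2 / 8" unfolding r_def using s2 by simp
 have r: "0 < r" "r < 1" unfolding r_def using s2 by auto
 define q where "q = (r + 1 / r) / 2"
 have q1: "q > 1"
 proof -
  have "(1 - r)^2 > 0" using r by simp
  hence "1 + r^2 > 2 * r" by (simp add: power2_diff)
  thus ?thesis using r by (simp add: q_def field_simps power2_eq_square)
 qed
 have "s / q < Sup S" using s q1 by (simp add: s_def[symmetric] divide_less_eq)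
 then obtain a b where ab: "a : L" "b : L" "a ~= b" "s / q < abs(Im (b - a)) / abs(Re (b - a))"
  using less_cSup_iff[of S "s / q"] S1 ab0 unfolding S_def by blast
 have "EX a b. a : L & b : L & Re a < Re b & s / q < abs(Im (b - a)) / abs(Re (b - a))"
 proof (cases "Re a < Re b")
  case False
  hence "Re b < Re a" using Re0[OF ab(1-3)] by simp
  moreover have "s / q < abs(Im (a - b)) / abs(Re (a - b))" using ab(4) by (simp add: abs_minus_commute)
  ultimately show ?thesis using ab by blast
 qed (use ab in blast)
 then obtain a b where ab: "a : L" "b : L" "Re a < Re b" "s / q < abs(Im (b - a)) / abs(Re (b - a))" by auto
 have "a ~= b" using ab by auto
 define y where "y = abs(Im (b - a)) / Re (b - a)"
 have y: "abs(Im (b - a)) = y * Re (b - a)" "y >= 0" "y > s / q" using ab by (auto simp: y_def)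
 have qy: "1 + s^2 <= q^2 * (1 + y^2)"
 proof -
  have "(s / q)^2 <= y^2" using y(3) s q1 by (intro power_mono) auto
  hence "s^2 <= q^2 * y^2" using q1 by (simp add: power_divide pos_divide_le_eq mult.commute)
  moreover have "1 <= q^2" using q1 by simp
  ultimately show ?thesis by (simp add: algebra_simps)
 qed
 \<comment> \<open>Only the arc of \<open>L\<close> between \<open>a\<close> and \<open>b\<close> is
   known to lie in the ellipse; the map for the complement of this arc is then restricted to
   \<open>-L\<close>.\<close>
 define si where "si = {w : L. Re w : {Re a..Re b}}"
 have inj: "inj_on Re L" using Re0 by (auto simp: inj_on_def)
 have "compact si"
 proof -
  have "si = L Int Re -` {Re a..Re b}" by (auto simp: si_def)
  moreover have "closed (Re -` {Re a..Re b})" by (auto intro!: closed_vimage continuous_intros)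
  ultimately show ?thesis using L(1) by auto
 qed
 have "connected (Re ` L)" using L(2) by (intro connected_continuous_image continuous_intros)
 hence "Re ` si = {Re a..Re b}" using connectedD_interval[of "Re ` L" "Re a" "Re b"] ab by (auto simp: si_def image_iff) blast
 hence homeo: "si homeomorphic {Re a..Re b}"
  using inj by (intro homeomorphic_compact[OF `compact si`, of Re]) (auto intro!: continuous_intros simp: si_def inj_on_def)
 have cc: "connected (- si)" by (rule connected_complement_homeomorphic_convex_compact[OF homeo]) auto
 have csi: "connected si" using homeomorphic_connectedness[OF homeo] by simp
 have absi: "a : si" "b : si" using ab by (auto simp: si_def)
 have siL: "-L <= -si" by (auto simp: si_def)
 obtain ze where z: "ze hol (-si)" "!!w. w ~: si ==> ze w ~= 0"
  "!!w. w ~: si ==> ze w + ((b - a) / 4)^2 / ze w = w - (a + b) / 2"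
  "(%w. ze w - w) -oo-> - (a + b) / 2" using joukowski_inverse[OF `compact si` csi cc absi `a ~= b`] by blast
 have thin: "cmod (w - a) + cmod (w - b) <= (r + 1 / r) / 2 * cmod (b - a)" if "w : si" for w
  using slope_bound[OF le _ ab(1,2) _ _ _ y(1,2) _ qy] that s q1 unfolding q_def si_def by auto
 have low: "r * (cmod (b - a) / 4) <= cmod (ze w)" if "w ~: si" for w
  by (rule joukowski_lower_bound[OF `compact si` z `a ~= b` r thin that])
 define mu where "mu = cmod (b - a) / 4"
 have mu: "mu > 0" using `a ~= b` by (simp add: mu_def)
 define t where "t = complex_of_real ((1 - s^2 / 6) * mu^2)"
 have tn: "cmod t < r^2 * mu^2"
 proof -
  have "cmod t = (1 - s^2 / 6) * mu^2" unfolding t_def norm_of_real using s2 by simp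
  also have "... < r^2 * mu^2" unfolding rsq using s2 mu by simp
  finally show ?thesis .
 qed
 have tt: "ALL w:-L. ALL w':-L. ze w * ze w' ~= t"
 proof (intro ballI notI)
  fix w w' assume that: "w : -L" "w' : -L" and e: "ze w * ze w' = t"
  have "(r * mu) * (r * mu) <= cmod (ze w) * cmod (ze w')"
   using low[of w] low[of w'] that siL r unfolding mu_def by (intro mult_mono) auto
  also have "... = cmod t" unfolding e[symmetric] by (simp add: norm_mult)
  finally show False using tn by (simp add: power2_eq_square mult_ac)
 qed
 obtain R where "L <= ball 0 R" using L(1) compact_imp_bounded bounded_subset_ballD by metis
 hence R: "far R <= -L" by auto
 have lim': "(%w. ze w - w) -oo-> - ((a + b) / 2)" using z(4) by (simp add: minus_divide_left)
 have z': "ze hol (-L)" using z(1) siL by auto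
 have zz: "ALL w:-L. ze w ~= 0" "ALL w:-L. ze w + ((b - a) / 4)^2 / ze w = w - (a + b) / 2" using z(2,3) siL by auto
 note J = joukowski_combination[OF z' zz lim' tt R]
 have "Re (t - ((b - a) / 4)^2) > 0"
 proof -
  define X where "X = Re (b - a)"
  have X: "X > 0" using ab by (simp add: X_def)
  have im2: "(Im (b - a))^2 = y^2 * X^2" using y(1) unfolding X_def by (metis power2_abs power_mult_distrib)
  have m2: "mu^2 = (1 + y^2) * X^2 / 16"
   unfolding mu_def power_divide cmod_power2 im2 X_def[symmetric] by (simp add: algebra_simps)
  have rk: "Re (((b - a) / 4)^2) = (1 - y^2) * X^2 / 16"
  proof -
   have "Re (((b - a) / 4)^2) = (X^2 - (Im (b - a))^2) / 16" by (simp add: X_def power2_eq_square)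
   thus ?thesis unfolding im2 by (simp add: algebra_simps)
  qed
  have "y >= 3/4 * s"
  proof -
   have "q <= 4/3"
   proof -
    have r8: "r >= 3/4"
    proof (rule power2_le_imp_le)
     show "(3/4)^2 <= r^2" unfolding rsq using s2 by (simp add: power2_eq_square)
    qed (use r in simp)
    have "1 / r <= 4/3" using r8 by (simp add: field_simps)
    thus ?thesis using r unfolding q_def by simp
   qed
   hence "s * (3/4) <= s / q" using s q1 by (simp add: field_simps)
   thus ?thesis using y(3) by linarith
  qed
  hence "(3/4 * s)^2 <= y^2" using s by simp
  hence ys: "y^2 >= 9/16 * s^2" by (simp add: power2_eq_square)
  have "(1 - s^2/6) * (1 + y^2) - (1 - y^2) = 2 * y^2 - s^2 / 6 * (1 + y^2)" by (simp add: algebra_simps)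
  also have "... > 0"
  proof -
   have "s^2 / 6 * (1 + y^2) = s^2 / 6 + s^2 * y^2 / 6" by (simp add: algebra_simps)
   also have "s^2 * y^2 / 6 <= y^2 / 6" using s2 mult_right_mono[of "s^2" 1 "y^2"] by simp
   finally have "s^2 / 6 * (1 + y^2) <= s^2 / 6 + y^2 / 6" by simp
   thus ?thesis using ys s2 by linarith
  qed
  finally have "((1 - s^2/6) * (1 + y^2) - (1 - y^2)) * X^2 / 16 > 0" using X by simp
  also have "((1 - s^2/6) * (1 + y^2) - (1 - y^2)) * X^2 / 16 = (1 - s\<^sup>2 / 6) * ((1 + y\<^sup>2) * X\<^sup>2 / 16) - (1 - y\<^sup>2) * X\<^sup>2 / 16"
   by (simp only: left_diff_distrib diff_divide_distrib)
  finally show ?thesis unfolding minus_complex.sel rk t_def Re_complex_of_real m2 .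
 qed
 thus ?thesis by (rule that[OF J])
qed

definition horizontal :: "complex set => bool" where
 "horizontal L <-> (ALL a:L. ALL b:L. Im a = Im b)"

text \<open>The expression \<open>z * (T (f z) - z)\<close> splits into
  \<open>z * (T (f z) - f z)\<close> and \<open>z * (f z - z)\<close>, and \<open>z / f z\<close>
  tends to 1.\<close>

lemma hydro_compose:
 assumes f: "hydro f" "(%z. z * (f z - z)) -oo-> a"
  and T: "hydro T" "(%w. w * (T w - w)) -oo-> c"
 shows "hydro (%z. T (f z))" "(%z. z * (T (f z) - z)) -oo-> c + a"
proof -
 have inf: "filterlim f at_infinity at_infinity" using hydro_at_infinity[OF f(1)] .
 have "(%z. T (f z) - f z) -oo-> 0" using T(1) inf unfolding hydro_def by (rule filterlim_compose)
 hence "(%z. (T (f z) - f z) + (f z - z)) -oo-> 0 + 0" using f(1) unfolding hydro_def by (intro tendsto_add)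
 thus "hydro (%z. T (f z))" by (simp add: hydro_def)
 have "(%z. f z * (T (f z) - f z)) -oo-> c" using T(2) inf by (rule filterlim_compose)
 moreover have "(%z. 1 - (f z - z) / f z) -oo-> 1 - 0"
  using f(1) inf unfolding hydro_def by (intro tendsto_diff tendsto_const tendsto_divide_0)
 ultimately have "(%z. (1 - (f z - z) / f z) * (f z * (T (f z) - f z)) + z * (f z - z)) -oo-> (1 - 0) * c + a"
  using f(2) by (intro tendsto_add tendsto_mult)
 hence lim: "(%z. (1 - (f z - z) / f z) * (f z * (T (f z) - f z)) + z * (f z - z)) -oo-> c + a" by simp
 show "(%z. z * (T (f z) - z)) -oo-> c + a"
 proof (rule Lim_transform_eventually[OF lim])
  have "\<forall>\<^sub>F z in at_infinity. cmod (f z) > 0" using eventually_norm_gt_at_infinity[OF inf] .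
  thus "\<forall>\<^sub>F z in at_infinity. (1 - (f z - z) / f z) * (f z * (T (f z) - f z)) + z * (f z - z) = z * (T (f z) - z)"
  proof eventually_elim
   case (elim z)
   hence "(1 - (f z - z) / f z) * f z = z" by (simp add: diff_divide_distrib)
   hence "(1 - (f z - z) / f z) * (f z * (T (f z) - f z)) = z * (T (f z) - f z)" by simp
   thus ?case by (simp add: algebra_simps)
  qed
 qed
qed

text \<open>Were an image hole of the maximiser not horizontal, composing with the improving map for
  the complement of that hole would raise the real part of the coefficient by \<open>Re c\<close>.
  The supremum is finite and attained by the uniform bounds near infinity.\<close>

theorem slit_map_exists:
 assumes E: "holes I E"
 obtains L f where "hole_map I E L f" "hydro f" "!!i. i : I ==> horizontal (L i)"
proof -
 let ?D = "hdom I E"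
 obtain R where R: "R > 0" "(UN i:I. E i) <= ball 0 R" using hdom_outside_ball[OF E] .
 have ext: "far R <= ?D" using exterior_in_hdom[OF R(2)] .
 define Cl where "Cl = {(f, a). f hol ?D & inj_on f ?D & hydro f & ((%z. z * (f z - z)) -oo-> a)}"
 define S where "S = (%(f, a). Re a) ` Cl"
 have fext: "f hol far R" "inj_on f (far R)" if "(f, a) : Cl" for f a using that ext inj_on_subset[of f ?D] by (auto simp: Cl_def)
 obtain C where C: "C > 0" "!!f z. f hol far R ==> inj_on f (far R) ==> hydro f ==> 2 * R <= cmod z ==> cmod (f z - z) <= C * R"
  using exterior_bound R(1) by auto
 have bdd: "bdd_above S"
 proof (rule bdd_aboveI)
  fix x assume "x : S"
  then obtain f a where fa: "(f, a) : Cl" "x = Re a" by (auto simp: S_def)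
  hence f: "hydro f" "(%z. z * (f z - z)) -oo-> a" by (auto simp: Cl_def)
  have "cmod (a - 0) <= 2 * R * (C * R)"
  proof (rule max_modulus_infinity(1)[OF _ f(2) R(1), of "2 * R"])
   show "(%z. z * (f z - z)) hol {z. R < cmod z}" using fext[OF fa(1)] by (intro holomorphic_intros)
   show "cmod (z * (f z - z) - 0) <= 2 * R * (C * R)" if "cmod z = 2 * R" for z
    using C(2)[OF fext[OF fa(1)] f(1), of z] that R(1) by (simp add: norm_mult)
  qed (use R in auto)
  thus "x <= 2 * R * (C * R)" using fa(2) complex_Re_le_cmod[of a] by simp
 qed
 have "(%z. z, 0) : Cl" by (simp add: Cl_def hydro_def)
 hence "S ~= {}" by (auto simp: S_def)
 have "EX fa. fa : Cl & Re (snd fa) > Sup S - 1 / real (Suc k)" for k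
 proof -
  have "Sup S - 1 / real (Suc k) < Sup S" by simp
  then obtain x where "x : S" "Sup S - 1 / real (Suc k) < x" using less_cSup_iff[OF `S ~= {}` bdd] by blast
  thus ?thesis by (auto simp: S_def)
 qed
 then obtain F where F: "!!k. F k : Cl" "!!k. Re (snd (F k)) > Sup S - 1 / real (Suc k)" by metis
 define f where "f k = fst (F k)" for k
 define a where "a k = snd (F k)" for k
 have fCl: "(f k, a k) : Cl" for k using F(1)[of k] by (simp add: f_def a_def)
 have f: "f k hol ?D" "inj_on (f k) ?D" "hydro (f k)" "(%z. z * (f k z - z)) -oo-> a k" for k
  using fCl[of k] by (auto simp: Cl_def)
 have lima: "(%k. Re (a k)) ----> Sup S"
 proof (rule tendsto_sandwich[of "%k. Sup S - 1 / real (Suc k)" _ _ "%k. Sup S"])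
  show "EV k. Sup S - 1 / real (Suc k) <= Re (a k)" using F(2) by (auto simp: a_def intro!: always_eventually less_imp_le)
  show "EV k. Re (a k) <= Sup S" using fCl bdd by (intro always_eventually allI cSup_upper) (force simp: S_def)+
  have "(%k. Sup S - 1 / real (Suc k)) ----> Sup S - 0" by (intro tendsto_diff tendsto_const lim_1_over_n[THEN LIMSEQ_Suc])
  thus "(%k. Sup S - 1 / real (Suc k)) ----> Sup S" by simp
 qed simp
 obtain r g where r: "strict_mono r" "kconv ?D (%k. ?D) (%k. f (r k)) g"
 proof (rule kconv_exists[of ?D "%_. ?D" f])
  fix Q :: "complex set" assume Q: "compact Q" "Q <= ?D"
  obtain rh where rh: "Q <= cball 0 rh" using compact_imp_bounded[OF Q(1)] bounded_subset_cball by auto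
  obtain M where M: "!!(I::'a set) E f z. holes I E ==> (UN i:I. E i) <= ball 0 R ==> f hol hdom I E ==> inj_on f (hdom I E) ==> hydro f ==> z : hdom I E ==> cmod z <= rh ==> cmod (f z) <= M"
   using hydro_bounds[OF R(1), of rh] by metis
  show "EX M. ALL k. ALL z:Q. z : ?D --> cmod (f k z) <= M" using M[OF E R(2) f(1-3)] rh by (auto simp: subset_iff)
 qed (use open_hdom[OF E] f in auto)
 have fe: "f (r k) hol far R" "inj_on (f (r k)) (far R)" for k using fext[OF fCl] by auto
 note HL = hydro_limit[OF R(1) fe f(3) kconv_mono[OF r(2) open_exterior ext] f(4)]
 have hg: "hydro g" using HL(1) .
 obtain b where b: "(%z. z * (g z - z)) -oo-> b" "(%k. a (r k)) ----> b" using HL(2) by blast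
 have Reb: "Re b = Sup S"
 proof -
  have "(%k. Re (a (r k))) ----> Re b" using b(2) by (rule tendsto_Re)
  moreover have "(%k. Re (a (r k))) ----> Sup S" using tendsto_subseq[OF lima r(1)] by simp
  ultimately show ?thesis using LIMSEQ_unique by blast
 qed
 have gh: "g hol ?D" using kconv_holomorphic[OF r(2)] .
 have ginj: "inj_on g ?D" by (rule kconv_inj[OF r(2) connected_hdom[OF E] hydro_not_constant[OF hg ext] f(2)])
 obtain L where L: "hole_map I E L g" using hole_map_exists[OF E gh ginj hydro_at_infinity[OF hg]] by blast
 have "horizontal (L i)" if i: "i : I" for i
 proof (rule ccontr)
  assume "~ horizontal (L i)"
  hence nh: "EX a:L i. EX b:L i. Im a ~= Im b" by (auto simp: horizontal_def)
  have Li: "compact (L i)" "connected (L i)" "connected (- L i)"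
   using hole_mapD(2)[OF L] i holes_connected_compl[OF hole_mapD(2)[OF L] i] by (auto simp: holes_def)
  obtain T c where T: "T hol (- L i)" "inj_on T (- L i)" "hydro T" "(%w. w * (T w - w)) -oo-> c" "Re c > 0"
   using horizontal_improvement[OF Li nh] by blast
  have gim: "g ` ?D <= - L i" using hole_mapD(6)[OF L] i by (auto simp: hdom_def)
  have "(%z. T (g z)) hol ?D" using holomorphic_on_compose_gen[OF gh T(1) gim] by (simp add: o_def)
  moreover have "inj_on (%z. T (g z)) ?D" using comp_inj_on[OF ginj inj_on_subset[OF T(2) gim]] by (simp add: o_def)
  ultimately have "((%z. T (g z)), c + b) : Cl" using hydro_compose[OF hg b(1) T(3,4)] by (simp add: Cl_def)
  hence "Re (c + b) <= Sup S" using bdd by (intro cSup_upper) (force simp: S_def)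
  thus False using Reb T(5) by simp
 qed
 thus ?thesis using that[OF L hg] by blast
qed

text \<open>The difference of two slit maps is bounded, and its boundary values lie on finitely many horizontal
 lines. A nonempty bounded open set cannot have its frontier in finitely many horizontal lines.\<close>

theorem slit_map_unique:
 assumes f: "hole_map I E L f" "hydro f" "!!i. i : I ==> horizontal (L i)"
  and g: "hole_map I E K g" "hydro g" "!!i. i : I ==> horizontal (K i)"
  and z: "z : hdom I E"
 shows "f z = g z"
proof -
 let ?D = "hdom I E"
 note F = hole_mapD[OF f(1)] and G = hole_mapD[OF g(1)]
 define d where "d z = f z - g z" for z
 have dh: "d hol ?D" unfolding d_def using F(3) G(3) by (intro holomorphic_intros)
 have d0: "d -oo-> 0"
 proof -
  have "(%z. (f z - z) - (g z - z)) -oo-> 0 - 0" using f(2) g(2) unfolding hydro_def by (intro tendsto_diff)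
  thus ?thesis by (simp add: d_def[abs_def])
 qed
 obtain R where R: "R > 0" "(UN i:I. E i) <= ball 0 R" using hdom_outside_ball[OF F(1)] .
 have ext: "far R <= ?D" using exterior_in_hdom[OF R(2)] .
 have seq0: "w = 0" if "filterlim x at_infinity sequentially" "(%k. d (x k)) ----> w" for x w
  using filterlim_compose[OF d0 that(1)] that(2) LIMSEQ_unique by blast
 have "d constant_on ?D"
 proof (rule ccontr)
  assume nc: "~ d constant_on ?D"
  define V where "V = d ` ?D"
  have oD: "open ?D" "connected ?D" using open_hdom[OF F(1)] connected_hdom[OF F(1)] by auto
  have oV: "open V" unfolding V_def using open_mapping_thm[OF dh oD oD(1) order_refl nc] .
  have bV: "bounded V"
  proof -
   have "\<forall>\<^sub>F z in at_infinity. dist (d z) 0 < 1" using d0 unfolding tendsto_iff by simp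
   then obtain B where B: "!!z. cmod z >= B ==> cmod (d z) < 1" by (auto simp: eventually_at_infinity)
   obtain M1 where M1: "f ` (?D Int cball 0 B) <= cball 0 M1" using F(7) bounded_subset_cball by auto
   obtain M2 where M2: "g ` (?D Int cball 0 B) <= cball 0 M2" using G(7) bounded_subset_cball by auto
   have "cmod (d z) <= max 1 (M1 + M2)" if "z : ?D" for z
   proof (cases "cmod z >= B")
    case True
    thus ?thesis using B[of z] by simp
   next
    case False
    hence "cmod (f z) <= M1" "cmod (g z) <= M2" using M1 M2 that by (auto simp: image_subset_iff)
    thus ?thesis unfolding d_def using norm_triangle_ineq4[of "f z" "g z"] by simp
   qed
   thus ?thesis unfolding V_def by (auto simp: bounded_iff)
  qed
  define h where "h i = Im (SOME w. w : L i) - Im (SOME w. w : K i)" for i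
  have hor: "Im w - Im v = h i" if "w : L i" "v : K i" "i : I" for w v i
  proof -
   have "Im w = Im (SOME w. w : L i)" using f(3)[OF that(3)] that(1) someI[of "%w. w : L i" w] unfolding horizontal_def by blast
   moreover have "Im v = Im (SOME w. w : K i)" using g(3)[OF that(3)] that(2) someI[of "%w. w : K i" v] unfolding horizontal_def by blast
   ultimately show ?thesis by (simp add: h_def)
  qed
  have front: "Im w : insert 0 (h ` I)" if w: "w : frontier V" for w
  proof -
   have "w : closure V" "w ~: V" using w oV by (auto simp: frontier_def interior_open)
   then obtain y where y: "!!k. y k : V" "y ----> w" unfolding closure_sequential by blast
   then obtain x where x: "!!k. x k : ?D" "!!k. y k = d (x k)" unfolding V_def image_iff by metis
   show ?thesis
   proof (cases "bounded (range x)")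
    case False
    have "EX q :: nat => nat. strict_mono q & filterlim (%k. x (q k)) at_infinity sequentially"
    proof -
     have ub: "EX n>N. cmod (x n) > B" for N and B
     proof (rule ccontr)
      assume "~ ?thesis"
      hence "cmod (x n) <= B" if "n > N" for n using that by auto
      moreover have "bounded (x ` {..N})" by auto
      then obtain B2 where "!!n. n <= N ==> cmod (x n) <= B2" by (auto simp: bounded_iff)
      ultimately have "cmod (x n) <= max B B2" for n by (metis le_max_iff_disj not_le)
      thus False using False by (auto simp: bounded_iff)
     qed
     define q where "q = rec_nat (SOME n. cmod (x n) > 0) (%k m. SOME n. n > m & cmod (x n) > real (Suc k))"
     have qS: "q (Suc k) > q k & cmod (x (q (Suc k))) > real (Suc k)" for k
      unfolding q_def using someI_ex[OF ub[of "rec_nat (SOME n. cmod (x n) > 0) (%k m. SOME n. n > m & cmod (x n) > real (Suc k)) k" "real (Suc k)"]] by simp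
     have "strict_mono q" using qS by (simp add: strict_mono_Suc_iff)
     moreover have "filterlim (%k. x (q k)) at_infinity sequentially"
     proof (rule filterlim_norm_at_top_imp_at_infinity)
      have "filterlim (%k. cmod (x (q (Suc k)))) at_top sequentially"
      proof (rule filterlim_at_top_mono)
       show "filterlim (%k. real (Suc k)) at_top sequentially"
        using filterlim_real_sequentially filterlim_sequentially_Suc by blast
       show "EV k. real (Suc k) <= cmod (x (q (Suc k)))" using qS by (auto intro!: always_eventually less_imp_le)
      qed
      thus "filterlim (%k. cmod (x (q k))) at_top sequentially" using filterlim_sequentially_Suc[of "%k. cmod (x (q k))"] by blast
     qed
     ultimately show ?thesis by auto
    qed
    then obtain q :: "nat => nat" where q: "strict_mono q" "filterlim (%k. x (q k)) at_infinity sequentially" by auto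
    have "(%k. d (x (q k))) ----> w" using tendsto_subseq[OF y(2) q(1)] x(2) by simp
    hence "w = 0" using seq0[OF q(2)] by blast
    thus ?thesis by simp
   next
    case True
    have bf: "bounded (range (%k. f (x k)))" using hole_map_bounded_iff[OF f(1), of x] True x(1) by blast
    obtain q1 l where q1: "strict_mono q1" "(%k. x (q1 k)) ----> l" using True by (rule bounded_seq_subseq)
    have "bounded (range (%k. f (x (q1 k))))" using bf by (rule bounded_subset) auto
    then obtain q2 u where q2: "strict_mono q2" "(%k. f (x (q1 (q2 k)))) ----> u" by (rule bounded_seq_subseq)
    define q where "q k = q1 (q2 k)" for k
    have q: "strict_mono q" using strict_mono_o[OF q1(1) q2(1)] by (simp add: q_def[abs_def] o_def)
    have xl: "(%k. x (q k)) ----> l" using tendsto_subseq[OF q1(2) q2(1)] by (simp add: q_def)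
    have fu: "(%k. f (x (q k))) ----> u" using q2(2) by (simp add: q_def)
    have dw: "(%k. d (x (q k))) ----> w" using tendsto_subseq[OF y(2) q] x(2) by simp
    have gv: "(%k. g (x (q k))) ----> u - w" using tendsto_diff[OF fu dw] by (simp add: d_def)
    have rx: "range (%k. x (q k)) <= ?D" using x(1) by auto
    show ?thesis
    proof (cases "l : ?D")
     case True
     have "isCont d l" using dh oD(1) True holomorphic_on_imp_continuous_on continuous_on_eq_continuous_at by blast
     hence "(%k. d (x (q k))) ----> d l" using xl isCont_tendsto_compose by blast
     hence "w = d l" using dw LIMSEQ_unique by blast
     thus ?thesis using `w ~: V` True by (auto simp: V_def)
    next
     case False
     then obtain i where i: "i : I" "l : E i" by (auto simp: hdom_def)
     have "u : L i" "u - w : K i" using F(9)[OF rx xl fu i(1)] G(9)[OF rx xl gv i(1)] i(2) by auto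
     hence "Im w = h i" using hor[of u i "u - w"] i(1) by simp
     thus ?thesis using i(1) by auto
    qed
   qed
  qed
  have fin: "finite (insert 0 (h ` I))" using F(1) by (auto simp: holes_def)
  obtain z0 where "z0 : V" unfolding V_def by (metis ex_in_conv image_is_empty nc constant_on_def)
  then obtain e where e: "e > 0" "ball z0 e <= V" using oV open_contains_ball by blast
  \<comment> \<open>A horizontal line through a point of \<open>V\<close> at a height outside the
    finite set: it leaves the bounded set \<open>V\<close> and so meets the frontier at a forbidden
    height.\<close>
  have "infinite {Im z0..<Im z0 + e}" using e(1) by simp
  then obtain t where t: "t : {Im z0..<Im z0 + e}" "t ~: insert 0 (h ` I)" using fin by (meson finite_subset subsetI)
  define p where "p = Complex (Re z0) t"
  have "z0 - p = Complex 0 (Im z0 - t)" by (simp add: p_def complex_eq_iff)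
  hence "cmod (z0 - p) = abs(Im z0 - t)" by (simp add: cmod_def)
  hence pV: "p : V" using e(2) t(1) by (auto simp: dist_norm)
  define A where "A = (%s. p + of_real s) ` (UNIV :: real set)"
  have "connected A" unfolding A_def by (intro connected_continuous_image continuous_intros) auto
  moreover have "A Int V ~= {}" using pV unfolding A_def by (auto intro!: exI[of _ p] image_eqI[of _ _ 0])
  moreover have "A - V ~= {}"
  proof -
   obtain M where M: "V <= cball 0 M" using bV bounded_subset_cball by auto
   have "cmod (complex_of_real (abs(M) + cmod p + 1)) = abs(M) + cmod p + 1" by (subst norm_of_real) simp
   hence "cmod (p + of_real (abs(M) + cmod p + 1)) > M"
    using norm_diff_ineq[of "of_real (abs(M) + cmod p + 1)" p] by (simp only: add.commute[of p])
   hence "p + of_real (abs(M) + cmod p + 1) ~: V" using M by auto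
   thus ?thesis unfolding A_def by blast
  qed
  ultimately obtain v where "v : A" "v : frontier V" using connected_Int_frontier by blast
  thus False using front[of v] t(2) by (auto simp: A_def p_def)
 qed
 then obtain c where c: "!!z. z : ?D ==> d z = c" by (auto simp: constant_on_def)
 have "\<forall>\<^sub>F z in at_infinity. d z = c" unfolding eventually_at_infinity using subsetD[OF ext] c by (intro exI[of _ "R + 1"]) simp
 hence "d -oo-> c" by (rule tendsto_eventually)
 hence "c = 0" using d0 tendsto_unique trivial_limit_at_infinity by blast
 thus ?thesis using c[OF z] by (simp add: d_def)
qed

section \<open>Domains symmetric in the real axis\<close>

lemma holes_frontier_approach:
 assumes E: "holes I E" and i: "i : I" and z: "z : frontier (E i)"
 obtains x where "range x <= hdom I E" "x ----> z"
proof -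
 define Q where "Q = (UN j:I-{i}. E j)"
 have cl: "closed (E i)" "closed Q" using E i unfolding Q_def by (auto simp: holes_def compact_imp_closed intro!: closed_UN)
 have "z : E i" using z cl(1) by (meson frontier_subset_closed subsetD)
 hence "z : - Q" using E i by (auto simp: Q_def holes_def disjoint_family_on_def)
 have "z : closure (- E i)" using z by (simp add: frontier_def closure_complement)
 then obtain y where y: "!!k. y k : - E i" "y ----> z" unfolding closure_sequential by blast
 have "EV k. y k : - Q" using y(2) `z : - Q` cl(2) by (intro topological_tendstoD) auto
 then obtain N where N: "!!k. k >= N ==> y k : - Q" unfolding eventually_sequentially by blast
 show ?thesis
 proof (rule that[of "%k. y (k + N)"])
  have "(UN j:I. E j) = E i Un Q" using i by (auto simp: Q_def)
  hence "y (k + N) : hdom I E" for k using N[of "k + N"] y(1)[of "k + N"] by (simp add: hdom_def)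
  thus "range (%k. y (k + N)) <= hdom I E" by auto
  show "(%k. y (k + N)) ----> z" using y(2) by (rule LIMSEQ_ignore_initial_segment)
 qed
qed

lemma compact_frontier_nonempty:
 fixes K :: "complex set" assumes "compact K" "K ~= {}" shows "frontier K ~= {}"
 using assms by (metis compact_imp_bounded frontier_eq_empty not_bounded_UNIV)

lemma hole_map_cluster:
 assumes f: "hole_map I E L f" and i: "i : I" and z: "z : frontier (E i)"
 obtains x w where "range x <= hdom I E" "x ----> z" "(%k. f (x k)) ----> w" "w : L i"
proof -
 obtain x where x: "range x <= hdom I E" "x ----> z" using holes_frontier_approach[OF hole_mapD(1)[OF f] i z] .
 have zE: "z : E i" using z hole_mapD(1)[OF f] i by (auto simp: holes_def compact_imp_closed intro: subsetD[OF frontier_subset_closed])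
 have "bounded (range (%k. f (x k)))" using hole_map_bounded_iff[OF f x(1)] x(2) convergent_imp_bounded by blast
 then obtain r w where r: "strict_mono r" "(%k. f (x (r k))) ----> w" by (rule bounded_seq_subseq)
 have xr: "(%k. x (r k)) ----> z" using tendsto_subseq[OF x(2) r(1)] by simp
 have rx: "range (%k. x (r k)) <= hdom I E" using x(1) by auto
 show ?thesis using that[OF rx xr r(2)] hole_mapD(9)[OF f rx xr r(2) i] zE by blast
qed

lemma connected_subset_hole:
 assumes L: "holes I L" and A: "connected A" "A <= (UN j:I. L j)" "A Int L i ~= {}" "i : I"
 shows "A <= L i"
proof -
 let ?R = "UN j:I-{i}. L j"
 have "closed (L i)" "closed ?R" using L A(4) by (auto simp: holes_def compact_imp_closed intro!: closed_UN)
 moreover have "L i Int ?R Int A = {}" using L A(4) by (auto simp: holes_def disjoint_family_on_def)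
 moreover have "A <= L i Un ?R" using A by auto
 ultimately have "L i Int A = {} | ?R Int A = {}" using A(1) unfolding connected_closed by simp
 hence "?R Int A = {}" using A(3) by blast
 thus ?thesis using `A <= L i Un ?R` by blast
qed

text \<open>The holes are the components of the complement of the image; which component has index
  \<open>i\<close> can be read off from one cluster value at a frontier point of
  \<open>E i\<close>.\<close>

lemma hole_map_image_unique:
 assumes f: "hole_map I E L f" "hole_map I E K f" and i: "i : I"
 shows "L i = K i"
proof -
 have *: "L i <= K i" if f: "hole_map I E L f" "hole_map I E K f" for L K
 proof -
  have "compact (E i)" "E i ~= {}" using hole_mapD(1)[OF f(1)] i by (auto simp: holes_def)
  then obtain z where z: "z : frontier (E i)" using compact_frontier_nonempty by blast
  obtain x w where x: "range x <= hdom I E" "x ----> z" "(%k. f (x k)) ----> w" "w : L i" using hole_map_cluster[OF f(1) i z] .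
  have "w : K i" using hole_mapD(9)[OF f(2) x(1-3) i] hole_mapD(9)[OF f(1) x(1-3) i] x(4) by blast
  have "hdom I L = hdom I K" using hole_mapD(6)[OF f(1)] hole_mapD(6)[OF f(2)] by simp
  hence "L i <= (UN j:I. K j)" using i by (auto simp: hdom_def)
  thus ?thesis using connected_subset_hole[OF hole_mapD(2)[OF f(2)]] hole_mapD(2)[OF f(1)] i x(4) `w : K i` by (auto simp: holes_def)
 qed
 show ?thesis using *[OF f(1,2)] *[OF f(2,1)] by auto
qed

lemma holes_cong: "(!!i. i : I ==> E i = E' i) ==> holes I E <-> holes I E'"
 unfolding holes_def disjoint_family_on_def by simp

lemma hdom_cong: "(!!i. i : I ==> E i = E' i) ==> hdom I E = hdom I E'"
 unfolding hdom_def by simp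

lemma hole_map_cong:
 assumes "!!i. i : I ==> E i = E' i" "!!i. i : I ==> L i = L' i" "!!z. z : hdom I E ==> f z = g z" "hole_map I E L f"
 shows "hole_map I E' L' g"
proof -
 have hd: "hdom I E' = hdom I E" "hdom I L' = hdom I L" using assms(1,2) by (simp_all add: hdom_def)
 have hE: "holes I E'" "holes I L'" using holes_cong[of I E E'] holes_cong[of I L L'] assms hole_mapD(1,2)[OF assms(4)] by auto
 show ?thesis unfolding hole_map_def hd
 proof (intro conjI allI impI)
  show "g hol hdom I E" using hole_mapD(3)[OF assms(4)] assms(3) by (rule holomorphic_transform)
  show "bij_betw g (hdom I E) (hdom I L)" using hole_mapD(4)[OF assms(4)] assms(3) by (metis bij_betw_cong)
  have "g ` (hdom I E Int cball 0 R) = f ` (hdom I E Int cball 0 R)" for R using assms(3) by simp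
  thus "bounded (g ` (hdom I E Int cball 0 R))" for R using hole_mapD(7)[OF assms(4)] by simp
  have "{z : hdom I E. g z : cball 0 R} = {z : hdom I E. f z : cball 0 R}" for R using assms(3) by auto
  thus "bounded {z : hdom I E. g z : cball 0 R}" for R using hole_mapD(8)[OF assms(4)] by simp
  fix x z w i assume x: "range x <= hdom I E" "x ----> z" "(%k. g (x k)) ----> w" "i : I"
  have "g (x k) = f (x k)" for k using assms(3)[of "x k"] x(1) by force
  hence "(%k. f (x k)) ----> w" using x(3) by simp
  thus "(z : E' i) = (w : L' i)" using hole_mapD(9)[OF assms(4) x(1,2) _ x(4)] assms(1,2) x(4) by blast
 qed (use hE in auto)
qed

lemma hole_map_affine:
 assumes f: "hole_map I E L f" and a: "au ~= 0"
 shows "hole_map I E (%i. (%w. au * w + be) ` L i) (%z. au * f z + be)"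
proof -
 let ?A = "%w::complex. au * w + be"
 have inj: "inj ?A" using a by (auto simp: inj_on_def)
 have surj: "surj ?A" using a by (intro surjI[of ?A "%w. (w - be) / au"]) simp
 have bij: "bij ?A" using inj surj by (simp add: bij_def)
 have cont: "continuous_on S ?A" for S by (intro continuous_intros)
 have L: "holes I L" using hole_mapD[OF f] by auto
 have comp: "- (?A ` S) = ?A ` (- S)" for S using bij by (simp add: bij_image_Compl_eq)
 have hd: "hdom I (%i. ?A ` L i) = ?A ` hdom I L" unfolding hdom_def comp[symmetric] by auto
 have hA: "holes I (%i. ?A ` L i)" unfolding holes_def
 proof (intro conjI ballI)
  show "disjoint_family_on (%i. ?A ` L i) I" using L inj unfolding holes_def disjoint_family_on_def by (metis image_Int image_empty)
  show "connected (- (UN i:I. ?A ` L i))"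
   using connected_continuous_image[OF cont connected_hdom[OF L]] hd by (simp add: hdom_def)
 qed (use L in "auto simp: holes_def intro!: compact_continuous_image connected_continuous_image cont")
 show ?thesis unfolding hole_map_def hd
 proof (intro conjI allI impI)
  show "(%z. ?A (f z)) hol hdom I E" using hole_mapD(3)[OF f] by (intro holomorphic_intros)
  show "bij_betw (%z. ?A (f z)) (hdom I E) (?A ` hdom I L)"
  proof -
   have "bij_betw ?A (hdom I L) (?A ` hdom I L)" using inj_on_subset[OF inj subset_UNIV] by (simp add: bij_betw_def)
   from bij_betw_trans[OF hole_mapD(4)[OF f] this] show ?thesis by (simp only: o_def)
  qed
  show "bounded ((%z. ?A (f z)) ` (hdom I E Int cball 0 R))" for R
  proof -
   obtain M where M: "!!z. z : hdom I E Int cball 0 R ==> cmod (f z) <= M" using hole_mapD(7)[OF f, of R] unfolding bounded_iff by blast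
   have "cmod (?A (f z)) <= cmod au * M + cmod be" if "z : hdom I E Int cball 0 R" for z
   proof -
    have "cmod (?A (f z)) <= cmod au * cmod (f z) + cmod be" using norm_triangle_ineq[of "au * f z" be] by (simp add: norm_mult)
    also have "... <= cmod au * M + cmod be" using M[OF that] by (intro add_mono mult_left_mono) auto
    finally show ?thesis .
   qed
   thus ?thesis unfolding bounded_iff by blast
  qed
  show "bounded {z : hdom I E. ?A (f z) : cball 0 R}" for R
  proof (rule bounded_subset[OF hole_mapD(8)[OF f, of "(R + cmod be) / cmod au"]], clarsimp)
   fix z assume "cmod (?A (f z)) <= R"
   moreover have "cmod (au * f z) <= cmod (?A (f z)) + cmod be" using norm_triangle_ineq4[of "?A (f z)" be] by simp
   ultimately have "cmod au * cmod (f z) <= R + cmod be" by (simp add: norm_mult)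
   thus "cmod (f z) <= (R + cmod be) / cmod au" using a by (simp add: pos_le_divide_eq mult.commute)
  qed
  fix x z w i assume x: "range x <= hdom I E" "x ----> z" "(%k. ?A (f (x k))) ----> w" "i : I"
  have "(%k. (?A (f (x k)) - be) / au) ----> (w - be) / au" using x(3) a by (intro tendsto_intros)
  hence "(%k. f (x k)) ----> (w - be) / au" using a by simp
  from hole_mapD(9)[OF f x(1,2) this x(4)] have "z : E i <-> (w - be) / au : L i" .
  also have "... <-> w : ?A ` L i"
  proof
   assume "(w - be) / au : L i"
   hence "?A ((w - be) / au) : ?A ` L i" by (rule imageI)
   thus "w : ?A ` L i" using a by simp
  next
   assume "w : ?A ` L i"
   thus "(w - be) / au : L i" using a by auto
  qed
  finally show "(z : E i) = (w : ?A ` L i)" .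
 qed (use hole_mapD(1)[OF f] hA in auto)
qed

section \<open>Doubling across the real axis\<close>

definition dbl :: "('i => complex set) => 'i \<times> bool => complex set" where
 "dbl E = (%(j, b). if b then E j else cnj ` E j)"

text \<open>Here each hole separately has connected complement; disjointness and Janiszewski's
  theorem give the same for the union, also after doubling.\<close>

definition uholes :: "'i set => ('i => complex set) => bool" where
 "uholes J E <-> finite J & disjoint_family_on E J &
  (ALL j:J. compact (E j) & connected (E j) & E j ~= {} & connected (- E j) & (ALL z:E j. Im z > 0))"

abbreviation ddom :: "'i set => ('i => complex set) => complex set" where
 "ddom J E \<equiv> hdom (J \<times> (UNIV :: bool set)) (dbl E)"

lemma dbl_simps[simp]: "dbl E (j, True) = E j" "dbl E (j, False) = cnj ` E j"
 by (auto simp: dbl_def)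

lemma cnj_image_compl: "- (cnj ` S) = cnj ` (- S)"
 by (intro set_eqI) (metis ComplD ComplI complex_cnj_cnj image_iff)

lemma in_cnj_image[simp]: "z : cnj ` S <-> cnj z : S"
 by (metis complex_cnj_cnj image_iff)

lemma dbl_cnj: "cnj z : dbl E (j, b) <-> z : dbl E (j, ~ b)"
 by (cases b) auto

lemma holes_dbl:
 assumes "uholes J E" shows "holes (J \<times> UNIV) (dbl E)"
proof (rule holesI)
 show "finite (J \<times> (UNIV :: bool set))" using assms by (auto simp: uholes_def)
 have *: "compact (E j)" "connected (E j)" "E j ~= {}" "connected (- E j)" "!!z. z : E j ==> Im z > 0" if "j : J" for j
  using assms that by (auto simp: uholes_def)
 fix i :: "'a \<times> bool" assume i: "i : J \<times> UNIV"
 obtain j b where jb: "i = (j, b)" "j : J" using i by auto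
 show "compact (dbl E i)" "connected (dbl E i)" "dbl E i ~= {}" "connected (- dbl E i)"
  using *[OF jb(2)] unfolding jb(1) by (cases b; auto simp: cnj_image_compl intro!: compact_continuous_image connected_continuous_image continuous_intros)+
next
 show "disjoint_family_on (dbl E) (J \<times> UNIV)" unfolding disjoint_family_on_def
 proof (intro ballI impI)
  fix p q :: "'a \<times> bool" assume pq: "p : J \<times> UNIV" "q : J \<times> UNIV" "p ~= q"
  obtain j b k c where jk: "p = (j, b)" "q = (k, c)" "j : J" "k : J" using pq by auto
  have im: "Im z > 0" if "z : E j" "j : J" for z j using assms that by (auto simp: uholes_def)
  have dj: "j ~= k ==> E j Int E k = {}" using assms jk by (auto simp: uholes_def disjoint_family_on_def)
  show "dbl E p Int dbl E q = {}"
  proof (cases "b = c")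
   case True
   hence "j ~= k" using pq(3) jk by auto
   thus ?thesis using dj True unfolding jk by (cases b) auto
  next
   case False
   have "False" if "z : E j'" "cnj z : E k'" "j' : J" "k' : J" for z j' k' using im[OF that(1,3)] im[OF that(2,4)] by simp
   thus ?thesis using False jk(3,4) unfolding jk by (cases b; cases c) auto
  qed
 qed
qed

lemma cnj_ddom: "z : ddom J E ==> cnj z : ddom J E"
 unfolding hdom_def by (auto simp: dbl_cnj)

lemma real_ddom: "uholes J E ==> Im z = 0 ==> z : ddom J E"
 unfolding hdom_def uholes_def by (auto simp: dbl_def split: if_splits) (metis complex_cnj_complex_of_real less_irrefl complex_is_Real_iff complex_cnj cnj.simps(2) minus_zero)+

lemma ddom_upper: "uholes J E ==> Im z > 0 ==> z : ddom J E <-> (ALL j:J. z ~: E j)"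
 unfolding hdom_def uholes_def dbl_def by (auto split: if_splits) force

lemma hole_map_cnj:
 assumes f: "hole_map (J \<times> UNIV) (dbl E) L f"
 shows "hole_map (J \<times> UNIV) (dbl E) (%(j, b). cnj ` L (j, ~ b)) (%z. cnj (f (cnj z)))"
proof -
 let ?D = "ddom J E" and ?L = "%(j, b). cnj ` L (j, ~ b)" and ?I = "J \<times> (UNIV :: bool set)"
 note F = hole_mapD[OF f]
 have cD: "cnj ` ?D = ?D" using cnj_ddom[of _ J E] cnj_ddom[of "cnj _" J E] by (intro set_eqI) auto
 have un: "(UN i:?I. ?L i) = cnj ` (UN i:?I. L i)"
 proof (intro set_eqI iffI)
  fix z assume "z : (UN i:?I. ?L i)"
  then obtain j b where "j : J" "cnj z : L (j, ~ b)" by auto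
  thus "z : cnj ` (UN i:?I. L i)" by auto
 next
  fix z assume "z : cnj ` (UN i:?I. L i)"
  then obtain j b where "j : J" "cnj z : L (j, b)" by auto
  thus "z : (UN i:?I. ?L i)" by (intro UN_I[of "(j, ~ b)"]) auto
 qed
 have hL: "hdom ?I ?L = cnj ` hdom ?I L" unfolding hdom_def un cnj_image_compl ..
 have L: "holes ?I ?L" unfolding holes_def
 proof (intro conjI)
  show "finite ?I" using F(1) by (auto simp: holes_def)
  show "ALL i:?I. compact (?L i) & connected (?L i) & ?L i ~= {}"
   using F(2) unfolding holes_def by (auto intro!: compact_continuous_image connected_continuous_image continuous_intros)
  have dj0: "disjoint_family_on L ?I" using F(2) by (simp add: holes_def)
  have dj: "L p Int L q = {}" if "p : ?I" "q : ?I" "p ~= q" for p q using disjoint_family_onD[OF dj0 that] .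
  show "disjoint_family_on ?L ?I" unfolding disjoint_family_on_def
  proof (intro ballI impI)
   fix p q assume "p : ?I" "q : ?I" "p ~= q"
   thus "?L p Int ?L q = {}" using dj[of "(fst p, ~ snd p)" "(fst q, ~ snd q)"] by (auto simp: prod_eq_iff split: prod.splits)
  qed
  show "connected (- (UN i:?I. ?L i))" unfolding un cnj_image_compl using connected_hdom[OF F(2)] unfolding hdom_def
   by (intro connected_continuous_image continuous_intros)
 qed
 show ?thesis unfolding hole_map_def
 proof (intro conjI allI impI)
  have "(cnj o f o cnj) hol ?D" using holomorphic_on_compose_cnj_cnj[of f ?D] F(3) cD open_hdom[OF F(1)] by simp
  thus "(%z. cnj (f (cnj z))) hol ?D" by (simp add: o_def)
  have b1: "bij_betw cnj ?D ?D" using cD by (simp add: bij_betw_def inj_on_def)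
  have b2: "bij_betw cnj (hdom ?I L) (hdom ?I ?L)" unfolding hL by (simp add: bij_betw_def inj_on_def)
  show "bij_betw (%z. cnj (f (cnj z))) ?D (hdom ?I ?L)"
   using bij_betw_trans[OF bij_betw_trans[OF b1 F(4)] b2] by (simp add: o_def)
  show "bounded ((%z. cnj (f (cnj z))) ` (?D Int cball 0 R))" for R
  proof -
   obtain M where M: "!!z. z : ?D Int cball 0 R ==> cmod (f z) <= M" using F(7)[of R] unfolding bounded_iff by blast
   have "cmod (cnj (f (cnj z))) <= M" if "z : ?D Int cball 0 R" for z using that M[of "cnj z"] cnj_ddom[of z J E] by simp
   thus ?thesis unfolding bounded_iff by blast
  qed
  show "bounded {z : ?D. cnj (f (cnj z)) : cball 0 R}" for R
  proof -
   obtain M where M: "!!z. z : {z : ?D. f z : cball 0 R} ==> cmod z <= M" using F(8)[of R] unfolding bounded_iff by blast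
   have "cmod z <= M" if "z : {z : ?D. cnj (f (cnj z)) : cball 0 R}" for z using that M[of "cnj z"] cnj_ddom[of z J E] by simp
   thus ?thesis unfolding bounded_iff by blast
  qed
  fix x z w i assume x: "range x <= ?D" "x ----> z" "(%k. cnj (f (cnj (x k)))) ----> w" "i : ?I"
  obtain j b where jb: "i = (j, b)" "j : J" using x(4) by auto
  have "range (%k. cnj (x k)) <= ?D" using x(1) cnj_ddom by (auto simp: image_subset_iff)
  moreover have "(%k. cnj (x k)) ----> cnj z" using x(2) by (rule tendsto_cnj)
  moreover have "(%k. f (cnj (x k))) ----> cnj w" using tendsto_cnj[OF x(3)] by simp
  ultimately have "cnj z : dbl E (j, ~ b) <-> cnj w : L (j, ~ b)" using F(9)[of "%k. cnj (x k)" "cnj z" "cnj w" "(j, ~ b)"] jb by auto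
  thus "(z : dbl E i) = (w : ?L i)" using dbl_cnj[of z E j "~ b"] unfolding jb(1) by simp
 qed (use F(1) L in auto)
qed

text \<open>Conformal maps between half-plane domains with holes, normalised at 0, 1 and infinity,
  in the form of their reflections: symmetry makes the real axis invariant, and the last clause
  states that the half-planes are not exchanged.\<close>

definition sym_map :: "'i set => ('i => complex set) => ('i => complex set) => (complex => complex) => bool" where
 "sym_map J E L f <-> uholes J E & uholes J L & hole_map (J \<times> UNIV) (dbl E) (dbl L) f & f 0 = 0 & f 1 = 1 &
   (ALL z:ddom J E. f (cnj z) = cnj (f z)) & (ALL z:ddom J E. 0 < Im z <-> 0 < Im (f z))"

lemma sym_mapD:
 assumes "sym_map J E L f"
 shows "uholes J E" "uholes J L" "hole_map (J \<times> UNIV) (dbl E) (dbl L) f" "f 0 = 0" "f 1 = 1"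
  "z : ddom J E ==> f (cnj z) = cnj (f z)" "z : ddom J E ==> 0 < Im (f z) <-> 0 < Im z" using assms unfolding sym_map_def by auto

lemma upper_ddom_connected:
 assumes "uholes J E"
 shows "connected (uhp - (UN j:J. E j))"
proof (rule connected_open_diff_closed)
 show "open uhp" by (intro open_Collect_less continuous_intros)
 show "connected uhp" by auto
 show "compact (UN j:J. E j)" using assms by (auto simp: uholes_def)
 show "(UN j:J. E j) <= uhp" using assms by (auto simp: uholes_def)
 show "connected (- (UN j:J. E j))" using assms by (intro connected_compl_UN) (auto simp: uholes_def)
qed

lemma upper_ddom: "uholes J E ==> uhp - (UN j:J. E j) = {z : ddom J E. Im z > 0}"
 using ddom_upper[of J E] by auto

text \<open>On the real axis \<open>f\<close> is real, and it is positive between 0 and 1, so the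
  derivative at 0 is positive and some point above 0 is mapped above the axis. Nonreal points have
  nonreal values, by injectivity and symmetry, and the upper part of the domain is
  connected.\<close>

lemma symmetric_map_upper:
 assumes E: "uholes J E" and f: "f hol ddom J E" "inj_on f (ddom J E)" "f 0 = 0" "f 1 = 1"
  and sym: "!!z. z : ddom J E ==> f (cnj z) = cnj (f z)" and z: "z : ddom J E"
 shows "0 < Im (f z) <-> 0 < Im z"
proof -
 let ?D = "ddom J E"
 have oD: "open ?D" using open_hdom[OF holes_dbl[OF E]] .
 have rD: "of_real x : ?D" for x using real_ddom[OF E, of "of_real x"] by simp
 have rr: "Im (f (of_real x)) = 0" for x
  using sym[OF rD[of x]] by (metis complex_cnj_complex_of_real complex_is_Real_iff Reals_cnj_iff)
 define u where "u x = Re (f (of_real x))" for x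
 have fu: "f (of_real x) = of_real (u x)" for x using rr[of x] by (simp add: u_def complex_eq_iff)
 have contf: "continuous_on ?D f" using f(1) by (rule holomorphic_on_imp_continuous_on)
 have contu: "continuous_on {0..1} u" unfolding u_def using rD by (intro continuous_intros continuous_on_compose2[OF contf]) auto
 have inju: "inj_on u {0..1}"
 proof (rule inj_onI)
  fix x y assume "u x = u y"
  hence "f (of_real x) = f (of_real y)" by (simp add: fu)
  thus "x = y" using inj_onD[OF f(2) _ rD rD] by auto
 qed
 have u01: "u 0 = 0" "u 1 = 1" using f(3,4) by (simp_all add: u_def)
 have pos: "u x > 0" if "0 < x" "x < 1" for x using continuous_inj_imp_mono[OF that contu inju] u01 by auto
 have z0: "0 : ?D" using rD[of 0] by simp
 define c where "c = deriv f 0"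
 have dc: "(f has_field_derivative c) (at 0)" unfolding c_def by (rule holomorphic_derivI[OF f(1) oD z0])
 have c0: "c ~= 0" unfolding c_def using holomorphic_injective_imp_regular[OF f(1) oD f(2) z0] .
 have lim: "((%h. f h / h) ---> c) (at 0)" using dc f(3) by (simp add: DERIV_def)
 have cpos: "Im c = 0" "Re c > 0"
 proof -
  \<comment> \<open>The shift by 2 keeps the points strictly between 0 and 1, where \<open>u\<close>
    is positive.\<close>
  define h where "h k = complex_of_real (1 / real (k + 2))" for k
  have "filterlim h (at 0) sequentially"
  proof (rule filterlim_atI)
   have "(%k. 1 / real (k + 2)) ----> 0" using LIMSEQ_ignore_initial_segment[OF lim_1_over_n, of 2] by simp
   hence "(%k. complex_of_real (1 / real (k + 2))) ----> of_real 0" by (rule tendsto_of_real)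
   thus "h ----> 0" by (simp only: h_def[abs_def] of_real_0)
   show "EV k. h k ~= 0" by (simp add: h_def del: of_real_divide)
  qed
  hence l: "(%k. f (h k) / h k) ----> c" using lim by (rule filterlim_compose[rotated])
  have e: "f (h k) / h k = of_real (u (1 / real (k + 2)) / (1 / real (k + 2)))" for k unfolding h_def fu by simp
  have "(%k. Im (f (h k) / h k)) ----> Im c" "(%k. Re (f (h k) / h k)) ----> Re c" using l by (auto intro: tendsto_intros)
  hence l2: "(%k. 0) ----> Im c" "(%k. u (1 / real (k + 2)) / (1 / real (k + 2))) ----> Re c" unfolding e by auto
  show "Im c = 0" using LIMSEQ_unique[OF l2(1) tendsto_const] by simp
  have "Re c >= 0"
  proof (rule LIMSEQ_le_const[OF l2(2)], intro exI[of _ 0] allI impI)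
   fix n :: nat
   have "u (1 / real (n + 2)) > 0" by (intro pos) auto
   thus "0 <= u (1 / real (n + 2)) / (1 / real (n + 2))" by simp
  qed
  thus "Re c > 0" using c0 `Im c = 0` by (metis complex_eq_iff less_eq_real_def zero_complex.sel)
 qed
 have nz: "Im (f w) ~= 0" if "w : ?D" "Im w ~= 0" for w
 proof
  assume "Im (f w) = 0"
  hence "cnj (f w) = f w" by (simp add: complex_eq_iff)
  hence "f (cnj w) = f w" using sym[OF that(1)] by simp
  hence "cnj w = w" using inj_onD[OF f(2) _ cnj_ddom[OF that(1)] that(1)] by blast
  thus False using that(2) by (simp add: complex_eq_iff)
 qed
 let ?U = "{z : ?D. Im z > 0}"
 have conU: "connected ?U" using upper_ddom_connected[OF E] upper_ddom[OF E] by simp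
 have up: "Im (f w) > 0" if w: "w : ?U" for w
 proof (rule ccontr)
  assume "~ Im (f w) > 0"
  hence neg: "Im (f w) < 0" using nz[of w] w by auto
  have conI: "connected ((%z. Im (f z)) ` ?U)"
   using conU by (intro connected_continuous_image continuous_intros continuous_on_subset[OF contf]) auto
  have "EX v:?U. Im (f v) > 0"
  proof -
   have "\<forall>\<^sub>F h in at 0. dist (f h / h) c < Re c" using lim cpos(2) unfolding tendsto_iff by blast
   moreover have "\<forall>\<^sub>F h in at 0. h : ?D" using oD z0 by (simp add: eventually_at_in_open')
   ultimately have "\<forall>\<^sub>F h in at 0. dist (f h / h) c < Re c & h : ?D" by (rule eventually_conj)
   then obtain d where d: "d > 0" "!!h. h ~= 0 ==> dist h 0 < d ==> dist (f h / h) c < Re c & h : ?D"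
    unfolding eventually_at by blast
   define v where "v = \<i> * of_real (d / 2)"
   have v: "v ~= 0" "dist v 0 < d" using d(1) by (auto simp: v_def norm_mult)
   hence vv: "cmod (f v / v - c) < Re c" "v : ?D" using d(2)[of v] by (auto simp: dist_norm)
   have "Re (f v / v) > 0" using abs_Re_le_cmod[of "f v / v - c"] vv(1) by simp
   hence "Re (f v / v) * (d / 2) > 0" using d(1) by simp
   moreover have "Im (f v) = Re (f v / v) * (d / 2)"
   proof -
    have "Im (q * v) = Re q * (d / 2)" for q by (simp add: v_def)
    from this[of "f v / v"] show ?thesis using v(1) by simp
   qed
   ultimately have "Im (f v) > 0" by simp
   moreover have "Im v > 0" using d(1) by (simp add: v_def)
   ultimately show ?thesis using vv(2) by blast
  qed
  then obtain v where v: "v : ?U" "Im (f v) > 0" by auto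
  have "0 : (%z. Im (f z)) ` ?U" using connectedD_interval[OF conI imageI[OF w] imageI[OF v(1)]] neg v(2) by auto
  thus False using nz by auto
 qed
 show ?thesis
 proof
  assume "0 < Im z" thus "0 < Im (f z)" using up z by auto
 next
  assume a: "0 < Im (f z)"
  show "0 < Im z"
  proof (rule ccontr)
   assume "~ 0 < Im z"
   then consider "Im z = 0" | "Im (cnj z) > 0" by force
   thus False
   proof cases
    case 1
    hence "z = of_real (Re z)" by (simp add: complex_eq_iff)
    thus False using rr[of "Re z"] a by simp
   next
    case 2
    hence "Im (f (cnj z)) > 0" using up cnj_ddom[OF z] by auto
    thus False using sym[OF z] a by simp
   qed
  qed
 qed
qed

text \<open>Conjugation yields a second family of image holes, equal to the first by uniqueness of
  the image; this pairs \<open>L (j, True)\<close> with \<open>L (j, False)\<close>. Being disjoint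
  from its mirror image, \<open>L (j, True)\<close> has no real point, and it contains a limit of
  values in the upper half-plane.\<close>

lemma symmetric_hole_map:
 assumes E: "uholes J E" and f: "hole_map (J \<times> UNIV) (dbl E) L f" "f 0 = 0" "f 1 = 1"
  and sym: "!!z. z : ddom J E ==> f (cnj z) = cnj (f z)"
 shows "sym_map J E (%j. L (j, True)) f" "!!j b. j : J ==> L (j, b) = dbl (%j. L (j, True)) (j, b)"
proof -
 let ?D = "ddom J E" and ?I = "J \<times> (UNIV :: bool set)"
 note F = hole_mapD[OF f(1)]
 have "hole_map ?I (dbl E) (%(j, b). cnj ` L (j, ~ b)) (%z. cnj (f (cnj z)))" using hole_map_cnj[OF f(1)] .
 hence "hole_map ?I (dbl E) (%(j, b). cnj ` L (j, ~ b)) f" by (rule hole_map_cong[rotated -1]) (use sym in auto)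
 note IU = hole_map_image_unique[OF f(1) this]
 have L: "L (j, b) = cnj ` L (j, ~ b)" if "j : J" for j b using IU[of "(j, b)"] that by simp
 show Ld: "L (j, b) = dbl (%j. L (j, True)) (j, b)" if "j : J" for j b using L[OF that, of False] by (cases b) auto
 have hL: "holes ?I L" using F(2) .
 have up: "0 < Im (f z) <-> 0 < Im z" if "z : ?D" for z using symmetric_map_upper[OF E F(3,5) f(2,3) sym that] .
 have LU: "Im w > 0" if j: "j : J" and w: "w : L (j, True)" for j w
 proof -
  have nr: "Im v ~= 0" if "v : L (j, True)" for v
  proof
   assume "Im v = 0"
   hence "cnj v = v" by (simp add: complex_eq_iff)
   hence "v : L (j, False)" using L[OF j, of False] that by auto
   moreover have "L (j, True) Int L (j, False) = {}" using hL j by (auto simp: holes_def disjoint_family_on_def)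
   ultimately show False using that by auto
  qed
  have cE: "compact (E j)" "E j ~= {}" using E j by (auto simp: uholes_def)
  then obtain z where z: "z : frontier (dbl E (j, True))" using compact_frontier_nonempty[of "E j"] by auto
  obtain x v where x: "range x <= ?D" "x ----> z" "(%k. f (x k)) ----> v" "v : L (j, True)"
   using hole_map_cluster[OF f(1) _ z] j by auto
  have zE: "z : E j" using z cE(1) by (auto simp: compact_imp_closed intro: subsetD[OF frontier_subset_closed])
  hence "Im z > 0" using E j by (auto simp: uholes_def)
  hence "EV k. Im (x k) > 0" using order_tendstoD(1)[OF tendsto_Im[OF x(2)]] by simp
  hence "EV k. Im (f (x k)) >= 0" by eventually_elim (use up x(1) in "auto simp: image_subset_iff intro: less_imp_le")
  hence "Im v >= 0" using tendsto_lowerbound[OF tendsto_Im[OF x(3)]] by simp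
  hence vpos: "Im v > 0" using nr[OF x(4)] by simp
  have "connected (L (j, True))" using hL j by (auto simp: holes_def)
  hence con: "connected (Im ` L (j, True))" by (intro connected_continuous_image continuous_intros)
  show "Im w > 0"
  proof (rule ccontr)
   assume "~ Im w > 0"
   hence "0 : Im ` L (j, True)" using connectedD_interval[OF con imageI[OF w] imageI[OF x(4)]] vpos by simp
   thus False using nr by auto
  qed
 qed
 have uL: "uholes J (%j. L (j, True))" unfolding uholes_def
 proof (intro conjI ballI)
  show "finite J" using E by (auto simp: uholes_def)
  show "disjoint_family_on (%j. L (j, True)) J" using hL by (auto simp: holes_def disjoint_family_on_def)
  fix j assume j: "j : J"
  show "compact (L (j, True))" "connected (L (j, True))" "L (j, True) ~= {}" using hL j by (auto simp: holes_def)
  show "connected (- L (j, True))" using holes_connected_compl[OF hL] j by auto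
  show "0 < Im z" if "z : L (j, True)" for z using LU[OF j that] .
 qed
 have "hole_map ?I (dbl E) (dbl (%j. L (j, True))) f" by (rule hole_map_cong[OF _ _ _ f(1)]) (use Ld in auto)
 thus "sym_map J E (%j. L (j, True)) f" unfolding sym_map_def using E uL f(2,3) sym up by blast
qed

lemma sym_map_inv:
 assumes "sym_map J E L f" shows "sym_map J L E (inv_into (ddom J E) f)"
proof -
 note S = sym_mapD[OF assms]
 let ?g = "inv_into (ddom J E) f"
 have inj: "inj_on f (ddom J E)" and im: "f ` ddom J E = ddom J L" using hole_mapD[OF S(3)] by auto
 have rD: "0 : ddom J E" "1 : ddom J E" using real_ddom[OF S(1)] by auto
 have g: "?g w : ddom J E" "f (?g w) = w" if "w : ddom J L" for w using im that by (auto simp: inv_into_into f_inv_into_f)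
 have "?g 0 = 0" "?g 1 = 1" using inv_into_f_f[OF inj rD(1)] inv_into_f_f[OF inj rD(2)] S(4,5) by auto
 moreover have "?g (cnj w) = cnj (?g w)" if "w : ddom J L" for w
 proof -
  have "f (cnj (?g w)) = cnj w" using S(6)[OF g(1)[OF that]] g(2)[OF that] by simp
  thus ?thesis using inv_into_f_f[OF inj cnj_ddom[OF g(1)[OF that]]] by simp
 qed
 moreover have "0 < Im w <-> 0 < Im (?g w)" if "w : ddom J L" for w using S(7)[OF g(1)[OF that]] g(2)[OF that] by simp
 ultimately show ?thesis unfolding sym_map_def using S(1,2) hole_map_inv[OF S(3)] by blast
qed

lemma sym_map_comp:
 assumes "sym_map J E L f" "sym_map J L K g" shows "sym_map J E K (%z. g (f z))"
proof -
 note S = sym_mapD[OF assms(1)] and T = sym_mapD[OF assms(2)]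
 have im: "f z : ddom J L" if "z : ddom J E" for z using hole_mapD(6)[OF S(3)] that by blast
 show ?thesis unfolding sym_map_def using S(1,4-6) T(2,4-6) S(7) T(7) im hole_map_comp[OF S(3) T(3)] by simp
qed

text \<open>The affine factors are real because \<open>f\<close> is real at the natural numbers
  \<open>k\<close>: there \<open>Im au * k + Im be\<close> tends to 0, and a linear expression with
  limit 0 vanishes.\<close>

lemma sym_map_affine_hydro:
 assumes "sym_map J E L f"
 obtains a b g where "a ~= 0" "!!z. f z = of_real a * g z + of_real b" "hydro g"
  "hole_map (J \<times> UNIV) (dbl E) (%i. (%w. of_real (1 / a) * w + of_real (- b / a)) ` dbl L i) g"
proof -
 note S = sym_mapD[OF assms]
 obtain au be g where g: "au ~= 0" "!!z. f z = au * g z + be" "hydro g" using hole_map_hydro_factor[OF S(3)] by metis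
 have rr: "Im (f (of_real x)) = 0" for x using S(6)[OF real_ddom[OF S(1), of "of_real x"]] by (simp add: complex_eq_iff)
 have rr': "Im (f (of_nat k)) = 0" for k using rr[of "real k"] by simp
 have seq: "filterlim (%k. complex_of_real (real k)) at_infinity sequentially"
  by (intro filterlim_norm_at_top_imp_at_infinity) (simp add: filterlim_real_sequentially)
 have gk: "(%k. g (of_real (real k)) - of_real (real k)) ----> 0" using filterlim_compose[OF g(3)[unfolded hydro_def] seq] .
 have fk: "(%k. f (of_real (real k)) - (au * of_real (real k) + be)) ----> 0"
  using tendsto_mult[OF tendsto_const[of au] gk] by (simp add: g(2) algebra_simps)
 hence im: "(%k. Im (f (of_real (real k)) - (au * of_real (real k) + be))) ----> Im 0" by (rule tendsto_Im)
 have im1: "(%k. Im au * real k + Im be) ----> 0" using tendsto_minus[OF im] rr' by (simp add: add.commute)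
 have "(%k. (Im au * real (Suc k) + Im be) - (Im au * real k + Im be)) ----> 0 - 0"
  by (rule tendsto_diff[OF LIMSEQ_Suc[OF im1] im1])
 hence "(%k. Im au) ----> 0" by (simp add: algebra_simps)
 hence ia: "Im au = 0" using LIMSEQ_unique by blast
 hence "(%k. Im be) ----> 0" using im1 by simp
 hence ib: "Im be = 0" using LIMSEQ_unique by blast
 define a where "a = Re au"
 define b where "b = Re be"
 have ab: "au = of_real a" "be = of_real b" using ia ib by (auto simp: a_def b_def complex_eq_iff)
 have a0: "a ~= 0" using g(1) ab by auto
 have "complex_of_real (1 / a) ~= 0" using a0 by simp
 from hole_map_affine[OF S(3) this, of "of_real (- b / a)"]
 have "hole_map (J \<times> UNIV) (dbl E) (%i. (%w. of_real (1 / a) * w + of_real (- b / a)) ` dbl L i) (%z. of_real (1 / a) * f z + of_real (- b / a))" .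
 moreover have "(%z. of_real (1 / a) * f z + of_real (- b / a)) = g" unfolding g(2) ab using a0 by (auto simp: field_simps)
 ultimately show ?thesis using that[OF a0 _ g(3)] g(2) ab by simp
qed

lemma horizontal_image:
 assumes "horizontal L" "!!w v. Im w = Im v ==> Im (h w) = Im (h v)"
 shows "horizontal (h ` L)" using assms unfolding horizontal_def by blast

lemma horizontal_affine:
 assumes "horizontal L" shows "horizontal ((%w. of_real a * w + of_real b) ` L)" by (rule horizontal_image[OF assms]) simp

lemma horizontal_cnj: "horizontal L ==> horizontal (cnj ` L)"
 by (rule horizontal_image) simp_all

lemma horizontal_dbl: "horizontal (L j) ==> horizontal (dbl L (j, b))"
 by (cases b) (simp_all only: dbl_simps horizontal_cnj)

text \<open>The conjugate of a hydrodynamic slit map is again one, so uniqueness makes it symmetric;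
  a real affine map then moves the images of 0 and 1 to 0 and 1 and keeps slits horizontal.\<close>

theorem sym_slit_exists:
 assumes E: "uholes J E"
 obtains L f where "sym_map J E L f" "!!j. j : J ==> horizontal (L j)"
proof -
 let ?I = "J \<times> (UNIV :: bool set)" and ?D = "ddom J E"
 obtain L f where f: "hole_map ?I (dbl E) L f" "hydro f" "!!i. i : ?I ==> horizontal (L i)"
  using slit_map_exists[OF holes_dbl[OF E]] by blast
 have h2: "hydro (%z. cnj (f (cnj z)))"
 proof -
  have "filterlim cnj at_infinity at_infinity" by (rule filterlim_norm_at_top_imp_at_infinity) (simp add: filterlim_norm_at_top)
  hence "(%z. f (cnj z) - cnj z) -oo-> 0" using f(2) unfolding hydro_def by (rule filterlim_compose[rotated])
  hence "(%z. cnj (f (cnj z) - cnj z)) -oo-> cnj 0" by (rule tendsto_cnj)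
  thus ?thesis by (simp add: hydro_def)
 qed
 have "horizontal (case i of (j, b) => cnj ` L (j, ~ b))" if i: "i : ?I" for i using i horizontal_cnj f by auto
 hence eq: "f z = cnj (f (cnj z))" if "z : ?D" for z using slit_map_unique[OF f hole_map_cnj[OF f(1)] h2 _ that] by blast
 have sym: "f (cnj z) = cnj (f z)" if "z : ?D" for z using eq[OF that] by simp
 have rD: "0 : ?D" "1 : ?D" using real_ddom[OF E] by auto
 have ri: "Im (f 0) = 0" "Im (f 1) = 0" using sym[OF rD(1)] sym[OF rD(2)] by (auto simp: complex_eq_iff)
 have ne: "f 1 ~= f 0" using hole_mapD(5)[OF f(1)] rD by (metis inj_onD zero_neq_one)
 define a where "a = 1 / (Re (f 1) - Re (f 0))"
 define b where "b = - a * Re (f 0)"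
 have "Re (f 1) - Re (f 0) ~= 0" using ne ri by (simp add: complex_eq_iff)
 hence a0: "a ~= 0" and a1: "a * Re (f 1) - a * Re (f 0) = 1" by (simp_all add: a_def diff_divide_distrib[symmetric])
 define g where "g z = of_real a * f z + of_real b" for z
 have g: "hole_map ?I (dbl E) (%i. (%w. of_real a * w + of_real b) ` L i) g"
  unfolding g_def using hole_map_affine[OF f(1), of "of_real a" "of_real b"] a0 by simp
 have g0: "g 0 = 0" "g 1 = 1" using ri a1 by (auto simp: g_def b_def complex_eq_iff)
 have gs: "g (cnj z) = cnj (g z)" if "z : ?D" for z using sym[OF that] by (simp add: g_def)
 show ?thesis by (rule that[OF symmetric_hole_map(1)[OF E g g0 gs]]) (use f(3) horizontal_affine in auto)
qed

theorem sym_slit_unique: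
 assumes f: "sym_map J E L f" "!!j. j : J ==> horizontal (L j)" and g: "sym_map J E K g" "!!j. j : J ==> horizontal (K j)"
 shows "!!z. z : ddom J E ==> f z = g z" "!!j. j : J ==> L j = K j"
proof -
 let ?I = "J \<times> (UNIV :: bool set)" and ?D = "ddom J E"
 note S = sym_mapD[OF f(1)] and T = sym_mapD[OF g(1)]
 obtain a b F where F: "a ~= 0" "!!z. f z = of_real a * F z + of_real b" "hydro F"
  "hole_map ?I (dbl E) (%i. (%w. of_real (1 / a) * w + of_real (- b / a)) ` dbl L i) F" by (rule sym_map_affine_hydro[OF f(1)]) blast
 obtain a' b' G where G: "a' ~= 0" "!!z. g z = of_real a' * G z + of_real b'" "hydro G"
  "hole_map ?I (dbl E) (%i. (%w. of_real (1 / a') * w + of_real (- b' / a')) ` dbl K i) G" by (rule sym_map_affine_hydro[OF g(1)]) blast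
 have FG: "F z = G z" if "z : ?D" for z
 proof (rule slit_map_unique[OF F(4,3) _ G(4,3) _ that])
  fix i :: "'a \<times> bool" assume i: "i : ?I"
  obtain j b where jb: "i = (j, b)" "j : J" using i by auto
  show "horizontal ((%w. of_real (1 / a) * w + of_real (- b / a)) ` dbl L i)" for a b
   unfolding jb(1) by (intro horizontal_affine horizontal_dbl f(2) jb(2))
  show "horizontal ((%w. of_real (1 / a) * w + of_real (- b / a)) ` dbl K i)" for a b
   unfolding jb(1) by (intro horizontal_affine horizontal_dbl g(2) jb(2))
 qed
 have rD: "0 : ?D" "1 : ?D" using real_ddom[OF S(1)] by auto
 have "of_real a * (F 1 - F 0) = (1::complex)" "of_real a' * (F 1 - F 0) = (1::complex)"
 proof -
  have "f 1 - f 0 = of_real a * (F 1 - F 0)" "g 1 - g 0 = of_real a' * (G 1 - G 0)" using F(2) G(2) by (simp_all add: right_diff_distrib)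
  thus "of_real a * (F 1 - F 0) = (1::complex)" "of_real a' * (F 1 - F 0) = (1::complex)"
   using S(4,5) T(4,5) FG[OF rD(1)] FG[OF rD(2)] by auto
 qed
 hence aa: "complex_of_real a = of_real a'" by (metis mult_cancel_right mult_eq_0_iff one_neq_zero)
 have bb: "complex_of_real b = of_real b'" using S(4) T(4) F(2)[of 0] G(2)[of 0] FG[OF rD(1)] aa by (metis add_left_cancel)
 show eq: "f z = g z" if "z : ?D" for z using F(2) G(2) FG[OF that] aa bb by simp
 have "hole_map ?I (dbl E) (dbl K) f" by (rule hole_map_cong[OF _ _ _ T(3)]) (use eq in auto)
 thus "L j = K j" if "j : J" for j using hole_map_image_unique[OF S(3), of "dbl K" "(j, True)"] that by auto
qed

theorem sym_maps_compact:
 assumes E: "uholes J E" and up: "!!e. e > 0 ==> EV k. ALL j:J. E' k j <= nhd (E j) e"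
  and sm: "!!k. sym_map J (E' k) (L' k) (f k)"
 obtains r L g where "strict_mono (r :: nat => nat)" "sym_map J E L g"
  "kconv (ddom J E) (%k. ddom J (E' (r k))) (%k. f (r k)) g"
  "!!dl. dl > 0 ==> EV k. ALL j:J. L' (r k) j <= nhd (L j) dl"
proof -
 let ?I = "J \<times> (UNIV :: bool set)"
 note S = sym_mapD[OF sm]
 have rD: "0 : ddom J E" "1 : ddom J E" using real_ddom[OF E] by auto
 have up2: "EV k. ALL i:?I. dbl (E' k) i <= nhd (dbl E i) e" if "e > 0" for e using up[OF that]
 proof eventually_elim
  case (elim k)
  have "cnj ` A <= nhd (cnj ` B) e" if "A <= nhd B e" for A B
  proof
   fix z assume "z : cnj ` A"
   hence "cnj z : nhd B e" using that by auto
   then obtain b where "b : B" "dist b (cnj z) < e" by (auto simp: in_nhd_iff)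
   moreover have "dist (cnj b) z = dist b (cnj z)" by (metis complex_cnj_cnj complex_cnj_diff complex_mod_cnj dist_norm)
   ultimately show "z : nhd (cnj ` B) e" unfolding in_nhd_iff by force
  qed
  thus ?case using elim by (auto simp: dbl_def split: prod.splits)
 qed
 obtain r L g where r: "strict_mono (r :: nat => nat)" and g: "hole_map ?I (dbl E) L g" "g 0 = 0" "g 1 = 1"
  and kc: "kconv (ddom J E) (%k. ddom J (E' (r k))) (%k. f (r k)) g"
  and L: "!!dl. dl > 0 ==> EV k. ALL i:?I. dbl (L' (r k)) i <= nhd (L i) dl"
  by (rule hole_maps_compact[OF holes_dbl[OF E] rD up2 S(3-5)]) blast+
 have sym: "g (cnj z) = cnj (g z)" if z: "z : ddom J E" for z
 proof -
  have l1: "(%k. f (r k) z) ----> g z" "(%k. f (r k) (cnj z)) ----> g (cnj z)"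
   using kconv_tendsto[OF kc z tendsto_const] kconv_tendsto[OF kc cnj_ddom[OF z] tendsto_const] .
  have "EV k. {z} <= ddom J (E' (r k))" using kconvD(4)[OF kc, of "{z}"] z by auto
  hence "EV k. f (r k) (cnj z) = cnj (f (r k) z)" by eventually_elim (simp add: S(6))
  hence "(%k. cnj (f (r k) z)) ----> g (cnj z)" by (rule Lim_transform_eventually[OF l1(2)])
  thus ?thesis using LIMSEQ_unique tendsto_cnj[OF l1(1)] by blast
 qed
 have "EV k. ALL j:J. L' (r k) j <= nhd (L (j, True)) dl" if "dl > 0" for dl using L[OF that] by eventually_elim force
 thus ?thesis using that[OF r symmetric_hole_map(1)[OF E g sym] kc] by blast
qed

section \<open>A Leray--Schauder principle\<close>

text \<open>Euclidean space of dimension \<open>N\<close> appears as the functions that vanish from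
  \<open>N\<close> on, since \<open>N\<close> varies with the number of holes and cannot be put into
  a type.\<close>

definition cube :: "nat => real => (nat => real) set" where
 "cube N M = {x. (ALL i<N. abs(x i) <= M) & (ALL i>=N. x i = 0)}"

lemma tendsto_fun_iff:
 fixes x :: "'b => nat => real"
 shows "(x ---> l) F <-> (ALL i. ((%k. x k i) ---> l i) F)"
proof -
 have "(x ---> l) F <-> limitin euclidean x l F" by simp
 also have "... <-> limitin (product_topology (%i. euclidean) UNIV) x l F" by (simp only: euclidean_product_topology)
 also have "... <-> (ALL i. ((%k. x k i) ---> l i) F)" by (simp add: limitin_componentwise)
 finally show ?thesis .
qed

lemma compact_cube: "compact (cube N M)"
proof -
 have eq: "cube N M = PiE UNIV (%i. if i < N then {- M..M} else {0})"
 proof (rule set_eqI)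
  fix x :: "nat => real"
  have "x : PiE UNIV (%i. if i < N then {- M..M} else {0}) <-> (ALL i. (i < N --> abs(x i) <= M) & (i >= N --> x i = 0))"
   unfolding PiE_UNIV_domain Pi_def by force
  thus "x : cube N M <-> x : PiE UNIV (%i. if i < N then {- M..M} else {0})" unfolding cube_def by blast
 qed
 have "compactin (product_topology (%i::nat. euclidean) UNIV) (PiE UNIV (%i. if i < N then {- M..M::real} else {0}))"
  by (auto simp: compactin_PiE)
 thus ?thesis unfolding eq by (simp add: euclidean_product_topology)
qed

text \<open>Kuhn's combinatorial lemma on a grid with mesh \<open>2 * M / p\<close>, where the label
  of a grid point in direction \<open>i\<close> tells whether \<open>f\<close> moves it up or down.
  Some small cube carries both labels in every direction.\<close>

lemma kuhn_approx:
 fixes f :: "(nat => real) => nat => real"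
 assumes "M > 0" and im: "!!x. x : cube N M ==> f x : cube N M" and "p > 0"
 shows "EX z:cube N M. ALL i<N. EX a b. a : cube N M & b : cube N M & (ALL j. abs(a j - z j) <= 2 * M / real p) &
   (ALL j. abs(b j - z j) <= 2 * M / real p) & a i <= f a i & f b i <= b i"
proof -
 define pt where "pt x i = (if i < N then 2 * M * (real (x i) / real p) - M else 0)" for x :: "nat => nat" and i
 have ptc: "pt x : cube N M" if "ALL i<N. x i <= p" for x
 proof -
  have "abs(pt x i) <= M" if "i < N" for i
  proof -
   have "real (x i) / real p <= 1" "0 <= real (x i) / real p" using `ALL i<N. x i <= p` that `p > 0` by auto
   hence "2 * M * (real (x i) / real p) <= 2 * M" "0 <= 2 * M * (real (x i) / real p)"
    using `M > 0` mult_left_mono[of "real (x i) / real p" 1 "2 * M"] by auto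
   thus ?thesis by (simp add: pt_def abs_le_iff)
  qed
  thus ?thesis by (auto simp: cube_def pt_def)
 qed
 define label :: "(nat => nat) => nat => nat" where
  "label x i = (if x i = p | (x i ~= 0 & f (pt x) i < pt x i) then 1 else 0)" for x i
 have lab: "ALL x. (ALL i<N. x i <= p) --> (ALL i<N. label x i = 0 | label x i = 1)"
  "ALL x. (ALL i<N. x i <= p) --> (ALL i<N. x i = 0 --> label x i = 0)"
  "ALL x. (ALL i<N. x i <= p) --> (ALL i<N. x i = p --> label x i = 1)" using `p > 0` by (simp_all add: label_def)
 obtain q where q: "ALL i<N. q i < p"
  "ALL i<N. EX r s. (ALL j<N. q j <= r j & r j <= q j + 1) & (ALL j<N. q j <= s j & s j <= q j + 1) & label r i ~= label s i"
  by (rule kuhn_lemma[OF `p > 0` lab])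
 have l0: "pt x i <= f (pt x) i" if "label x i = 0" "i < N" "ALL i<N. x i <= p" for x i
 proof (cases "x i = 0")
  case True
  hence "pt x i = - M" using that by (simp add: pt_def)
  moreover have "f (pt x) i >= - M" using im[OF ptc[OF that(3)]] that(2) by (auto simp: cube_def)
  ultimately show ?thesis by simp
 next
  case False
  thus ?thesis using that(1) by (auto simp: label_def split: if_splits)
 qed
 have l1: "f (pt x) i <= pt x i" if "label x i ~= 0" "i < N" "ALL i<N. x i <= p" for x i
 proof (cases "x i = p")
  case True
  hence "pt x i = M" using that `p > 0` by (simp add: pt_def)
  moreover have "f (pt x) i <= M" using im[OF ptc[OF that(3)]] that(2) by (auto simp: cube_def)
  ultimately show ?thesis by simp
 next
  case False
  thus ?thesis using that(1) by (auto simp: label_def split: if_splits)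
 qed
 have near: "abs(pt r j - pt q j) <= 2 * M / real p" if "ALL j<N. q j <= r j & r j <= q j + 1" for r j
 proof (cases "j < N")
  case True
  hence "q j <= r j" "r j <= q j + 1" using that by auto
  hence d: "real (r j) - real (q j) <= 1" "0 <= real (r j) - real (q j)" by auto
  moreover have "pt r j - pt q j = 2 * M / real p * (real (r j) - real (q j))" using True by (simp add: pt_def field_simps diff_divide_distrib)
  moreover have P: "2 * M / real p > 0" using `M > 0` `p > 0` by simp
  moreover have "2 * M / real p * (real (r j) - real (q j)) <= 2 * M / real p * 1" using d(1) P by (intro mult_left_mono) auto
  moreover have "0 <= 2 * M / real p * (real (r j) - real (q j))" using d(2) P by (intro mult_nonneg_nonneg) auto
  ultimately show ?thesis by simp
 qed (use `M > 0` in "simp add: pt_def")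
 have qc: "pt q : cube N M" using q(1) by (intro ptc) auto
 show ?thesis
 proof (intro bexI[OF _ qc] allI impI)
  fix i assume i: "i < N"
  obtain r s where rs: "ALL j<N. q j <= r j & r j <= q j + 1" "ALL j<N. q j <= s j & s j <= q j + 1" "label r i ~= label s i"
   using q(2) i by blast
  have *: "EX a b. a : cube N M & b : cube N M & (ALL j. abs(a j - pt q j) <= 2 * M / real p) &
   (ALL j. abs(b j - pt q j) <= 2 * M / real p) & a i <= f a i & f b i <= b i"
   if rs: "ALL j<N. q j <= r j & r j <= q j + 1" "ALL j<N. q j <= s j & s j <= q j + 1" "label r i = 0" "label s i ~= 0" for r s
  proof -
   have rp: "ALL j<N. r j <= p" "ALL j<N. s j <= p" using rs(1,2) q(1) by (metis Suc_eq_plus1 Suc_leI le_trans)+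
   show ?thesis
    by (intro exI[of _ "pt r"] exI[of _ "pt s"] conjI allI near rs(1,2) ptc rp l0[OF rs(3) i rp(1)] l1[OF rs(4) i rp(2)])
  qed
  show "EX a b. a : cube N M & b : cube N M & (ALL j. abs(a j - pt q j) <= 2 * M / real p) &
   (ALL j. abs(b j - pt q j) <= 2 * M / real p) & a i <= f a i & f b i <= b i"
  proof (cases "label r i = 0")
   case True
   thus ?thesis using *[OF rs(1,2)] rs(3) by auto
  next
   case False
   hence "label s i = 0" using rs(3) by (auto simp: label_def split: if_splits)
   thus ?thesis using *[OF rs(2,1) _ False] by auto
  qed
 qed
qed

text \<open>As the mesh tends to 0, the points with opposite labels have the same limit, where both
  inequalities hold at once.\<close>

theorem brouwer_nat_cube:
 fixes f :: "(nat => real) => nat => real"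
 assumes cont: "continuous_on (cube N M) f" and im: "f ` cube N M <= cube N M" and M: "M > 0"
 obtains x where "x : cube N M" "f x = x"
proof -
 have im': "!!x. x : cube N M ==> f x : cube N M" using im by auto
 have "ALL k. EX z:cube N M. ALL i<N. EX a b. a : cube N M & b : cube N M & (ALL j. abs(a j - z j) <= 2 * M / real (Suc k)) &
   (ALL j. abs(b j - z j) <= 2 * M / real (Suc k)) & a i <= f a i & f b i <= b i" using kuhn_approx M im' by blast
 then obtain z where z: "!!k. z k : cube N M" "!!k i. i < N ==> EX a b. a : cube N M & b : cube N M & (ALL j. abs(a j - z k j) <= 2 * M / real (Suc k)) &
   (ALL j. abs(b j - z k j) <= 2 * M / real (Suc k)) & a i <= f a i & f b i <= b i" by metis
 obtain l r where r: "l : cube N M" "strict_mono r" "(%k. z (r k)) ----> l" using compact_subseq[OF compact_cube z(1)] .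
 have zl: "(%k. z (r k) j) ----> l j" for j using r(3) unfolding tendsto_fun_iff by simp
 have small: "(%k. 2 * M / real (Suc (r k))) ----> 0"
 proof -
  have "(%k. 2 * M * (1 / real (Suc k))) ----> 2 * M * 0" by (intro tendsto_mult tendsto_const lim_1_over_n[THEN LIMSEQ_Suc])
  hence "(%k. 2 * M / real (Suc k)) ----> 0" by simp
  from tendsto_subseq[OF this r(2)] show ?thesis by simp
 qed
 have conv: "(%k. a k j) ----> l j" if "!!k j. abs(a k j - z (r k) j) <= 2 * M / real (Suc (r k))" for a j
 proof -
  have "(%k. a k j - z (r k) j) ----> 0" by (rule Lim_null_comparison[OF _ small]) (use that in auto)
  from tendsto_add[OF this zl[of j]] show ?thesis by simp
 qed
 have fl: "(%k. f (a k) i) ----> f l i" if "!!k. a k : cube N M" "!!j. (%k. a k j) ----> l j" for a i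
 proof -
  have "a ----> l" using that(2) by (simp add: tendsto_fun_iff)
  hence "(%k. f (a k)) ----> f l" using cont r(1) that(1) by (auto simp: continuous_on_sequentially o_def)
  thus ?thesis unfolding tendsto_fun_iff by blast
 qed
 have "f l i = l i" for i
 proof (cases "i < N")
  case True
  have "ALL k. EX a b. a : cube N M & b : cube N M & (ALL j. abs(a j - z (r k) j) <= 2 * M / real (Suc (r k))) &
   (ALL j. abs(b j - z (r k) j) <= 2 * M / real (Suc (r k))) & a i <= f a i & f b i <= b i" using z(2)[OF True] by simp
  from this[unfolded choice_iff] obtain a b where ab0: "ALL k. a k : cube N M & b k : cube N M & (ALL j. abs(a k j - z (r k) j) <= 2 * M / real (Suc (r k))) &
   (ALL j. abs(b k j - z (r k) j) <= 2 * M / real (Suc (r k))) & a k i <= f (a k) i & f (b k) i <= b k i" by auto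
  have ab: "!!k. a k : cube N M" "!!k. b k : cube N M" "!!k j. abs(a k j - z (r k) j) <= 2 * M / real (Suc (r k))"
   "!!k j. abs(b k j - z (r k) j) <= 2 * M / real (Suc (r k))" "!!k. a k i <= f (a k) i" "!!k. f (b k) i <= b k i"
   using ab0 by auto
  have "l i <= f l i" using LIMSEQ_le[OF conv[OF ab(3)] fl[OF ab(1) conv[OF ab(3)]]] ab(5) by blast
  moreover have "f l i <= l i" using LIMSEQ_le[OF fl[OF ab(2) conv[OF ab(4)]] conv[OF ab(4)]] ab(6) by blast
  ultimately show ?thesis by simp
 next
  case False
  thus ?thesis using r(1) im'[OF r(1)] by (simp add: cube_def)
 qed
 thus ?thesis using that[OF r(1)] by auto
qed

text \<open>The parameter is made a function \<open>cut\<close> of the point, equal to 1 on the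
  projection \<open>P\<close> of the zero set and to 0 at distance \<open>ep\<close> from it. At
  \<open>t = 0\<close> the equation reads \<open>x = X0\<close>, so the map
  \<open>x - h (cut x) x\<close> can be continued by the constant \<open>X0\<close> and has a fixed
  point by Brouwer's theorem. There \<open>h (cut x) x = 0\<close>, so \<open>x\<close> lies in
  \<open>P\<close>, and then \<open>cut x = 1\<close>.\<close>

theorem leray_schauder:
 fixes h :: "real => (nat => real) => nat => real"
 assumes C: "open C" and cont: "continuous_on ({0..1} \<times> C) (%p. h (fst p) (snd p))"
  and hN: "!!t x i. i >= N ==> h t x i = x i"
  and Z: "compact {p : {0..1} \<times> C. h (fst p) (snd p) = (%_. 0)}"
  and h0: "!!x i. x : C ==> i < N ==> h 0 x i = x i - X0 i" and X0: "X0 : C" "!!i. i >= N ==> X0 i = 0"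
 obtains x where "x : C" "h 1 x = (%_. 0)"
proof -
 define Zs where "Zs = {p : {0..1} \<times> C. h (fst p) (snd p) = (%_. 0)}"
 define P where "P = snd ` Zs"
 have cP: "compact P" unfolding P_def Zs_def using Z by (intro compact_continuous_image continuous_intros)
 have X0P: "X0 : P"
 proof -
  have "h 0 X0 i = 0" for i using h0[OF X0(1)] hN[of i 0 X0] X0(2)[of i] by (cases "i < N") auto
  hence "(0, X0) : Zs" using X0 by (auto simp: Zs_def)
  thus ?thesis unfolding P_def by force
 qed
 have coord: "EX B. ALL x:S. ALL i<N. abs(f x i) <= B" if "compact S" "continuous_on S f" for S and f :: "(nat => real) => nat => real"
 proof -
  have "continuous_on S (%x. \<Sum>i<N. abs(f x i))"
   using continuous_on_product_then_coordinatewise[OF that(2)] by (intro continuous_intros)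
  hence "bounded ((%x. \<Sum>i<N. abs(f x i)) ` S)" using that(1) by (intro compact_imp_bounded compact_continuous_image)
  then obtain B where B: "!!x. x : S ==> norm (\<Sum>i<N. abs(f x i)) <= B" unfolding bounded_iff by blast
  have "abs(f x i) <= B" if "x : S" "i < N" for x i
   using B[OF that(1)] member_le_sum[of i "{..<N}" "%i. abs(f x i)"] that(2) by simp
  thus ?thesis by blast
 qed
 obtain B where B: "!!x i. x : P ==> i < N ==> abs(x i) <= B" using coord[OF cP continuous_on_id] by auto
 \<comment> \<open>Bounding the coordinates makes the closed neighbourhood \<open>Nb\<close> of
   \<open>P\<close> compact.\<close>
 define C' where "C' = C Int (\<Inter>i\<in>{..<N}. {x. abs(x i) < B + 1})"
 have "open C'" unfolding C'_def
  by (intro open_Int C open_INT finite_lessThan ballI open_Collect_less continuous_intros continuous_on_product_coordinates)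
 moreover have "P <= C'" using B by (fastforce simp: C'_def P_def Zs_def)
 ultimately obtain e where e: "e > 0" "nhd P e <= C'" using nhd_subset_open[OF cP] by metis
 define ep where "ep = e / 2"
 define dl where "dl x = infdist x P" for x
 have epC: "x : C'" if "dl x <= ep" for x
 proof -
  have "dl x < e" using that e(1) by (simp add: ep_def)
  then obtain y where "y : P" "dist x y < e"
   using X0P unfolding dl_def by (metis infdist_notempty cINF_less_iff bdd_below_image_dist empty_iff)
  thus "x : C'" using e(2) by (metis dist_commute in_nhd_iff subsetD)
 qed
 have dlP: "dl x = 0" if "x : P" for x using that by (simp add: dl_def)
 have ep: "ep > 0" using e(1) by (simp add: ep_def)
 have dl_nonneg: "dl x >= 0" for x by (simp add: dl_def infdist_nonneg)
 have dl_cont: "continuous_on A dl" for A unfolding dl_def by (intro continuous_intros)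
 define A where "A = {x :: nat => real. ALL i>=N. x i = 0}"
 define Nb where "Nb = {x : A. dl x <= ep}"
 have NbC: "Nb <= C" using epC by (auto simp: Nb_def C'_def)
 have cNb: "compact Nb"
 proof -
  have "closed {x. dl x <= ep}" by (intro closed_Collect_le dl_cont continuous_on_const)
  moreover have "Nb = cube N (B + 1) Int {x. dl x <= ep}"
   using epC by (force simp: Nb_def A_def cube_def C'_def intro: less_imp_le)
  ultimately show ?thesis using compact_Int_closed[OF compact_cube] by simp
 qed
 define cut where "cut x = max 0 (1 - dl x / ep)" for x
 have cut_01: "cut x : {0..1}" for x using dl_nonneg[of x] ep by (auto simp: cut_def)
 have cut_cont: "continuous_on S cut" for S unfolding cut_def using ep by (intro continuous_intros dl_cont) auto
 define G where "G x i = x i - h (cut x) x i" for x i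
 have Gc: "continuous_on Nb G"
 proof (rule continuous_on_coordinatewise_then_product)
  fix i
  have "continuous_on Nb (%x. (cut x, x))" by (intro continuous_on_Pair cut_cont continuous_on_id)
  moreover have "(%x. (cut x, x)) ` Nb <= {0..1} \<times> C" using cut_01 NbC by blast
  ultimately have hc: "continuous_on Nb (%x. h (cut x) x)" using continuous_on_compose2[OF cont, of Nb "%x. (cut x, x)"] by simp
  have "continuous_on Nb (%x. h (cut x) x i)" by (rule continuous_on_product_then_coordinatewise[OF hc])
  thus "continuous_on Nb (%x. G x i)" unfolding G_def
   by (intro continuous_intros continuous_on_subset[OF continuous_on_product_coordinates]) auto
 qed
 have GN: "G x i = 0" if "i >= N" for x i using hN[OF that] by (simp add: G_def)
 obtain B2 where B2: "!!x i. x : Nb ==> i < N ==> abs(G x i) <= B2" using coord[OF cNb Gc] by blast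
 define M where "M = max 1 (max B2 B)"
 have M: "M > 0" "B2 <= M" "B <= M" by (auto simp: M_def)
 \<comment> \<open>The two definitions agree where \<open>dl x = ep\<close>: there
   \<open>cut x = 0\<close> and \<open>h 0 x = x - X0\<close>.\<close>
 define Ph where "Ph x = (if x : Nb then G x else X0)" for x
 have "continuous_on (cube N M) Ph"
 proof -
  define F2 where "F2 = {x. dl x >= ep}"
  have "closed F2" unfolding F2_def by (intro closed_Collect_le dl_cont continuous_on_const)
  have sub: "cube N M <= Nb Un F2" by (auto simp: cube_def Nb_def F2_def A_def)
  have "continuous_on (Nb Un F2) Ph" unfolding Ph_def
  proof (rule continuous_on_cases[OF compact_imp_closed[OF cNb] `closed F2` Gc continuous_on_const], clarify)
   fix x assume x: "x : Nb & x ~: Nb | x : F2 & x : Nb"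
   hence "dl x = ep" "x : Nb" by (auto simp: Nb_def F2_def)
   hence "cut x = 0" using ep by (simp add: cut_def)
   show "G x = X0"
   proof
    fix i show "G x i = X0 i"
    proof (cases "i < N")
     case True
     thus ?thesis using h0[of x i] NbC `x : Nb` `cut x = 0` by (auto simp: G_def)
    qed (use GN X0(2) in auto)
   qed
  qed
  thus ?thesis using sub continuous_on_subset by blast
 qed
 moreover have "Ph ` cube N M <= cube N M"
 proof
  fix y assume "y : Ph ` cube N M"
  then obtain x where y: "y = Ph x" by auto
  show "y : cube N M"
  proof (cases "x : Nb")
   case True
   thus ?thesis using B2[OF True] GN M(2) y by (force simp: Ph_def cube_def)
  next
   case False
   thus ?thesis using B[OF X0P] X0(2) M(3) y by (force simp: Ph_def cube_def)
  qed
 qed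
 ultimately obtain x where x: "x : cube N M" "Ph x = x" using brouwer_nat_cube M(1) by blast
 have xNb: "x : Nb"
 proof (rule ccontr)
  assume n: "x ~: Nb"
  hence "x = X0" using x(2) by (simp add: Ph_def)
  thus False using n dlP[OF X0P] ep X0(2) by (auto simp: Nb_def A_def)
 qed
 hence "G x = x" using x(2) by (simp add: Ph_def)
 hence hz: "h (cut x) x = (%_. 0)" by (auto simp: G_def fun_eq_iff)
 hence "(cut x, x) : Zs" using cut_01 xNb NbC by (auto simp: Zs_def)
 hence "x : P" unfolding P_def by force
 hence "cut x = 1" using dlP by (simp add: cut_def)
 thus ?thesis using that hz xNb NbC by auto
qed

section \<open>Boundary behaviour of Riemann maps\<close>

text \<open>If 0 were in the unbounded component, Borsuk's theorem would give a continuous argument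
  \<open>g\<close> on \<open>A\<close>. The increment \<open>g (om * x) - g x\<close> is determined
  modulo \<open>2 * pi\<close>, hence locally constant, and so a constant \<open>c\<close> on the
  connected \<open>A\<close>; after \<open>m\<close> rotations \<open>m * c = 0\<close>, so the
  rotation would be trivial.\<close>

lemma rotation_invariant_separates:
 fixes A :: "complex set"
 assumes cA: "compact A" and conA: "connected A" and ne: "A ~= {}" and om: "om ^ m = 1" "om ~= 1" and m: "m > 0"
  and inv: "!!z. z : A ==> om * z : A" and nz: "0 ~: A"
 shows "bounded (connected_component_set (- A) 0)"
proof (rule ccontr)
 assume unb: "~ bounded (connected_component_set (- A) 0)"
 have nom: "cmod om = 1" using om norm_one norm_power m power_eq_1_iff by blast
 obtain c where c: "homotopic_with_canon (%x. True) A (sphere 0 1) (%x. inverse (norm (x - 0)) *\<^sub>R (x - 0)) (%x. c)"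
  using Borsuk_map_essential_bounded_component[OF cA nz] unb by auto
 then obtain g :: "complex => real" where g: "continuous_on A g" "!!x. x : A ==> inverse (norm x) *\<^sub>R x = exp (\<i> * of_real (g x))"
  using inessential_eq_continuous_logarithm_circle[of A "%x. inverse (norm (x - 0)) *\<^sub>R (x - 0)"] by auto
 have e: "exp (\<i> * of_real (g (om * x) - g x)) = om" if x: "x : A" for x
 proof -
  have "exp (\<i> * of_real (g (om * x))) = om * exp (\<i> * of_real (g x))"
  proof -
   have "om * (x /\<^sub>R cmod x) = om * x /\<^sub>R cmod x" by simp
   thus ?thesis using g(2)[OF inv[OF x]] g(2)[OF x] nom by (metis norm_mult mult_1)
  qed
  thus ?thesis by (simp add: right_diff_distrib exp_diff)
 qed
 define h where "h x = g (om * x) - g x" for x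
 have hc: "continuous_on A h" unfolding h_def
  by (intro continuous_on_diff g(1) continuous_on_compose2[OF g(1), of A "%x. om * x"] continuous_intros) (use inv in auto)
 have hd: "EX e>0. ALL y. y : A & h y ~= h x --> e <= norm (h y - h x)" if x: "x : A" for x
 proof (intro exI[of _ "2 * pi"] conjI allI impI)
  fix y assume y: "y : A & h y ~= h x"
  have "exp (\<i> * of_real (h y)) = exp (\<i> * of_real (h x))" using e[OF x] e[of y] y by (simp add: h_def)
  then obtain k :: int where k: "\<i> * of_real (h y) = \<i> * of_real (h x) + (of_int (2 * k) * pi) * \<i>" unfolding exp_eq by blast
  hence "\<i> * of_real (h y) = \<i> * of_real (h x + 2 * of_int k * pi)" by (simp add: algebra_simps)
  hence kk: "h y = h x + 2 * of_int k * pi" by (simp only: mult_cancel_left of_real_eq_iff) auto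
  hence "k ~= 0" using y by auto
  hence "1 <= abs(real_of_int k)" by simp
  hence "2 * pi * 1 <= 2 * pi * abs(real_of_int k)" by simp
  also have "... = norm (h y - h x)" using kk by (simp add: abs_mult)
  finally show "2 * pi <= norm (h y - h x)" by simp
 qed auto
 have "h constant_on A" using continuous_discrete_range_constant[OF conA hc] hd by blast
 then obtain c where c: "!!x. x : A ==> h x = c" unfolding constant_on_def by blast
 obtain x where x: "x : A" using ne by blast
 have it: "om ^ k * x : A & g (om ^ k * x) = g x + real k * c" for k
 proof (induction k)
  case (Suc k)
  have "om ^ Suc k * x = om * (om ^ k * x)" by simp
  moreover have "g (om * (om ^ k * x)) = g (om ^ k * x) + c" using c[of "om ^ k * x"] Suc by (simp add: h_def)
  moreover have "om * (om ^ k * x) : A" using Suc inv by blast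
  moreover have "om ^ Suc k * x = om * (om ^ k * x)" by simp
  ultimately show ?case using Suc by (simp only: of_nat_Suc) (simp add: distrib_right)
 qed (use x in auto)
 have "c = 0" using it[of m] om(1) m by simp
 thus False using e[OF x] c[OF x] om(2) by (simp add: h_def)
qed

lemma continuous_connected_zero:
 fixes f :: "complex => real"
 assumes "connected A" "continuous_on A f" "a : A" "b : A" "f a <= 0" "0 <= f b"
 obtains x where "x : A" "f x = 0"
proof -
 have "connected (f ` A)" using assms by (intro connected_continuous_image)
 hence "0 : f ` A" using assms connectedD_interval[of "f ` A" "f a" "f b" 0] by auto
 thus ?thesis using that by auto
qed

text \<open>The continuum \<open>A\<close> crosses two lines through 0 that meet at the angle
  \<open>pi / m\<close>. Reflections in these lines generate the rotations by
  \<open>2 * pi / m\<close>, and the mirror images and rotations of \<open>A\<close> form one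
  connected invariant set \<open>S\<close> that surrounds or contains 0. The product of
  \<open>u\<close> and its mirrored version over all rotations has on \<open>S\<close> one factor of
  size at most \<open>ep\<close>, the others being at most \<open>M\<close>; by the maximum
  principle the same bound holds at 0.\<close>

lemma koebe_lemma:
 fixes u :: "complex => complex"
 assumes hl: "u hol ball 0 1" and M: "!!z. z : ball 0 1 ==> cmod (u z) <= M"
  and A: "compact A" "connected A" "A <= ball 0 1" and ep: "!!z. z : A ==> cmod (u z) <= ep" "0 <= ep"
  and ab: "a : A" "b : A" and m: "m >= 2"
  and sep: "Im a <= 0" "0 <= Im b" "Im (a * cis (- (pi / m))) <= 0" "0 <= Im (b * cis (- (pi / m)))"
 shows "cmod (u 0) ^ (2 * m) <= ep * M ^ (2 * m - 1)"
proof -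
 define om where "om = cis (2 * pi / m)"
 have omm: "om ^ m = 1" by (simp add: om_def Complex.DeMoivre)
 have nom: "cmod om = 1" by (simp add: om_def)
 have om1: "om ~= 1"
 proof
  assume "om = 1"
  hence "cos (2 * pi / m) = 1" by (metis om_def cis.sel(1) one_complex.sel(1))
  moreover have "0 < 2 * pi / m" "2 * pi / m <= pi" using m by (auto simp: field_simps)
  ultimately show False using cos_monotone_0_pi[of 0 "2 * pi / m"] by simp
 qed
 have nk[simp]: "cmod (om ^ k) = 1" for k by (simp add: norm_power nom)
 have M0: "0 <= M" using M[of 0] norm_ge_zero order_trans by (metis centre_in_ball zero_less_one)
 define B where "B = A Un cnj ` A"
 define S where "S = (\<Union>k<m. (%z. om ^ k * z) ` B)"
 obtain p where p: "p : A" "Im p = 0"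
  by (rule continuous_connected_zero[OF A(2) _ ab, of Im]) (use sep in "auto intro: continuous_intros")
 obtain q where q: "q : A" "Im (q * cis (- (pi / m))) = 0"
  by (rule continuous_connected_zero[OF A(2) _ ab, of "%z. Im (z * cis (- (pi / m)))"])
   (use sep in "simp_all del: times_complex.sel add: continuous_intros")
 have pB: "cnj p = p" using p(2) by (simp add: complex_eq_iff)
 have cB: "compact B" "connected B" "B <= ball 0 1"
 proof -
  show "compact B" unfolding B_def using A(1) by (intro compact_Un compact_continuous_image continuous_intros)
  show "connected B" unfolding B_def using A(2) p pB
   by (intro connected_Un connected_continuous_image continuous_intros) (auto intro!: image_eqI[of p cnj p])
  show "B <= ball 0 1" using A(3) by (auto simp: B_def)
 qed
 \<comment> \<open>Reflection in the line through 0 of direction \<open>cis (pi / m)\<close> is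
   conjugation followed by \<open>om\<close>; it fixes the crossing point \<open>q\<close>, so
   \<open>B\<close> meets its image under the rotation \<open>om\<close>.\<close>
 have qq: "om * cnj q = q"
 proof -
  have "q * cis (- (pi / m)) = cnj (q * cis (- (pi / m)))" using q(2) by (simp add: complex_eq_iff)
  also have "... = cnj q * cis (pi / m)" by (simp add: cis_cnj)
  finally have "q * cis (- (pi / m)) * cis (pi / m) = cnj q * (cis (pi / m) * cis (pi / m))" by simp
  moreover have "cis (- (pi / m)) * cis (pi / m) = 1" "cis (pi / m) * cis (pi / m) = om" by (simp_all add: cis_mult om_def)
  ultimately show ?thesis by (metis mult.assoc mult.commute mult_1)
 qed
 have meet: "EX x. x : B & x : (%z. om * z) ` B"
  using qq q(1) by (intro exI[of _ q]) (auto simp: B_def image_iff intro!: bexI[of _ "cnj q"])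
 have con: "connected (\<Union>k<n. (%z. om ^ k * z) ` B)" for n
 proof (induction n)
  case (Suc n)
  show ?case
  proof (cases "n = 0")
   case True
   thus ?thesis using cB(2) by simp
  next
   case False
   then obtain n' where n': "n = Suc n'" by (cases n) auto
   obtain x where x: "x : B" "x : (%z. om * z) ` B" using meet by blast
   have "om ^ n' * x : (%z. om ^ n' * z) ` B" using x by blast
   moreover have "om ^ n' * x : (%z. om ^ n * z) ` B" using x(2) n' by auto
   ultimately have "(\<Union>k<n. (%z. om ^ k * z) ` B) Int (%z. om ^ n * z) ` B ~= {}" using n' by blast
   moreover have "connected ((%z. om ^ n * z) ` B)" using cB(2) by (intro connected_continuous_image continuous_intros)
   ultimately have "connected ((\<Union>k<n. (%z. om ^ k * z) ` B) Un (%z. om ^ n * z) ` B)" using Suc by (intro connected_Un)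
   thus ?thesis by (simp add: lessThan_Suc Un_commute)
  qed
 qed simp
 have cS: "compact S" "connected S" "S <= ball 0 1"
 proof -
  show "compact S" unfolding S_def using cB(1) by (intro compact_UN compact_continuous_image continuous_intros) auto
  show "connected S" unfolding S_def by (rule con)
  show "S <= ball 0 1" using cB(3) by (auto simp: S_def norm_mult)
 qed
 have mp: "om ^ k = om ^ (k mod m)" for k by (metis omm div_mult_mod_eq mult.commute power_add power_mult power_one mult_1)
 have powS: "om ^ k * z : S" if "z : B" for k z unfolding S_def using that m mp[of k] by auto
 have inv: "om * z : S" if "z : S" for z
 proof -
  obtain k y where "y : B" "z = om ^ k * y" using `z : S` unfolding S_def by blast
  thus ?thesis using powS[of y "Suc k"] by (simp add: mult_ac)
 qed
 define T where "T z = (\<Prod>k<m. u (om ^ k * z) * cnj (u (cnj (om ^ k * z))))" for z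
 have Thol: "T hol ball 0 1"
 proof -
  have im: "(%z. om ^ k * z) ` ball 0 1 <= ball 0 1" for k by (auto simp: norm_mult)
  have lin: "(%z. om ^ k * z) hol ball 0 1" for k by simp
  have 1: "(%z. u (om ^ k * z)) hol ball 0 1" for k using holomorphic_on_compose_gen[OF lin hl im] by (simp add: o_def)
  have 2: "(%z. cnj (u (cnj z))) hol ball 0 1"
  proof -
   have "(cnj o u o cnj) hol ball 0 1"
   proof (rule holomorphic_on_compose_cnj_cnj)
    have "cnj ` ball 0 1 = ball (0::complex) 1" by auto
    thus "u hol cnj ` ball 0 1" using hl by simp
   qed simp
   thus ?thesis by (simp add: o_def)
  qed
  have 3: "(%z. cnj (u (cnj (om ^ k * z)))) hol ball 0 1" for k
   using holomorphic_on_compose_gen[OF lin 2 im, of k] by (simp only: o_def)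
  show ?thesis unfolding T_def by (intro holomorphic_on_prod holomorphic_on_mult 1 3)
 qed
 have T0: "cmod (T 0) = cmod (u 0) ^ (2 * m)" by (simp add: T_def norm_mult norm_power power_mult power2_eq_square)
 have TS: "cmod (T z) <= ep * M ^ (2 * m - 1)" if z: "z : S" for z
 proof -
  have zb: "z : ball 0 1" using z cS(3) by auto
  have all: "cmod (u (om ^ k * z)) <= M" "cmod (u (cnj (om ^ k * z))) <= M" for k
  proof -
   have "cmod (om ^ k * z) < 1" using zb by (simp add: norm_mult)
   thus "cmod (u (om ^ k * z)) <= M" "cmod (u (cnj (om ^ k * z))) <= M" by (auto intro!: M simp del: complex_cnj_mult)
  qed
  obtain k y where ky: "k < m" "y : B" "z = om ^ k * y" using z by (auto simp: S_def)
  \<comment> \<open>The rotation that takes \<open>z\<close> back to \<open>B\<close>; reduced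
    modulo \<open>m\<close> since \<open>k\<close> may be 0.\<close>
  define k' where "k' = (m - k) mod m"
  have k'm: "k' < m" using m by (simp add: k'_def)
  have "om ^ k' * z = y"
  proof -
   have "om ^ k' = om ^ (m - k)" using mp[of "m - k"] by (simp add: k'_def)
   hence "om ^ k' * om ^ k = 1" using ky(1) omm by (simp add: power_add[symmetric])
   thus ?thesis using ky(3) by simp
  qed
  hence yk: "cmod (u (om ^ k' * z)) <= ep | cmod (u (cnj (om ^ k' * z))) <= ep" using ky(2) ep(1) by (auto simp: B_def)
  have sp: "cmod (u (om ^ k' * z)) * cmod (u (cnj (om ^ k' * z))) <= ep * M" using yk
  using all ep mult_mono M0 mult.commute by (metis norm_imp_pos_and_ge)
  have "cmod (T z) = (\<Prod>k<m. cmod (u (om ^ k * z)) * cmod (u (cnj (om ^ k * z))))"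
   by (simp add: T_def prod_norm[symmetric] norm_mult del: complex_cnj_mult)
  also have "... = (cmod (u (om ^ k' * z)) * cmod (u (cnj (om ^ k' * z)))) *
    (\<Prod>k\<in>{..<m} - {k'}. cmod (u (om ^ k * z)) * cmod (u (cnj (om ^ k * z))))" using k'm by (intro prod.remove) auto
  also have "... <= (ep * M) * (\<Prod>k\<in>{..<m} - {k'}. M * M)"
  using mult_mono sp prod_mono conjI all mult_nonneg_nonneg norm_ge_zero M0 ep prod_nonneg by (smt (verit))
  also have "... = ep * M ^ (2 * m - 1)"
  proof -
   have "card ({..<m} - {k'}) = m - 1" using k'm by simp
   hence "(ep * M) * (\<Prod>k\<in>{..<m} - {k'}. M * M) = ep * (M ^ 1 * (M ^ 2) ^ (m - 1))" by (simp add: power2_eq_square)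
   also have "... = ep * M ^ (1 + 2 * (m - 1))" by (simp only: power_add power_mult)
   also have "1 + 2 * (m - 1) = 2 * m - 1" using m by simp
   finally show ?thesis .
  qed
  finally show ?thesis .
 qed
 have "cmod (T 0) <= ep * M ^ (2 * m - 1)"
 proof (cases "0 : S")
  case False
  \<comment> \<open>The bounded component of 0: its frontier lies in \<open>S\<close>, and it lies
    in the convex hull of \<open>S\<close>, which keeps its closure inside the disc.\<close>
  define V where "V = connected_component_set (- S) 0"
  have "p : S" using powS[of p 0] p(1) by (simp add: B_def)
  hence bV: "bounded V" unfolding V_def using rotation_invariant_separates[OF cS(1,2) _ omm om1 _ inv False] m by auto
  have oV: "open V" unfolding V_def using cS(1) by (intro open_connected_component open_Compl compact_imp_closed)
  have fV: "frontier V <= S"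
  using frontier_of_connected_component_subset cS frontier_subset_closed compact_imp_closed by (force simp: V_def)
  have "convex hull S <= ball 0 1" using cS(3) by (intro hull_minimal) auto
  have VB: "closure V <= ball 0 1"
  proof -
   have "V <= convex hull S"
   proof
    fix v assume v: "v : V"
    show "v : convex hull S"
    proof (rule ccontr)
     assume nv: "v ~: convex hull S"
     have "connected (- (convex hull S))" using cS(1)
      by (intro connected_complement_bounded_convex) (auto simp: compact_imp_bounded compact_convex_hull)
     moreover have "- (convex hull S) <= - S" using hull_subset[of S convex] by auto
     ultimately have "- (convex hull S) <= connected_component_set (- S) v" using nv by (intro connected_component_maximal) auto
     moreover have "connected_component_set (- S) v = V" using v connected_component_eq unfolding V_def by blast
     ultimately have "bounded (- (convex hull S))" using bV bounded_subset by blast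
     moreover have "bounded (convex hull S)" using cS(1) by (simp add: compact_imp_bounded bounded_convex_hull)
     ultimately have "bounded (UNIV :: complex set)" using bounded_Un[of "convex hull S" "- (convex hull S)"] by simp
     thus False by simp
    qed
   qed
   hence "closure V <= convex hull S" using cS(1) by (intro closure_minimal compact_imp_closed compact_convex_hull)
   thus ?thesis using `convex hull S <= ball 0 1` by blast
  qed
  show ?thesis
  proof (rule maximum_modulus_frontier[of T V])
   show "T hol interior V" using Thol VB closure_subset interior_subset by force
   show "continuous_on (closure V) T" using Thol VB by (meson holomorphic_on_imp_continuous_on holomorphic_on_subset)
   show "0 : V" unfolding V_def using False by simp
  qed (use bV fV TS in auto)
 qed (rule TS)
 thus ?thesis using T0 by simp
qed


text \<open>The limits lie symmetrically to the direction \<open>c\<close>, at the angle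
  \<open>ta\<close>. For \<open>m\<close> with \<open>pi / m < ta\<close>, both lines through 0 used
  in \<open>koebe_lemma\<close> separate them, so the connected sets cross both lines. The exponent
  stays fixed while \<open>ep\<close> tends to 0.\<close>

lemma koebe_arcs:
 fixes g :: "complex => complex" and a b :: "nat => complex"
 assumes hl: "g hol ball 0 1" and bd: "bounded (g ` ball 0 1)"
  and c: "cmod c = 1" and ta: "0 < ta" "ta <= pi / 2" and lim: "a ----> c * cis (- ta)" "b ----> c * cis ta"
  and A: "!!ep. ep > 0 ==> EV n. EX A. compact A & connected A & A <= ball 0 1 & a n : A & b n : A &
    (ALL z:A. cmod (g z - p) <= ep)"
 shows "g 0 = p"
proof -
 obtain k :: nat where k: "pi / ta < real k" using reals_Archimedean2 by blast
 define m where "m = max k 2"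
 have m: "m >= 2" "pi / ta < real m" using k by (auto simp: m_def)
 define s where "s = pi / real m"
 have s: "0 < s" "s < ta" using m ta by (auto simp: s_def field_simps)
 obtain M0 where M0: "!!z. z : ball 0 1 ==> cmod (g z) <= M0" using bd unfolding bounded_iff by blast
 define M where "M = M0 + cmod p"
 define u where "u z = g (c * z) - p" for z
 have cb: "c * z : ball 0 1" if "z : ball 0 1" for z using that c by (simp add: norm_mult)
 have u_hol: "u hol ball 0 1"
 proof -
  have lin: "(%z. c * z) hol ball 0 1" by simp
  have im: "(%z. c * z) ` ball 0 1 <= ball 0 1" using cb by blast
  have "(%z. g (c * z)) hol ball 0 1" using holomorphic_on_compose_gen[OF lin hl im] by (simp add: o_def)
  thus ?thesis unfolding u_def by (intro holomorphic_intros)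
 qed
 have uM: "cmod (u z) <= M" if "z : ball 0 1" for z
  using M0[OF cb[OF that]] norm_triangle_ineq4[of "g (c * z)" p] by (simp add: u_def M_def)
 have cc: "c * cnj c = 1" using c by (simp add: complex_norm_square[symmetric])
 define a' where "a' n = cnj c * a n" for n
 define b' where "b' n = cnj c * b n" for n
 have la: "a' ----> cis (- ta)"
  using tendsto_mult_left[OF lim(1), of "cnj c"] cc by (simp add: a'_def[abs_def] mult.assoc[symmetric] mult.commute[of "cnj c" c])
 have lb: "b' ----> cis ta"
  using tendsto_mult_left[OF lim(2), of "cnj c"] cc by (simp add: b'_def[abs_def] mult.assoc[symmetric] mult.commute[of "cnj c" c])
 have sgn: "sin ta > 0" "sin (ta + s) > 0" "sin (ta - s) > 0" using s ta by (auto intro!: sin_gt_zero)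
 have e1: "EV n. Im (a' n) < 0" by (rule order_tendstoD[OF tendsto_Im[OF la]]) (use sgn in simp)
 have e2: "EV n. 0 < Im (b' n)" by (rule order_tendstoD[OF tendsto_Im[OF lb]]) (use sgn in simp)
 have e3: "EV n. Im (a' n * cis (- s)) < 0"
 proof (rule order_tendstoD)
  show "(%n. Im (a' n * cis (- s))) ----> Im (cis (- ta) * cis (- s))" by (intro tendsto_intros la)
  have "cis (- ta) * cis (- s) = cis (- (ta + s))" by (simp add: cis_mult)
  thus "Im (cis (- ta) * cis (- s)) < 0" using sgn(2) by (metis cis.sel(2) neg_less_0_iff_less sin_minus)
 qed
 have e4: "EV n. 0 < Im (b' n * cis (- s))"
 proof (rule order_tendstoD)
  show "(%n. Im (b' n * cis (- s))) ----> Im (cis ta * cis (- s))" by (intro tendsto_intros lb)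
  have "cis ta * cis (- s) = cis (ta - s)" by (simp add: cis_mult)
  thus "0 < Im (cis ta * cis (- s))" using sgn(3) by simp
 qed
 have bound: "cmod (u 0) ^ (2 * m) <= ep * M ^ (2 * m - 1)" if ep: "ep > 0" for ep
 proof -
  have "EX n. Im (a' n) < 0 & 0 < Im (b' n) & Im (a' n * cis (- s)) < 0 & 0 < Im (b' n * cis (- s)) &
   (EX A. compact A & connected A & A <= ball 0 1 & a n : A & b n : A & (ALL z:A. cmod (g z - p) <= ep))"
   using eventually_happens'[OF sequentially_bot eventually_conj[OF e1 eventually_conj[OF e2 eventually_conj[OF e3 eventually_conj[OF e4 A[OF ep]]]]]]
   by blast
  then obtain n A where n: "Im (a' n) < 0" "0 < Im (b' n)" "Im (a' n * cis (- s)) < 0" "0 < Im (b' n * cis (- s))"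
   and A: "compact A" "connected A" "A <= ball 0 1" "a n : A" "b n : A" "!!z. z : A ==> cmod (g z - p) <= ep" by auto
  define B where "B = (%z. cnj c * z) ` A"
  show ?thesis
  proof (rule koebe_lemma[OF u_hol uM, of B])
   show "compact B" unfolding B_def using A(1) by (intro compact_continuous_image continuous_intros)
   show "connected B" unfolding B_def using A(2) by (intro connected_continuous_image continuous_intros)
   show "B <= ball 0 1" using A(3) c by (auto simp: B_def norm_mult)
   show "cmod (u z) <= ep" if "z : B" for z
   proof -
    obtain y where y: "y : A" "z = cnj c * y" using `z : B` by (auto simp: B_def)
    have "c * z = y" using cc y(2) by simp
    thus ?thesis using A(6)[OF y(1)] by (simp add: u_def)
   qed
   show "a' n : B" "b' n : B" using A(4,5) by (auto simp: B_def a'_def b'_def)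
   show "Im (a' n) <= 0" "0 <= Im (b' n)" using n by auto
   show "Im (a' n * cis (- (pi / real m))) <= 0" "0 <= Im (b' n * cis (- (pi / real m)))" using n(3,4) unfolding s_def by auto
  qed (use ep m in auto)
 qed
 have "((%ep. ep * M ^ (2 * m - 1)) ---> 0 * M ^ (2 * m - 1)) (at_right 0)" by (intro tendsto_intros)
 hence "cmod (u 0) ^ (2 * m) <= 0"
  by (intro tendsto_lowerbound[where F = "at_right (0::real)" and f = "%ep. ep * M ^ (2 * m - 1)"])
   (use bound in "auto simp: eventually_at_right_less intro: eventually_mono[OF eventually_at_right_less[of 0]]")
 hence "cmod (u 0) ^ (2 * m) = 0" by (intro antisym) auto
 hence "u 0 = 0" by simp
 thus ?thesis by (simp add: u_def)
qed

text \<open>The direction \<open>c\<close> is the midpoint of an arc between \<open>a0\<close> and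
  \<open>b0\<close> of at most a half circle; if the angle is negative, \<open>a\<close> and
  \<open>b\<close> change roles.\<close>

lemma koebe_circle:
 fixes g :: "complex => complex" and a b :: "nat => complex"
 assumes hl: "g hol ball 0 1" and bd: "bounded (g ` ball 0 1)"
  and n: "cmod a0 = 1" "cmod b0 = 1" "a0 ~= b0" and lim: "a ----> a0" "b ----> b0"
  and A: "!!ep. ep > 0 ==> EV n. EX A. compact A & connected A & A <= ball 0 1 & a n : A & b n : A &
    (ALL z:A. cmod (g z - p) <= ep)"
 shows "g 0 = p"
proof -
 define ta where "ta = Arg (b0 / a0) / 2"
 have nz: "a0 ~= 0" "b0 ~= 0" using n by auto
 have ba: "b0 / a0 = cis (2 * ta)" using cis_Arg[of "b0 / a0"] nz n by (simp add: ta_def sgn_div_norm norm_divide)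
 have r: "- pi < 2 * ta" "2 * ta <= pi" using Arg_bounded[of "b0 / a0"] by (auto simp: ta_def)
 have "ta ~= 0" using ba n(3) by auto
 define c where "c = a0 * cis ta"
 have c: "cmod c = 1" using n by (simp add: c_def norm_mult)
 have a0: "a0 = c * cis (- ta)" by (simp add: c_def cis_mult)
 have b0: "b0 = c * cis ta"
 proof -
  have "b0 = a0 * cis (2 * ta)" using ba nz by (simp add: field_simps)
  thus ?thesis by (simp add: c_def cis_mult)
 qed
 show ?thesis
 proof (cases "ta > 0")
  case True
  thus ?thesis using koebe_arcs[OF hl bd c _ _ _ _ A, of ta] r lim a0 b0 by auto
 next
  case False
  have A': "EV n. EX A. compact A & connected A & A <= ball 0 1 & b n : A & a n : A &
    (ALL z:A. cmod (g z - p) <= ep)" if "ep > 0" for ep by (rule eventually_mono[OF A[OF that]]) blast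
  show ?thesis using koebe_arcs[OF hl bd c _ _ _ _ A', of "- ta"] r lim a0 b0 False `ta ~= 0` by auto
 qed
qed

section \<open>Jordan domains and the extension of Riemann maps to the boundary\<close>

lemma simple_loop_start_at:
 assumes "simple_path c" "pathfinish c = pathstart c" "p : path_image c"
 obtains c' where "simple_path c'" "pathstart c' = p" "pathfinish c' = p" "path_image c' = path_image c"
proof -
 obtain t where t: "t : {0..1}" "c t = p" using assms(3) by (auto simp: path_image_def)
 show ?thesis by (rule that[of "shiftpath t c"])
   (use t assms in "auto simp: simple_path_shiftpath pathstart_shiftpath pathfinish_shiftpath path_image_shiftpath")
qed

lemma jordan_domain_curve:
 assumes "bounded_jordan_domain H"
 obtains c where "simple_path c" "pathfinish c = pathstart c" "path_image c = frontier H"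
  "H = inside (frontier H)"
proof -
 have H: "open H" "connected H" "bounded H" "H ~= {}" using assms by (auto simp: bounded_jordan_domain_def)
 obtain c where c: "simple_path c" "pathfinish c = pathstart c" "path_image c = frontier H"
  using assms by (auto simp: bounded_jordan_domain_def jordan_curve_def)
 note J = Jordan_inside_outside[OF c(1,2), unfolded c(3)]
 have disj: "H Int frontier H = {}" using H(1) by (simp add: frontier_def interior_open)
 have whole: "H = U" if U: "connected U" "frontier U = frontier H" "U Int frontier H = {}" "H Int U ~= {}" for U
 proof
  show "U <= H" using connected_Int_frontier[OF U(1)] U(3,4) by auto
  show "H <= U" using connected_Int_frontier[OF H(2)] U(2,4) disj by auto
 qed
 have "H Int outside (frontier H) = {}"
 proof (rule ccontr)
  assume "H Int outside (frontier H) ~= {}"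
  hence "H = outside (frontier H)" using J by (intro whole) auto
  thus False using J H(3) by simp
 qed
 moreover have "H <= inside (frontier H) Un outside (frontier H)" using J disj by blast
 ultimately have "H Int inside (frontier H) ~= {}" using H(4) by blast
 hence "H = inside (frontier H)" using J by (intro whole) auto
 thus ?thesis using that[OF c] by blast
qed

text \<open>Janiszewski's theorem for the boundary curve and the closed set \<open>T\<close>, which
  consists of the part \<open>si\<close> of the curve away from \<open>p\<close> and of the outside
  of \<open>ball p e\<close>. Their intersection is the arc \<open>si\<close>, which is connected,
  so two points separated by neither set are not separated by the union.\<close>

lemma jordan_local_connectivity:
 assumes bj: "bounded_jordan_domain H" and p: "p : frontier H" and e: "e > 0"
 obtains d where "d > 0" "!!x y. x : H ==> y : H ==> dist x p < d ==> dist y p < d ==> connected_component (H Int ball p e) x y"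
proof -
 have H: "open H" "connected H" using bj by (auto simp: bounded_jordan_domain_def)
 have disj: "H Int frontier H = {}" using H(1) by (simp add: frontier_def interior_open)
 obtain c0 where c0: "simple_path c0" "pathfinish c0 = pathstart c0" "path_image c0 = frontier H"
  using jordan_domain_curve[OF bj] by metis
 obtain c where c: "simple_path c" "pathstart c = p" "pathfinish c = p" "path_image c = frontier H"
  using simple_loop_start_at[OF c0(1,2)] c0(3) p by auto
 have cc: "continuous_on {0..1} c" using c(1) by (simp add: simple_path_def path_def)
 have c01: "c 0 = p" "c 1 = p" using c(2,3) by (auto simp: pathstart_def pathfinish_def)
 obtain d1 where d1: "d1 > 0" "!!t. t : {0..1} ==> dist t 0 < d1 ==> dist (c t) (c 0) < e"
  using cc e unfolding continuous_on_iff by (metis atLeastAtMost_iff order_refl zero_le_one)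
 obtain d2 where d2: "d2 > 0" "!!t. t : {0..1} ==> dist t 1 < d2 ==> dist (c t) (c 1) < e"
  using cc e unfolding continuous_on_iff by (metis atLeastAtMost_iff order_refl zero_le_one)
 define et where "et = min (1/4) (min (d1/2) (d2/2))"
 have et: "0 < et" "et < 1/2" "et < d1" "et < d2" using d1 d2 by (auto simp: et_def)
 define si where "si = c ` {et..1-et}"
 have sub: "{et..1-et} <= {0..1}" using et by auto
 have s: "compact si" "connected si"
  unfolding si_def using continuous_on_subset[OF cc sub] by (auto intro: compact_continuous_image connected_continuous_image)
 have ps: "p ~: si"
 proof
  assume "p : si"
  then obtain t where t: "t : {et..1-et}" "c t = c 0" using c01 by (auto simp: si_def)
  thus False using c(1) et unfolding simple_path_def loop_free_def by force
 qed
 define T where "T = si Un - ball p e"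
 have rest: "c t : si Un ball p e" if t: "t : {0..1}" for t
 proof -
  consider "t < et" | "t > 1 - et" | "t : {et..1-et}" by force
  thus ?thesis
  proof cases
   case 1
   thus ?thesis using d1(2)[OF t] t et c01 by (auto simp: dist_commute)
  next
   case 2
   thus ?thesis using d2(2)[OF t] t et c01 by (auto simp: dist_real_def dist_commute)
  qed (auto simp: si_def)
 qed
 have sf: "si <= frontier H" unfolding si_def c(4)[symmetric] path_image_def using sub by blast
 have gT: "frontier H Int T = si"
 proof
  show "si <= frontier H Int T" using sf by (auto simp: T_def)
  show "frontier H Int T <= si" using rest unfolding c(4)[symmetric] path_image_def T_def by blast
 qed
 have cT: "closed T" unfolding T_def using s(1) by (intro closed_Un compact_imp_closed closed_Compl open_ball)
 have "open (- T)" using cT by auto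
 moreover have "p : - T" using ps e by (auto simp: T_def)
 ultimately obtain d where d: "d > 0" "ball p d <= - T" by (meson openE)
 show ?thesis
 proof (rule that[OF d(1)])
  fix x y assume xy: "x : H" "y : H" "dist x p < d" "dist y p < d"
  have "connected_component (- T) x y" unfolding connected_component_def
   by (rule exI[of _ "ball p d"]) (use xy(3,4) d(2) in "simp add: dist_commute")
  moreover have "connected_component (- frontier H) x y" using xy(1,2) H(2) disj unfolding connected_component_def by auto
  moreover have "compact (frontier H)" using bj by (intro compact_frontier_bounded) (simp add: bounded_jordan_domain_def)
  ultimately have "connected_component (- (frontier H Un T)) x y" using Janiszewski[OF _ cT] gT s(2) by simp
  then obtain S where S: "connected S" "S <= - (frontier H Un T)" "x : S" "y : S" unfolding connected_component_def by blast
  have "S <= H" using connected_Int_frontier[OF S(1), of H] S(2,3) xy(1) by blast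
  thus "connected_component (H Int ball p e) x y"
   unfolding connected_component_def using S by (intro exI[of _ S]) (auto simp: T_def)
 qed
qed

text \<open>Otherwise two sequences with the same limit \<open>p\<close> on the boundary have images
  with distinct limits on the circle. Short connections in \<open>H\<close> near \<open>p\<close>
  become connected sets between neighbourhoods of these limits on which \<open>g\<close> is close to
  \<open>p\<close>, and Koebe's lemma yields \<open>g 0 = p\<close>, although \<open>g 0\<close>
  lies in \<open>H\<close>.\<close>

lemma riemann_map_uniformly_continuous:
 assumes bj: "bounded_jordan_domain H" and fi: "fi hol H" "g hol ball 0 1"
  "!!z. z : H ==> fi z : ball 0 1 & g (fi z) = z" "!!z. z : ball 0 1 ==> g z : H & fi (g z) = z"
 shows "uniformly_continuous_on H fi"
proof (rule ccontr)
 have H: "open H" "bounded H" using bj by (auto simp: bounded_jordan_domain_def)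
 have gc: "continuous_on (ball 0 1) g" "continuous_on H fi" using fi(1,2) by (auto intro: holomorphic_on_imp_continuous_on)
 assume "~ uniformly_continuous_on H fi"
 then obtain e where e: "e > 0" "ALL d>0. EX x:H. EX y:H. dist y x < d & ~ dist (fi y) (fi x) < e"
  unfolding uniformly_continuous_on_def by auto
 have "EX x y. x : H & y : H & dist y x < 1 / real (Suc n) & ~ dist (fi y) (fi x) < e" for n
  using spec[OF e(2), of "1 / real (Suc n)"] by auto
 then obtain x y where xyH: "!!n. x n : H" "!!n. y n : H" and xy: "!!n. dist (y n) (x n) < 1 / real (Suc n)" "!!n. ~ dist (fi (y n)) (fi (x n)) < e"
  by metis
 have cH: "compact (closure H)" using H(2) by simp
 have "compact (closure H \<times> (cball (0::complex) 1 \<times> cball (0::complex) 1))" using cH by (intro compact_Times) auto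
 moreover have "(x n, fi (x n), fi (y n)) : closure H \<times> (cball 0 1 \<times> cball 0 1)" for n
  using xyH fi(3) closure_subset[of H] by (auto intro: less_imp_le)
 ultimately obtain l r where lr: "l : closure H \<times> (cball 0 1 \<times> cball 0 1)" "strict_mono r"
  "(%n. (x (r n), fi (x (r n)), fi (y (r n)))) ----> l" by (rule compact_subseq)
 obtain p a b where l: "l = (p, a, b)" by (metis prod_cases3)
 have lx: "(%n. x (r n)) ----> p" using tendsto_fst[OF lr(3)] l by simp
 have la: "(%n. fi (x (r n))) ----> a" using tendsto_fst[OF tendsto_snd[OF lr(3)]] l by simp
 have lb: "(%n. fi (y (r n))) ----> b" using tendsto_snd[OF tendsto_snd[OF lr(3)]] l by simp
 have ly: "(%n. y (r n)) ----> p"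
 proof (rule tendsto_close[OF _ lx])
  fix k
  have "1 / real (Suc (r k)) <= 1 / real (Suc k)" using seq_suble[OF lr(2), of k] by (simp add: frac_le)
  thus "dist (y (r k)) (x (r k)) < 1 / real (Suc k)" using xy(1)[of "r k"] by linarith
 qed
 have ab: "a ~= b"
 proof
  assume "a = b"
  hence "(%n. dist (fi (y (r n))) (fi (x (r n)))) ----> 0" using tendsto_dist[OF lb la] by simp
  hence "EV n. dist (fi (y (r n))) (fi (x (r n))) < e" using e(1) by (simp add: order_tendstoD)
  thus False using xy(2) by auto
 qed
 have pH: "p ~: H" by (metis gc H continuous_on_eq_continuous_at lx ly isCont_tendsto_compose la lb ab LIMSEQ_unique)
 hence pf: "p : frontier H" using lr(1) l H(1) by (simp add: frontier_def interior_open)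
 have bdry: "cmod w = 1" if w: "w : cball 0 1" "(%n. fi (u n)) ----> w" "u ----> p" "!!n. u n : H" for w u
 proof (rule ccontr)
  assume "cmod w ~= 1"
  hence wb: "w : ball 0 1" using w(1) by simp
  hence "isCont g w" using gc(1) continuous_on_eq_continuous_at by blast
  hence "(%n. g (fi (u n))) ----> g w" using w(2) isCont_tendsto_compose by blast
  moreover have "(%n. g (fi (u n))) = u" using w(4) fi(3) by auto
  ultimately have "g w = p" using w(3) LIMSEQ_unique by simp
  thus False using pH fi(4)[OF wb] by simp
 qed
 have "g 0 = p"
 proof (rule koebe_circle[OF fi(2) _ _ _ ab la lb])
  have "g ` ball 0 1 <= H" using fi(4) by blast
  thus "bounded (g ` ball 0 1)" using H(2) bounded_subset by blast
  show "cmod a = 1" using bdry[OF _ la lx] lr(1) l xyH by simp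
  show "cmod b = 1" using bdry[OF _ lb ly] lr(1) l xyH by simp
  fix ep :: real assume ep: "ep > 0"
  obtain d where d: "d > 0" "!!x y. x : H ==> y : H ==> dist x p < d ==> dist y p < d ==> connected_component (H Int ball p ep) x y"
   using jordan_local_connectivity[OF bj pf ep] by auto
  have "EV n. dist (x (r n)) p < d & dist (y (r n)) p < d" using tendstoD[OF lx d(1)] tendstoD[OF ly d(1)] by eventually_elim auto
  thus "EV n. EX A. compact A & connected A & A <= ball 0 1 & fi (x (r n)) : A & fi (y (r n)) : A &
    (ALL z:A. cmod (g z - p) <= ep)"
  proof (rule eventually_mono)
   fix n assume n: "dist (x (r n)) p < d & dist (y (r n)) p < d"
   have "connected_component (H Int ball p ep) (x (r n)) (y (r n))" using d(2) xyH n by blast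
   hence "path_component (H Int ball p ep) (x (r n)) (y (r n))" using H(1) by (simp add: open_path_connected_component open_Int)
   then obtain k where k: "path k" "path_image k <= H Int ball p ep" "pathstart k = x (r n)" "pathfinish k = y (r n)"
    unfolding path_component_def by blast
   define A where "A = fi ` path_image k"
   have kc: "continuous_on (path_image k) fi" using gc(2) k(2) continuous_on_subset by blast
   have "compact A" unfolding A_def using kc k(1) by (intro compact_continuous_image compact_path_image)
   moreover have "connected A" unfolding A_def using kc k(1) by (intro connected_continuous_image connected_path_image)
   moreover have "A <= ball 0 1" unfolding A_def using k(2) fi(3) by blast
   moreover have "fi (x (r n)) : A" "fi (y (r n)) : A" unfolding A_def using k(3,4) by (metis imageI pathstart_in_path_image pathfinish_in_path_image)+
   moreover have "cmod (g z - p) <= ep" if "z : A" for z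
   proof -
    obtain w where "w : path_image k" "z = fi w" using `z : A` by (auto simp: A_def)
    moreover have "g (fi w) = w" "dist p w < ep" using k(2) fi(3) `w : path_image k` by auto
    ultimately show ?thesis by (simp add: dist_norm norm_minus_commute)
   qed
   ultimately show "EX A. compact A & connected A & A <= ball 0 1 & fi (x (r n)) : A & fi (y (r n)) : A &
    (ALL z:A. cmod (g z - p) <= ep)" by auto
  qed
 qed
 thus False using pH fi(4)[of 0] by auto
qed

lemma norm_cis_diff_le: "cmod (cis a - cis b) <= abs(a - b)"
proof -
 have "cis a - cis b = cis b * (exp (\<i> * of_real (a - b)) - 1)" by (simp add: cis_conv_exp exp_diff field_simps)
 hence "cmod (cis a - cis b) = 2 * abs(sin ((a - b) / 2))" by (simp only: norm_mult norm_cis dist_exp_i_1)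
 also have "... <= 2 * abs((a - b) / 2)" by (intro mult_left_mono abs_sin_x_le_abs_x) auto
 finally show ?thesis by simp
qed

lemma rotations_dense:
 assumes "cmod u = r" "cmod v = r" "r > 0" "m > 0"
 shows "EX k<m. cmod (cis (2 * pi / real m) ^ k * u - v) <= r * (2 * pi / real m)"
proof -
 have u0: "u ~= 0" using assms by auto
 define th where "th = Arg2pi (v / u)"
 have th: "0 <= th" "th < 2 * pi" using Arg2pi[of "v / u"] by (auto simp: th_def)
 have vu: "v = u * cis th"
 proof -
  have "v / u = of_real (cmod (v / u)) * exp (\<i> * of_real th)" unfolding th_def using Arg2pi_eq by simp
  also have "cmod (v / u) = 1" using assms by (simp add: norm_divide)
  finally show ?thesis using u0 by (simp add: cis_conv_exp field_simps)
 qed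
 define k where "k = nat \<lfloor>th * real m / (2 * pi)\<rfloor>"
 have x: "0 <= th * real m / (2 * pi)" "th * real m / (2 * pi) < real m" using th assms(4) by (auto simp: field_simps)
 have k1: "real k <= th * real m / (2 * pi)" "th * real m / (2 * pi) < real k + 1" using x(1) unfolding k_def by auto
 have km: "k < m" using k1 x by simp
 have "abs(real k * (2 * pi / real m) - th) <= 2 * pi / real m"
 proof -
  have m: "real m > 0" using assms(4) by simp
  have "real k * (2 * pi / real m) <= th" "th <= (real k + 1) * (2 * pi / real m)" using k1 m by (simp_all add: field_simps)
  hence "th <= real k * (2 * pi / real m) + 2 * pi / real m" by (simp only: distrib_right)
  moreover have "0 <= 2 * pi / real m" by simp
  ultimately show ?thesis using `real k * (2 * pi / real m) <= th` unfolding abs_le_iff by (intro conjI; linarith)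
 qed
 hence "cmod (cis (real k * (2 * pi / real m)) - cis th) <= 2 * pi / real m" using norm_cis_diff_le order_trans by blast
 moreover have "cis (2 * pi / real m) ^ k * u - v = u * (cis (real k * (2 * pi / real m)) - cis th)"
  by (simp add: vu Complex.DeMoivre algebra_simps)
 ultimately have "cmod (cis (2 * pi / real m) ^ k * u - v) <= r * (2 * pi / real m)"
  using assms by (simp only: norm_mult) (intro mult_left_mono, auto)
 thus ?thesis using km by blast
qed

text \<open>Near \<open>p\<close> a centre \<open>c\<close> in \<open>H\<close> and a point
  \<open>q\<close> outside are chosen, and \<open>qs\<close> is multiplied over \<open>m\<close>
  rotations about \<open>c\<close>. Let \<open>W\<close> be the region inside the circle through
  \<open>q\<close> where all rotated points lie in \<open>H\<close>. At a frontier point of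
  \<open>W\<close> inside the circle some rotated point lies on the boundary near \<open>p\<close>,
  so the product vanishes; on the circle there is no frontier point, as one of its rotations would
  lie next to \<open>q\<close>, outside \<open>closure H\<close>. The maximum principle gives a zero
  at \<open>c\<close>.\<close>

lemma vanishing_on_boundary_arc:
 assumes bj: "bounded_jordan_domain H" and cont: "continuous_on (closure H) qs" and hl: "qs hol H"
  and p: "p : frontier H" and rh: "rh > 0" and van: "!!z. z : frontier H ==> dist z p < rh ==> qs z = 0"
 shows "EX c:H. qs c = 0"
proof -
 have H: "open H" "bounded H" using bj by (auto simp: bounded_jordan_domain_def)
 obtain c0 where c0: "simple_path c0" "pathfinish c0 = pathstart c0" "path_image c0 = frontier H" "H = inside (frontier H)"
  using jordan_domain_curve[OF bj] by auto
 note J = Jordan_inside_outside[OF c0(1,2), unfolded c0(3), folded c0(4)]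
 have clH: "closure H Int outside (frontier H) = {}" using J by (simp add: closure_Un_frontier Int_Un_distrib2) (use in blast)
 have "p : closure (outside (frontier H))" using J p by (simp add: closure_Un_frontier)
 then obtain q where q: "q : outside (frontier H)" "dist q p < rh / 4" using rh closure_approachable by (metis zero_less_divide_iff zero_less_numeral)
 have "p : closure H" using p by (simp add: frontier_def)
 then obtain c where c: "c : H" "dist c p < rh / 4" using rh closure_approachable by (metis zero_less_divide_iff zero_less_numeral)
 define r where "r = dist q c"
 have "c ~= q" using q c clH closure_subset by blast
 hence r: "r > 0" by (simp add: r_def)
 have r2: "r < rh / 2" unfolding r_def using q c dist_triangle2[of q c p] by simp
 obtain et where et: "et > 0" "ball q et <= outside (frontier H)" using J q(1) by (meson openE)
 obtain k :: nat where k: "r * (2 * pi) / et < real k" using reals_Archimedean2 by blast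
 define m where "m = max k 1"
 have "m > 0" "real k <= real m" by (auto simp: m_def)
 hence "r * (2 * pi) / et < real m" using k by simp
 hence m: "m > 0" "r * (2 * pi / real m) < et" using `m > 0` et(1) by (auto simp: field_simps)
 define om where "om = cis (2 * pi / real m)"
 have nom: "cmod (om ^ k) = 1" for k by (simp add: om_def norm_power)
 define R where "R k z = c + om ^ k * (z - c)" for k z
 have Rc: "continuous_on S (R k)" for k S unfolding R_def by (intro continuous_intros)
 have Rd: "cmod (R k z - c) = cmod (z - c)" for k z by (simp add: R_def norm_mult nom)
 define W where "W = ball c r Int (\<Inter>k\<in>{..<m}. R k -` H)"
 have oW: "open W" unfolding W_def by (intro open_Int open_ball open_INT) (auto intro!: open_vimage H(1) Rc)
 have Rcl: "R k z : closure H" if "z : closure W" "k < m" for k z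
 proof -
  have "R k ` closure W <= closure H" using that(2) closure_subset[of H] by (intro image_closure_subset Rc) (auto simp: W_def)
  thus ?thesis using that by blast
 qed
 define Q where "Q z = (\<Prod>k<m. qs (R k z))" for z
 have "cmod (Q c) <= 0"
 proof (rule maximum_modulus_frontier[of Q W])
  have 1: "(%z. qs (R k z)) hol W" if "k < m" for k
  proof -
   have lin: "R k hol W" unfolding R_def by (intro holomorphic_intros)
   have im: "R k ` W <= H" using that by (auto simp: W_def)
   show ?thesis using holomorphic_on_compose_gen[OF lin hl im] by (simp add: o_def)
  qed
  hence "Q hol W" unfolding Q_def by (intro holomorphic_on_prod) auto
  thus "Q hol interior W" using oW by (simp add: interior_open)
  show "continuous_on (closure W) Q"
   unfolding Q_def by (intro continuous_on_prod continuous_on_compose2[OF cont Rc]) (use Rcl in auto)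
  show "bounded W" unfolding W_def by auto
  show "c : W" using c(1) r by (auto simp: W_def R_def)
  fix z assume "z : frontier W"
  hence z: "z : closure W" "z ~: W" using oW by (auto simp: frontier_def interior_open)
  have "closure W <= cball c r" unfolding W_def by (intro closure_minimal) (auto simp: less_imp_le)
  hence zr: "cmod (z - c) <= r" using z(1) by (auto simp: dist_norm norm_minus_commute)
  show "cmod (Q z) <= 0"
  proof (cases "cmod (z - c) = r")
   case True
   have "cmod (q - c) = r" by (simp add: r_def dist_norm)
   then obtain k where k: "k < m" "cmod (om ^ k * (z - c) - (q - c)) <= r * (2 * pi / real m)"
    using rotations_dense[OF True _ r m(1)] unfolding om_def by blast
   hence "dist q (R k z) < et" using m(2) by (simp add: dist_norm R_def norm_minus_commute algebra_simps)
   hence "R k z : outside (frontier H)" using et(2) by auto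
   thus ?thesis using Rcl[OF z(1) k(1)] clH by blast
  next
   case False
   hence zr': "cmod (z - c) < r" using zr by simp
   then obtain k where k: "k < m" "R k z ~: H" using z(2) by (auto simp: W_def dist_norm norm_minus_commute)
   hence "R k z : frontier H" using Rcl[OF z(1) k(1)] H(1) by (simp add: frontier_def interior_open)
   moreover have "dist (R k z) p < rh"
   proof -
    have "dist (R k z) c < rh / 2" using Rd[of k z] zr' r2 by (simp add: dist_norm)
    thus ?thesis using c(2) dist_triangle[of "R k z" p c] rh by simp
   qed
   ultimately have "qs (R k z) = 0" using van by blast
   thus ?thesis using k(1) by (auto simp: Q_def)
  qed
 qed
 hence "Q c = 0" by simp
 hence "qs c = 0" by (simp add: Q_def R_def)
 thus ?thesis using c(1) by blast
qed

text \<open>If both arcs of the curve from \<open>p\<close> to \<open>q\<close> contained a point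
  outside \<open>K\<close>, these two points would split the curve into two closed arcs that
  separate \<open>K\<close>. So \<open>K\<close> contains an open arc; the midpoint of its parameter
  interval gives a point at positive distance from the rest of the curve.\<close>

lemma connected_subset_contains_arc:
 fixes c :: "real => complex"
 assumes c: "simple_path c" "pathfinish c = pathstart c" and K: "connected K" "K <= path_image c"
  and pq: "p : K" "q : K" "p ~= q"
 obtains p0 rh where "p0 : path_image c" "rh > 0" "!!z. z : path_image c ==> dist z p0 < rh ==> z : K"
proof -
 have "p : path_image c" using pq(1) K(2) by blast
 then obtain d where d: "simple_path d" "pathstart d = p" "pathfinish d = p" "path_image d = path_image c"
  using simple_loop_start_at[OF c] by auto
 have dc: "continuous_on {0..1} d" using d(1) by (simp add: simple_path_def path_def)
 have dI: "path_image c = d ` {0..1}" using d(4) by (simp add: path_image_def)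
 have d01: "d 0 = p" "d 1 = p" using d(2,3) by (auto simp: pathstart_def pathfinish_def)
 have inj: "x = y" if "d x = d y" "x : {0..1}" "y : {0<..<1}" for x y
  using d(1) that unfolding simple_path_def loop_free_def by force
 have "q : path_image d" using pq(2) K(2) d(4) by blast
 then obtain t0 where t0: "t0 : {0..1}" "d t0 = q" unfolding path_image_def by blast
 have t01: "0 < t0" "t0 < 1" using t0 d01 pq(3) by (metis atLeastAtMost_iff less_eq_real_def)+
 have cpt: "compact (d ` {a..b})" if "0 <= a" "b <= 1" for a b
  using that by (intro compact_continuous_image continuous_on_subset[OF dc]) auto
 have fin: "EX p0 rh. p0 : path_image c & rh > 0 & (ALL z. z : path_image c --> dist z p0 < rh --> z : K)"
  if ab: "0 <= a" "a < b" "b <= 1" "d ` {a<..<b} <= K" for a b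
 proof -
  define p0 where "p0 = d ((a + b) / 2)"
  have mid: "(a + b) / 2 : {0<..<1}" "a < (a + b) / 2" "(a + b) / 2 < b" using ab by auto
  define C where "C = d ` {0..a} Un d ` {b..1}"
  have "p0 ~: C"
  proof
   assume "p0 : C"
   then obtain t where t: "t : {0..a} Un {b..1}" "d t = d ((a + b) / 2)" unfolding C_def p0_def image_Un[symmetric] by force
   hence "t = (a + b) / 2" using ab by (intro inj[OF _ _ mid(1)]) auto
   thus False using t(1) mid by auto
  qed
  moreover have "open (- C)" unfolding C_def using ab by (intro open_Compl closed_Un compact_imp_closed cpt) auto
  ultimately obtain rh where rh: "rh > 0" "ball p0 rh <= - C" by (meson ComplI openE)
  show ?thesis
  proof (intro exI conjI allI impI)
   show "rh > 0" by (rule rh(1))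
   show "p0 : path_image c" unfolding dI p0_def using mid(1) by auto
   fix z assume z: "z : path_image c" "dist z p0 < rh"
   obtain t where t: "t : {0..1}" "z = d t" using z(1) unfolding dI by blast
   have "z ~: C" using z(2) rh(2) by (auto simp: dist_commute)
   hence "t : {a<..<b}" using t by (auto simp: C_def)
   thus "z : K" using t ab(4) by blast
  qed
 qed
 show ?thesis
 proof (cases "d ` {0<..<t0} <= K | d ` {t0<..<1} <= K")
  case True
  hence "EX p0 rh. p0 : path_image c & rh > 0 & (ALL z. z : path_image c --> dist z p0 < rh --> z : K)"
   using fin[of 0 t0] fin[of t0 1] t01 by auto
  thus ?thesis using that by blast
 next
  case False
  then obtain t1 t2 where t: "t1 : {0<..<t0}" "d t1 ~: K" "t2 : {t0<..<1}" "d t2 ~: K" by blast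
  define A where "A = d ` {t1..t2}"
  define B where "B = d ` {0..t1} Un d ` {t2..1}"
  have "closed A" "closed B" unfolding A_def B_def using t by (auto intro!: compact_imp_closed cpt closed_Un)
  moreover have "K <= A Un B"
  proof
   fix z assume "z : K"
   then obtain t where t: "t : {0..1}" "z = d t" using K(2) unfolding dI by blast
   hence "t : {t1..t2} | t : {0..t1} | t : {t2..1}" by auto
   thus "z : A Un B" using t by (auto simp: A_def B_def)
  qed
  moreover have "A Int B Int K = {}"
  proof (rule ccontr)
   assume "A Int B Int K ~= {}"
   then obtain s s' where s: "s : {t1..t2}" "s' : {0..t1} Un {t2..1}" "d s' = d s" "d s : K"
   proof -
    obtain z where z: "z : A" "z : B" "z : K" using `A Int B Int K ~= {}` by blast
    obtain s where s: "s : {t1..t2}" "z = d s" using z(1) unfolding A_def by blast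
    obtain s' where s': "s' : {0..t1} Un {t2..1}" "z = d s'" using z(2) unfolding B_def by blast
    show ?thesis by (rule that[OF s(1) s'(1)]) (use s s' z in auto)
   qed
   have "s' = s" using s t by (intro inj[OF s(3)]) auto
   hence "s = t1 | s = t2" using s by auto
   thus False using s(4) t by auto
  qed
  moreover have "A Int K ~= {}" using t0 pq(2) t by (auto simp: A_def intro!: image_eqI[of _ d t0])
  moreover have "p : B" using d01 t by (auto simp: B_def intro!: image_eqI[of _ d 0])
  ultimately show ?thesis using K(1) pq(1) unfolding connected_closed by blast
 qed
qed

text \<open>Uniform continuity gives the extension; injectivity on the boundary is the main point.
  If \<open>p\<close> and \<open>q\<close> had the same image \<open>ze\<close>, the cluster set
  \<open>K\<close> of the inverse map at \<open>ze\<close> would be a connected part of the boundary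
  that contains both, hence would contain an arc on which \<open>fi - ze\<close> vanishes; then it
  would vanish somewhere in \<open>H\<close>, where \<open>fi\<close> has values inside the disc.
  Compactness makes the inverse continuous.\<close>

theorem caratheodory_extension:
 assumes bj: "bounded_jordan_domain H"
 obtains fi g where "fi hol H" "g hol ball 0 1" "continuous_on (closure H) fi" "continuous_on (cball 0 1) g"
  "fi ` H = ball 0 1" "g ` ball 0 1 = H" "fi ` closure H = cball 0 1" "g ` cball 0 1 = closure H"
  "!!z. z : closure H ==> g (fi z) = z" "!!z. z : cball 0 1 ==> fi (g z) = z"
proof -
 have H: "open H" "bounded H" "connected H" "H ~= {}" using bj by (auto simp: bounded_jordan_domain_def)
 obtain c where c: "simple_path c" "pathfinish c = pathstart c" "path_image c = frontier H" "H = inside (frontier H)"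
  using jordan_domain_curve[OF bj] by auto
 have sc: "simply_connected H" using simply_connected_inside_simple_path[OF c(1)] c(3,4) by simp
 have "H ~= UNIV" using H(2) by auto
 then obtain fi0 g0 where fi0: "fi0 hol H" "g0 hol ball 0 1"
  "!!z. z : H ==> fi0 z : ball 0 1 & g0 (fi0 z) = z" "!!z. z : ball 0 1 ==> g0 z : H & fi0 (g0 z) = z"
  using Riemann_mapping_theorem[of H] H sc by blast
 have "uniformly_continuous_on H fi0" by (rule riemann_map_uniformly_continuous[OF bj fi0])
 then obtain fi where fi: "uniformly_continuous_on (closure H) fi" "!!x. x : H ==> fi0 x = fi x"
  by (rule uniformly_continuous_on_extension_on_closure) blast
 have fic: "continuous_on (closure H) fi" using fi(1) by (rule uniformly_continuous_imp_continuous)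
 have fih: "fi hol H" using fi0(1) fi(2) holomorphic_cong by metis
 have fib: "fi z : ball 0 1" "g0 (fi z) = z" if "z : H" for z using fi0(3)[OF that] fi(2)[OF that] by auto
 have gH: "g0 z : H" "fi (g0 z) = z" if "z : ball 0 1" for z using fi0(4)[OF that] fi(2) by auto
 have im1: "fi ` H = ball 0 1"
 proof
  show "fi ` H <= ball 0 1" using fib by blast
  show "ball 0 1 <= fi ` H" using gH by force
 qed
 have cH: "compact (closure H)" using H(2) by simp
 have cb: "closure (ball (0::complex) 1) = cball 0 1" by simp
 have im2: "fi ` closure H = cball 0 1"
 proof
  show "fi ` closure H <= cball 0 1" by (intro image_closure_subset fic closed_cball) (use fib(1) in force)
  have "closed (fi ` closure H)" using cH fic by (intro compact_imp_closed compact_continuous_image)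
  moreover have "ball 0 1 <= fi ` closure H" using im1 closure_subset by blast
  ultimately show "cball 0 1 <= fi ` closure H" using cb closure_minimal by metis
 qed
 have g0c: "continuous_on (ball 0 1) g0" using fi0(2) by (rule holomorphic_on_imp_continuous_on)
 have bdry: "cmod (fi z) = 1" if z: "z : frontier H" for z
 proof (rule ccontr)
  assume "cmod (fi z) ~= 1"
  have zc: "z : closure H" "z ~: H" using z H(1) by (auto simp: frontier_def interior_open)
  hence b: "fi z : ball 0 1" using im2 `cmod (fi z) ~= 1` by force
  obtain x where x: "!!n. x n : H" "x ----> z" using zc(1) closure_sequential by blast
  have "(%n. fi (x n)) ----> fi z"
   using fic zc(1) x closure_subset[of H] unfolding continuous_on_sequentially by (auto simp: o_def)
  moreover have "isCont g0 (fi z)" using g0c b continuous_on_eq_continuous_at by blast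
  ultimately have "(%n. g0 (fi (x n))) ----> g0 (fi z)" using isCont_tendsto_compose by blast
  hence "x ----> g0 (fi z)" using x(1) fib(2) by simp
  hence "z = g0 (fi z)" using x(2) LIMSEQ_unique by blast
  thus False using gH(1)[OF b] zc(2) by simp
 qed
 have injf: "p = q" if pq: "p : frontier H" "q : frontier H" "fi p = fi q" for p q
 proof (rule ccontr)
  assume ne: "p ~= q"
  define ze where "ze = fi p"
  define S where "S n = ball 0 1 Int ball ze (1 / real (Suc n))" for n
  define K where "K = (\<Inter>n. closure (g0 ` S n))"
  have gS: "g0 ` S n <= H" for n using gH by (auto simp: S_def)
  have clS: "closure (g0 ` S n) <= closure H" for n using gS by (rule closure_mono)
  have K1: "connected K" unfolding K_def
  proof (rule connected_nest)
   show "compact (closure (g0 ` S n))" for n using gS H(2) bounded_subset compact_closure by blast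
   show "connected (closure (g0 ` S n))" for n unfolding S_def
    by (intro connected_imp_connected_closure connected_continuous_image continuous_on_subset[OF g0c] convex_connected convex_Int convex_ball) auto
   show "closure (g0 ` S n) <= closure (g0 ` S m)" if "m <= n" for m n
   proof -
    have "1 / real (Suc n) <= 1 / real (Suc m)" using that by (simp add: field_simps)
    hence "S n <= S m" unfolding S_def by auto
    thus ?thesis by (intro closure_mono image_mono)
   qed
  qed
  have K2: "w : closure H & fi w = ze" if w: "w : K" for w
  proof -
   have wc: "w : closure H" using w clS by (auto simp: K_def)
   have "EX z. z : S n & dist (g0 z) w < 1 / real (Suc n)" for n
   proof -
    have "w : closure (g0 ` S n)" using w by (auto simp: K_def)
    thus ?thesis unfolding closure_approachable by (auto dest!: spec[of _ "1 / real (Suc n)"])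
   qed
   then obtain z where z: "!!n. z n : S n" "!!n. dist (g0 (z n)) w < 1 / real (Suc n)" by metis
   have lz: "z ----> ze" by (rule tendsto_close[OF _ tendsto_const]) (use z(1) in "auto simp: S_def dist_commute")
   have lg: "(%n. g0 (z n)) ----> w" by (rule tendsto_close[OF z(2) tendsto_const])
   have gin: "g0 (z n) : closure H" for n using gS[of n] z(1)[of n] closure_subset[of H] by blast
   have "(%n. fi (g0 (z n))) ----> fi w" using fic wc lg gin unfolding continuous_on_sequentially by (auto simp: o_def)
   moreover have "fi (g0 (z n)) = z n" for n using gH(2) z(1)[of n] by (auto simp: S_def)
   ultimately show ?thesis using lz wc LIMSEQ_unique by auto
  qed
  have z1: "cmod ze = 1" using bdry pq(1) by (simp add: ze_def)
  have K3: "K <= frontier H"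
  proof
   fix w assume w: "w : K"
   have "w ~: H" using K2[OF w] fib(1)[of w] z1 by auto
   thus "w : frontier H" using K2[OF w] H(1) by (simp add: frontier_def interior_open)
  qed
  have K4: "x : K" if x: "x : frontier H" "fi x = ze" for x unfolding K_def
  proof
   fix n
   have xc: "x : closure H" using x(1) by (simp add: frontier_def)
   then obtain u where u: "!!n. u n : H" "u ----> x" using closure_sequential by blast
   have "(%k. fi (u k)) ----> ze"
    using fic xc u closure_subset[of H] x(2) unfolding continuous_on_sequentially by (auto simp: o_def)
   moreover have "0 < 1 / real (Suc n)" by simp
   ultimately have "EV k. dist (fi (u k)) ze < 1 / real (Suc n)" by (rule tendstoD)
   hence "EV k. u k : closure (g0 ` S n)"
   proof (rule eventually_mono)
    fix k assume k: "dist (fi (u k)) ze < 1 / real (Suc n)"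
    have "fi (u k) : S n" using k fib(1)[OF u(1)[of k]] by (simp add: S_def dist_commute)
    hence "u k : g0 ` S n" using fib(2)[OF u(1)[of k]] by force
    thus "u k : closure (g0 ` S n)" using closure_subset[of "g0 ` S n"] by blast
   qed
   thus "x : closure (g0 ` S n)" using u(2) by (intro Lim_in_closed_set[of "closure (g0 ` S n)" u]) auto
  qed
  have "p : K" "q : K" using K4 pq by (auto simp: ze_def)
  then obtain p0 rh where p0: "p0 : frontier H" "rh > 0" "!!z. z : frontier H ==> dist z p0 < rh ==> z : K"
   using connected_subset_contains_arc[OF c(1,2) K1 _ _ _ ne] K3 unfolding c(3) by auto
  have "EX w:H. fi w - ze = 0"
   using fic fih p0 K2 by (intro vanishing_on_boundary_arc[OF bj _ _ p0(1,2)] continuous_intros holomorphic_intros) auto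
  then obtain w where "w : H" "fi w = ze" by auto
  thus False using fib(1)[of w] z1 by simp
 qed
 have inj: "inj_on fi (closure H)"
 proof (rule inj_onI)
  fix x y assume xy: "x : closure H" "y : closure H" "fi x = fi y"
  have fr: "u : H | u : frontier H" if "u : closure H" for u using that H(1) by (auto simp: frontier_def interior_open)
  show "x = y"
  proof (cases "x : H")
   case True
   hence "y : H" using fr[OF xy(2)] bdry[of y] fib(1)[of x] xy(3) by auto
   thus ?thesis using True fib(2) xy(3) by metis
  next
   case False
   hence xf: "x : frontier H" using fr xy(1) by blast
   hence "y : frontier H" using fr[OF xy(2)] bdry[of x] fib(1)[of y] xy(3) by auto
   thus ?thesis using injf xf xy(3) by blast
  qed
 qed
 define g where "g = inv_into (closure H) fi"
 have gl: "g (fi z) = z" if "z : closure H" for z unfolding g_def using inj that by simp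
 have gr: "fi (g z) = z" "g z : closure H" if "z : cball 0 1" for z
  unfolding g_def using that im2 by (metis f_inv_into_f, metis inv_into_into)
 have gg: "g z = g0 z" if "z : ball 0 1" for z using gH[OF that] gl[of "g0 z"] closure_subset[of H] by auto
 show ?thesis
 proof (rule that[OF fih _ fic _ im1 _ im2 _ gl gr(1)])
  show "g hol ball 0 1" using fi0(2) gg holomorphic_cong[OF refl] by metis
  show "continuous_on (cball 0 1) g" using continuous_on_inv[OF fic cH, of g] gl im2 by auto
  show "g ` ball 0 1 = H" using gg fib by (metis (no_types, lifting) image_cong im1 image_image image_ident)
  show "g ` cball 0 1 = closure H" using gl im2 by force
 qed
qed

section \<open>The upper half-plane as model of a Jordan domain with three marked points\<close>

definition cayley :: "complex => complex" where "cayley w = \<i> * (1 + w) / (1 - w)"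
definition cayley_inv :: "complex => complex" where "cayley_inv w = (w - \<i>) / (w + \<i>)"

lemma cayley_inv_cayley: "w ~= 1 ==> cayley_inv (cayley w) = w"
proof -
 assume w: "w ~= 1"
 hence d: "1 - w ~= 0" by simp
 have "cayley w - \<i> = 2 * \<i> * w / (1 - w)" "cayley w + \<i> = 2 * \<i> / (1 - w)"
  using d by (simp_all add: cayley_def field_simps)
 thus ?thesis using d by (simp add: cayley_inv_def)
qed

lemma cayley_cayley_inv: "w ~= - \<i> ==> cayley (cayley_inv w) = w"
proof -
 assume w: "w ~= - \<i>"
 hence d: "w + \<i> ~= 0" by (simp add: eq_neg_iff_add_eq_0)
 have "1 + cayley_inv w = 2 * w / (w + \<i>)" "1 - cayley_inv w = 2 * \<i> / (w + \<i>)"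
  using d by (simp_all add: cayley_inv_def field_simps)
 thus ?thesis using d by (simp add: cayley_def)
qed

lemma Im_cayley: "Im (cayley w) = (1 - (cmod w)\<^sup>2) / (cmod (1 - w))\<^sup>2"
 unfolding cmod_power2 by (simp add: cayley_def Im_divide power2_eq_square algebra_simps)

lemma norm_cayley_inv:
 assumes "Im w >= 0"
 shows "cmod (cayley_inv w) <= 1" "Im w > 0 ==> cmod (cayley_inv w) < 1" "cayley_inv w ~= 1" "w + \<i> ~= 0"
proof -
 show nz: "w + \<i> ~= 0" using assms by (auto simp: complex_eq_iff)
 have sq: "(cmod (w + \<i>))\<^sup>2 - (cmod (w - \<i>))\<^sup>2 = 4 * Im w" unfolding cmod_power2 by (simp add: power2_eq_square algebra_simps)
 have "(cmod (w - \<i>))\<^sup>2 <= (cmod (w + \<i>))\<^sup>2" using sq assms by linarith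
 hence "cmod (w - \<i>) <= cmod (w + \<i>)" by simp
 thus "cmod (cayley_inv w) <= 1" by (simp add: cayley_inv_def norm_divide divide_le_eq_1)
 show "cmod (cayley_inv w) < 1" if "Im w > 0"
 using sq that power2_less_imp_less norm_divide divide_less_eq_1 by (smt (verit) cayley_inv_def norm_not_less_zero)
 show "cayley_inv w ~= 1"
 proof
  assume "cayley_inv w = 1"
  hence "w - \<i> = w + \<i>" by (simp add: cayley_inv_def)
  thus False by simp
 qed
qed

text \<open>Minus the cotangent of half the angle: increasing on the open interval from 0 to
  \<open>pi\<close>, so counterclockwise order becomes the order of the real line.\<close>

lemma cayley_cis: "sin be ~= 0 ==> cayley (cis (2 * be)) = of_real (- cos be / sin be)"
proof -
 assume s: "sin be ~= 0"
 have a: "1 + cis (2 * be) = 2 * of_real (cos be) * cis be"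
  by (simp add: complex_eq_iff sin_double cos_double_cos power2_eq_square)
 have b: "1 - cis (2 * be) = - (2 * \<i>) * of_real (sin be) * cis be"
  by (simp add: complex_eq_iff sin_double cos_double_sin power2_eq_square)
 show ?thesis unfolding cayley_def a b by simp
qed

text \<open>Since \<open>(g z - g 0) / z\<close> has no zero on the closed disc,
  \<open>g z - g 0 = z * exp (L z)\<close>, and the winding number of the curve about
  \<open>g 0\<close> equals that of its image on the circle. As it is 1, the continuous argument
  \<open>th\<close> of the image gains exactly \<open>2 * pi\<close>; being injective, it
  increases.\<close>

lemma ccw_ordered_angles:
 assumes bj: "bounded_jordan_domain H" and ccw: "ccw_ordered (frontier H) z1 z2 z3"
  and g: "g hol ball 0 1" "continuous_on (closure H) fi" "continuous_on (cball 0 1) g"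
  "fi ` H = ball 0 1" "fi ` closure H = cball 0 1" "g ` ball 0 1 = H"
  "!!z. z : closure H ==> g (fi z) = z" "!!z. z : cball 0 1 ==> fi (g z) = z"
 obtains t1 t2 t3 where "fi z1 = cis t1" "fi z2 = cis t2" "fi z3 = cis t3" "t1 < t2" "t2 < t3" "t3 < t1 + 2 * pi"
proof -
 have H: "open H" using bj by (auto simp: bounded_jordan_domain_def)
 obtain c0 where c0: "H = inside (frontier H)" using jordan_domain_curve[OF bj] by auto
 obtain c t1 t2 t3 where c: "simple_path c" "pathfinish c = pathstart c" "path_image c = frontier H"
  "ALL w : inside (frontier H). winding_number c w = 1"
  "0 <= t1" "t1 < t2" "t2 < t3" "t3 < 1" "c t1 = z1" "c t2 = z2" "c t3 = z3" using ccw unfolding ccw_ordered_def by blast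
 have ginj: "x = y" if "x : cball 0 1" "y : cball 0 1" "g x = g y" for x y using g(8) that by metis
 have g0H: "g 0 : H" using g(6) by auto
 have wn: "winding_number c (g 0) = 1" using c(4) g0H c0 by blast
 define u where "u z = (if z = 0 then deriv g 0 else (g z - g 0) / z)" for z
 have gd: "(g has_field_derivative deriv g 0) (at 0)" using g(1) by (intro holomorphic_derivI[of g "ball 0 1"]) auto
 have uc: "continuous_on (cball 0 1) u" unfolding continuous_on_def
 proof
  fix x :: complex assume x: "x : cball 0 1"
  show "(u ---> u x) (at x within cball 0 1)"
  proof (cases "x = 0")
   case True
   have "((%z. (g z - g 0) / (z - 0)) ---> deriv g 0) (at 0)" using gd unfolding has_field_derivative_iff by simp
   hence "(u ---> deriv g 0) (at 0)" by (rule Lim_transform_eventually) (auto simp: u_def eventually_at_filter)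
   thus ?thesis using True by (auto simp: u_def intro: tendsto_within_subset)
  next
   case False
   have "((%z. (g z - g 0) / z) ---> (g x - g 0) / x) (at x within cball 0 1)"
    using g(3) x False unfolding continuous_on_def by (intro tendsto_intros) auto
   moreover have "\<forall>\<^sub>F z in at x within cball 0 1. (g z - g 0) / z = u z"
    unfolding eventually_at_filter by (rule eventually_mono[OF t1_space_nhds[OF False]]) (auto simp: u_def)
   ultimately have "(u ---> (g x - g 0) / x) (at x within cball 0 1)" by (rule Lim_transform_eventually)
   thus ?thesis using False by (simp add: u_def)
  qed
 qed
 have unz: "u z ~= 0" if "z : cball 0 1" for z
 proof (cases "z = 0")
  case True
  have "inj_on g (ball 0 1)" using ginj by (auto intro!: inj_onI simp: less_imp_le)
  thus ?thesis using holomorphic_injective_imp_regular[OF g(1), of 0] True by (auto simp: u_def)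
 next
  case False
  thus ?thesis using ginj[of z 0] that by (auto simp: u_def)
 qed
 obtain L where L: "continuous_on (cball 0 1) L" "!!z. z : cball 0 1 ==> u z = exp (L z)"
  using continuous_logarithm_on_cball[OF uc unz] by auto
 have gL: "g z - g 0 = z * exp (L z)" if "z : cball 0 1" for z
  using L(2)[OF that] by (cases "z = 0") (auto simp: u_def field_simps)
 define w where "w t = fi (c t)" for t
 have fc: "frontier H <= closure H" by (simp add: frontier_def)
 have cI: "c t : frontier H" if "t : {0..1}" for t using c(3) that by (auto simp: path_image_def)
 have cc: "continuous_on {0..1} c" using c(1) by (simp add: simple_path_def path_def)
 have wc: "continuous_on {0..1} w" unfolding w_def by (rule continuous_on_compose2[OF g(2) cc]) (use cI fc in auto)
 have w1: "cmod (w t) = 1" if t: "t : {0..1}" for t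
 proof (rule ccontr)
  assume n: "cmod (w t) ~= 1"
  have cl: "c t : closure H" using cI[OF t] fc by blast
  hence "w t : cball 0 1" unfolding w_def using g(5) by blast
  hence "w t : ball 0 1" using n by simp
  hence "c t : H" using g(6,7) cl unfolding w_def by (metis imageI)
  thus False using cI[OF t] H by (simp add: frontier_def interior_open)
 qed
 obtain q where q: "continuous_on {0..1} q" "!!t. t : {0..1} ==> w t = exp (q t)"
 using continuous_logarithm_on_contractible wc convex_imp_contractible w1 that by (smt (verit, best) convex_real_interval(5) norm_zero)
 define th where "th t = Im (q t)" for t
 have wt: "w t = cis (th t)" if t: "t : {0..1}" for t using w1 t q norm_exp_eq_Re exp_eq_polar by (auto simp: th_def)
 have thc: "continuous_on {0..1} th" unfolding th_def by (intro continuous_intros q(1))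
 have ends: "c 0 = c 1" using c(2) by (simp add: pathstart_def pathfinish_def)
 \<comment> \<open>A logarithm of \<open>c t - g 0\<close>; the term \<open>L (w t)\<close> has
   equal values at both ends, so the increment of \<open>P\<close> is that of
   \<open>th\<close>.\<close>
 define P where "P t = \<i> * of_real (th t) + L (w t)" for t
 have Pp: "path P" unfolding path_def P_def by (intro continuous_intros thc continuous_on_compose2[OF L(1) wc]) (use w1 in auto)
 have "winding_number c (g 0) = winding_number (%t. c t - g 0) 0" by (rule winding_number_offset)
 also have "... = winding_number (exp o P) 0"
 proof (rule winding_number_cong)
  fix t :: real assume t: "0 <= t" "t <= 1"
  have "c t = g (w t)" using g(7)[of "c t"] cI[of t] fc t by (auto simp: w_def)
  hence "c t - g 0 = w t * exp (L (w t))" using gL[of "w t"] w1[of t] t by simp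
  thus "c t - g 0 = (exp o P) t" using wt[of t] t by (simp add: P_def exp_add cis_conv_exp)
 qed
 also have "... = (P 1 - P 0) / (2 * of_real pi * \<i>)"
  using winding_number_compose_exp[OF Pp] by (simp add: pathfinish_def pathstart_def)
 also have "P 1 - P 0 = \<i> * of_real (th 1 - th 0)" using ends by (simp add: P_def w_def algebra_simps)
 finally have "\<i> * of_real (th 1 - th 0) / (2 * of_real pi * \<i>) = 1" using wn by simp
 hence "\<i> * of_real (th 1 - th 0) = \<i> * of_real (2 * pi)" by simp
 hence "of_real (th 1 - th 0) = (of_real (2 * pi) :: complex)" by simp
 hence e: "th 1 = th 0 + 2 * pi" by (simp only: of_real_eq_iff)
 have inj: "inj_on th {0..1}"
 proof (rule inj_onI)
  fix s t :: real assume st: "s : {0..1}" "t : {0..1}" "th s = th t"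
  hence "fi (c s) = fi (c t)" using wt by (simp add: w_def)
  hence "c s = c t" using g(7) cI[OF st(1)] cI[OF st(2)] fc by (metis subsetD)
  hence "s = t | s = 0 & t = 1 | s = 1 & t = 0" using c(1) st unfolding simple_path_def loop_free_def by blast
  thus "s = t" using e st(3) by auto
 qed
 have mono: "th a < th b" if ab: "0 <= a" "a < b" "b < 1" "th a < th 1" for a b
 proof -
  have "continuous_on {a..1} th" "inj_on th {a..1}" using ab by (auto intro: continuous_on_subset[OF thc] inj_on_subset[OF inj])
  hence "th a < th b & th b < th 1 | th 1 < th b & th b < th a" by (rule continuous_inj_imp_mono[OF ab(2,3)])
  thus ?thesis using ab(4) by auto
 qed
 have l1: "th t < th 1 & th 0 <= th t" if t: "0 <= t" "t < 1" for t
 proof (cases "t = 0")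
  case False
  thus ?thesis using continuous_inj_imp_mono[of 0 t 1 th] thc inj t e pi_gt_zero by fastforce
 qed (use e in auto)
 show ?thesis
 proof (rule that[of "th t1" "th t2" "th t3"])
  show "fi z1 = cis (th t1)" "fi z2 = cis (th t2)" "fi z3 = cis (th t3)"
   using wt[of t1] wt[of t2] wt[of t3] c by (auto simp: w_def)
  show "th t1 < th t2" "th t2 < th t3" using mono[of t1 t2] mono[of t2 t3] l1[of t1] l1[of t2] c by auto
  show "th t3 < th t1 + 2 * pi" using l1[of t3] l1[of t1] c e by auto
 qed
qed

text \<open>\<open>z1\<close> goes to infinity, \<open>z2\<close> to 0 and \<open>z3\<close> to 1;
  the last two clauses are continuity of both maps at infinity and at \<open>z1\<close>.\<close>

definition half_plane_map ::
  "complex set => complex => complex => complex => (complex => complex) => (complex => complex) => bool" where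
 "half_plane_map H z1 z2 z3 Ph Ps <-> Ph hol H & Ps hol uhp &
  Ph ` H = uhp & Ps ` uhp = H &
  continuous_on (closure H - {z1}) Ph & continuous_on {w. Im w >= 0} Ps &
  (ALL z:closure H - {z1}. Im (Ph z) >= 0 & Ps (Ph z) = z) &
  (ALL w. Im w >= 0 --> Ps w : closure H - {z1} & Ph (Ps w) = w) &
  Ph z2 = 0 & Ph z3 = 1 & z2 ~= z1 & z3 ~= z1 &
  (ALL e>0. EX R. ALL w. Im w >= 0 --> cmod w > R --> dist (Ps w) z1 < e) &
  (ALL R. EX d>0. ALL z:closure H - {z1}. dist z z1 < d --> cmod (Ph z) > R)"

lemma half_plane_mapI:
 assumes "Ph hol H" "Ps hol uhp"
  "Ph ` H = uhp" "Ps ` uhp = H"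
  "continuous_on (closure H - {z1}) Ph" "continuous_on {w. Im w >= 0} Ps"
  "!!z. z : closure H - {z1} ==> Im (Ph z) >= 0 & Ps (Ph z) = z"
  "!!w. Im w >= 0 ==> Ps w : closure H - {z1} & Ph (Ps w) = w"
  "Ph z2 = 0" "Ph z3 = 1" "z2 ~= z1" "z3 ~= z1"
  "!!e. e > 0 ==> EX R. ALL w. Im w >= 0 --> cmod w > R --> dist (Ps w) z1 < e"
  "!!R. EX d>0. ALL z:closure H - {z1}. dist z z1 < d --> cmod (Ph z) > R"
 shows "half_plane_map H z1 z2 z3 Ph Ps"
 unfolding half_plane_map_def by (intro conjI ballI allI impI assms) (use assms(7,8) in auto)

lemma half_plane_mapD:
 assumes "half_plane_map H z1 z2 z3 Ph Ps"
 shows "Ph hol H" "Ps hol uhp"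
  "Ph ` H = uhp" "Ps ` uhp = H"
  "continuous_on (closure H - {z1}) Ph" "continuous_on {w. Im w >= 0} Ps"
  "z : closure H - {z1} ==> Im (Ph z) >= 0 & Ps (Ph z) = z"
  "Im w >= 0 ==> Ps w : closure H - {z1} & Ph (Ps w) = w"
  "Ph z2 = 0" "Ph z3 = 1" "z2 ~= z1" "z3 ~= z1"
  "e > 0 ==> EX R. ALL w. Im w >= 0 --> cmod w > R --> dist (Ps w) z1 < e"
  "EX d>0. ALL z:closure H - {z1}. dist z z1 < d --> cmod (Ph z) > R" using assms unfolding half_plane_map_def by blast+

text \<open>After the map to the disc, a rotation takes the image of \<open>z1\<close> to 1, which
  the Cayley map sends to infinity; \<open>z2\<close> and \<open>z3\<close> then have real images
  \<open>x2 < x3\<close> by the orientation, and an increasing real affine map moves these to 0 and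
  1.\<close>

theorem half_plane_map_exists:
 assumes bj: "bounded_jordan_domain H" and z1f: "z1 : frontier H" and ccw: "ccw_ordered (frontier H) z1 z2 z3"
 shows "EX Ph Ps. half_plane_map H z1 z2 z3 Ph Ps"
proof -
 have H: "open H" using bj by (auto simp: bounded_jordan_domain_def)
 obtain fi g where g: "fi hol H" "g hol ball 0 1" "continuous_on (closure H) fi" "continuous_on (cball 0 1) g"
  "fi ` H = ball 0 1" "g ` ball 0 1 = H" "fi ` closure H = cball 0 1" "g ` cball 0 1 = closure H"
  "!!z. z : closure H ==> g (fi z) = z" "!!z. z : cball 0 1 ==> fi (g z) = z" using caratheodory_extension[OF bj] by auto
 obtain t1 t2 t3 where t: "fi z1 = cis t1" "fi z2 = cis t2" "fi z3 = cis t3" "t1 < t2" "t2 < t3" "t3 < t1 + 2 * pi"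
  using ccw_ordered_angles[OF bj ccw g(2-5) g(7,6,9,10)] by auto
 define be2 where "be2 = (t2 - t1) / 2"
 define be3 where "be3 = (t3 - t1) / 2"
 have be: "0 < be2" "be2 < be3" "be3 < pi" using t by (auto simp: be2_def be3_def)
 define x2 where "x2 = - cos be2 / sin be2"
 define x3 where "x3 = - cos be3 / sin be3"
 have sp: "sin be2 > 0" "sin be3 > 0" "sin (be3 - be2) > 0" using be by (auto intro!: sin_gt_zero)
 have "x3 - x2 = sin (be3 - be2) / (sin be2 * sin be3)" using sp by (simp add: x2_def x3_def sin_diff field_simps)
 hence x23: "x2 < x3" using sp by (smt (verit) divide_pos_pos mult_pos_pos)
 define a where "a = cis t1"
 have a0: "a ~= 0" "cmod a = 1" by (auto simp: a_def)
 define M where "M z = (cayley (z / a) - of_real x2) / of_real (x3 - x2)" for z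
 define N where "N w = a * cayley_inv (of_real x2 + of_real (x3 - x2) * w)" for w
 have x0: "complex_of_real (x3 - x2) ~= 0" using x23 by simp
 have ImT: "Im (of_real x2 + of_real (x3 - x2) * w) = (x3 - x2) * Im w" for w by simp
 have ImT0: "Im (of_real x2 + of_real (x3 - x2) * w) >= 0" if "Im w >= 0" for w using that x23 by simp
 have MN: "M (N w) = w" if "Im w >= 0" for w
 proof -
  have "of_real x2 + of_real (x3 - x2) * w ~= - \<i>" using norm_cayley_inv(4)[OF ImT0[OF that]] by auto
  thus ?thesis using a0 x0 by (simp add: M_def N_def cayley_cayley_inv del: of_real_diff)
 qed
 have NM: "N (M z) = z" if "z ~= a" for z using that a0 x0 of_real_diff cayley_inv_cayley by (auto simp: M_def N_def)
 have ImM: "Im (M z) = (1 - (cmod z)\<^sup>2) / (cmod (1 - z / a))\<^sup>2 / (x3 - x2)" for z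
  using a0 by (simp add: M_def Im_divide_of_real Im_cayley norm_divide del: of_real_diff)
 have ImM0: "Im (M z) >= 0" if "cmod z <= 1" for z
  unfolding ImM using that x23 by (intro divide_nonneg_nonneg) (auto simp: abs_square_le_1)
 have ImM1: "Im (M z) > 0" if "cmod z < 1" for z
 proof -
  have "z / a ~= 1" using that a0 by auto
  hence "cmod (1 - z / a) > 0" by simp
  thus ?thesis unfolding ImM using that x23 by (intro divide_pos_pos) (auto simp: abs_square_less_1)
 qed
 have Nb: "cmod (N w) <= 1" "Im w > 0 ==> cmod (N w) < 1" "N w ~= a" if "Im w >= 0" for w
 proof -
  show "cmod (N w) <= 1" using norm_cayley_inv(1)[OF ImT0[OF that]] a0 by (simp add: N_def norm_mult del: of_real_diff)
  show "N w ~= a" using norm_cayley_inv(3)[OF ImT0[OF that]] a0 by (simp add: N_def del: of_real_diff)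
  show "cmod (N w) < 1" if "Im w > 0"
  proof -
   have "Im (of_real x2 + of_real (x3 - x2) * w) > 0" using that x23 by simp
   thus ?thesis using norm_cayley_inv(2)[OF ImT0[OF `Im w >= 0`]] a0 by (simp add: N_def norm_mult del: of_real_diff)
  qed
 qed
 have Mh: "M hol (- {a})" unfolding M_def cayley_def by (intro holomorphic_intros) auto
 have Nc: "continuous_on {w. Im w >= 0} N"
  unfolding N_def cayley_inv_def using norm_cayley_inv(4)[OF ImT0] by (intro continuous_intros) auto
 have Nh: "N hol uhp" unfolding N_def cayley_inv_def using norm_cayley_inv(4)[OF ImT0] by (intro holomorphic_intros) auto
 define Ph where "Ph z = M (fi z)" for z
 define Ps where "Ps w = g (N w)" for w
 have z1c: "z1 : closure H" "z1 ~: H" using z1f H by (auto simp: frontier_def interior_open)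
 have ga: "g a = z1" using g(9)[OF z1c(1)] t(1) by (simp add: a_def)
 have fia: "fi z ~= a" if "z : closure H - {z1}" for z using g(9)[of z] that ga by auto
 have fi1: "cmod (fi z) <= 1" if "z : closure H" for z using g(7) that by auto
 have fi2: "cmod (fi z) < 1" if "z : H" for z using g(5) that by auto
 have gcl: "g z : closure H" if "cmod z <= 1" for z using g(8) that by auto
 have A: "Im (Ph z) >= 0 & Ps (Ph z) = z" if "z : closure H - {z1}" for z
  using ImM0[OF fi1] NM[OF fia[OF that]] g(9) that by (auto simp: Ph_def Ps_def)
 have B: "Ps w : closure H - {z1} & Ph (Ps w) = w" if w: "Im w >= 0" for w
 using g Nb w t MN gcl by (auto simp: a_def Ph_def Ps_def)
 have HU: "Ph z : uhp" if "z : H" for z using ImM1[OF fi2[OF that]] by (simp add: Ph_def)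
 have UH: "Ps w : H" if "Im w > 0" for w using g(6) Nb(2)[of w] that by (auto simp: Ps_def)
 have Hs: "H <= closure H - {z1}" using z1c closure_subset by blast
 have cPs: "continuous_on {w. Im w >= 0} Ps" unfolding Ps_def by (rule continuous_on_compose2[OF g(4) Nc]) (use Nb(1) in auto)
 have cay: "cis t / a = cis (t - t1)" for t by (simp add: a_def cis_divide)
 have z23: "z2 ~= z1" "z3 ~= z1"
 proof -
  have *: "cis t ~= a" if "t1 < t" "t < t1 + 2 * pi" for t
  proof
   assume "cis t = a"
   moreover have "2 * ((t - t1) / 2) = t - t1" by simp
   ultimately have "cis (2 * ((t - t1) / 2)) = 1" using cay[of t] a0 by (metis divide_self)
   moreover have "sin ((t - t1) / 2) > 0" using that by (intro sin_gt_zero) auto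
   ultimately have "cos (2 * ((t - t1) / 2)) = 1" "sin ((t - t1) / 2) > 0" by (metis cis.sel(1) one_complex.sel(1), blast)
   thus False using cos_double_sin[of "(t - t1) / 2"] by simp
  qed
  show "z2 ~= z1" "z3 ~= z1" using *[of t2] *[of t3] t by (auto simp: a_def)
 qed
 have "half_plane_map H z1 z2 z3 Ph Ps"
 proof (rule half_plane_mapI)
  show "Ph hol H"
  proof -
   have im: "fi ` H <= - {a}" using fia Hs by blast
   show ?thesis using holomorphic_on_compose_gen[OF g(1) Mh im] by (simp add: o_def Ph_def[abs_def])
  qed
  show "Ps hol uhp"
  proof -
   have im: "N ` uhp <= ball 0 1" using Nb(2) by auto
   show ?thesis using holomorphic_on_compose_gen[OF Nh g(2) im] by (simp add: o_def Ps_def[abs_def])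
  qed
  show "Ph ` H = uhp"
  proof
   show "uhp <= Ph ` H"
   proof
    fix w assume "w : uhp"
    thus "w : Ph ` H" using UH[of w] B[of w] by force
   qed
  qed (use HU in blast)
  show "Ps ` uhp = H"
  proof
   show "H <= Ps ` uhp"
   proof
    fix z assume z: "z : H"
    thus "z : Ps ` uhp" using A[of z] HU[OF z] Hs by force
   qed
  qed (use UH in blast)
  show "continuous_on (closure H - {z1}) Ph" unfolding Ph_def
   by (rule continuous_on_compose2[OF holomorphic_on_imp_continuous_on[OF Mh]])
    (use fia in "auto intro: continuous_on_subset[OF g(3)]")
  show "continuous_on {w. Im w >= 0} Ps" by (rule cPs)
  show "Im (Ph z) >= 0 & Ps (Ph z) = z" if "z : closure H - {z1}" for z by (rule A[OF that])
  show "Ps w : closure H - {z1} & Ph (Ps w) = w" if "Im w >= 0" for w by (rule B[OF that])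
  show "Ph z2 = 0"
  proof -
   have "cayley (cis t2 / a) = of_real x2"
   proof -
    have "2 * be2 = t2 - t1" by (simp add: be2_def)
    thus ?thesis unfolding cay x2_def using cayley_cis[of be2] sp by simp
   qed
   thus ?thesis using t(2) by (simp add: Ph_def M_def)
  qed
  show "Ph z3 = 1"
  proof -
   have "cayley (cis t3 / a) = of_real x3"
   proof -
    have "2 * be3 = t3 - t1" by (simp add: be3_def)
    thus ?thesis unfolding cay x3_def using cayley_cis[of be3] sp by simp
   qed
   thus ?thesis using t(3) x0 by (simp add: Ph_def M_def)
  qed
  show "z2 ~= z1" "z3 ~= z1" by (rule z23)+
  show "EX R. ALL w. Im w >= 0 --> cmod w > R --> dist (Ps w) z1 < e" if e: "e > 0" for e
  proof -
   have "a : cball 0 1" using a0 by simp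
   then obtain d where d: "d > 0" "!!z. z : cball 0 1 ==> dist z a < d ==> dist (g z) (g a) < e"
    using g(4) e unfolding continuous_on_iff by metis
   have "(%w. 2 * \<i> / (of_real x2 + of_real (x3 - x2) * w + \<i>)) -oo-> 0"
   proof (rule tendsto_divide_0[OF tendsto_const])
    have "filterlim (%w. of_real (x3 - x2) * w + (of_real x2 + \<i>)) at_infinity at_infinity"
     by (rule tendsto_add_filterlim_at_infinity'[OF tendsto_mult_filterlim_at_infinity[OF tendsto_const x0 filterlim_ident] tendsto_const])
    thus "filterlim (%w. of_real x2 + of_real (x3 - x2) * w + \<i>) at_infinity at_infinity" by (simp add: add_ac)
   qed
   hence "\<forall>\<^sub>F w in at_infinity. dist (2 * \<i> / (of_real x2 + of_real (x3 - x2) * w + \<i>)) 0 < d" using d(1) by (rule tendstoD)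
   then obtain R where R: "!!w. cmod w >= R ==> cmod (2 * \<i> / (of_real x2 + of_real (x3 - x2) * w + \<i>)) < d"
    unfolding eventually_at_infinity by auto
   show ?thesis
   proof (intro exI allI impI)
    fix w assume w: "Im w >= 0" "cmod w > R"
    have nz: "of_real x2 + of_real (x3 - x2) * w + \<i> ~= 0" using norm_cayley_inv(4)[OF ImT0[OF w(1)]] .
    have "N w - a = a * (- (2 * \<i> / (of_real x2 + of_real (x3 - x2) * w + \<i>)))"
     using nz by (simp add: N_def cayley_inv_def field_simps)
    hence "dist (N w) a < d" using R[of w] w(2) a0 by (simp only: dist_norm norm_mult norm_minus_cancel) simp
    thus "dist (Ps w) z1 < e" using d(2)[of "N w"] Nb(1)[OF w(1)] ga by (simp add: Ps_def)
   qed
  qed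
  show "EX d>0. ALL z:closure H - {z1}. dist z z1 < d --> cmod (Ph z) > R" for R
  proof -
   define K where "K = Ps ` ({w. Im w >= 0} Int cball 0 R)"
   have "closed {w. Im w >= 0}" by (simp add: closed_halfspace_Im_ge)
   hence "compact ({w. Im w >= 0} Int cball 0 R)" by auto
   hence "compact K" unfolding K_def by (intro compact_continuous_image continuous_on_subset[OF cPs]) auto
   hence "open (- K)" by (simp add: compact_imp_closed open_Compl)
   moreover have "z1 : - K" using B by (auto simp: K_def)
   ultimately obtain d where d: "d > 0" "ball z1 d <= - K" by (meson openE)
   show ?thesis
   proof (intro exI[of _ d] conjI ballI impI)
    fix z assume z: "z : closure H - {z1}" "dist z z1 < d"
    show "cmod (Ph z) > R"
    proof (rule ccontr)
     assume "~ cmod (Ph z) > R"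
     hence "z : K" unfolding K_def using A[OF z(1)] by force
     thus False using d(2) z(2) by (auto simp: dist_commute)
    qed
   qed (rule d(1))
  qed
 qed
 thus ?thesis by auto
qed

section \<open>Continuity of the slit data\<close>

text \<open>Coordinates \<open>3 * j\<close>, \<open>3 * j + 1\<close>, \<open>3 * j + 2\<close> are
  the abscissa of the left end, the height and the length of slit \<open>j\<close>; a negative
  length counts as 0.\<close>

definition slit :: "(nat => real) => nat => complex set" where
 "slit y j = cbox (Complex (y (3 * j)) (y (3 * j + 1))) (Complex (y (3 * j) + max 0 (y (3 * j + 2))) (y (3 * j + 1)))"

lemma in_slit_iff:
 "z : slit y j <-> Im z = y (3 * j + 1) & y (3 * j) <= Re z & Re z <= y (3 * j) + max 0 (y (3 * j + 2))"
 unfolding slit_def in_cbox_complex_iff by auto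

lemma slit_props:
 "compact (slit y j)" "connected (slit y j)" "slit y j ~= {}" "connected (- slit y j)" "horizontal (slit y j)"
proof -
 have c: "compact (slit y j)" "convex (slit y j)" by (auto simp: slit_def)
 thus "compact (slit y j)" "connected (slit y j)" "connected (- slit y j)"
  by (auto intro: convex_connected connected_complement_bounded_convex compact_imp_bounded)
 have "Complex (y (3 * j)) (y (3 * j + 1)) : slit y j" by (simp add: in_slit_iff)
 thus "slit y j ~= {}" by auto
 show "horizontal (slit y j)" by (auto simp: horizontal_def in_slit_iff)
qed

lemma horizontal_eq_cbox:
 assumes "compact L" "connected L" "L ~= {}" "horizontal L"
 shows "EX a b l. l >= 0 & L = cbox (Complex a b) (Complex (a + l) b)"
proof -
 obtain w where w: "w : L" using assms(3) by blast
 define b where "b = Im w"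
 have b: "Im z = b" if "z : L" for z using assms(4)[unfolded horizontal_def] w that unfolding b_def by blast
 have "compact (Re ` L)" "connected (Re ` L)"
  using assms by (auto intro!: compact_continuous_image connected_continuous_image continuous_intros)
 then obtain a c where ac: "Re ` L = {a..c}" using connected_compact_interval_1 by metis
 have "a <= c" using ac w by (metis atLeastatMost_empty_iff2 image_is_empty empty_iff)
 have "z : L <-> z : cbox (Complex a b) (Complex c b)" for z
 proof
  assume z: "z : L"
  hence "Re z : {a..c}" using ac by blast
  thus "z : cbox (Complex a b) (Complex c b)" using b[OF z] by (simp add: in_cbox_complex_iff)
 next
  assume "z : cbox (Complex a b) (Complex c b)"
  hence s: "Re z : Re ` L" "Im z = b" using ac by (auto simp: in_cbox_complex_iff)
  then obtain v where "v : L" "Re v = Re z" by auto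
  thus "z : L" using b[of v] s(2) by (metis complex_eq_iff)
 qed
 hence "L = cbox (Complex a b) (Complex (a + (c - a)) b)" by auto
 thus ?thesis using `a <= c` by (intro exI[of _ a] exI[of _ b] exI[of _ "c - a"] conjI) simp_all
qed

lemma slit_eqD:
 assumes "slit y j = slit y' j" "0 <= y (3 * j + 2)" "0 <= y' (3 * j + 2)"
 shows "y (3 * j) = y' (3 * j)" "y (3 * j + 1) = y' (3 * j + 1)" "y (3 * j + 2) = y' (3 * j + 2)"
proof -
 have in1: "Complex (u (3 * j)) (u (3 * j + 1)) : slit u j" "Complex (u (3 * j) + u (3 * j + 2)) (u (3 * j + 1)) : slit u j"
  if "0 <= u (3 * j + 2)" for u using that by (auto simp: in_slit_iff)
 have out: "Im z = u (3 * j + 1) & u (3 * j) <= Re z & Re z <= u (3 * j) + u (3 * j + 2)" if "z : slit u j" "0 <= u (3 * j + 2)" for z u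
  using that by (auto simp: in_slit_iff)
 have a: "y (3 * j + 1) = y' (3 * j + 1)" "y' (3 * j) <= y (3 * j)" "y (3 * j) + y (3 * j + 2) <= y' (3 * j) + y' (3 * j + 2)"
  using out[OF in1(1)[of y, OF assms(2), unfolded assms(1)] assms(3)] out[OF in1(2)[of y, OF assms(2), unfolded assms(1)] assms(3)] by auto
 have b: "y (3 * j) <= y' (3 * j)" "y' (3 * j) + y' (3 * j + 2) <= y (3 * j) + y (3 * j + 2)"
  using out[OF in1(1)[of y', OF assms(3), folded assms(1)] assms(2)] out[OF in1(2)[of y', OF assms(3), folded assms(1)] assms(2)] by auto
 show "y (3 * j) = y' (3 * j)" "y (3 * j + 1) = y' (3 * j + 1)" "y (3 * j + 2) = y' (3 * j + 2)" using a b by auto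
qed

lemma slit_near:
 assumes d: "abs(y (3 * j) - y' (3 * j)) < dl / 3" "abs(y (3 * j + 1) - y' (3 * j + 1)) < dl / 3" "abs(y (3 * j + 2) - y' (3 * j + 2)) < dl / 3"
 shows "slit y j <= nhd (slit y' j) dl"
proof
 fix z assume z: "z : slit y j"
 define s where "s = Re z - y (3 * j)"
 have s: "0 <= s" "s <= max 0 (y (3 * j + 2))" using z by (auto simp: in_slit_iff s_def)
 define s' where "s' = min s (max 0 (y' (3 * j + 2)))"
 define w where "w = Complex (y' (3 * j) + s') (y' (3 * j + 1))"
 have w: "w : slit y' j" using s(1) by (auto simp: in_slit_iff w_def s'_def)
 have "0 < dl" using d(1) by linarith
 hence "abs(s - s') < dl / 3" using s d(3) unfolding s'_def by (auto simp: abs_if split: if_splits)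
 moreover have "Re (w - z) = (y' (3 * j) - y (3 * j)) + (s' - s)" "Im (w - z) = y' (3 * j + 1) - y (3 * j + 1)"
  using z by (auto simp: w_def s_def in_slit_iff)
 hence "abs(Re (w - z)) <= abs(y (3 * j) - y' (3 * j)) + abs(s - s')" "abs(Im (w - z)) = abs(y (3 * j + 1) - y' (3 * j + 1))" by auto
 moreover have "cmod (w - z) <= abs(Re (w - z)) + abs(Im (w - z))" by (rule cmod_le)
 ultimately have "cmod (w - z) < dl" using d(1,2) by linarith
 thus "z : nhd (slit y' j) dl" using w by (auto simp: in_nhd_iff dist_norm)
qed

lemma slit_convergence:
 assumes y: "y ----> y'" and "dl > 0"
 shows "EV k. slit (y k) j <= nhd (slit y' j) dl"
  "EV k. slit y' j <= nhd (slit (y k) j) dl"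
proof -
 have e: "EV k. dist (y k i) (y' i) < dl / 3" for i using y `dl > 0` unfolding tendsto_fun_iff by (intro tendstoD) auto
 have e3: "EV k. dist (y k (3 * j)) (y' (3 * j)) < dl / 3 & dist (y k (3 * j + 1)) (y' (3 * j + 1)) < dl / 3 &
  dist (y k (3 * j + 2)) (y' (3 * j + 2)) < dl / 3" by (intro eventually_conj e)
 show "EV k. slit (y k) j <= nhd (slit y' j) dl" by (rule eventually_mono[OF e3], rule slit_near) (simp_all only: dist_real_def)
 show "EV k. slit y' j <= nhd (slit (y k) j) dl"
  by (rule eventually_mono[OF e3], rule slit_near) (simp_all only: dist_real_def abs_minus_commute[of "y' _"])
qed

lemma closed_nhd_inter:
 assumes "closed A" "!!dl. dl > 0 ==> z : nhd A dl"
 shows "z : A" using assms closure_approachable[of z A] by (auto simp: in_nhd_iff)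

lemma slit_subset_limit:
 assumes cl: "closed A" and up: "!!dl. dl > 0 ==> EV k. B k <= nhd A dl"
  and low: "!!dl. dl > 0 ==> EV k. C <= nhd (B k) dl"
 shows "C <= A"
proof
 fix z assume z: "z : C"
 show "z : A"
 proof (rule closed_nhd_inter[OF cl])
  fix dl :: real assume "dl > 0"
  hence "dl / 2 > 0" by simp
  then obtain k where k: "B k <= nhd A (dl / 2)" "C <= nhd (B k) (dl / 2)"
   using eventually_happens'[OF sequentially_bot eventually_conj[OF up low]] by blast
  hence "z : nhd (B k) (dl / 2)" using z by blast
  then obtain b where b: "b : B k" "dist b z < dl / 2" unfolding in_nhd_iff by blast
  hence "b : nhd A (dl / 2)" using k by blast
  then obtain a where a: "a : A" "dist a b < dl / 2" unfolding in_nhd_iff by blast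
  have "dist a z < dl" using a b dist_triangle[of a z b] by simp
  thus "z : nhd A dl" using a by (auto simp: in_nhd_iff)
 qed
qed

lemma sym_map_image_eq: "sym_map J E L f ==> f ` ddom J E = ddom J L"
 using hole_mapD(6) sym_mapD(3) by blast

lemma ddom_antimono:
 assumes "!!j. j : J ==> E j <= K j" shows "ddom J K <= ddom J E"
proof
 fix z assume z: "z : ddom J K"
 have "z ~: dbl E (j, b)" if "j : J" for j b
 proof -
  have "z ~: dbl K (j, b)" using z that by (auto simp: hdom_def)
  thus ?thesis using assms[OF that] by (cases b) auto
 qed
 thus "z : ddom J E" by (auto simp: hdom_def)
qed

lemma uholes_cong:
 assumes "!!j. j : J ==> E j = E' j" shows "uholes J E <-> uholes J E'"
 unfolding uholes_def disjoint_family_on_def using assms by auto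

lemma sym_map_cong:
 assumes f: "sym_map J E L f" and E: "!!j. j : J ==> E j = E' j" and L: "!!j. j : J ==> L j = L' j"
 shows "sym_map J E' L' f"
proof -
 have d: "dbl A i = dbl A' i" if "!!j. j : J ==> A j = A' j" "i : J \<times> UNIV" for A A' i using that by (auto simp: dbl_def)
 have "ddom J E = ddom J E'" by (rule hdom_cong) (rule d[OF E])
 moreover have "hole_map (J \<times> UNIV) (dbl E') (dbl L') f" by (rule hole_map_cong[OF d[OF E] d[OF L] refl sym_mapD(3)[OF f]])
 ultimately show ?thesis using f uholes_cong[of J E E', OF E] uholes_cong[of J L L', OF L] unfolding sym_map_def by auto
qed

lemma uholes_eqI:
 assumes "uholes J E" "uholes J L" "!!j. j : J ==> E j <= L j" "ddom J E <= ddom J L" "j : J"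
 shows "E j = L j"
proof
 show "L j <= E j"
 proof
  fix z assume z: "z : L j"
  hence Im: "Im z > 0" using assms(2,5) by (auto simp: uholes_def)
  hence "z ~: ddom J L" using ddom_upper[OF assms(2) Im] z assms(5) by blast
  then obtain i where i: "i : J" "z : E i" using ddom_upper[OF assms(1) Im] assms(4) by blast
  hence "i = j" using assms(2,3,5) z unfolding uholes_def disjoint_family_on_def by blast
  thus "z : E j" using i by simp
 qed
qed (rule assms(3)[OF assms(5)])

text \<open>The compactness theorem gives only that the limit slits \<open>slit y\<close> lie in the
  image holes \<open>L\<close> of the limit map \<open>g\<close>. For equality the inverse maps are
  taken to a limit \<open>h\<close> as well, on the complement of \<open>slit y\<close>. Since the
  \<open>E' k\<close> fill up \<open>E\<close>, the holes \<open>K\<close> of the image of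
  \<open>h\<close> contain \<open>E\<close>, so \<open>h\<close> and \<open>g\<close> can be
  composed in both orders and turn out to be inverse to each other; this forces
  \<open>slit y = L\<close>.\<close>

lemma sym_maps_limit_slits:
 assumes E: "uholes J E" and up: "!!e j. e > 0 ==> j : J ==> EV k. E' k j <= nhd (E j) e"
  and low: "!!e j. e > 0 ==> j : J ==> EV k. E j <= nhd (E' k j) e"
  and sm: "!!k. sym_map J (E' k) (slit (y' k)) (f k)"
  and N: "!!i k. i div 3 ~: J ==> y' k i = 0"
  and pos: "!!j k. j : J ==> 0 <= y' k (3 * j + 2)"
 obtains r y g where "strict_mono (r :: nat => nat)" "sym_map J E (slit y) g" "(%k. y' (r k)) ----> y"
proof -
 have fJ: "finite J" using E by (simp add: uholes_def)
 then obtain n where n: "J <= {..<n}" using finite_nat_bounded by blast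
 have up': "!!e. e > 0 ==> EV k. ALL j:J. E' k j <= nhd (E j) e" using up fJ by (auto intro: eventually_ball_finite)
 obtain r L g where r: "strict_mono (r :: nat => nat)" "sym_map J E L g"
  "kconv (ddom J E) (%k. ddom J (E' (r k))) (%k. f (r k)) g"
  "!!dl. dl > 0 ==> EV k. ALL j:J. slit (y' (r k)) j <= nhd (L j) dl" using sym_maps_compact[OF E up' sm] by blast
 have uL: "uholes J L" using sym_mapD(2)[OF r(2)] .
 have "bounded (UN j:J. nhd (L j) 1)" using uL by (auto simp: uholes_def compact_imp_bounded intro!: bounded_UN bounded_nhd)
 then obtain M0 where M0: "(UN j:J. nhd (L j) 1) <= cball 0 M0" using bounded_subset_cball by blast
 define M where "M = max 0 M0"
 have M: "(UN j:J. nhd (L j) 1) <= cball 0 M" "0 <= M" using M0 by (auto simp: M_def)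
 obtain k0 where k0: "!!k. k >= k0 ==> ALL j:J. slit (y' (r k)) j <= nhd (L j) 1"
  using r(4)[of 1] unfolding eventually_sequentially by auto
 \<comment> \<open>Slits inside \<open>cball 0 M\<close> have ends of modulus at most
   \<open>M\<close>; a length, as a difference of two abscissas, needs \<open>2 * M\<close>.\<close>
 have yb: "abs(y' (r (k + k0)) i) <= 2 * M" if i: "i div 3 : J" for k i
 proof -
  define y where "y = y' (r (k + k0))"
  define j where "j = i div 3"
  have j: "j : J" using i by (simp add: j_def)
  have s: "slit y j <= cball 0 M" using k0[of "k + k0"] j M(1) unfolding y_def by auto
  have l: "0 <= y (3 * j + 2)" unfolding y_def by (rule pos[OF j])
  have "Complex (y (3 * j)) (y (3 * j + 1)) : slit y j" "Complex (y (3 * j) + y (3 * j + 2)) (y (3 * j + 1)) : slit y j"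
   using l by (auto simp: in_slit_iff)
  hence c: "cmod (Complex (y (3 * j)) (y (3 * j + 1))) <= M" "cmod (Complex (y (3 * j) + y (3 * j + 2)) (y (3 * j + 1))) <= M"
   using s by auto
  have "abs(y (3 * j)) <= M" "abs(y (3 * j + 1)) <= M" "abs(y (3 * j) + y (3 * j + 2)) <= M"
   using c abs_Re_le_cmod[of "Complex (y (3 * j)) (y (3 * j + 1))"] abs_Im_le_cmod[of "Complex (y (3 * j)) (y (3 * j + 1))"]
    abs_Re_le_cmod[of "Complex (y (3 * j) + y (3 * j + 2)) (y (3 * j + 1))"] by (simp_all only: complex.sel)
  hence b: "abs(y (3 * j)) <= 2 * M" "abs(y (3 * j + 1)) <= 2 * M" "abs(y (3 * j + 2)) <= 2 * M" by linarith+
  have "i = 3 * j + i mod 3" by (simp add: j_def)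
  moreover have "i mod 3 = 0 | i mod 3 = 1 | i mod 3 = 2" by auto
  ultimately have "i = 3 * j | i = 3 * j + 1 | i = 3 * j + 2" by auto
  thus ?thesis using b unfolding y_def by auto
 qed
 have yc: "y' (r (k + k0)) : cube (3 * n) (2 * M)" for k
 proof -
  have "abs(y' (r (k + k0)) i) <= 2 * M" for i using yb N M(2) by (cases "i div 3 : J") auto
  moreover have "y' (r (k + k0)) i = 0" if "3 * n <= i" for i using that n N by fastforce
  ultimately show ?thesis by (simp add: cube_def)
 qed
 obtain y r' where r': "strict_mono r'" "(%k. y' (r (r' k + k0))) ----> y" by (rule compact_subseq[OF compact_cube yc])
 define q where "q k = r' k + k0" for k
 have q: "strict_mono q" using r'(1) by (auto simp: strict_mono_def q_def)
 define p where "p k = r (q k)" for k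
 have p: "strict_mono p" unfolding p_def using r(1) q by (auto simp: strict_mono_def)
 have py: "(%k. y' (p k)) ----> y" using r'(2) by (simp add: p_def q_def)
 have kc: "kconv (ddom J E) (%k. ddom J (E' (p k))) (%k. f (p k)) g" unfolding p_def by (rule kconv_subseq[OF r(3) q])
 have upL: "!!dl. dl > 0 ==> EV k. ALL j:J. slit (y' (p k)) j <= nhd (L j) dl"
  unfolding p_def by (rule eventually_subseq[OF r(4) q])
 have yL: "slit y j <= L j" if j: "j : J" for j
 proof (rule slit_subset_limit)
  show "closed (L j)" using uL j by (auto simp: uholes_def compact_imp_closed)
  show "EV k. slit (y' (p k)) j <= nhd (L j) dl" if "dl > 0" for dl using upL[OF that] by (rule eventually_mono) (use j in blast)
  show "EV k. slit y j <= nhd (slit (y' (p k)) j) dl" if "dl > 0" for dl by (rule slit_convergence(2)[OF py that])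
 qed
 have uy: "uholes J (slit y)" unfolding uholes_def
 proof (intro conjI ballI)
  show "disjoint_family_on (slit y) J" using uL yL unfolding uholes_def disjoint_family_on_def by blast
  show "Im z > 0" if "j : J" "z : slit y j" for j z using uL yL that unfolding uholes_def by blast
 qed (use fJ slit_props in auto)
 define ta where "ta k = inv_into (ddom J (E' (p k))) (f (p k))" for k
 have ta: "sym_map J (slit (y' (p k))) (E' (p k)) (ta k)" for k unfolding ta_def by (rule sym_map_inv[OF sm])
 have upy: "EV k. ALL j:J. slit (y' (p k)) j <= nhd (slit y j) e" if "e > 0" for e
  using fJ by (intro eventually_ball_finite) (auto intro: slit_convergence(1)[OF py that])
 obtain s K h where s: "strict_mono (s :: nat => nat)" "sym_map J (slit y) K h"
  "kconv (ddom J (slit y)) (%k. ddom J (slit (y' (p (s k))))) (%k. ta (s k)) h"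
  "!!dl. dl > 0 ==> EV k. ALL j:J. E' (p (s k)) j <= nhd (K j) dl" using sym_maps_compact[OF uy upy ta] by blast
 have uK: "uholes J K" using sym_mapD(2)[OF s(2)] .
 have ps: "strict_mono (%k. p (s k))" using p s(1) by (auto simp: strict_mono_def)
 have EK: "E j <= K j" if j: "j : J" for j
 proof (rule slit_subset_limit)
  show "closed (K j)" using uK j by (auto simp: uholes_def compact_imp_closed)
  show "EV k. E' (p (s k)) j <= nhd (K j) dl" if "dl > 0" for dl using s(4)[OF that] by (rule eventually_mono) (use j in blast)
  show "EV k. E j <= nhd (E' (p (s k)) j) dl" if "dl > 0" for dl by (rule eventually_subseq[OF low[OF that j] ps])
 qed
 have Ly: "ddom J L <= ddom J (slit y)" using yL by (rule ddom_antimono)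
 have hg: "h (g z) = z" if z: "z : ddom J E" for z
 proof -
  have gz: "g z : ddom J (slit y)" using sym_map_image_eq[OF r(2)] z Ly by blast
  have "(%k. f (p k) z) ----> g z" by (rule kconv_tendsto[OF kc z tendsto_const])
  hence "(%k. f (p (s k)) z) ----> g z" using tendsto_subseq[OF _ s(1)] by fastforce
  hence 1: "(%k. ta (s k) (f (p (s k)) z)) ----> h (g z)" by (rule kconv_tendsto[OF s(3) gz])
  have "EV k. {z} <= ddom J (E' (p k))" using kconvD(4)[OF kc, of "{z}"] z by simp
  hence "EV k. {z} <= ddom J (E' (p (s k)))" by (rule eventually_subseq[OF _ s(1)])
  hence "EV k. ta (s k) (f (p (s k)) z) = z"
  proof (rule eventually_mono)
   fix k assume k: "{z} <= ddom J (E' (p (s k)))"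
   have "inj_on (f (p (s k))) (ddom J (E' (p (s k))))" using hole_mapD(5)[OF sym_mapD(3)[OF sm]] .
   thus "ta (s k) (f (p (s k)) z) = z" unfolding ta_def using k by simp
  qed
  hence "(%k. ta (s k) (f (p (s k)) z)) ----> z" by (rule tendsto_eventually)
  thus ?thesis using 1 LIMSEQ_unique by blast
 qed
 have EsubK: "ddom J E <= ddom J K"
 proof
  fix z assume z: "z : ddom J E"
  have "g z : ddom J (slit y)" using sym_map_image_eq[OF r(2)] z Ly by blast
  hence "h (g z) : ddom J K" using sym_map_image_eq[OF s(2)] by blast
  thus "z : ddom J K" using hg[OF z] by simp
 qed
 have E_subset: "ddom J K <= ddom J E" using EK by (rule ddom_antimono)
 \<comment> \<open>\<open>h\<close> is injective and \<open>h (g (h w)) = h w\<close>, so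
   \<open>w = g (h w)\<close> is a value of \<open>g\<close>.\<close>
 have "ddom J (slit y) <= ddom J L"
 proof
  fix w assume w: "w : ddom J (slit y)"
  hence hw: "h w : ddom J E" using sym_map_image_eq[OF s(2)] E_subset by blast
  hence gh: "g (h w) : ddom J L" using sym_map_image_eq[OF r(2)] by blast
  have "h (g (h w)) = h w" by (rule hg[OF hw])
  moreover have "inj_on h (ddom J (slit y))" using hole_mapD(5)[OF sym_mapD(3)[OF s(2)]] .
  ultimately have "g (h w) = w" using w gh Ly by (meson inj_onD subsetD)
  thus "w : ddom J L" using gh by simp
 qed
 hence "slit y j = L j" if "j : J" for j using uholes_eqI[OF uy uL yL _ that] by blast
 hence "sym_map J E (slit y) g" by (intro sym_map_cong[OF r(2)]) auto
 thus ?thesis using that[OF p _ py] by blast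
qed

text \<open>Every subsequence has a further one that converges to slit data of \<open>E\<close>, and
  these are unique.\<close>

theorem slit_data_convergence:
 assumes E: "uholes J E" and up: "!!e j. e > 0 ==> j : J ==> EV k. E' k j <= nhd (E j) e"
  and low: "!!e j. e > 0 ==> j : J ==> EV k. E j <= nhd (E' k j) e"
  and sm: "!!k. sym_map J (E' k) (slit (y' k)) (f k)"
  and N: "!!i k. i div 3 ~: J ==> y' k i = 0"
  and pos: "!!j k. j : J ==> 0 <= y' k (3 * j + 2)"
  and y: "sym_map J E (slit y) g" "!!i. i div 3 ~: J ==> y i = 0" "!!j. j : J ==> 0 <= y (3 * j + 2)"
 shows "y' ----> y"
proof (rule ccontr)
 assume "~ y' ----> y"
 then obtain e where e: "e > 0" "~ (EV k. dist (y' k) y < e)" unfolding tendsto_iff by blast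
 obtain r :: "nat => nat" where r: "strict_mono r" "!!k. ~ dist (y' (r k)) y < e" using not_eventually_subseq[OF e(2)] by blast
 obtain q y2 g2 where q: "strict_mono q" "sym_map J E (slit y2) g2" "(%k. y' (r (q k))) ----> y2"
 proof (rule sym_maps_limit_slits[OF E, of "%k. E' (r k)" "%k. y' (r k)" "%k. f (r k)"])
  show "EV k. E' (r k) j <= nhd (E j) e" if "e > 0" "j : J" for e j by (rule eventually_subseq[OF up[OF that] r(1)])
  show "EV k. E j <= nhd (E' (r k) j) e" if "e > 0" "j : J" for e j by (rule eventually_subseq[OF low[OF that] r(1)])
 qed (use sm N pos in auto)
 have lim: "(%k. y' (r (q k)) i) ----> y2 i" for i using q(3) unfolding tendsto_fun_iff by blast
 have "y2 = y"
 proof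
  fix i
  show "y2 i = y i"
  proof (cases "i div 3 : J")
   case True
   define j where "j = i div 3"
   have j: "j : J" using True by (simp add: j_def)
   have "slit y2 j = slit y j" by (rule sym_slit_unique(2)[OF q(2) _ y(1) _ j]) (rule slit_props(5))+
   moreover have "0 <= y2 (3 * j + 2)" by (rule LIMSEQ_le_const[OF lim]) (use pos j in blast)
   ultimately have "y2 (3 * j) = y (3 * j)" "y2 (3 * j + 1) = y (3 * j + 1)" "y2 (3 * j + 2) = y (3 * j + 2)"
    using slit_eqD[of y2 j y] y(3)[OF j] by auto
   moreover have "i = 3 * j | i = 3 * j + 1 | i = 3 * j + 2" unfolding j_def by auto
   ultimately show ?thesis by auto
  next
   case False
   hence "(%k. 0) ----> y2 i" using lim[of i] N by simp
   thus ?thesis using y(2)[OF False] LIMSEQ_unique[OF tendsto_const] by metis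
  qed
 qed
 hence "EV k. dist (y' (r (q k))) y < e" using q(3) e(1) tendstoD by blast
 thus False using r(2) by simp
qed

section \<open>Shape fields\<close>

lemma hausdorff_dist_less:
 assumes A: "compact A" "A ~= {}" and B: "compact B" "B ~= {}" and e: "hausdorff_dist A B < e"
 shows "A <= nhd B e" "B <= nhd A e"
proof -
 have *: "C <= nhd D e" if C: "compact C" "D ~= {}" "(SUP a\<in>C. infdist a D) < e" for C D :: "complex set"
 proof
  fix z assume z: "z : C"
  have "compact ((%a. infdist a D) ` C)" using C(1) by (intro compact_continuous_image continuous_intros)
  hence "bdd_above ((%a. infdist a D) ` C)" by (intro bounded_imp_bdd_above compact_imp_bounded)
  hence "infdist z D <= (SUP a\<in>C. infdist a D)" using z by (intro cSUP_upper)
  hence "infdist z D < e" using C(3) by simp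
  hence "EX d:D. dist z d < e" using C(2) by (simp add: infdist_def cINF_less_iff)
  thus "z : nhd D e" by (auto simp: in_nhd_iff dist_commute)
 qed
 show "A <= nhd B e" "B <= nhd A e" using * A B e unfolding hausdorff_dist_def by auto
qed

lemma shape_field_near:
 assumes S: "shape_field D S" and p: "p : D" and e: "e > 0"
 shows "EX d>0. ALL q:D. dist q p < d --> S q <= nhd (S p) e & S p <= nhd (S q) e"
proof -
 have shp: "compact (S q)" "S q ~= {}" if "q : D" for q using S that unfolding shape_field_def by auto
 have "((%q. hausdorff_dist (S q) (S p)) ---> 0) (at p within D)" using S p unfolding shape_field_def by blast
 hence "\<forall>\<^sub>F q in at p within D. dist (hausdorff_dist (S q) (S p)) 0 < e" using e by (rule tendstoD)
 then obtain d where d: "d > 0" "!!q. q : D ==> q ~= p ==> dist q p < d ==> abs(hausdorff_dist (S q) (S p)) < e"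
  unfolding eventually_at by auto
 show ?thesis
 proof (intro exI[of _ d] conjI ballI impI d(1))
  fix q assume q: "q : D" "dist q p < d"
  have *: "S q <= nhd (S p) e & S p <= nhd (S q) e"
  proof (cases "q = p")
   case True
   thus ?thesis using subset_nhd[OF e] by blast
  next
   case False
   hence "hausdorff_dist (S q) (S p) < e" using d(2)[OF q(1) False q(2)] by simp
   thus ?thesis using hausdorff_dist_less shp q(1) p by simp
  qed
  thus "S q <= nhd (S p) e" "S p <= nhd (S q) e" by auto
 qed
qed

lemma compact_locally_uniform:
 fixes D :: "complex set"
 assumes D: "compact D" and loc: "!!p. p : D ==> EX d>0. EX K::nat. ALL q:D. dist q p < d --> Q q K"
  and mono: "!!q K K'. Q q K ==> K <= K' ==> Q q K'"
 shows "EX K. ALL q:D. Q q K"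
proof -
 have "ALL p:D. EX d. d > 0 & (EX K. ALL q:D. dist q p < d --> Q q K)" using loc by blast
 from this[unfolded bchoice_iff] obtain d where d: "!!p. p : D ==> d p > 0 & (EX K. ALL q:D. dist q p < d p --> Q q K)" by blast
 have "D <= (UN p:D. ball p (d p))" using d by force
 then obtain F where F: "F <= D" "finite F" "D <= (UN p:F. ball p (d p))" using compactE_image[OF D, of D] by (metis open_ball)
 have "ALL p:F. EX K. ALL q:D. dist q p < d p --> Q q K" using d F(1) by blast
 from this[unfolded bchoice_iff] obtain K where K: "!!p q. p : F ==> q : D ==> dist q p < d p ==> Q q (K p)" by blast
 have "Q q (\<Sum>p\<in>F. K p)" if q: "q : D" for q
 proof -
  obtain p where p: "p : F" "dist q p < d p" using F(3) q by (auto simp: dist_commute)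
  thus ?thesis using mono[OF K[OF p(1) q p(2)]] F(2) by (simp add: member_le_sum)
 qed
 thus ?thesis by blast
qed

text \<open>Adding the variational inequalities for the two closest points bounds the square of their distance.\<close>

lemma closest_point_near:
 fixes A B :: "complex set"
 assumes A: "convex A" "closed A" "A ~= {}" and B: "convex B" "closed B" "B ~= {}"
  and AB: "A <= nhd B e" "B <= nhd A e" and r: "dist x (closest_point A x) <= r" "dist x (closest_point B x) <= r"
 shows "(dist (closest_point A x) (closest_point B x))\<^sup>2 <= 2 * r * e"
proof -
 have *: "inner (x - closest_point S x) (b - closest_point S x) <= r * e"
  if S: "convex S" "closed S" "b : nhd S e" "dist x (closest_point S x) <= r" for S b
 proof -
  obtain s where s: "s : S" "dist s b < e" using S(3) unfolding in_nhd_iff by blast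
  have "inner (x - closest_point S x) (b - closest_point S x) =
    inner (x - closest_point S x) (s - closest_point S x) + inner (x - closest_point S x) (b - s)" by (simp add: inner_diff_right)
  also have "... <= 0 + norm (x - closest_point S x) * norm (b - s)" by (intro add_mono closest_point_dot S s norm_cauchy_schwarz)
  also have "... <= r * e" using S(4) s(2) by (simp add: dist_norm norm_minus_commute) (intro mult_mono, auto intro: order_trans[OF norm_ge_zero])
  finally show ?thesis .
 qed
 let ?a = "closest_point A x" and ?b = "closest_point B x"
 have "?a : nhd B e" "?b : nhd A e" using AB closest_point_in_set[OF A(2,3)] closest_point_in_set[OF B(2,3)] by blast+
 hence "inner (x - ?a) (?b - ?a) + inner (x - ?b) (?a - ?b) <= r * e + r * e"
  using *[OF A(1,2) _ r(1)] *[OF B(1,2) _ r(2)] by (intro add_mono)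
 moreover have "inner (x - ?a) (?b - ?a) + inner (x - ?b) (?a - ?b) = (dist ?a ?b)\<^sup>2"
  by (simp add: dist_norm power2_norm_eq_inner inner_diff_left inner_diff_right inner_commute)
 ultimately show ?thesis by (metis mult_2 mult.assoc)
qed

text \<open>A continuous choice of a boundary point of each shape: translating it to the origin makes the shapes
 depend on the centre continuously, with the centre on the boundary.\<close>

definition boundary_section :: "complex set => (complex => complex set) => (complex => complex) => bool" where
 "boundary_section D S b <-> (ALL p:D. b p : S p) &
  (ALL p:D. EX v. ALL t. 0 < t --> t <= 1 --> b p + of_real t * v ~: S p) &
  (ALL p:D. ALL e>0. EX d>0. ALL q:D. dist q p < d -->
    (%z. z - b q) ` S q <= nhd ((%z. z - b p) ` S p) e & (%z. z - b p) ` S p <= nhd ((%z. z - b q) ` S q) e) &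
  (EX c>0. ALL p:D. EX v:(%z. z - b p) ` S p. c <= cmod v)"

lemma boundary_sectionD:
 assumes "boundary_section D S b"
 shows "p : D ==> b p : S p"
  "p : D ==> EX v. ALL t. 0 < t --> t <= 1 --> b p + of_real t * v ~: S p"
  "p : D ==> e > 0 ==> EX d>0. ALL q:D. dist q p < d -->
    (%z. z - b q) ` S q <= nhd ((%z. z - b p) ` S p) e & (%z. z - b p) ` S p <= nhd ((%z. z - b q) ` S q) e"
  "EX c>0. ALL p:D. EX v:(%z. z - b p) ` S p. c <= cmod v" using assms unfolding boundary_section_def by auto

text \<open>\<open>b p\<close> is the point of \<open>S p\<close> nearest to a fixed point
  \<open>R\<close> outside all shapes. It lies on the boundary because the segment towards
  \<open>R\<close> leaves \<open>S p\<close> at once, and it depends continuously on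
  \<open>p\<close> because nearest points of convex sets do.\<close>

theorem boundary_section_exists:
 assumes D: "compact D" and S: "shape_field D S"
 shows "EX b. boundary_section D S b"
proof -
 have shp: "compact (S q)" "convex (S q)" "S q ~= {}" "closed (S q)" if "q : D" for q
  using S that compact_imp_closed unfolding shape_field_def by blast+
 have two: "EX a:S q. EX b:S q. a ~= b" if "q : D" for q using S that unfolding shape_field_def by blast
 have "EX K. ALL q:D. S q <= cball 0 (real K)"
 proof (rule compact_locally_uniform[OF D])
  fix p assume p: "p : D"
  obtain B where B: "nhd (S p) 1 <= cball 0 B"
   using bounded_subset_cball[OF bounded_nhd[OF compact_imp_bounded[OF shp(1)[OF p]]]] .
  obtain K :: nat where "B < real K" using reals_Archimedean2 by blast
  hence "nhd (S p) 1 <= cball 0 (real K)" using B subset_cball[of B "real K"] by force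
  thus "EX d>0. EX K::nat. ALL q:D. dist q p < d --> S q <= cball 0 (real K)"
   using shape_field_near[OF S p zero_less_one] by (meson order_trans)
 qed (use subset_cball in "meson of_nat_le_iff order_trans")
 then obtain K where K: "!!p. p : D ==> S p <= cball 0 (real K)" by blast
 define R where "R = complex_of_real (real K + 1)"
 define b where "b p = closest_point (S p) R" for p
 have b: "b p : S p" "!!s. s : S p ==> dist R (b p) <= dist R s" if "p : D" for p
  unfolding b_def using closest_point_exists[of "S p" R] shp[OF that] by auto
 have bK: "cmod (b p) <= real K" if "p : D" for p using b(1)[OF that] K[OF that] by auto
 have bR: "dist R (b p) > 0" if "p : D" for p using bK[OF that] norm_triangle_ineq2[of R "b p"]
  unfolding dist_norm R_def norm_of_real by linarith
 have bR2: "dist R (b p) <= 2 * real K + 1" if "p : D" for p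
  using bK[OF that] norm_triangle_ineq4[of R "b p"] unfolding dist_norm R_def norm_of_real by simp
 have out: "b p + of_real t * (R - b p) ~: S p" if p: "p : D" and t: "0 < t" "t <= 1" for p t
 proof
  assume "b p + of_real t * (R - b p) : S p"
  hence "dist R (b p) <= dist R (b p + of_real t * (R - b p))" by (rule b(2)[OF p])
  also have "... = cmod (of_real (1 - t) * (R - b p))" by (simp add: dist_norm algebra_simps)
  also have "... = (1 - t) * dist R (b p)" using t by (simp add: norm_mult dist_norm del: of_real_diff)
  finally have "t * dist R (b p) <= 0" by (simp add: algebra_simps)
  thus False using t(1) bR[OF p] mult_pos_pos[of t "dist R (b p)"] by linarith
 qed
 have bc: "EX d>0. ALL q:D. dist q p < d --> dist (b q) (b p) < e" if p: "p : D" and e: "e > 0" for p e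
 proof -
  have "0 < e\<^sup>2 / (2 * (2 * real K + 1))" using e by simp
  then obtain e' where e': "0 < e'" "e' < e\<^sup>2 / (2 * (2 * real K + 1))" using dense by blast
  hence e'2: "2 * (2 * real K + 1) * e' < e\<^sup>2" by (simp add: pos_less_divide_eq mult.commute)
  obtain d where d: "d > 0" "!!q. q : D ==> dist q p < d ==> S q <= nhd (S p) e' & S p <= nhd (S q) e'"
   using shape_field_near[OF S p e'(1)] by blast
  have "dist (b q) (b p) < e" if q: "q : D" "dist q p < d" for q
  proof -
   have "(dist (b q) (b p))\<^sup>2 <= 2 * (2 * real K + 1) * e'"
    unfolding b_def using d(2)[OF q] shp[OF p] shp[OF q(1)] bR2[OF p] bR2[OF q(1)] by (intro closest_point_near) (auto simp: b_def)
   hence "(dist (b q) (b p))\<^sup>2 < e\<^sup>2" using e'2 by linarith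
   thus ?thesis using e by (simp add: power2_less_imp_less)
  qed
  thus ?thesis using d(1) by blast
 qed
 have nearT: "EX d>0. ALL q:D. dist q p < d -->
    (%z. z - b q) ` S q <= nhd ((%z. z - b p) ` S p) e & (%z. z - b p) ` S p <= nhd ((%z. z - b q) ` S q) e"
  if p: "p : D" and e: "e > 0" for p e
 proof -
  have e2: "e / 2 > 0" using e by simp
  obtain d1 where d1: "d1 > 0" "!!q. q : D ==> dist q p < d1 ==> S q <= nhd (S p) (e / 2) & S p <= nhd (S q) (e / 2)"
   using shape_field_near[OF S p e2] by blast
  obtain d2 where d2: "d2 > 0" "!!q. q : D ==> dist q p < d2 ==> dist (b q) (b p) < e / 2" using bc[OF p e2] by blast
  have sub: "(%z. z - u) ` A <= nhd ((%z. z - v) ` B) e" if AB: "A <= nhd B (e / 2)" "dist u v < e / 2" for A B and u v :: complex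
  proof
   fix z assume "z : (%z. z - u) ` A"
   then obtain a where a: "a : A" "z = a - u" by auto
   hence "a : nhd B (e / 2)" using AB(1) by blast
   then obtain a' where a': "a' : B" "dist a' a < e / 2" unfolding in_nhd_iff by blast
   have "(a' - v) - z = (a' - a) + (u - v)" using a(2) by simp
   hence "cmod ((a' - v) - z) <= cmod (a' - a) + cmod (u - v)" by (metis norm_triangle_ineq)
   hence "dist (a' - v) z < e" using a'(2) AB(2) unfolding dist_norm by simp
   thus "z : nhd ((%z. z - v) ` B) e" using a'(1) unfolding in_nhd_iff by blast
  qed
  show ?thesis
  proof (intro exI[of _ "min d1 d2"] conjI ballI impI)
   show "min d1 d2 > 0" using d1(1) d2(1) by simp
   fix q assume q: "q : D" "dist q p < min d1 d2"
   show "(%z. z - b q) ` S q <= nhd ((%z. z - b p) ` S p) e" using d1(2)[OF q(1)] d2(2)[OF q(1)] q(2) by (intro sub) auto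
   show "(%z. z - b p) ` S p <= nhd ((%z. z - b q) ` S q) e" using d1(2)[OF q(1)] d2(2)[OF q(1)] q(2) by (intro sub) (auto simp: dist_commute)
  qed
 qed
 \<comment> \<open>A uniform lower bound for the extent of the shapes is sought in the form
   \<open>1 / Suc K\<close>, which makes it monotone in a natural number as the covering argument
   requires.\<close>
 have "EX K. ALL q:D. EX v:(%z. z - b q) ` S q. 1 / real (Suc K) <= cmod v"
 proof (rule compact_locally_uniform[OF D])
  fix p assume p: "p : D"
  obtain s where s: "s : S p" "s ~= b p" using two[OF p] by metis
  hence "cmod (s - b p) / 2 > 0" by simp
  then obtain K where K: "1 / real (Suc K) < cmod (s - b p) / 2" using nat_approx_posE by metis
  obtain d where d: "d > 0" "!!q. q : D ==> dist q p < d ==> (%z. z - b p) ` S p <= nhd ((%z. z - b q) ` S q) (cmod (s - b p) / 2)"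
   using nearT[OF p `cmod (s - b p) / 2 > 0`] by meson
  have "EX v:(%z. z - b q) ` S q. 1 / real (Suc K) <= cmod v" if q: "q : D" "dist q p < d" for q
  proof -
   have "s - b p : nhd ((%z. z - b q) ` S q) (cmod (s - b p) / 2)" using d(2)[OF q] s(1) by blast
   then obtain v where v: "v : (%z. z - b q) ` S q" "dist v (s - b p) < cmod (s - b p) / 2" unfolding in_nhd_iff by blast
   have "cmod (s - b p) <= cmod v + dist v (s - b p)"
    using norm_triangle_sub[of "s - b p" v] by (simp add: dist_norm norm_minus_commute)
   thus ?thesis using v K by (intro bexI[OF _ v(1)]) linarith
  qed
  thus "EX d>0. EX K. ALL q:D. dist q p < d --> (EX v:(%z. z - b q) ` S q. 1 / real (Suc K) <= cmod v)" using d(1) by blast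
 next
  fix q and K K' :: nat assume "EX v:(%z. z - b q) ` S q. 1 / real (Suc K) <= cmod v" "K <= K'"
  moreover from this(2) have "1 / real (Suc K') <= 1 / real (Suc K)" by (simp add: frac_le)
  ultimately show "EX v:(%z. z - b q) ` S q. 1 / real (Suc K') <= cmod v" by (meson order_trans)
 qed
 hence lower: "EX c>0. ALL p:D. EX v:(%z. z - b p) ` S p. c <= cmod v" by (meson of_nat_0_less_iff zero_less_Suc zero_less_divide_1_iff)
 show ?thesis unfolding boundary_section_def
 proof (intro exI[of _ b] conjI ballI)
  show "EX v. ALL t. 0 < t --> t <= 1 --> b p + of_real t * v ~: S p" if "p : D" for p using out[OF that] by auto
  show "ALL e>0. EX d>0. ALL q:D. dist q p < d -->
    (%z. z - b q) ` S q <= nhd ((%z. z - b p) ` S p) e & (%z. z - b p) ` S p <= nhd ((%z. z - b q) ` S q) e"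
   if "p : D" for p using nearT[OF that] by blast
 qed (use b(1) lower in auto)
qed

section \<open>Slit data of a half-plane domain\<close>

lemma sym_map_id: "uholes J E ==> sym_map J E E (%z. z)"
proof -
 assume E: "uholes J E"
 note h = holes_dbl[OF E]
 have "hole_map (J \<times> UNIV) (dbl E) (dbl E) (%z. z)" unfolding hole_map_def
 proof (intro conjI allI impI)
  show "bij_betw (%z. z) (ddom J E) (ddom J E)" by (simp add: bij_betw_def)
  show "bounded ((%z. z) ` (ddom J E Int cball 0 R))" for R by auto
  show "bounded {z : ddom J E. z : cball 0 R}" for R by (rule bounded_subset[of "cball 0 R"]) auto
  show "(z : dbl E i) = (w : dbl E i)" if "x ----> z" "(%k. x k) ----> w" for x z w i using LIMSEQ_unique[OF that] by simp
 qed (use h in auto)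
 thus ?thesis using E by (simp add: sym_map_def)
qed

lemma compact_frontier_singleton:
 assumes L: "compact L" "L ~= {}" "frontier L <= {l :: complex}"
 shows "L = {l}"
proof -
 have "w = l" if w: "w : L" for w
 proof (rule ccontr)
  assume "w ~= l"
  have "connected (- {l})" by (simp add: connected_punctured_universe)
  moreover have "- {l} Int L ~= {}" using w `w ~= l` by blast
  moreover have "- {l} - L ~= {}"
  proof
   assume "- {l} - L = {}"
   hence "UNIV <= insert l L" by auto
   hence "bounded (UNIV :: complex set)" using L(1) by (metis bounded_insert compact_imp_bounded bounded_subset)
   thus False by simp
  qed
  ultimately have "- {l} Int frontier L ~= {}" by (rule connected_Int_frontier)
  thus False using L(3) by blast
 qed
 thus ?thesis using L(2) by blast
qed

text \<open>Near the isolated point \<open>a\<close> the map is bounded, so the singularity is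
  removable by Riemann's theorem; all cluster values at \<open>a\<close> equal the value of the
  extension, and the frontier of \<open>L i\<close> is that single point.\<close>

lemma hole_map_point:
 assumes f: "hole_map I E L f" and i: "i : I" and a: "E i = {a}"
 shows "EX l. L i = {l}"
proof -
 note E = hole_mapD(1)[OF f]
 obtain e where e: "0 < e" "!!j k. j : I ==> k : I ==> j ~= k ==> nhd (E j) e Int nhd (E k) e = {}"
  using holes_subset_nhd[OF E zero_less_one] by metis
 have sub: "ball a e - {a} <= hdom I E"
 proof
  fix z assume z: "z : ball a e - {a}"
  have "z ~: E j" if j: "j : I" for j
  proof (cases "j = i")
   case False
   have "z : nhd (E i) e" using z a by (simp add: in_nhd_iff)
   thus ?thesis using e(2)[OF j i False] subset_nhd[OF e(1), of "E j"] by blast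
  qed (use z a in auto)
  thus "z : hdom I E" by (auto simp: hdom_def)
 qed
 define R where "R = cmod a + e"
 have "ball a e - {a} <= cball 0 R"
 proof
  fix z assume "z : ball a e - {a}"
  thus "z : cball 0 R" using norm_triangle_sub[of z a] by (simp add: R_def dist_norm norm_minus_commute)
 qed
 hence "f ` (ball a e - {a}) <= f ` (hdom I E Int cball 0 R)" using sub by blast
 hence "bounded (f ` (ball a e - {a}))" using hole_mapD(7)[OF f] bounded_subset by blast
 then obtain B where B: "!!z. z : ball a e - {a} ==> cmod (f z) <= B" unfolding bounded_iff by blast
 have hl: "f hol (ball a e - {a})" using hole_mapD(3)[OF f] sub holomorphic_on_subset by blast
 have "EX g. g hol ball a e & (ALL z:ball a e - {a}. g z = f z)"
 proof (rule holomorphic_on_extend_bounded[THEN iffD2])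
  show "f hol (ball a e - {a})" by (rule hl)
  show "a : interior (ball a e)" using e(1) by simp
  have "\<forall>\<^sub>F z in at a. cmod (f z) <= B"
   unfolding eventually_at using e(1) B by (intro exI[of _ e]) (auto simp: dist_commute)
  thus "EX B. \<forall>\<^sub>F z in at a. cmod (f z) <= B" by auto
 qed
 then obtain g where g: "g hol ball a e" "!!z. z : ball a e - {a} ==> g z = f z" by auto
 have "frontier (L i) <= {g a}"
 proof
  fix w assume w: "w : frontier (L i)"
  obtain x u where x: "range x <= hdom I L" "x ----> w" "(%k. inv_into (hdom I E) f (x k)) ----> u" "u : E i"
   using hole_map_cluster[OF hole_map_inv[OF f] i w] by auto
  define y where "y k = inv_into (hdom I E) f (x k)" for k
  have y: "y k : hdom I E" "f (y k) = x k" for k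
   using x(1) hole_mapD(6)[OF f] by (auto simp: y_def intro!: inv_into_into f_inv_into_f)
  have ya: "y ----> a" using x(3,4) a by (simp add: y_def[abs_def])
  have "isCont g a" using g(1) e(1) by (metis holomorphic_on_imp_continuous_on continuous_on_eq_continuous_at open_ball centre_in_ball)
  hence "(%k. g (y k)) ----> g a" using ya isCont_tendsto_compose by blast
  moreover have "EV k. g (y k) = x k"
  proof (rule eventually_mono[OF tendstoD[OF ya e(1)]])
   fix k assume k: "dist (y k) a < e"
   have "a ~: hdom I E" using a i by (auto simp: hdom_def)
   hence "y k ~= a" using y(1) by auto
   thus "g (y k) = x k" using g(2)[of "y k"] y(2) k by (simp add: dist_commute)
  qed
  ultimately have "x ----> g a" by (rule Lim_transform_eventually)
  thus "w : {g a}" using x(2) LIMSEQ_unique by blast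
 qed
 hence "L i = {g a}" using hole_mapD(2)[OF f] i by (intro compact_frontier_singleton) (auto simp: holes_def)
 thus ?thesis by simp
qed

lemma sym_map_point_iff:
 assumes f: "sym_map J E L f" and j: "j : J"
 shows "(EX a. E j = {a}) <-> (EX a. L j = {a})"
 using hole_map_point[OF sym_mapD(3)[OF f], of "(j, True)"] hole_map_point[OF sym_mapD(3)[OF sym_map_inv[OF f]], of "(j, True)"] j
 by auto

text \<open>The last two clauses single out one coordinate vector: coordinates that belong to no
  hole are 0, and lengths are not negative.\<close>

definition slit_data :: "nat set => (nat => complex set) => (nat => real) => bool" where
 "slit_data J E y <-> (EX f. sym_map J E (slit y) f) & (ALL i. i div 3 ~: J --> y i = 0) & (ALL j:J. 0 <= y (3 * j + 2))"

lemma div3_cases: obtains "i = 3 * (i div 3)" | "i = 3 * (i div 3) + 1" | "i = 3 * (i div 3) + (2::nat)"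
 by force

lemma slit_data_exists:
 assumes E: "uholes J E" shows "EX y. slit_data J E y"
proof -
 obtain L f where f: "sym_map J E L f" "!!j. j : J ==> horizontal (L j)" using sym_slit_exists[OF E] by auto
 have "ALL j:J. EX a b l. l >= 0 & L j = cbox (Complex a b) (Complex (a + l) b)"
  using sym_mapD(2)[OF f(1)] f(2) by (auto simp: uholes_def intro!: horizontal_eq_cbox)
 then obtain a b l where abl: "!!j. j : J ==> l j >= 0 & L j = cbox (Complex (a j) (b j)) (Complex (a j + l j) (b j))" by metis
 define y where "y i = (if i div 3 : J then (if i mod 3 = 0 then a (i div 3) else if i mod 3 = 1 then b (i div 3) else l (i div 3)) else 0)" for i
 have y: "y (3 * j) = a j" "y (3 * j + 1) = b j" "y (3 * j + 2) = l j" if "j : J" for j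
 proof -
  have "(3 * j) div 3 = j" "(3 * j) mod 3 = 0" "(3 * j + 1) div 3 = j" "(3 * j + 1) mod 3 = 1" "(3 * j + 2) div 3 = j" "(3 * j + 2) mod 3 = 2"
   by presburger+
  thus "y (3 * j) = a j" "y (3 * j + 1) = b j" "y (3 * j + 2) = l j" using that unfolding y_def by auto
 qed
 have "L j = slit y j" if "j : J" for j using abl[OF that] unfolding slit_def y[OF that] by simp
 hence "sym_map J E (slit y) f" by (intro sym_map_cong[OF f(1)]) auto
 thus ?thesis unfolding slit_data_def using y(3) abl by (intro exI[of _ y]) (auto simp: y_def)
qed

lemma slit_data_unique:
 assumes "slit_data J E y" "slit_data J E y'" shows "y = y'"
proof
 fix i
 obtain f g where fg: "sym_map J E (slit y) f" "sym_map J E (slit y') g" using assms by (auto simp: slit_data_def)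
 show "y i = y' i"
 proof (cases "i div 3 : J")
  case True
  define j where "j = i div 3"
  have j: "j : J" using True by (simp add: j_def)
  have "slit y j = slit y' j" by (rule sym_slit_unique(2)[OF fg(1) _ fg(2) _ j]) (rule slit_props(5))+
  hence "y (3 * j) = y' (3 * j)" "y (3 * j + 1) = y' (3 * j + 1)" "y (3 * j + 2) = y' (3 * j + 2)"
   using slit_eqD[of y j y'] assms j unfolding slit_data_def by blast+
  thus ?thesis unfolding j_def by (metis div3_cases)
 qed (use assms in "simp add: slit_data_def")
qed

lemma slit_singleton_iff: "0 <= y (3 * j + 2) ==> (EX a. slit y j = {a}) <-> y (3 * j + 2) = 0"
proof
 assume y: "0 <= y (3 * j + 2)" and "EX a. slit y j = {a}"
 then obtain a where a: "slit y j = {a}" by auto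
 have "Complex (y (3 * j)) (y (3 * j + 1)) : slit y j" "Complex (y (3 * j) + y (3 * j + 2)) (y (3 * j + 1)) : slit y j"
  using y by (auto simp: in_slit_iff)
 thus "y (3 * j + 2) = 0" unfolding a by auto
next
 assume "y (3 * j + 2) = 0"
 thus "EX a. slit y j = {a}" by (simp add: slit_def)
qed

lemma slit_data_zero_iff:
 assumes "slit_data J E y" "j : J"
 shows "y (3 * j + 2) = 0 <-> (EX a. E j = {a})"
proof -
 obtain f where "sym_map J E (slit y) f" using assms by (auto simp: slit_data_def)
 from sym_map_point_iff[OF this assms(2)] slit_singleton_iff[of y j] assms show ?thesis by (simp add: slit_data_def)
qed

section \<open>Configurations of shapes and their slit data\<close>

lemma continuous_near_compact:
 fixes Ph :: "complex => complex"
 assumes D: "open D" and c: "continuous_on D Ph" and P: "compact P" "P <= D" and e: "e > 0"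
 obtains d where "d > 0" "nhd P d <= D" "!!x y. x : P ==> dist x y < d ==> dist (Ph x) (Ph y) < e"
proof -
 obtain d0 where d0: "d0 > 0" "nhd P d0 <= D" using nhd_subset_open[OF P(1) D P(2)] .
 define Q where "Q = closure (nhd P (d0 / 2))"
 have "bounded (nhd P (d0 / 2))" using P(1) by (intro bounded_nhd compact_imp_bounded)
 hence cQ: "compact Q" unfolding Q_def by simp
 have QD: "Q <= D"
 proof
  fix z assume "z : Q"
  then obtain w where w: "w : nhd P (d0 / 2)" "dist w z < d0 / 2"
   unfolding Q_def using closure_approachable[of z] d0(1) by (metis half_gt_zero)
  then obtain x where x: "x : P" "dist x w < d0 / 2" unfolding in_nhd_iff by blast
  have "dist x z < d0" using w x dist_triangle[of x z w] by simp
  hence "z : nhd P d0" using x(1) unfolding in_nhd_iff by blast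
  thus "z : D" using d0 by blast
 qed
 have "uniformly_continuous_on Q Ph" by (rule compact_uniformly_continuous[OF continuous_on_subset[OF c QD] cQ])
 then obtain d1 where d1: "d1 > 0" "!!x y. x : Q ==> y : Q ==> dist y x < d1 ==> dist (Ph y) (Ph x) < e"
  unfolding uniformly_continuous_on_def using e by auto
 have nQ: "nhd P (d0 / 2) <= Q" unfolding Q_def by (rule closure_subset)
 show ?thesis
 proof (rule that[of "min d1 (d0 / 2)"])
  show "min d1 (d0 / 2) > 0" using d0 d1 by simp
  show "nhd P (min d1 (d0 / 2)) <= D"
   proof -
    have "min d1 (d0 / 2) <= d0" using d0(1) by simp
    thus ?thesis using nhd_mono[OF order_refl] d0(2) by blast
   qed
  show "dist (Ph x) (Ph y) < e" if "x : P" "dist x y < min d1 (d0 / 2)" for x y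
  proof -
   have "x : nhd P (d0 / 2)" using that(1) subset_nhd[of "d0 / 2" P] d0(1) by auto
   moreover have "y : nhd P (d0 / 2)" using that unfolding in_nhd_iff by auto
   ultimately show ?thesis using d1(2)[of y x] that(2) nQ by auto
  qed
 qed
qed

text \<open>\<open>D\<close> stands for the target Jordan domain, seen through the half-plane map
  \<open>Ph\<close>, and \<open>T j p\<close> for the shape at \<open>p\<close> translated so that
  its chosen boundary point is at 0. The constant \<open>c0\<close> gives all shapes a minimal
  extent, so that sizes are bounded and a positive size never gives a point.\<close>

locale shape_configuration =
 fixes J :: "nat set" and D :: "complex set" and Ph Ps :: "complex => complex"
  and T :: "nat => complex => complex set" and c0 :: real
 assumes finJ: "finite J" and D: "open D" "connected D" "bounded D"
  and Phc: "continuous_on D Ph" and Psc: "continuous_on uhp Ps"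
  and PhD: "!!z. z : D ==> Im (Ph z) > 0 & Ps (Ph z) = z"
  and PsU: "!!w. Im w > 0 ==> Ps w : D & Ph (Ps w) = w"
  and T: "!!j p. j : J ==> p : D ==> compact (T j p) & convex (T j p) & 0 : T j p"
  and T_near: "!!j p e. j : J ==> p : D ==> e > 0 ==>
   EX d>0. ALL q:D. dist q p < d --> T j q <= nhd (T j p) e & T j p <= nhd (T j q) e"
  and c0: "c0 > 0" "!!j p. j : J ==> p : D ==> EX v:T j p. c0 <= cmod v"
begin

definition hat :: "(nat => real) => nat => complex" where "hat X j = Complex (X (3 * j)) (X (3 * j + 1))"

text \<open>Scaling about 0 keeps the chosen point of the translated shape in place, so
  \<open>Ps (hat X j)\<close> is both the place where the shape field is evaluated and a point of
  the shape.\<close>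

definition shp :: "(nat => real) => nat => complex set" where
 "shp X j = (%v. Ps (hat X j) + of_real (max 0 (X (3 * j + 2))) * v) ` T j (Ps (hat X j))"

definition hl :: "(nat => real) => nat => complex set" where "hl X j = Ph ` shp X j"

definition valid :: "(nat => real) set" where
 "valid = {X. (ALL j:J. X (3 * j + 1) > 0 & shp X j <= D) & disjoint_family_on (shp X) J}"

lemma pt_in: "X (3 * j + 1) > 0 ==> Ps (hat X j) : D"
 using PsU by (simp add: hat_def)

lemma shp_props:
 assumes "j : J" "X (3 * j + 1) > 0"
 shows "compact (shp X j)" "convex (shp X j)" "Ps (hat X j) : shp X j" "X (3 * j + 2) <= 0 ==> shp X j = {Ps (hat X j)}"
proof -
 note t = T[OF assms(1) pt_in[of X, OF assms(2)]]
 show "compact (shp X j)" unfolding shp_def using t by (intro compact_continuous_image continuous_intros) auto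
 have "shp X j = (+) (Ps (hat X j)) ` ((*\<^sub>R) (max 0 (X (3 * j + 2))) ` T j (Ps (hat X j)))"
  by (simp add: shp_def image_image scaleR_conv_of_real)
 thus "convex (shp X j)" using t by (metis convex_scaling convex_translation)
 show "Ps (hat X j) : shp X j" unfolding shp_def using t by auto
 show "shp X j = {Ps (hat X j)}" if "X (3 * j + 2) <= 0" unfolding shp_def using t that by auto
qed

lemma shp_not_singleton:
 assumes "j : J" "X (3 * j + 1) > 0" "X (3 * j + 2) > 0"
 shows "EX w:shp X j. cmod (w - Ps (hat X j)) >= X (3 * j + 2) * c0"
proof -
 obtain v where v: "v : T j (Ps (hat X j))" "c0 <= cmod v" using c0(2)[OF assms(1) pt_in[of X, OF assms(2)]] by blast
 have "Ps (hat X j) + of_real (X (3 * j + 2)) * v : shp X j" unfolding shp_def using v(1) assms(3) by simp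
 moreover have "cmod (of_real (X (3 * j + 2)) * v) >= X (3 * j + 2) * c0" using v(2) assms(3) by (simp add: norm_mult)
 ultimately show ?thesis by force
qed

lemma Ph_inj: "x : D ==> y : D ==> Ph x = Ph y ==> x = y"
 using PhD by metis

lemma Ps_hol: "j : J ==> X : valid ==> Ps ` hl X j = shp X j"
proof -
 assume "j : J" "X : valid"
 hence "shp X j <= D" by (auto simp: valid_def)
 hence "!!x. x : shp X j ==> Ps (Ph x) = x" using PhD by blast
 thus ?thesis by (simp add: hl_def image_image)
qed

text \<open>The images need not be convex; that their complements are connected is transported from
  the convex shapes through the homeomorphism between \<open>D\<close> and the half-plane.\<close>

lemma uholes_hol: assumes X: "X : valid" shows "uholes J (hl X)"
 unfolding uholes_def
proof (intro conjI ballI)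
 have sub: "shp X j <= D" "X (3 * j + 1) > 0" if "j : J" for j using X that by (auto simp: valid_def)
 show "finite J" by (rule finJ)
 show "disjoint_family_on (hl X) J" unfolding disjoint_family_on_def
 proof (intro ballI impI)
  fix i j assume ij: "i : J" "j : J" "i ~= j"
  have "shp X i Int shp X j = {}" using X ij by (auto simp: valid_def disjoint_family_on_def)
  thus "hl X i Int hl X j = {}" unfolding hl_def using sub(1)[OF ij(1)] sub(1)[OF ij(2)] Ph_inj by blast
 qed
 fix j assume j: "j : J"
 note s = sub[OF j] and p = shp_props[of j X, OF j sub(2)[OF j]]
 have cS: "continuous_on (shp X j) Ph" using Phc s(1) continuous_on_subset by blast
 show ch: "compact (hl X j)" unfolding hl_def using cS p(1) by (rule compact_continuous_image)
 show "connected (hl X j)" unfolding hl_def using cS p(2) by (intro connected_continuous_image convex_connected)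
 show "hl X j ~= {}" unfolding hl_def using p(3) by blast
 show im: "0 < Im z" if "z : hl X j" for z using that PhD s(1) unfolding hl_def by blast
 show "connected (- hl X j)"
 proof (rule connected_compl_of_diff)
  show "open uhp" by (rule open_halfspace_Im_gt)
  show "closed (hl X j)" using ch by (rule compact_imp_closed)
  show "hl X j <= uhp" using im by blast
  have "connected (- shp X j)" using p(1,2) by (intro connected_complement_bounded_convex) (auto simp: compact_imp_bounded)
  hence "connected (D - shp X j)" using connected_open_diff_closed[OF D(1,2) p(1) s(1)] by blast
  hence "connected (Ph ` (D - shp X j))" using Phc by (meson connected_continuous_image continuous_on_subset Diff_subset)
  moreover have "Ph ` (D - shp X j) = uhp - hl X j"
  proof
   show "Ph ` (D - shp X j) <= uhp - hl X j" unfolding hl_def using PhD Ph_inj s(1) by blast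
   show "uhp - hl X j <= Ph ` (D - shp X j)"
   proof
    fix w assume w: "w : uhp - hl X j"
    hence "Ps w : D" "Ph (Ps w) = w" using PsU by auto
    moreover have "Ps w ~: shp X j" using w `Ph (Ps w) = w` unfolding hl_def by force
    ultimately show "w : Ph ` (D - shp X j)" by force
   qed
  qed
  ultimately show "connected (uhp - hl X j)" by simp
 qed
qed

lemma hol_singleton_iff:
 assumes X: "X : valid" and j: "j : J"
 shows "(EX a. hl X j = {a}) <-> X (3 * j + 2) <= 0"
proof
 have s: "X (3 * j + 1) > 0" using X j by (auto simp: valid_def)
 show "EX a. hl X j = {a}" if "X (3 * j + 2) <= 0" unfolding hl_def shp_props(4)[of j X, OF j s that] by simp
 assume "EX a. hl X j = {a}"
 then obtain a where "hl X j = {a}" by auto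
 hence sh: "shp X j = {Ps a}" using Ps_hol[OF j X] by simp
 show "X (3 * j + 2) <= 0"
 proof (rule ccontr)
  assume n: "~ X (3 * j + 2) <= 0"
  hence "X (3 * j + 2) > 0" by simp
  from shp_not_singleton[of j X, OF j s this] obtain w where w: "w : shp X j" "cmod (w - Ps (hat X j)) >= X (3 * j + 2) * c0" by auto
  have "X (3 * j + 2) * c0 > 0" using n c0(1) by simp
  moreover have "w = Ps (hat X j)" using w(1) shp_props(3)[of j X, OF j s] sh by simp
  ultimately show False using w(2) by simp
 qed
qed

text \<open>Three perturbations enter: of the centre, of the size and of the shape. Each is kept to
  at most a quarter of \<open>e\<close>; the second uses the bound \<open>B\<close> on the shape,
  the third the bound \<open>r + 1\<close> on nearby sizes.\<close>

lemma shp_near: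
 assumes j: "j : J" and s: "X (3 * j + 1) > 0" and lim: "x ----> X" and e: "e > 0"
 shows "EV k. 0 < x k (3 * j + 1) & shp (x k) j <= nhd (shp X j) e & shp X j <= nhd (shp (x k) j) e"
proof -
 have l: "(%k. x k i) ----> X i" for i using lim unfolding tendsto_fun_iff by blast
 have "(%k. hat (x k) j) ----> hat X j" unfolding hat_def by (intro tendsto_Complex l)
 moreover have "isCont Ps (hat X j)" using Psc s open_halfspace_Im_gt[of 0] by (simp add: continuous_on_eq_continuous_at hat_def)
 ultimately have lp: "(%k. Ps (hat (x k) j)) ----> Ps (hat X j)" by (rule isCont_tendsto_compose[rotated])
 define p where "p = Ps (hat X j)"
 have pD: "p : D" unfolding p_def by (rule pt_in[of X, OF s])
 define r where "r = max 0 (X (3 * j + 2))"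
 have "bounded (T j p)" using T[OF j pD] by (intro compact_imp_bounded) blast
 then obtain B0 where B0: "!!v. v : T j p ==> cmod v <= B0" unfolding bounded_iff by blast
 define B where "B = max 1 B0 + 1"
 have "B > 1" "B0 <= B" by (auto simp: B_def)
 hence B: "B > 1" "!!v. v : T j p ==> cmod v <= B" using B0 by (blast, meson order_trans)
 define et where "et = min 1 (e / (4 * (r + 1)))"
 have r0: "r >= 0" by (simp add: r_def)
 have et: "et > 0" "et <= 1" "(r + 1) * et <= e / 4"
 proof -
  show "et > 0" "et <= 1" using e r0 by (auto simp: et_def)
  have "(r + 1) * et <= (r + 1) * (e / (4 * (r + 1)))" using r0 by (intro mult_left_mono) (auto simp: et_def)
  also have "... = e / 4" using r0 by (simp add: field_simps)
  finally show "(r + 1) * et <= e / 4" .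
 qed
 obtain d where d: "d > 0" "!!q. q : D ==> dist q p < d ==> T j q <= nhd (T j p) et & T j p <= nhd (T j q) et"
  using T_near[OF j pD et(1)] by blast
 define dl where "dl = min 1 (e / (4 * (B + 1)))"
 have dl: "dl > 0" "dl <= 1" "dl * (B + 1) <= e / 4"
 proof -
  show "dl > 0" "dl <= 1" using e B(1) by (auto simp: dl_def)
  have "dl * (B + 1) <= (e / (4 * (B + 1))) * (B + 1)" using B(1) by (intro mult_right_mono) (auto simp: dl_def)
  also have "... = e / 4" using B(1) by (simp add: field_simps)
  finally show "dl * (B + 1) <= e / 4" .
 qed
 have "(%k. max 0 (x k (3 * j + 2))) ----> r" unfolding r_def by (intro tendsto_max tendsto_const l)
 hence e1: "EV k. dist (max 0 (x k (3 * j + 2))) r < dl" using dl(1) by (rule tendstoD)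
 have "0 < min d (e / 4)" using d(1) e by simp
 hence e2: "EV k. dist (Ps (hat (x k) j)) p < min d (e / 4)" using lp unfolding p_def by (rule tendstoD[rotated])
 have e3: "EV k. 0 < x k (3 * j + 1)" using l s by (rule order_tendstoD)
 have move: "cmod ((q + of_real t * w) - (q' + of_real t' * w')) < e"
  if "cmod (q - q') < e / 4" "abs(t - t') < dl" "cmod w <= B + 1" "cmod (w - w') < et" "0 <= t'" "t' <= r + 1" for q q' w w' t t'
 proof -
  have "(q + of_real t * w) - (q' + of_real t' * w') = (q - q') + (of_real (t - t') * w + of_real t' * (w - w'))" by (simp add: algebra_simps)
  hence "cmod ((q + of_real t * w) - (q' + of_real t' * w')) <= cmod (q - q') + (cmod (of_real (t - t') * w) + cmod (of_real t' * (w - w')))"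
   by (metis norm_triangle_mono order_refl)
  also have "... = cmod (q - q') + (abs(t - t') * cmod w + t' * cmod (w - w'))" using that(5) by (simp add: norm_mult del: of_real_diff)
  also have "abs(t - t') * cmod w <= dl * (B + 1)" using that(2,3) by (intro mult_mono) auto
  also have "t' * cmod (w - w') <= (r + 1) * et" using that(4-6) by (intro mult_mono) auto
  finally show ?thesis using that(1) dl(3) et(3) e by simp
 qed
 show ?thesis using eventually_conj[OF e1 eventually_conj[OF e2 e3]]
 proof (rule eventually_mono)
  fix k assume k: "dist (max 0 (x k (3 * j + 2))) r < dl & dist (Ps (hat (x k) j)) p < min d (e / 4) & 0 < x k (3 * j + 1)"
  define q where "q = Ps (hat (x k) j)"
  define t where "t = max 0 (x k (3 * j + 2))"
  have qD: "q : D" unfolding q_def using pt_in[of "x k" j] k by blast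
  have tr: "abs(t - r) < dl" "0 <= t" "t <= r + 1" using k dl(2) by (auto simp: t_def dist_real_def)
  have qp: "cmod (q - p) < e / 4" "dist q p < d" using k by (auto simp: q_def dist_norm)
  note TT = d(2)[OF qD qp(2)]
  have sx: "shp (x k) j = (%v. q + of_real t * v) ` T j q" "shp X j = (%v. p + of_real r * v) ` T j p"
   by (simp_all add: shp_def q_def t_def p_def r_def)
  have "shp (x k) j <= nhd (shp X j) e"
  proof
   fix z assume "z : shp (x k) j"
   then obtain v where v: "v : T j q" "z = q + of_real t * v" using sx by blast
   hence "v : nhd (T j p) et" using TT by blast
   then obtain u where u: "u : T j p" "dist u v < et" unfolding in_nhd_iff by blast
   have "cmod ((p + of_real r * u) - z) < e" unfolding v(2)
    by (rule move) (use u v qp tr B(2)[OF u(1)] in "auto simp: dist_norm norm_minus_commute")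
   thus "z : nhd (shp X j) e" unfolding in_nhd_iff sx using u(1) by (auto simp: dist_norm)
  qed
  moreover have "shp X j <= nhd (shp (x k) j) e"
  proof
   fix z assume "z : shp X j"
   then obtain v where v: "v : T j p" "z = p + of_real r * v" using sx by blast
   hence "v : nhd (T j q) et" using TT by blast
   then obtain u where u: "u : T j q" "dist u v < et" unfolding in_nhd_iff by blast
   have "cmod u <= B + 1" using B(2)[OF v(1)] u(2) et(2) norm_triangle_sub[of u v] by (simp add: dist_norm)
   hence "cmod ((q + of_real t * u) - z) < e" unfolding v(2) by (intro move) (use u v qp tr r0 in "auto simp: dist_norm")
   thus "z : nhd (shp (x k) j) e" unfolding in_nhd_iff sx using u(1) by (auto simp: dist_norm)
  qed
  ultimately show "0 < x k (3 * j + 1) & shp (x k) j <= nhd (shp X j) e & shp X j <= nhd (shp (x k) j) e" using k by blast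
 qed
qed

lemma hol_near:
 assumes X: "X : valid" and j: "j : J" and lim: "x ----> X" and e: "e > 0"
 shows "EV k. hl (x k) j <= nhd (hl X j) e & hl X j <= nhd (hl (x k) j) e"
proof -
 have s: "X (3 * j + 1) > 0" "shp X j <= D" using X j by (auto simp: valid_def)
 obtain d where d: "d > 0" "nhd (shp X j) d <= D" "!!u v. u : shp X j ==> dist u v < d ==> dist (Ph u) (Ph v) < e"
  using continuous_near_compact[OF D(1) Phc shp_props(1)[of j X, OF j s(1)] s(2) e] by auto
 show ?thesis using shp_near[OF j s(1) lim d(1)]
 proof (rule eventually_mono)
  fix k assume k: "0 < x k (3 * j + 1) & shp (x k) j <= nhd (shp X j) d & shp X j <= nhd (shp (x k) j) d"
  show "hl (x k) j <= nhd (hl X j) e & hl X j <= nhd (hl (x k) j) e"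
  proof (intro conjI subsetI)
   fix z assume "z : hl (x k) j"
   then obtain v where v: "v : shp (x k) j" "z = Ph v" by (auto simp: hl_def)
   then obtain u where u: "u : shp X j" "dist u v < d" using k unfolding nhd_def by auto
   thus "z : nhd (hl X j) e" using d(3)[OF u] v(2) unfolding in_nhd_iff hl_def by blast
  next
   fix z assume "z : hl X j"
   then obtain u where u: "u : shp X j" "z = Ph u" by (auto simp: hl_def)
   then obtain v where v: "v : shp (x k) j" "dist v u < d" using k unfolding nhd_def by auto
   hence "dist (Ph v) z < e" using d(3)[OF u(1), of v] u(2) by (simp add: dist_commute)
   thus "z : nhd (hl (x k) j) e" using v(1) unfolding in_nhd_iff hl_def by blast
  qed
 qed
qed

lemma eventually_valid:
 assumes X: "X : valid" and lim: "x ----> X"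
 shows "EV k. x k : valid"
proof -
 have s: "X (3 * j + 1) > 0" "shp X j <= D" if "j : J" for j using X that by (auto simp: valid_def)
 have cs: "compact (shp X j)" if "j : J" for j using shp_props(1)[of _ X, OF that s(1)[OF that]] .
 obtain e where e: "e > 0" "!!i j. i : J ==> j : J ==> i ~= j ==> nhd (shp X i) e Int nhd (shp X j) e = {}"
 using X nhds_disjoint_family finJ cs that by (auto simp: valid_def)
 have "ALL j:J. EX d>0. nhd (shp X j) d <= D" using nhd_subset_open[OF cs D(1) s(2)] by metis
 then obtain d where d: "!!j. j : J ==> d j > 0" "!!j. j : J ==> nhd (shp X j) (d j) <= D" by metis
 have "EV k. ALL j:J. 0 < x k (3 * j + 1) & shp (x k) j <= nhd (shp X j) (min e (d j))"
 proof (intro eventually_ball_finite finJ ballI)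
  fix j assume j: "j : J"
  have "min e (d j) > 0" using e(1) d(1)[OF j] by simp
  from shp_near[OF j s(1)[OF j] lim this] show "EV k. 0 < x k (3 * j + 1) & shp (x k) j <= nhd (shp X j) (min e (d j))"
   by (rule eventually_mono) blast
 qed
 thus ?thesis
 proof (rule eventually_mono)
  fix k assume k: "ALL j:J. 0 < x k (3 * j + 1) & shp (x k) j <= nhd (shp X j) (min e (d j))"
  have a: "shp (x k) j <= nhd (shp X j) e" "shp (x k) j <= D" if "j : J" for j
  proof -
   have "shp (x k) j <= nhd (shp X j) (min e (d j))" using k that by blast
   thus "shp (x k) j <= nhd (shp X j) e" "shp (x k) j <= D"
    using nhd_mono[OF order_refl, of "min e (d j)" e "shp X j"] nhd_mono[OF order_refl, of "min e (d j)" "d j" "shp X j"] d(2)[OF that] by auto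
  qed
  have "disjoint_family_on (shp (x k)) J" unfolding disjoint_family_on_def using a(1) e(2) by blast
  thus "x k : valid" using k a(2) by (auto simp: valid_def)
 qed
qed

lemma open_valid: "open valid"
proof -
 have "closed (- valid)" unfolding closed_sequential_limits using allI impI conjE eventually_valid by fastforce
 thus ?thesis by (simp add: closed_def)
qed

text \<open>A shape of size \<open>r > 0\<close> contains a point at distance at least
  \<open>r * c0\<close> from its centre, and both lie in \<open>D\<close>.\<close>

lemma rad_bound:
 assumes DM: "D <= cball 0 M" and X: "X : valid" and j: "j : J"
 shows "X (3 * j + 2) <= 2 * abs(M) / c0"
proof (cases "X (3 * j + 2) > 0")
 case True
 have s: "X (3 * j + 1) > 0" "shp X j <= D" using X j by (auto simp: valid_def)
 obtain w where w: "w : shp X j" "cmod (w - Ps (hat X j)) >= X (3 * j + 2) * c0" using shp_not_singleton[of j X, OF j s(1) True] by blast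
 have "cmod w <= M" "cmod (Ps (hat X j)) <= M" using w(1) shp_props(3)[of j X, OF j s(1)] s(2) DM by auto
 hence "cmod (w - Ps (hat X j)) <= 2 * abs(M)" using norm_triangle_ineq4[of w "Ps (hat X j)"] by simp
 hence "X (3 * j + 2) * c0 <= 2 * abs(M)" using w(2) by simp
 thus ?thesis using c0(1) by (simp add: field_simps)
next
 case False
 moreover have "0 <= 2 * abs(M) / c0" using c0(1) by simp
 ultimately show ?thesis by simp
qed

definition dat :: "(nat => real) => nat => real" where "dat X = (SOME y. slit_data J (hl X) y)"

lemma dat: "X : valid ==> slit_data J (hl X) (dat X)"
 unfolding dat_def by (rule someI_ex[OF slit_data_exists[OF uholes_hol]])

lemma dat_zero_iff: "X : valid ==> j : J ==> dat X (3 * j + 2) = 0 <-> X (3 * j + 2) <= 0"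
 using slit_data_zero_iff[OF dat] hol_singleton_iff by blast

lemma dat_nonneg: "X : valid ==> j : J ==> 0 <= dat X (3 * j + 2)"
 using dat by (auto simp: slit_data_def)

text \<open>If all shapes are points, the half-plane without them already is a slit domain, and the
  identity is its slit map.\<close>

lemma dat_points:
 assumes X: "X : valid" and r: "!!j. j : J ==> X (3 * j + 2) <= 0" and j: "j : J"
 shows "dat X (3 * j) = X (3 * j)" "dat X (3 * j + 1) = X (3 * j + 1)"
proof -
 define y where "y i = (if i div 3 : J & i mod 3 ~= 2 then X i else 0)" for i
 have y: "y (3 * j) = X (3 * j)" "y (3 * j + 1) = X (3 * j + 1)" "y (3 * j + 2) = 0" if "j : J" for j
 proof -
  have "(3 * j) div 3 = j" "(3 * j) mod 3 = 0" "(3 * j + 1) div 3 = j" "(3 * j + 1) mod 3 = 1" "(3 * j + 2) div 3 = j" "(3 * j + 2) mod 3 = 2"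
   by presburger+
  thus "y (3 * j) = X (3 * j)" "y (3 * j + 1) = X (3 * j + 1)" "y (3 * j + 2) = 0" using that unfolding y_def by auto
 qed
 have "hl X j = slit y j" if j: "j : J" for j
 using X j shp_props r PsU y cbox_idem by (auto simp: valid_def hl_def hat_def slit_def)
 hence "sym_map J (hl X) (slit y) (%z. z)" by (intro sym_map_cong[OF sym_map_id[OF uholes_hol[OF X]]]) auto
 hence "slit_data J (hl X) y" unfolding slit_data_def using y(3) by (auto simp: y_def)
 hence "dat X = y" using slit_data_unique dat[OF X] by blast
 thus "dat X (3 * j) = X (3 * j)" "dat X (3 * j + 1) = X (3 * j + 1)" using y[OF j] by auto
qed

lemma continuous_dat: "continuous_on valid dat"
 unfolding continuous_on_sequentially
proof (intro allI ballI impI, elim conjE)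
 fix x X assume X: "X : valid" "ALL n. x n : valid" "x ----> X"
 obtain g where g: "sym_map J (hl X) (slit (dat X)) g" using dat[OF X(1)] by (auto simp: slit_data_def)
 have "ALL k. EX f. sym_map J (hl (x k)) (slit (dat (x k))) f" using dat X(2) by (auto simp: slit_data_def)
 from this[unfolded choice_iff] obtain f where f: "!!k. sym_map J (hl (x k)) (slit (dat (x k))) (f k)" by auto
 have "(%k. dat (x k)) ----> dat X"
 proof (rule slit_data_convergence[OF uholes_hol[OF X(1)], of "%k. hl (x k)" "%k. dat (x k)" f "dat X" g])
  show "EV k. hl (x k) j <= nhd (hl X j) e" if "e > 0" "j : J" for e j
   using hol_near[OF X(1) that(2) X(3) that(1)] by (rule eventually_mono) blast
  show "EV k. hl X j <= nhd (hl (x k) j) e" if "e > 0" "j : J" for e j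
   using hol_near[OF X(1) that(2) X(3) that(1)] by (rule eventually_mono) blast
  show "sym_map J (hl (x k)) (slit (dat (x k))) (f k)" for k by (rule f)
  show "sym_map J (hl X) (slit (dat X)) g" by (rule g)
  show "dat (x k) i = 0" if "i div 3 ~: J" for i k using dat[of "x k"] X(2) that by (auto simp: slit_data_def)
  show "dat X i = 0" if "i div 3 ~: J" for i using dat[OF X(1)] that by (auto simp: slit_data_def)
  show "0 <= dat (x k) (3 * j + 2)" if "j : J" for j k using dat_nonneg X(2) that by blast
  show "0 <= dat X (3 * j + 2)" if "j : J" for j using dat_nonneg X(1) that by blast
 qed
 thus "(dat o x) ----> dat X" by (simp add: o_def)
qed

end

section \<open>The homotopy and its zeros\<close>

context shape_configuration
begin

text \<open>A negative size parameter gives a point, whose slit has length 0. Adding the negative part of the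
 parameter to the length makes the corrected datum see it, so that zeros with negative size are excluded.\<close>

definition mdat :: "(nat => real) => nat => real" where
 "mdat X i = dat X i + (if i mod 3 = 2 & i div 3 : J then min 0 (X i) else 0)"

definition shrink :: "(nat => real) => real => nat => real" where
 "shrink y t i = (if i mod 3 = 2 then t * y i else y i)"

text \<open>For t up to 1/2 the slit data are deformed to the identity map, with target the slits of length 0; from
 1/2 to 1 the target slits grow to their full length.\<close>

definition htp :: "(nat => real) => real => (nat => real) => nat => real" where
 "htp y t X i = (if i div 3 : J then (1 - min 1 (2 * t)) * (X i - shrink y 0 i) + min 1 (2 * t) * mdat X i - min 1 (2 * t) * shrink y 0 i
   - (shrink y (max 0 (2 * t - 1)) i - shrink y 0 i) else X i)"

lemma coord_cases: "(3 * j) div 3 = j" "(3 * j) mod 3 = 0" "(3 * j + 1) div 3 = j" "(3 * j + 1) mod 3 = 1"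
 "(3 * j + 2) div 3 = j" "(3 * j + 2) mod 3 = (2::nat)" by presburger+

lemma continuous_htp: "continuous_on ({0..1} \<times> valid) (%p. htp y (fst p) (snd p))"
proof (rule continuous_on_coordinatewise_then_product)
 fix i
 have X: "continuous_on ({0..1::real} \<times> valid) (%p. snd p i)"
  by (intro continuous_on_compose2[OF continuous_on_product_coordinates[of i] continuous_on_snd[OF continuous_on_id]]) auto
 have "continuous_on ({0..1::real} \<times> valid) (%p. dat (snd p))"
  by (intro continuous_on_compose2[OF continuous_dat continuous_on_snd[OF continuous_on_id]]) auto
 hence d: "continuous_on ({0..1::real} \<times> valid) (%p. dat (snd p) i)" by (rule continuous_on_product_then_coordinatewise)
 have m: "continuous_on ({0..1::real} \<times> valid) (%p. mdat (snd p) i)"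
  unfolding mdat_def by (cases "i mod 3 = 2 & i div 3 : J") (auto intro!: continuous_intros X d)
 have s: "continuous_on ({0..1::real} \<times> valid) (%p. shrink y (max 0 (2 * fst p - 1)) i)"
  unfolding shrink_def by (cases "i mod 3 = 2") (auto intro!: continuous_intros)
 show "continuous_on ({0..1} \<times> valid) (%p. htp y (fst p) (snd p) i)"
  unfolding htp_def by (cases "i div 3 : J") (auto intro!: continuous_intros X m s)
qed

text \<open>Either \<open>a = 1\<close> or \<open>b = 0\<close>. For the size \<open>r\<close> and
  the slit length \<open>l\<close> of hole \<open>j\<close>, a zero means
  \<open>(1 - a) * r + a * (l + min 0 r) = b * y (3 * j + 2)\<close>, with right side nonnegative.
  If \<open>r\<close> is negative, then \<open>l = 0\<close> and the left side is \<open>r\<close>,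
  a contradiction. If \<open>a < 1\<close>, the right side is 0 and \<open>r = 0\<close> follows for
  every hole, so all shapes are points, whose slit data are their own coordinates.\<close>

lemma htp_zero:
 assumes X: "X : valid" and t: "t : {0..1}" and z: "htp y t X = (%_. 0)" and y: "!!i. i div 3 ~: J ==> y i = 0"
  "!!j. j : J ==> 0 <= y (3 * j + 2)"
 shows "dat X = shrink y (max 0 (2 * t - 1))" "!!j. j : J ==> 0 <= X (3 * j + 2)" "!!i. i div 3 ~: J ==> X i = 0"
proof -
 define a where "a = min 1 (2 * t)"
 define b where "b = max 0 (2 * t - 1)"
 have ab: "0 <= a" "a <= 1" "0 <= b" "a = 1 | b = 0" using t by (auto simp: a_def b_def)
 have out: "X i = 0" if "i div 3 ~: J" for i using fun_cong[OF z, of i] that by (simp add: htp_def)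
 have eq: "(1 - a) * (X i - shrink y 0 i) + a * mdat X i - a * shrink y 0 i - (shrink y b i - shrink y 0 i) = 0" if "i div 3 : J" for i
  using fun_cong[OF z, of i] that by (simp add: htp_def a_def b_def)
 have third: "0 <= X (3 * j + 2) & dat X (3 * j + 2) = b * y (3 * j + 2) & (a < 1 --> X (3 * j + 2) = 0)" if j: "j : J" for j
 proof -
  define r where "r = X (3 * j + 2)"
  define l where "l = dat X (3 * j + 2)"
  have l0: "0 <= l" "l = 0 <-> r <= 0" using dat_nonneg[OF X j] dat_zero_iff[OF X j] by (auto simp: l_def r_def)
  have "(3 * j + 2) div 3 : J" using j by (simp only: coord_cases)
  from eq[OF this] have e: "(1 - a) * r + a * (l + min 0 r) - b * y (3 * j + 2) = 0"
   using j by (simp only: shrink_def mdat_def coord_cases r_def l_def) simp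
  have yb: "0 <= b * y (3 * j + 2)" using y(2)[OF j] ab by simp
  have "0 <= r"
  proof (rule ccontr)
   assume "~ 0 <= r"
   hence "l = 0" "min 0 r = r" using l0 by auto
   hence "r = b * y (3 * j + 2)" using e by (simp add: algebra_simps)
   thus False using yb `~ 0 <= r` by simp
  qed
  moreover have "a < 1 --> r = 0"
  proof
   assume a: "a < 1"
   hence "b = 0" using ab by auto
   hence "(1 - a) * r + a * l = 0" using e `0 <= r` by simp
   moreover have "0 <= (1 - a) * r" "0 <= a * l" using `0 <= r` l0 ab by auto
   ultimately have "(1 - a) * r = 0" by linarith
   thus "r = 0" using a by simp
  qed
  moreover have "l = b * y (3 * j + 2)"
  proof (cases "a < 1")
   case True
   hence "r = 0" "b = 0" using `a < 1 --> r = 0` ab by auto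
   thus ?thesis using l0 by simp
  next
   case False
   hence "a = 1" using ab by simp
   thus ?thesis using e `0 <= r` by simp
  qed
  ultimately show ?thesis by (simp add: r_def l_def)
 qed
 show "!!j. j : J ==> 0 <= X (3 * j + 2)" using third by blast
 show "!!i. i div 3 ~: J ==> X i = 0" by (rule out)
 show "dat X = shrink y (max 0 (2 * t - 1))" unfolding b_def[symmetric]
 proof
  fix i
  show "dat X i = shrink y b i"
  proof (cases "i div 3 : J")
   case False
   hence "dat X i = 0" using dat[OF X] by (simp add: slit_data_def)
   thus ?thesis using y(1)[OF False] by (simp add: shrink_def)
  next
   case True
   define j where "j = i div 3"
   have j: "j : J" using True by (simp add: j_def)
   have two: "dat X i = shrink y b i" if i2: "i mod 3 ~= 2" "i = 3 * j | i = 3 * j + 1"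
   proof -
    have e: "(1 - a) * (X i - y i) + a * dat X i - a * y i = 0" using eq[OF True] i2(1) by (simp add: shrink_def mdat_def)
    have "dat X i = y i"
    proof (cases "a < 1")
     case True
     hence "!!k. k : J ==> X (3 * k + 2) <= 0" using third by simp
     hence "dat X i = X i" using dat_points[OF X _ j] i2(2) by blast
     thus ?thesis using e by (simp add: algebra_simps)
    next
     case False
     hence "a = 1" using ab by simp
     thus ?thesis using e by simp
    qed
    thus ?thesis using i2(1) by (simp add: shrink_def)
   qed
   have "i = 3 * j | i = 3 * j + 1 | i = 3 * j + 2" unfolding j_def by auto
   then consider "i = 3 * j" | "i = 3 * j + 1" | "i = 3 * j + 2" by auto
   thus ?thesis
   proof cases
    case 1
    hence "i mod 3 ~= 2" by simp
    thus ?thesis using two 1 by blast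
   next
    case 2
    hence "i mod 3 ~= 2" by simp
    thus ?thesis using two 2 by blast
   next
    case 3
    hence "i mod 3 = 2" using coord_cases(6)[of j] by simp
    moreover have "dat X i = b * y i" using third[OF j] 3 by simp
    ultimately show ?thesis by (simp add: shrink_def)
   qed
  qed
 qed
qed

lemma shrink_coords: "shrink y t (3 * j) = y (3 * j)" "shrink y t (3 * j + 1) = y (3 * j + 1)" "shrink y t (3 * j + 2) = t * y (3 * j + 2)"
 unfolding shrink_def by (simp_all only: coord_cases) simp_all

lemma slit_shrink_subset:
 assumes "0 <= t" "t <= 1" "0 <= y (3 * j + 2)"
 shows "slit (shrink y t) j <= slit y j"
proof -
 have "t * y (3 * j + 2) <= y (3 * j + 2)" using assms mult_right_mono[of t 1 "y (3 * j + 2)"] by simp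
 moreover have "0 <= t * y (3 * j + 2)" using assms by simp
 ultimately show ?thesis unfolding slit_def shrink_coords by (auto simp: in_cbox_complex_iff)
qed

lemma uholes_shrink:
 assumes u: "uholes J (slit y)" and t: "0 <= t" "t <= 1" and y: "!!j. j : J ==> 0 <= y (3 * j + 2)"
 shows "uholes J (slit (shrink y t))" unfolding uholes_def
proof (intro conjI ballI)
 have s: "slit (shrink y t) j <= slit y j" if "j : J" for j by (rule slit_shrink_subset[of t y j, OF t y[OF that]])
 show "finite J" by (rule finJ)
 show "disjoint_family_on (slit (shrink y t)) J" using u s unfolding uholes_def disjoint_family_on_def by blast
 show "0 < Im z" if "j : J" "z : slit (shrink y t) j" for j z using u s that unfolding uholes_def by blast
qed (use slit_props in auto)

text \<open>Along zeros of the homotopy the configuration cannot leave the open set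
  \<open>valid\<close>. The inverse slit maps start from shrunk slits that converge, so a
  subsequence has image holes close to limit holes \<open>K\<close>, which are disjoint and compact
  in the half-plane. Hence the centres stay in compact sets \<open>Q j\<close>, the sizes are
  bounded because \<open>D\<close> is, and the limit shapes lie in the disjoint images of the
  \<open>Q j\<close> under \<open>Ps\<close>.\<close>

lemma valid_limit:
 assumes u: "uholes J (slit y)" and y: "!!i. i div 3 ~: J ==> y i = 0" "!!j. j : J ==> 0 <= y (3 * j + 2)"
  and X: "!!k. X k : valid" "!!k j. j : J ==> 0 <= X k (3 * j + 2)" "!!k i. i div 3 ~: J ==> X k i = 0"
  and b: "!!k. b k : {0..1}" "b ----> b0" and d: "!!k. dat (X k) = shrink y (b k)"
 obtains l r where "strict_mono (r :: nat => nat)" "l : valid" "(%k. X (r k)) ----> l"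
proof -
 have b0: "0 <= b0" "b0 <= 1" using b(1) by (auto intro: LIMSEQ_le_const[OF b(2)] LIMSEQ_le_const2[OF b(2)])
 have ly: "(%k. shrink y (b k)) ----> shrink y b0" unfolding tendsto_fun_iff
 proof
  fix i show "(%k. shrink y (b k) i) ----> shrink y b0 i" unfolding shrink_def by (cases "i mod 3 = 2") (auto intro!: tendsto_intros b(2))
 qed
 have "ALL k. EX f. sym_map J (slit (shrink y (b k))) (hl (X k)) f"
 proof
  fix k
  obtain f where "sym_map J (hl (X k)) (slit (shrink y (b k))) f" using dat[OF X(1)[of k]] d[of k] by (auto simp: slit_data_def)
  thus "EX f. sym_map J (slit (shrink y (b k))) (hl (X k)) f" using sym_map_inv by blast
 qed
 from this[unfolded choice_iff] obtain f where f: "!!k. sym_map J (slit (shrink y (b k))) (hl (X k)) (f k)" by auto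
 have up: "EV k. ALL j:J. slit (shrink y (b k)) j <= nhd (slit (shrink y b0) j) e" if "e > 0" for e
  using finJ by (intro eventually_ball_finite) (auto intro: slit_convergence(1)[OF ly that])
 have uS: "uholes J (slit (shrink y b0))" by (rule uholes_shrink[OF u b0]) (rule y(2))
 obtain r K g where r: "strict_mono (r :: nat => nat)" "sym_map J (slit (shrink y b0)) K g"
  "!!dl. dl > 0 ==> EV k. ALL j:J. hl (X (r k)) j <= nhd (K j) dl"
 proof (rule sym_maps_compact[OF uS])
  fix e :: real assume "e > 0"
  thus "EV k. ALL j:J. slit (shrink y (b k)) j <= nhd (slit (shrink y b0) j) e" by (rule up)
 next
  show "sym_map J (slit (shrink y (b k))) (hl (X k)) (f k)" for k by (rule f)
 qed (use that in blast)
 have uK: "uholes J K" using sym_mapD(2)[OF r(2)] .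
 have K: "compact (K j)" "K j <= uhp" if "j : J" for j using uK that by (auto simp: uholes_def)
 obtain e where e: "e > 0" "!!i j. i : J ==> j : J ==> i ~= j ==> nhd (K i) e Int nhd (K j) e = {}"
 using uK nhds_disjoint_family K finJ that by (auto simp: uholes_def)
 have "ALL j:J. EX d>0. nhd (K j) d <= uhp" using nhd_subset_open[OF K(1) open_halfspace_Im_gt K(2)] by metis
 then obtain dd where dd: "!!j. j : J ==> dd j > 0" "!!j. j : J ==> nhd (K j) (dd j) <= uhp" by metis
 \<comment> \<open>Half the minimum leaves room between the closed neighbourhoods \<open>Q j\<close>
   and the open ones of radius \<open>e\<close> and \<open>dd j\<close>; inserting \<open>e\<close>
   keeps the set nonempty.\<close>
 define dl where "dl = Min (insert e (dd ` J)) / 2"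
 have dl: "dl > 0" "dl < e" "!!j. j : J ==> dl < dd j"
 proof -
  have m: "Min (insert e (dd ` J)) > 0" using finJ e(1) dd(1) by simp
  thus "dl > 0" by (simp add: dl_def)
  have "Min (insert e (dd ` J)) <= e" using finJ by simp
  thus "dl < e" using m by (simp add: dl_def)
  fix j assume "j : J"
  hence "Min (insert e (dd ` J)) <= dd j" using finJ by simp
  thus "dl < dd j" using m by (simp add: dl_def)
 qed
 define Q where "Q j = closure (nhd (K j) dl)" for j
 have Qs: "Q j <= nhd (K j) c" if "dl < c" for j c
 proof
  fix z assume "z : Q j"
  then obtain w where w: "w : nhd (K j) dl" "dist w z < c - dl"
   unfolding Q_def using closure_approachable[of z] `dl < c` by (metis diff_gt_0_iff_gt)
  then obtain x where x: "x : K j" "dist x w < dl" unfolding in_nhd_iff by blast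
  have "dist x z < c" using w x dist_triangle[of x z w] by simp
  thus "z : nhd (K j) c" using x(1) unfolding in_nhd_iff by blast
 qed
 have cQ: "compact (Q j)" if "j : J" for j unfolding Q_def using K(1)[OF that] by (simp add: bounded_nhd compact_imp_bounded)
 have QU: "Q j <= uhp" if "j : J" for j using Qs[OF dl(3)[OF that]] dd(2)[OF that] by blast
 have Qd: "Q i Int Q j = {}" if "i : J" "j : J" "i ~= j" for i j using Qs[OF dl(2)] e(2)[OF that] by blast
 obtain k0 where k0: "!!k. k >= k0 ==> ALL j:J. hl (X (r k)) j <= nhd (K j) dl"
  using r(3)[OF dl(1)] unfolding eventually_sequentially by auto
 have hQ: "hl (X (r (k + k0))) j <= Q j" if "j : J" for k j
  using k0[of "k + k0"] that closure_subset[of "nhd (K j) dl"] unfolding Q_def by auto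
 obtain M1 where M1: "D <= cball 0 M1" using D(3) bounded_subset_cball by blast
 have "bounded (UN j:J. Q j)" using finJ cQ by (auto intro!: bounded_UN compact_imp_bounded)
 then obtain M2 where M2: "(UN j:J. Q j) <= cball 0 M2" using bounded_subset_cball by blast
 define M where "M = max \<bar>M2\<bar> (2 * abs(M1) / c0)"
 obtain n where n: "J <= {..<n}" using finJ finite_nat_bounded by blast
 have hatQ: "hat (X (r (k + k0))) j : Q j" if j: "j : J" for k j
 proof -
  have s: "X (r (k + k0)) (3 * j + 1) > 0" using X(1) j by (auto simp: valid_def)
  have "Ph (Ps (hat (X (r (k + k0))) j)) : hl (X (r (k + k0))) j" unfolding hl_def using shp_props(3)[of j "X (r (k + k0))", OF j s] by blast
  hence "hat (X (r (k + k0))) j : hl (X (r (k + k0))) j" using PsU s by (simp add: hat_def)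
  thus ?thesis using hQ[OF j] by blast
 qed
 have "X (r (k + k0)) : cube (3 * n) M" for k
 proof -
  define x where "x = X (r (k + k0))"
  have "abs(x i) <= M" for i
  proof (cases "i div 3 : J")
   case True
   define j where "j = i div 3"
   have j: "j : J" using True by (simp add: j_def)
   have "hat x j : cball 0 M2" using hatQ[OF j, of k] M2 j unfolding x_def by blast
   hence "abs(x (3 * j)) <= M2" "abs(x (3 * j + 1)) <= M2"
    using abs_Re_le_cmod[of "hat x j"] abs_Im_le_cmod[of "hat x j"] by (auto simp: hat_def simp del: complex_norm)
   moreover have "abs(x (3 * j + 2)) <= 2 * abs(M1) / c0"
    using rad_bound[OF M1 X(1)[of "r (k + k0)"] j] X(2)[OF j, of "r (k + k0)"] unfolding x_def by simp
   ultimately have "abs(x (3 * j)) <= M" "abs(x (3 * j + 1)) <= M" "abs(x (3 * j + 2)) <= M" unfolding M_def by linarith+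
   moreover have "i = 3 * j | i = 3 * j + 1 | i = 3 * j + 2" unfolding j_def by auto
   ultimately show ?thesis by auto
  next
   case False
   have "0 <= M" by (simp add: M_def)
   thus ?thesis using X(3)[OF False] by (simp add: x_def)
  qed
  moreover have "x i = 0" if "3 * n <= i" for i
  proof -
   have "n <= i div 3" using that by simp
   thus ?thesis unfolding x_def using n by (intro X(3)) auto
  qed
  ultimately show ?thesis by (simp add: cube_def x_def)
 qed
 then obtain l q where q: "strict_mono q" "(%k. X (r (q k + k0))) ----> l" by (rule compact_subseq[OF compact_cube])
 define p where "p k = r (q k + k0)" for k
 have p: "strict_mono p" using r(1) q(1) by (auto simp: strict_mono_def p_def)
 have lp: "(%k. X (p k)) ----> l" using q(2) by (simp add: p_def)
 have lc: "(%k. X (p k) i) ----> l i" for i using lp unfolding tendsto_fun_iff by blast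
 have lpos: "l (3 * j + 1) > 0" if j: "j : J" for j
 proof -
  have "(%k. hat (X (p k)) j) ----> hat l j" unfolding hat_def by (intro tendsto_Complex lc)
  moreover have "hat (X (p k)) j : Q j" for k unfolding p_def by (rule hatQ[OF j])
  ultimately have "hat l j : Q j" using cQ[OF j] by (meson closed_sequentially compact_imp_closed)
  thus ?thesis using QU[OF j] by (auto simp: hat_def)
 qed
 have sub: "shp l j <= Ps ` Q j" if j: "j : J" for j
 proof (rule slit_subset_limit[where B = "%k. shp (X (p k)) j"])
  have "compact (Ps ` Q j)" using cQ[OF j] QU[OF j] by (intro compact_continuous_image continuous_on_subset[OF Psc])
  thus "closed (Ps ` Q j)" by (rule compact_imp_closed)
  have "shp (X (p k)) j <= Ps ` Q j" for k using hQ[OF j, of "q k"] Ps_hol[OF j X(1)[of "p k"]] unfolding p_def by blast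
  thus "EV k. shp (X (p k)) j <= nhd (Ps ` Q j) dl" if "dl > 0" for dl
   using subset_nhd[OF that, of "Ps ` Q j"] by (intro always_eventually allI) (meson subset_trans)
  show "EV k. shp l j <= nhd (shp (X (p k)) j) dl" if "dl > 0" for dl
   using shp_near[of j l, OF j lpos[OF j] lp that] by (rule eventually_mono) blast
 qed
 have "l : valid" unfolding valid_def mem_Collect_eq
 proof (intro conjI ballI)
  show "l (3 * j + 1) > 0" if "j : J" for j by (rule lpos[OF that])
  show "shp l j <= D" if "j : J" for j using sub[OF that] QU[OF that] PsU by blast
  show "disjoint_family_on (shp l) J" unfolding disjoint_family_on_def
  proof (intro ballI impI)
   fix i j assume ij: "i : J" "j : J" "i ~= j"
   have "Ps ` Q i Int Ps ` Q j = {}"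
   proof (rule ccontr)
    assume "Ps ` Q i Int Ps ` Q j ~= {}"
    then obtain u v where uv: "u : Q i" "v : Q j" "Ps u = Ps v" by auto
    have "Im u > 0" "Im v > 0" using uv QU[OF ij(1)] QU[OF ij(2)] by auto
    hence "u = v" using PsU uv(3) by metis
    thus False using Qd[OF ij] uv by blast
   qed
   thus "shp l i Int shp l j = {}" using sub[OF ij(1)] sub[OF ij(2)] by blast
  qed
 qed
 thus ?thesis using that[OF p _ lp] by blast
qed

text \<open>The homotopy starts at \<open>X0\<close>: shapes of size 0 at the left ends of the
  slits. Its zero set is compact by \<open>valid_limit\<close>, so continuation reaches
  \<open>t = 1\<close>, where the target slits have full length.\<close>

theorem slit_data_attained:
 assumes u: "uholes J (slit y)" and y: "!!i. i div 3 ~: J ==> y i = 0" "!!j. j : J ==> 0 <= y (3 * j + 2)"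
 obtains X where "X : valid" "dat X = y"
proof -
 obtain n where n: "J <= {..<n}" using finJ finite_nat_bounded by blast
 have outJ: "i div 3 ~: J" if "i >= 3 * n" for i using that n by auto
 define X0 where "X0 = shrink y 0"
 have X0: "X0 (3 * j) = y (3 * j)" "X0 (3 * j + 1) = y (3 * j + 1)" "X0 (3 * j + 2) = 0" for j
  unfolding X0_def shrink_coords by auto
 have hs: "hat X0 j : slit y j" for j unfolding hat_def X0 by (simp add: in_slit_iff)
 have pos: "X0 (3 * j + 1) > 0" if "j : J" for j using hs u that by (force simp: uholes_def hat_def)
 have sh0: "shp X0 j = {Ps (hat X0 j)}" if "j : J" for j using shp_props(4)[of j X0, OF that pos[OF that]] X0(3) by simp
 have X0v: "X0 : valid" unfolding valid_def mem_Collect_eq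
 proof (intro conjI ballI)
  show "shp X0 j <= D" if "j : J" for j using sh0[OF that] pt_in[of X0, OF pos[OF that]] by simp
  show "disjoint_family_on (shp X0) J" unfolding disjoint_family_on_def
  proof (intro ballI impI)
   fix i j assume ij: "i : J" "j : J" "i ~= j"
   have "hat X0 i ~= hat X0 j" using u ij hs unfolding uholes_def disjoint_family_on_def by (metis disjoint_iff)
   hence "Ps (hat X0 i) ~= Ps (hat X0 j)" using PsU pos ij unfolding hat_def by (metis complex.sel(2))
   thus "shp X0 i Int shp X0 j = {}" using sh0 ij by simp
  qed
 qed (use pos in blast)
 define Z where "Z = {p : {0..1} \<times> valid. htp y (fst p) (snd p) = (%_. 0)}"
 have "compact Z" unfolding compact_def
 proof (intro allI impI)
  fix s :: "nat => real \<times> (nat => real)" assume s: "ALL k. s k : Z"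
  have sZ: "fst (s k) : {0..1}" "snd (s k) : valid" "htp y (fst (s k)) (snd (s k)) = (%_. 0)" for k
  proof -
   have "s k : Z" using s by blast
   thus "fst (s k) : {0..1}" "snd (s k) : valid" "htp y (fst (s k)) (snd (s k)) = (%_. 0)" by (auto simp: Z_def)
  qed
  obtain t r where r: "t : {0..1}" "strict_mono r" "(%k. fst (s (r k))) ----> t" by (rule compact_subseq[OF compact_Icc sZ(1)])
  note hz = htp_zero[OF sZ(2,1,3) y]
  have lb: "(%k. max 0 (2 * fst (s (r k)) - 1)) ----> max 0 (2 * t - 1)" by (intro tendsto_intros r(3))
  have b01: "max 0 (2 * fst (s (r k)) - 1) : {0..1}" for k using sZ(1)[of "r k"] by auto
  obtain l q where q: "strict_mono q" "l : valid" "(%k. snd (s (r (q k)))) ----> l"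
   by (rule valid_limit[OF u y, of "%k. snd (s (r k))" "%k. max 0 (2 * fst (s (r k)) - 1)"]) (use hz sZ(2) lb b01 in blast)+
  have rq: "strict_mono (%k. r (q k))" using r(2) q(1) by (auto simp: strict_mono_def)
  have "(%k. fst (s (r (q k)))) ----> t" using tendsto_subseq[OF r(3) q(1)] by simp
  hence "(%k. (fst (s (r (q k))), snd (s (r (q k))))) ----> (t, l)" using q(3) by (rule tendsto_Pair)
  hence ls: "(%k. s (r (q k))) ----> (t, l)" by simp
  have tl: "(t, l) : {0..1} \<times> valid" using r(1) q(2) by simp
  have "(%k. htp y (fst (s (r (q k)))) (snd (s (r (q k))))) ----> htp y t l"
  proof -
   have "!!x a. a : {0..1} \<times> valid ==> (ALL n. x n : {0..1} \<times> valid) & x ----> a ==> ((%p. htp y (fst p) (snd p)) o x) ----> htp y (fst a) (snd a)"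
    using continuous_htp[unfolded continuous_on_sequentially] by blast
   from this[OF tl, of "%k. s (r (q k))"] ls sZ show ?thesis by (simp add: o_def mem_Times_iff)
  qed
  hence "(%k. (%_. 0)) ----> htp y t l" using sZ(3) by simp
  hence "htp y t l = (%_. 0)" using LIMSEQ_unique[OF tendsto_const] by metis
  hence "(t, l) : Z" using tl by (simp add: Z_def)
  thus "EX l:Z. EX r. strict_mono r & (s o r) ----> l"
   using rq ls by (intro bexI[of _ "(t, l)"] exI[of _ "%k. r (q k)"]) (simp_all add: o_def)
 qed
 obtain X where X: "X : valid" "htp y 1 X = (%_. 0)"
 proof (rule leray_schauder[OF open_valid continuous_htp[of y], of "3 * n" "%i. if i div 3 : J then X0 i else 0"])
  \<comment> \<open>The starting point is written with an explicit 0 outside \<open>J\<close>; it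
    equals \<open>X0\<close> because \<open>y\<close> vanishes there.\<close>
  have Xe: "(%i. if i div 3 : J then X0 i else 0) = X0" using y(1) by (auto simp: X0_def shrink_def)
  show "htp y t x i = x i" if "3 * n <= i" for t x i using outJ[OF that] by (simp add: htp_def)
  show "compact {p : {0..1} \<times> valid. htp y (fst p) (snd p) = (%_. 0)}" using `compact Z` by (simp add: Z_def)
  show "htp y 0 x i = x i - (if i div 3 : J then X0 i else 0)" for x i by (simp add: htp_def X0_def)
  show "(%i. if i div 3 : J then X0 i else 0) : valid" unfolding Xe by (rule X0v)
  show "(if i div 3 : J then X0 i else 0) = 0" if "3 * n <= i" for i using outJ[OF that] by simp
 qed
 have "dat X = shrink y (max 0 (2 * 1 - 1))" by (rule htp_zero(1)[OF X(1) _ X(2) y]) simp_all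
 hence "dat X = y" by (simp add: shrink_def fun_eq_iff)
 thus ?thesis using that X(1) by blast
qed

end

section \<open>Proof of the theorem\<close>

text \<open>The segment from \<open>z\<close> to a nearest point of \<open>A\<close> meets the
  frontier, no farther away than that nearest point.\<close>

lemma infdist_frontier:
 fixes A :: "complex set"
 assumes A: "compact A" "A ~= {}" and z: "z ~: A"
 shows "infdist z (frontier A) = infdist z A"
proof (rule antisym)
 have cA: "closed A" using A(1) by (rule compact_imp_closed)
 show "infdist z A <= infdist z (frontier A)"
  using frontier_subset_closed[OF cA] compact_frontier_nonempty[OF A] by (intro infdist_mono)
 obtain a where a: "a : A" "infdist z A = dist z a" using infdist_attains_inf[OF cA A(2)] by auto
 have "closed_segment z a Int frontier A ~= {}" using a(1) z by (intro connected_Int_frontier) auto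
 then obtain c where c: "c : closed_segment z a" "c : frontier A" by auto
 have "infdist z (frontier A) <= dist z c" using c(2) by (rule infdist_le)
 also have "... <= dist z a" using segment_bound(1)[OF c(1)] by (simp add: dist_norm norm_minus_commute)
 finally show "infdist z (frontier A) <= infdist z A" using a(2) by simp
qed

lemma tends_to_frontier_iff:
 assumes A: "compact A" "A ~= {}" and x: "!!k. x k ~: A"
 shows "tends_to_set x (frontier A) <-> (ALL e>0. EV k. x k : nhd A e)"
proof -
 have 1: "infdist (x k) (frontier A) = infdist (x k) A" for k by (rule infdist_frontier[OF A x])
 have 2: "infdist z A < e <-> z : nhd A e" for z e
 proof -
  have "infdist z A < e <-> (EX a:A. dist z a < e)" using A(2) by (simp add: infdist_def cINF_less_iff)
  thus ?thesis by (simp add: in_nhd_iff dist_commute)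
 qed
 show ?thesis unfolding tends_to_set_def 1 tendsto_iff by (simp add: 2[symmetric] infdist_nonneg)
qed

lemma sym_map_upper_image:
 assumes f: "sym_map J E L f"
 shows "f ` (uhp - (UN j:J. E j)) = uhp - (UN j:J. L j)"
proof -
 note D = sym_mapD[OF f]
 have "f ` {z : ddom J E. Im z > 0} = {z : ddom J L. Im z > 0}"
 proof
  show "f ` {z : ddom J E. Im z > 0} <= {z : ddom J L. Im z > 0}" using sym_map_image_eq[OF f] D(7) by blast
  show "{z : ddom J L. Im z > 0} <= f ` {z : ddom J E. Im z > 0}"
  proof
   fix w assume w: "w : {z : ddom J L. Im z > 0}"
   then obtain z where "z : ddom J E" "w = f z" using sym_map_image_eq[OF f] by blast
   thus "w : f ` {z : ddom J E. Im z > 0}" using w D(7) by blast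
  qed
 qed
 thus ?thesis using upper_ddom[OF D(1)] upper_ddom[OF D(2)] by simp
qed

lemma sym_map_real:
 assumes f: "sym_map J E L f" and z: "z : ddom J E" "Im z >= 0"
 shows "Im (f z) >= 0"
proof (cases "Im z = 0")
 case True
 hence "cnj z = z" by (simp add: complex_eq_iff)
 hence "f z = cnj (f z)" using sym_mapD(6)[OF f z(1)] by simp
 thus ?thesis by (simp add: complex_eq_iff)
qed (use sym_mapD(7)[OF f z(1)] z(2) in auto)

lemma uholes_closed_upper:
 assumes "uholes J E" "Im z >= 0" "!!j. j : J ==> z ~: E j"
 shows "z : ddom J E" using ddom_upper[OF assms(1), of z] real_ddom[OF assms(1), of z] assms(2,3) by force

lemma image_diff_UN:
 assumes "!!u. u : A ==> h u : B & k (h u) = u" "!!w. w : B ==> k w : A & h (k w) = w" "!!j. j : J ==> F j <= A"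
 shows "h ` (A - (UN j:J. F j)) = B - (UN j:J. h ` F j)"
proof -
 have inj: "inj_on h A" using assms(1) by (metis inj_onI)
 have "h ` A = B" using assms(1,2) by force
 thus ?thesis using inj_on_image_set_diff[OF inj, of A "UN j:J. F j"] assms(3) by (simp add: image_UN UN_subset_iff)
qed

theorem mainTheorem5:
  fixes H H' \<gamma> \<gamma>' G :: "complex set"
    and n :: nat
    and F :: "nat \<Rightarrow> complex set"
    and \<FF> :: "nat \<Rightarrow> complex \<Rightarrow> complex set"
    and z z' :: "nat \<Rightarrow> complex"
  assumes "bounded_jordan_domain H" and "frontier H = \<gamma>"
    and "bounded_jordan_domain H'" and "frontier H' = \<gamma>'"
    and "\<And>j. j \<in> {1..n} \<Longrightarrow> connected (F j) \<and> compact (F j) \<and> F j \<subseteq> H"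
    and "\<And>j. j \<in> {1..n} \<Longrightarrow> \<exists>a\<in>F j. \<exists>b\<in>F j. a \<noteq> b"
    and "disjoint_family_on F {1..n}"
    and "G = H - (\<Union>j\<in>{1..n}. F j)"
    and "connected_of_order (n + 1) G"
    and "\<And>j. j \<in> {1..n} \<Longrightarrow> shape_field (closure H') (\<FF> j)"
    and "z ` {1,2,3} \<subseteq> \<gamma>" and "inj_on z {1,2,3}" and "ccw_ordered \<gamma> (z 1) (z 2) (z 3)"
    and "z' ` {1,2,3} \<subseteq> \<gamma>'" and "inj_on z' {1,2,3}" and "ccw_ordered \<gamma>' (z' 1) (z' 2) (z' 3)"
  shows "\<exists>(F' :: nat \<Rightarrow> complex set) (f :: complex \<Rightarrow> complex).
           (\<forall>j\<in>{1..n}. F' j \<in> shape_field_image (closure H') (\<FF> j)) \<and>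
           conformal_equivalence G (H' - (\<Union>j\<in>{1..n}. F' j)) f \<and>
           (\<forall>j\<in>{1..n}. boundary_corresponds f G (F j) (F' j)) \<and>
           (\<exists>g. continuous_on (G \<union> \<gamma>) g \<and> (\<forall>w\<in>G. g w = f w) \<and>
                (\<forall>k\<in>{1,2,3}. g (z k) = z' k))"
proof -
 define J where "J = {1..n}"
 have fJ: "finite J" by (simp add: J_def)
 have F: "connected (F j)" "compact (F j)" "F j <= H" "EX a:F j. EX b:F j. a ~= b" if "j : J" for j
  using assms(5,6) that by (auto simp: J_def)
 have H: "open H" "connected H" using assms(1) by (auto simp: bounded_jordan_domain_def)
 have H': "open H'" "connected H'" "bounded H'" using assms(3) by (auto simp: bounded_jordan_domain_def)
 have G: "open G" "connected G" "G = H - (UN j:J. F j)" using assms(8,9) by (auto simp: connected_of_order_def J_def)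
 have zf: "z 1 : frontier H" "z 2 : frontier H" "z 3 : frontier H" using assms(2,11) by auto
 have zf': "z' 1 : frontier H'" "z' 2 : frontier H'" "z' 3 : frontier H'" using assms(4,14) by auto
 obtain Ph Ps where "half_plane_map H (z 1) (z 2) (z 3) Ph Ps"
  using half_plane_map_exists[OF assms(1) zf(1) assms(13)[folded assms(2)]] by blast
 note P = half_plane_mapD[OF this]
 obtain Ph' Ps' where "half_plane_map H' (z' 1) (z' 2) (z' 3) Ph' Ps'"
  using half_plane_map_exists[OF assms(3) zf'(1) assms(16)[folded assms(4)]] by blast
 note P' = half_plane_mapD[OF this]
 have Hc: "w : closure H - {z 1}" if "w : H" for w
  using that zf(1) H(1) closure_subset[of H] by (auto simp: frontier_def interior_open)
 have Hc': "w : closure H' - {z' 1}" if "w : H'" for w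
  using that zf'(1) H'(1) closure_subset[of H'] by (auto simp: frontier_def interior_open)
 have PhH: "Im (Ph w) > 0 & Ps (Ph w) = w" if "w : H" for w using P(3) P(7)[OF Hc[OF that]] that by blast
 have PsH: "Ps w : H & Ph (Ps w) = w" if "Im w > 0" for w using P(4) P(8)[of w] that by auto
 have PhH': "Im (Ph' w) > 0 & Ps' (Ph' w) = w" if "w : H'" for w using P'(3) P'(7)[OF Hc'[OF that]] that by blast
 have PsH': "Ps' w : H' & Ph' (Ps' w) = w" if "Im w > 0" for w using P'(4) P'(8)[of w] that by auto
 have cont: "continuous_on H Ph" "continuous_on uhp Ps" "continuous_on H' Ph'" "continuous_on uhp Ps'"
  using P(1,2) P'(1,2) by (auto intro: holomorphic_on_imp_continuous_on)
 define E where "E j = Ph ` F j" for j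
 have EF: "Ps ` E j = F j" if "j : J" for j using PhH F(3)[OF that] by (force simp: E_def)
 have EU: "E j <= uhp" if "j : J" for j using PhH F(3)[OF that] by (auto simp: E_def)
 have Ec: "compact (E j)" "connected (E j)" "E j ~= {}" if "j : J" for j using F[OF that] unfolding E_def
  by (auto intro!: compact_continuous_image connected_continuous_image continuous_on_subset[OF cont(1)])
 have Ed: "E i Int E j = {}" if ij: "i : J" "j : J" "i ~= j" for i j
 proof -
  have "F i Int F j = {}" using assms(7) ij by (auto simp: disjoint_family_on_def J_def)
  moreover have "Ps w : F i Int F j" if "w : E i Int E j" for w using that EF[OF ij(1)] EF[OF ij(2)] by blast
  ultimately show ?thesis by auto
 qed
 have PhG: "Ph ` G = uhp - (UN j:J. E j)" unfolding G(3) E_def by (rule image_diff_UN[of H _ _ Ps]) (use PhH PsH F(3) in auto)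
 have uE: "uholes J E"
 proof -
  have cU: "compact (UN j:J. E j)" using fJ Ec(1) by auto
  have "connected (uhp - (UN j:J. E j))"
   unfolding PhG[symmetric] using G by (intro connected_continuous_image continuous_on_subset[OF cont(1)]) auto
  \<comment> \<open>Adding the closed lower half-plane to the connected set
    \<open>uhp - (UN j:J. E j)\<close> keeps it connected.\<close>
  hence cc: "connected (- (UN j:J. E j))"
   using EU by (intro connected_compl_of_diff[OF open_halfspace_Im_gt[of 0] compact_imp_closed[OF cU]]) auto
  have "connected (- E j)" if j: "j : J" for j
  proof (rule connected_compl_part)
   show "closed (E j)" using Ec(1)[OF j] by (rule compact_imp_closed)
   show "closed (UN i:J - {j}. E i)" using fJ Ec(1) by (intro compact_imp_closed compact_UN) auto
   show "E j Int (UN i:J - {j}. E i) = {}" using Ed[OF j] by blast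
   have "E j Un (UN i:J - {j}. E i) = (UN i:J. E i)" using j by blast
   thus "connected (- (E j Un (UN i:J - {j}. E i)))" using cc by simp
  qed
  moreover have "disjoint_family_on E J" unfolding disjoint_family_on_def using Ed by blast
  ultimately show ?thesis unfolding uholes_def using fJ Ec EU by blast
 qed
 obtain y where y: "slit_data J E y" using slit_data_exists[OF uE] by blast
 then obtain fE where fE: "sym_map J E (slit y) fE" and y0: "!!i. i div 3 ~: J ==> y i = 0" "!!j. j : J ==> 0 <= y (3 * j + 2)"
  by (auto simp: slit_data_def)
 \<comment> \<open>Holes with more than one point have slits of positive length; this makes the
   sizes positive in the end, so that the shapes found are genuine homothetic copies.\<close>
 have ypos: "y (3 * j + 2) > 0" if j: "j : J" for j
 proof -
  have "\<nexists>a. E j = {a}"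
  proof
   assume "EX a. E j = {a}"
   then obtain a where "E j = {a}" by auto
   hence "F j = {Ps a}" using EF[OF j] by simp
   thus False using F(4)[OF j] by auto
  qed
  thus ?thesis using slit_data_zero_iff[OF y j] y0(2)[OF j] by simp
 qed
 have cH': "compact (closure H')" using H'(3) by simp
 have shf: "shape_field (closure H') (\<FF> j)" if "j : J" for j using assms(10) that by (simp add: J_def)
 have "ALL j:J. EX b. boundary_section (closure H') (\<FF> j) b" using boundary_section_exists[OF cH' shf] by blast
 from this[unfolded bchoice_iff] obtain b where b: "!!j. j : J ==> boundary_section (closure H') (\<FF> j) (b j)" by auto
 have "ALL j:J. EX c. c > 0 & (ALL p:closure H'. EX v:(%z. z - b j p) ` \<FF> j p. c <= cmod v)"
  using boundary_sectionD(4)[OF b] by blast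
 from this[unfolded bchoice_iff] obtain c where c: "!!j. j : J ==> c j > 0"
  "!!j p. j : J ==> p : closure H' ==> EX v:(%z. z - b j p) ` \<FF> j p. c j <= cmod v" by auto
 define c0 where "c0 = Min (insert 1 (c ` J))"
 have c0: "c0 > 0" unfolding c0_def using fJ c(1) by simp
 have c0j: "c0 <= c j" if "j : J" for j unfolding c0_def using fJ that by simp
 define T where "T j p = (%z. z - b j p) ` \<FF> j p" for j p
 have cl: "p : closure H'" if "p : H'" for p using that closure_subset by blast
 interpret shape_configuration J H' Ph' Ps' T c0
 proof
  fix j p assume jp: "j : J" "p : H'"
  have "compact (\<FF> j p)" "convex (\<FF> j p)" using shf[OF jp(1)] cl[OF jp(2)] by (auto simp: shape_field_def)
  moreover have "T j p = (+) (- b j p) ` \<FF> j p" by (simp add: T_def)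
  moreover have "b j p : \<FF> j p" by (rule boundary_sectionD(1)[OF b[OF jp(1)] cl[OF jp(2)]])
  hence "0 : T j p" unfolding T_def by simp
  ultimately show "compact (T j p) & convex (T j p) & 0 : T j p" by (metis compact_translation convex_translation)
  show "EX v:T j p. c0 <= cmod v" using c(2)[OF jp(1) cl[OF jp(2)]] c0j[OF jp(1)] unfolding T_def by force
  fix e :: real assume "e > 0"
  then obtain d where "d > 0" "ALL q:closure H'. dist q p < d --> T j q <= nhd (T j p) e & T j p <= nhd (T j q) e"
   using boundary_sectionD(3)[OF b[OF jp(1)] cl[OF jp(2)]] unfolding T_def by blast
  thus "EX d>0. ALL q:H'. dist q p < d --> T j q <= nhd (T j p) e & T j p <= nhd (T j q) e" using cl by blast
 qed (use fJ H' cont PhH' PsH' c0 in auto)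
 obtain X where X: "X : valid" "dat X = y" using slit_data_attained[OF sym_mapD(2)[OF fE] y0] by blast
 then obtain fX where fX: "sym_map J (hl X) (slit y) fX" using dat[OF X(1)] by (auto simp: slit_data_def)
 define F' where "F' = shp X"
 \<comment> \<open>\<open>G\<close> and the configuration \<open>X\<close> have the same slit
   domain, so the slit map of one followed by the inverse slit map of the other joins them.\<close>
 define m where "m w = inv_into (ddom J (hl X)) fX (fE w)" for w
 have m: "sym_map J E (hl X) m" unfolding m_def using sym_map_comp[OF fE sym_map_inv[OF fX]] .
 define f where "f w = Ps' (m (Ph w))" for w
 have Xp: "X (3 * j + 1) > 0" "shp X j <= H'" if "j : J" for j using X(1) that by (auto simp: valid_def)
 have r: "X (3 * j + 2) > 0" if "j : J" for j using dat_zero_iff[OF X(1) that] ypos[OF that] X(2) by auto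
 have mG: "m ` (uhp - (UN j:J. E j)) = uhp - (UN j:J. hl X j)" by (rule sym_map_upper_image[OF m])
 have "Ps' ` (uhp - (UN j:J. hl X j)) = H' - (UN j:J. Ps' ` hl X j)"
  by (rule image_diff_UN[of _ _ _ Ph']) (use PhH' PsH' uholes_hol[OF X(1)] in "auto simp: uholes_def")
 hence UG': "Ps' ` (uhp - (UN j:J. hl X j)) = H' - (UN j:J. F' j)" using Ps_hol X(1) by (simp add: F'_def)
 have upE: "uhp - (UN j:J. E j) <= ddom J E" using upper_ddom[OF uE] by blast
 have m_hol: "m hol ddom J E" "inj_on m (ddom J E)" using hole_mapD(3,5)[OF sym_mapD(3)[OF m]] by auto
 have fG: "f ` G = H' - (UN j:J. F' j)"
 proof -
  have "f ` G = Ps' ` m ` Ph ` G" by (simp add: f_def image_image)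
  thus ?thesis unfolding PhG mG UG' .
 qed
 have f_inj: "inj_on f G"
 proof (rule inj_onI)
  fix u v assume uv: "u : G" "v : G" "f u = f v"
  have a: "Ph u : uhp - (UN j:J. E j)" "Ph v : uhp - (UN j:J. E j)" using uv PhG by auto
  hence "Im (m (Ph u)) > 0" "Im (m (Ph v)) > 0" using mG by auto
  hence "m (Ph u) = m (Ph v)" using PsH' uv(3) unfolding f_def by metis
  hence "Ph u = Ph v" using m_hol(2) a upE by (meson inj_onD subsetD)
  thus "u = v" using uv PhH G(3) by (metis DiffD1)
 qed
 have f_hol: "f hol G"
 proof -
  have 1: "Ph hol G" using P(1) G(3) by auto
  have 2: "(%w. m (Ph w)) hol G" using holomorphic_on_compose_gen[OF 1 m_hol(1)] PhG upE by (simp add: o_def)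
  have "(%w. m (Ph w)) ` G = m ` Ph ` G" by auto
  hence 3: "(%w. m (Ph w)) ` G <= uhp" unfolding PhG mG by blast
  show ?thesis using holomorphic_on_compose_gen[OF 2 P'(2) 3] by (simp add: o_def f_def[abs_def])
 qed
 have conf: "conformal_equivalence G (H' - (UN j:J. F' j)) f" unfolding conformal_equivalence_def
 proof (intro conjI)
  show "bij_betw f G (H' - (UN j:J. F' j))" using f_inj fG by (simp add: bij_betw_def)
  show "inv_into G f hol H' - (UN j:J. F' j)" using holomorphic_on_inv_into[OF f_hol G(1) f_inj] fG by simp
 qed (rule f_hol)
 have img: "F' j : shape_field_image (closure H') (\<FF> j)" if j: "j : J" for j
 proof -
  define p where "p = Ps' (hat X j)"
  define s where "s = X (3 * j + 2)"
  have s: "s > 0" "max 0 (X (3 * j + 2)) = s" using r[OF j] by (auto simp: s_def)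
  have pH: "p : H'" unfolding p_def by (rule pt_in[of X, OF Xp(1)[OF j]])
  have Fp: "F' j = (%v. p + of_real s * (v - b j p)) ` \<FF> j p" unfolding F'_def shp_def p_def[symmetric] s(2) T_def by auto
  have pF: "p : F' j" unfolding F'_def p_def by (rule shp_props(3)[of j X, OF j Xp(1)[OF j]])
  have "p : frontier (F' j)" unfolding frontier_straddle
  proof (intro allI impI conjI)
   fix e :: real assume e: "e > 0"
   show "EX x:F' j. dist p x < e" using pF e by force
   obtain v where v: "!!t. 0 < t ==> t <= 1 ==> b j p + of_real t * v ~: \<FF> j p" using boundary_sectionD(2)[OF b[OF j] cl[OF pH]] by blast
   \<comment> \<open>The point \<open>p + s * t * v\<close> lies outside the shape and, with this
     \<open>t\<close>, within distance \<open>e\<close> of \<open>p\<close>; the summand 1 keeps the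
     denominator positive.\<close>
   define t where "t = min 1 (e / (2 * s * (cmod v + 1)))"
   have dpos: "2 * s * (cmod v + 1) > 0" using s(1) by (intro mult_pos_pos) (auto simp: add_nonneg_pos)
   hence t: "0 < t" "t <= 1" "t <= e / (2 * s * (cmod v + 1))" using e by (auto simp: t_def)
   have "p + of_real s * (of_real t * v) ~: F' j" using Fp s v t by fastforce
   moreover have "dist p (p + of_real s * (of_real t * v)) < e"
   proof -
    have "dist p (p + of_real s * (of_real t * v)) = t * (s * cmod v)" using s(1) t(1) by (simp add: dist_norm norm_mult)
    also have "... <= (e / (2 * s * (cmod v + 1))) * (s * cmod v)" using t(3) s(1) by (intro mult_right_mono) auto
    also have "... = e / 2 * (cmod v / (cmod v + 1))" using s(1) by simp
    also have "... <= e / 2 * 1" using e by (intro mult_left_mono) (auto simp: divide_le_eq_1 add_nonneg_pos)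
    also have "... < e" using e by simp
    finally show ?thesis .
   qed
   ultimately show "EX x. x ~: F' j & dist p x < e" by auto
  qed
  moreover have "homothetic (F' j) (\<FF> j p)" unfolding homothetic_def
  proof (intro exI conjI)
   show "1 / s > 0" using s(1) by simp
   show "(%w. of_real (1 / s) * w + (b j p - of_real (1 / s) * p)) ` F' j = \<FF> j p"
    unfolding Fp image_image using s(1) by (simp add: algebra_simps)
  qed
  moreover have "F' j <= closure H'" using Xp(2)[OF j] cl unfolding F'_def by blast
  ultimately show ?thesis unfolding shape_field_image_def by blast
 qed
 \<comment> \<open>Closeness to a hole is carried along \<open>Ph\<close>, \<open>m\<close> and
   \<open>Ps'\<close> and back: the outer maps are uniformly continuous near the compact holes, and
   \<open>m\<close> respects neighbourhoods of holes as a hole map.\<close>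
 have bc: "boundary_corresponds f G (F j) (F' j)" if j: "j : J" for j unfolding boundary_corresponds_def
 proof (intro allI impI)
  fix x :: "nat => complex" assume x: "range x <= G"
  have xG: "x k : G" for k using x by blast
  have xF: "x k ~: F j" "x k : H" for k using xG[of k] j unfolding G(3) by auto
  have fx: "f (x k) : H' - (UN j:J. F' j)" for k using fG xG by blast
  have fF: "f (x k) ~: F' j" for k using fx[of k] j by blast
  have xE: "Ph (x k) : ddom J E" "Im (Ph (x k)) > 0" for k using PhG upE xG[of k] by auto
  have mI: "Im (m (Ph (x k))) > 0" for k using sym_mapD(7)[OF m xE(1)] xE(2) by blast
  have mX: "m (Ph (x k)) : ddom J (hl X)" for k using sym_map_image_eq[OF m] xE(1) by blast
  have cF': "compact (F' j)" "F' j ~= {}" using shp_props(1,3)[of j X, OF j Xp(1)[OF j]] unfolding F'_def by auto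
  have cF: "F j ~= {}" using F(4)[OF j] by blast
  have move: "ALL e>0. EV k. h (x k) : nhd (h ` A) e"
   if A: "compact A" "A <= D" "open D" "continuous_on D h" and x: "ALL e>0. EV k. x k : nhd A e"
   for A D and h :: "complex => complex" and x :: "nat => complex"
  proof (intro allI impI)
   fix e :: real assume e: "e > 0"
   obtain d where d: "d > 0" "!!u v. u : A ==> dist u v < d ==> dist (h u) (h v) < e"
    using continuous_near_compact[OF A(3,4,1,2) e] by metis
   have "EV k. x k : nhd A d" using x d(1) by blast
   thus "EV k. h (x k) : nhd (h ` A) e" by (rule eventually_mono) (use d(2) in "unfold in_nhd_iff, blast")
  qed
  have moveS: "ALL e>0. EV k. h (x k) : nhd (L j) e"
   if h: "sym_map J K L h" "!!k. x k : ddom J K" and x: "ALL e>0. EV k. x k : nhd (K j) e" for K L h and x :: "nat => complex"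
  proof (intro allI impI)
   fix e :: real assume e: "e > 0"
   have jj: "(j, True) : J \<times> UNIV" using j by simp
   obtain d where d: "d > 0" "!!w. w : nhd (K j) d ==> w : ddom J K ==> h w : nhd (L j) e"
    using hole_map_nhd[OF sym_mapD(3)[OF h(1)] jj e] by auto
   have "EV k. x k : nhd (K j) d" using x d(1) by blast
   thus "EV k. h (x k) : nhd (L j) e" by (rule eventually_mono) (use d(2) h(2) in blast)
  qed
  have op: "open uhp" by (rule open_halfspace_Im_gt)
  have hX: "compact (hl X j)" "hl X j <= uhp" using uholes_hol[OF X(1)] j unfolding uholes_def by auto
  have "(ALL e>0. EV k. x k : nhd (F j) e) <-> (ALL e>0. EV k. f (x k) : nhd (F' j) e)"
  proof
   assume "ALL e>0. EV k. x k : nhd (F j) e"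
   hence "ALL e>0. EV k. Ph (x k) : nhd (E j) e" unfolding E_def by (rule move[OF F(2)[OF j] F(3)[OF j] H(1) cont(1)])
   hence "ALL e>0. EV k. m (Ph (x k)) : nhd (hl X j) e" by (rule moveS[OF m xE(1)])
   hence "ALL e>0. EV k. Ps' (m (Ph (x k))) : nhd (Ps' ` hl X j) e" by (rule move[OF hX op cont(4)])
   thus "ALL e>0. EV k. f (x k) : nhd (F' j) e" unfolding Ps_hol[OF j X(1)] F'_def f_def .
  next
   assume "ALL e>0. EV k. f (x k) : nhd (F' j) e"
   hence "ALL e>0. EV k. Ph' (f (x k)) : nhd (hl X j) e"
    unfolding hl_def F'_def[symmetric] using Xp(2)[OF j, folded F'_def] by (intro move[OF cF'(1) _ H'(1) cont(3)])
   hence "ALL e>0. EV k. m (Ph (x k)) : nhd (hl X j) e" using PsH'[OF mI] unfolding f_def by simp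
   hence "ALL e>0. EV k. inv_into (ddom J E) m (m (Ph (x k))) : nhd (E j) e" by (rule moveS[OF sym_map_inv[OF m] mX])
   hence "ALL e>0. EV k. Ph (x k) : nhd (E j) e" using xE(1) m_hol(2) by simp
   hence "ALL e>0. EV k. Ps (Ph (x k)) : nhd (Ps ` E j) e" by (rule move[OF Ec(1)[OF j] EU[OF j] op cont(2)])
   thus "ALL e>0. EV k. x k : nhd (F j) e" unfolding EF[OF j] using PhH[OF xF(2)] by simp
  qed
  thus "tends_to_set x (frontier (F j)) <-> tends_to_set (%k. f (x k)) (frontier (F' j))"
   using tends_to_frontier_iff[OF F(2)[OF j] cF, of x] tends_to_frontier_iff[OF cF', of "%k. f (x k)"] xF(1) fF by simp
 qed
 \<comment> \<open>The point \<open>z 1\<close> corresponds to infinity, so the value there is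
   prescribed; continuity follows because \<open>Ph\<close> tends to infinity at \<open>z 1\<close>,
   \<open>m\<close> at infinity, and \<open>Ps'\<close> tends to \<open>z' 1\<close> at
   infinity.\<close>
 define g where "g w = (if w = z 1 then z' 1 else f w)" for w
 have S: "w : closure H - {z 1} & Ph w : ddom J E & Im (Ph w) >= 0" if w: "w : G Un \<gamma>" "w ~= z 1" for w
 proof -
  have wc: "w : closure H - {z 1}" using w G(3) assms(2) closure_subset[of H] by (auto simp: frontier_def)
  have "Ph w ~: E j" if j: "j : J" for j
  proof
   assume "Ph w : E j"
   hence "w : F j" using EF[OF j] P(7)[OF wc] by force
   hence "w : H" "w ~: G" using F(3)[OF j] j unfolding G(3) by auto
   thus False using w(1) assms(2) H(1) by (auto simp: frontier_def interior_open)
  qed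
  thus ?thesis using uholes_closed_upper[OF uE] P(7)[OF wc] wc by blast
 qed
 have fc: "continuous_on ((G Un \<gamma>) - {z 1}) f" unfolding f_def
 proof (rule continuous_on_compose2[OF P'(6)])
  show "continuous_on (G Un \<gamma> - {z 1}) (%w. m (Ph w))"
   by (rule continuous_on_compose2[OF holomorphic_on_imp_continuous_on[OF m_hol(1)]])
    (use S in "auto intro: continuous_on_subset[OF P(5)]")
  show "(%w. m (Ph w)) ` (G Un \<gamma> - {z 1}) <= {w. Im w >= 0}" using S sym_map_real[OF m] by auto
 qed
 have gc: "continuous_on (G Un \<gamma>) g" unfolding continuous_on_iff
 proof (intro ballI allI impI)
  fix w and e :: real assume w: "w : G Un \<gamma>" and e: "e > 0"
  show "EX d>0. ALL u:G Un \<gamma>. dist u w < d --> dist (g u) (g w) < e"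
  proof (cases "w = z 1")
   case True
   obtain R where R: "!!v. Im v >= 0 ==> cmod v > R ==> dist (Ps' v) (z' 1) < e" using P'(13)[OF e] by blast
   have "bounded {u : ddom J E. m u : cball 0 R}" by (rule hole_mapD(8)[OF sym_mapD(3)[OF m]])
   then obtain R2 where R2: "{u : ddom J E. m u : cball 0 R} <= cball 0 R2" using bounded_subset_cball by blast
   obtain d where d: "d > 0" "!!u. u : closure H - {z 1} ==> dist u (z 1) < d ==> cmod (Ph u) > R2" using P(14) by blast
   show ?thesis
   proof (intro exI[of _ d] conjI ballI impI d(1))
    fix u assume u: "u : G Un \<gamma>" "dist u w < d"
    show "dist (g u) (g w) < e"
    proof (cases "u = z 1")
     case False
     note Su = S[OF u(1) False]
     have "cmod (Ph u) > R2" using d(2) Su u(2) True by blast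
     hence "m (Ph u) ~: cball 0 R" using R2 Su by auto
     hence "dist (Ps' (m (Ph u))) (z' 1) < e" using sym_map_real[OF m] Su by (intro R) auto
     thus ?thesis using False True by (simp add: g_def f_def)
    qed (use True e in "simp add: g_def")
   qed
  next
   case False
   then obtain d where d: "d > 0" "!!u. u : G Un \<gamma> - {z 1} ==> dist u w < d ==> dist (f u) (f w) < e"
    using fc w e unfolding continuous_on_iff by (metis Diff_iff singletonD)
   show ?thesis
   proof (intro exI[of _ "min d (dist (z 1) w)"] conjI ballI impI)
    show "0 < min d (dist (z 1) w)" using d(1) False by auto
    fix u assume u: "u : G Un \<gamma>" "dist u w < min d (dist (z 1) w)"
    hence "u ~= z 1" by auto
    thus "dist (g u) (g w) < e" using d(2)[of u] u False by (simp add: g_def)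
   qed
  qed
 qed
 have gG: "g w = f w" if "w : G" for w using Hc that G by (auto simp: g_def)
 have m01: "m 0 = 0" "m 1 = 1" using sym_mapD(4,5)[OF m] by auto
 have gz: "g (z 1) = z' 1" "g (z 2) = z' 2" "g (z 3) = z' 3"
 proof -
  show "g (z 1) = z' 1" by (simp add: g_def)
  have "z' 2 : closure H' - {z' 1}" "z' 3 : closure H' - {z' 1}" using zf'(2,3) P'(11,12) by (auto simp: frontier_def)
  hence "Ps' 0 = z' 2" "Ps' 1 = z' 3" using P'(7)[of "z' 2"] P'(7)[of "z' 3"] P'(9,10) by auto
  thus "g (z 2) = z' 2" "g (z 3) = z' 3" using P(9-12) m01 by (auto simp: g_def f_def)
 qed
 show ?thesis using img conf bc gc gG gz unfolding J_def by blast
qed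

end
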